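(* For every $\varepsilon>0$ there is a constant $C_\varepsilon>0$, depending only on $\varepsilon$, such that for all positive integers $M,N$ and every family of complex numbers $(a_n)_{n\in\mathbb{Z}[i]}$, $$\sum^{*}_{\substack{m\in\mathbb{Z}[i]\\ \mathcal{N}(m)\le M}}\left|\ \sum^{*}_{\substack{n\in\mathbb{Z}[i]\\ \mathcal{N}(n)\le N}} a_n\left(\frac{n}{m}\right)_4\right|^2\le C_\varepsilon\left(M+N+(MN)^{3/4}\right)(MN)^{\varepsilon}\sum_{\substack{n\in\mathbb{Z}[i]\\ \mathcal{N}(n)\le N}}|a_n|^2,$$ where the asterisks indicate that $m$ and $n$ run over square-free elements of $\mathbb{Z}[i]$ that are congruent to $1$ modulo $(1+i)^3$.
   Context: $\mathcal{N}(m)$ denotes the norm of $m\in\mathbb{Z}[i]$, i.e. $\mathcal{N}(a+bi)=a^2+b^2$. The quartic residue symbol: for a prime $\pi\in\mathbb{Z}[i]$ with $\mathcal{N}(\pi)\ne 2$ and $a\in\mathbb{Z}[i]$ coprime to $\pi$, $\left(\frac{a}{\pi}\right)_4\in\{\pm1,\pm i\}$ is determined by $\left(\frac{a}{\pi}\right)_4\equiv a^{(\mathcal{N}(\pi)-1)/4}\pmod{\pi}$; if $\pi\mid a$ then $\left(\frac{a}{\pi}\right)_4=0$. It is extended multiplicatively in the lower argument to all $n\in\mathbb{Z}[i]$ with $(\mathcal{N}(n),2)=1$, with value $1$ when $n$ is a unit. *)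

theory Defs
  imports Complex_Main "HOL-Computational_Algebra.Squarefree"
begin

section \<open>The ring of Gaussian integers\<close>

datatype gauss_int = Gauss_Int (gre: int) (gim: int)

lemma gauss_int_eq_iff: "x = y \<longleftrightarrow> gre x = gre y \<and> gim x = gim y"
  by (cases x; cases y) auto

instantiation gauss_int :: comm_ring_1
begin

definition zero_gauss_int :: gauss_int where "0 = Gauss_Int 0 0"
definition one_gauss_int :: gauss_int where "1 = Gauss_Int 1 0"
definition plus_gauss_int :: "gauss_int \<Rightarrow> gauss_int \<Rightarrow> gauss_int" where
  "x + y = Gauss_Int (gre x + gre y) (gim x + gim y)"
definition uminus_gauss_int :: "gauss_int \<Rightarrow> gauss_int" where
  "- x = Gauss_Int (- gre x) (- gim x)"
definition minus_gauss_int :: "gauss_int \<Rightarrow> gauss_int \<Rightarrow> gauss_int" where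
  "x - y = Gauss_Int (gre x - gre y) (gim x - gim y)"
definition times_gauss_int :: "gauss_int \<Rightarrow> gauss_int \<Rightarrow> gauss_int" where
  "x * y = Gauss_Int (gre x * gre y - gim x * gim y) (gre x * gim y + gim x * gre y)"

instance
  by standard
    (simp_all add: gauss_int_eq_iff zero_gauss_int_def one_gauss_int_def plus_gauss_int_def
       uminus_gauss_int_def minus_gauss_int_def times_gauss_int_def algebra_simps)

end

lemma gauss_int_components [simp]:
  "gre 0 = 0" "gim 0 = 0" "gre 1 = 1" "gim 1 = 0"
  "gre (x + y) = gre x + gre y" "gim (x + y) = gim x + gim y"
  "gre (- x) = - gre x" "gim (- x) = - gim x"
  "gre (x - y) = gre x - gre y" "gim (x - y) = gim x - gim y"
  "gre (x * y) = gre x * gre y - gim x * gim y"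
  "gim (x * y) = gre x * gim y + gim x * gre y"
  by (simp_all add: zero_gauss_int_def one_gauss_int_def plus_gauss_int_def
       uminus_gauss_int_def minus_gauss_int_def times_gauss_int_def)

definition gauss_i :: gauss_int where "gauss_i = Gauss_Int 0 1"

lemma gauss_i_components [simp]: "gre gauss_i = 0" "gim gauss_i = 1"
  by (simp_all add: gauss_i_def)

definition gauss_norm :: "gauss_int \<Rightarrow> nat" where
  "gauss_norm z = nat ((gre z)\<^sup>2 + (gim z)\<^sup>2)"

definition complex_of_gauss :: "gauss_int \<Rightarrow> complex" where
  "complex_of_gauss z = Complex (of_int (gre z)) (of_int (gim z))"

lemma int_gauss_norm: "int (gauss_norm z) = (gre z)\<^sup>2 + (gim z)\<^sup>2"
  by (simp add: gauss_norm_def)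

lemma gauss_norm_0 [simp]: "gauss_norm 0 = 0"
  and gauss_norm_1 [simp]: "gauss_norm 1 = 1"
  by (simp_all add: gauss_norm_def)

lemma gauss_norm_eq_0_iff [simp]: "gauss_norm z = 0 \<longleftrightarrow> z = 0"
proof -
  have "gauss_norm z = 0 \<longleftrightarrow> (gre z)\<^sup>2 + (gim z)\<^sup>2 = 0"
    by (metis int_gauss_norm of_nat_eq_0_iff)
  then show ?thesis
    by (simp add: sum_power2_eq_zero_iff gauss_int_eq_iff)
qed

lemma gauss_norm_mult: "gauss_norm (x * y) = gauss_norm x * gauss_norm y"
proof -
  have "int (gauss_norm (x * y)) = int (gauss_norm x * gauss_norm y)"
    by (simp add: int_gauss_norm power2_eq_square algebra_simps)
  then show ?thesis by linarith
qed

instance gauss_int :: idom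
proof
  fix x y :: gauss_int
  assume "x \<noteq> 0" "y \<noteq> 0"
  then show "x * y \<noteq> 0"
    by (metis gauss_norm_eq_0_iff gauss_norm_mult mult_eq_0_iff)
qed

subsection \<open>Euclidean division and unique factorisation\<close>

text \<open>
  Nearest-integer division, used componentwise.  The instances below serve only to make
  \<^const>\<open>prime_factorization\<close> available.
\<close>

definition round_div :: "int \<Rightarrow> int \<Rightarrow> int" where
  "round_div a b = (2 * a + b) div (2 * b)"

lemma round_div_bound:
  assumes "b > 0"
  shows "2 * \<bar>a - round_div a b * b\<bar> \<le> b"
proof -
  define r where "r = (2 * a + b) mod (2 * b)"
  define t where "t = round_div a b * b"
  have "2 * a + b = (2 * a + b) div (2 * b) * (2 * b) + r"
    unfolding r_def by (rule div_mult_mod_eq[symmetric])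
  then have "2 * a + b = 2 * t + r"
    by (simp add: t_def round_div_def)
  moreover have "0 \<le> r" "r < 2 * b"
    using assms by (simp_all add: r_def)
  ultimately have "2 * \<bar>a - t\<bar> \<le> b" by (simp add: abs_if)
  then show ?thesis by (simp add: t_def)
qed

lemma round_div_mult:
  assumes "b > 0"
  shows "round_div (a * b) b = a"
proof -
  have "2 * (a * b) + b = b + a * (2 * b)" by simp
  then have "round_div (a * b) b = a + b div (2 * b)"
    unfolding round_div_def using assms by (metis add.commute div_mult_self1 mult_eq_0_iff
        not_less_iff_gr_or_eq zero_neq_numeral)
  then show ?thesis using assms by simp
qed

definition gauss_cnj :: "gauss_int \<Rightarrow> gauss_int" where
  "gauss_cnj z = Gauss_Int (gre z) (- gim z)"

lemma gauss_cnj_components [simp]: "gre (gauss_cnj z) = gre z" "gim (gauss_cnj z) = - gim z"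
  by (simp_all add: gauss_cnj_def)

text \<open>The unit \<open>i\<^sup>k\<close> such that \<open>z = i\<^sup>k * w\<close> with \<open>Re w > 0\<close> and \<open>Im w \<ge> 0\<close>.\<close>

definition gauss_unit_factor :: "gauss_int \<Rightarrow> gauss_int" where
  "gauss_unit_factor z =
     (if gre z > 0 \<and> gim z \<ge> 0 then 1
      else if gre z \<le> 0 \<and> gim z > 0 then gauss_i
      else if gre z < 0 \<and> gim z \<le> 0 then - 1
      else if gre z \<ge> 0 \<and> gim z < 0 then - gauss_i
      else 0)"

lemma gauss_unit_factor_minus: "gauss_unit_factor (- z) = - gauss_unit_factor z"
  by (simp add: gauss_unit_factor_def)

lemma gauss_unit_factor_i_times: "gauss_unit_factor (gauss_i * z) = gauss_i * gauss_unit_factor z"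
proof -
  have "gauss_i * gauss_i = - 1" by (simp add: gauss_int_eq_iff)
  then show ?thesis by (simp add: gauss_unit_factor_def)
qed

instantiation gauss_int :: normalization_euclidean_semiring
begin

definition divide_gauss_int :: "gauss_int \<Rightarrow> gauss_int \<Rightarrow> gauss_int" where
  "x div y = (if y = 0 then 0 else
     Gauss_Int (round_div (gre (x * gauss_cnj y)) (int (gauss_norm y)))
               (round_div (gim (x * gauss_cnj y)) (int (gauss_norm y))))"

definition modulo_gauss_int :: "gauss_int \<Rightarrow> gauss_int \<Rightarrow> gauss_int" where
  "x mod y = x - x div y * y" for x y :: gauss_int

definition euclidean_size_gauss_int :: "gauss_int \<Rightarrow> nat" where
  "euclidean_size_gauss_int = gauss_norm"

definition unit_factor_gauss_int :: "gauss_int \<Rightarrow> gauss_int" where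
  "unit_factor_gauss_int = gauss_unit_factor"

definition normalize_gauss_int :: "gauss_int \<Rightarrow> gauss_int" where
  "normalize_gauss_int z = gauss_cnj (gauss_unit_factor z) * z"

instance
proof
  fix a b :: gauss_int
  have norm_pos: "0 < int (gauss_norm b)" if "b \<noteq> 0" for b
    using that by (simp add: zero_less_iff_neq_zero)
  show "a * b div b = a" if "b \<noteq> 0"
  proof -
    have "gre (a * b * gauss_cnj b) = gre a * int (gauss_norm b)"
         "gim (a * b * gauss_cnj b) = gim a * int (gauss_norm b)"
      by (simp_all add: int_gauss_norm power2_eq_square algebra_simps)
    then show ?thesis
      using that norm_pos[OF that]
      by (cases a) (simp add: divide_gauss_int_def round_div_mult del: gauss_int_components)
  qed
  show "a div 0 = 0" by (simp add: divide_gauss_int_def)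
  show "a div b * b + a mod b = a" by (simp add: modulo_gauss_int_def)
  show "euclidean_size (0 :: gauss_int) = 0" by (simp add: euclidean_size_gauss_int_def)
  show "euclidean_size a \<le> euclidean_size (a * b)" if "b \<noteq> 0"
    using norm_pos[OF that] by (simp add: euclidean_size_gauss_int_def gauss_norm_mult)
  show "euclidean_size (a mod b) < euclidean_size b" if "b \<noteq> 0"
  proof -
    define n where "n = int (gauss_norm b)"
    have n: "n > 0" using norm_pos[OF that] by (simp add: n_def)
    define u v where "u = gre (a * gauss_cnj b)" and "v = gim (a * gauss_cnj b)"
    define r s where "r = u - round_div u n * n" and "s = v - round_div v n * n"
    have q: "a div b = Gauss_Int (round_div u n) (round_div v n)"
      using that by (simp add: divide_gauss_int_def u_def v_def n_def del: gauss_int_components)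
    have bb: "b * gauss_cnj b = Gauss_Int n 0"
      by (simp add: gauss_int_eq_iff n_def int_gauss_norm power2_eq_square)
    have "a mod b * gauss_cnj b = a * gauss_cnj b - a div b * (b * gauss_cnj b)"
      by (simp add: modulo_gauss_int_def algebra_simps del: gauss_int_components)
    also have "\<dots> = Gauss_Int r s"
      by (simp add: gauss_int_eq_iff q bb r_def s_def u_def v_def)
    finally have eq: "a mod b * gauss_cnj b = Gauss_Int r s" .
    have "gauss_norm (gauss_cnj b) = gauss_norm b"
      by (simp add: gauss_norm_def)
    then have "int (gauss_norm (a mod b)) * n = r\<^sup>2 + s\<^sup>2"
      using arg_cong[OF eq, of "\<lambda>z. int (gauss_norm z)"]
      by (simp add: gauss_norm_mult n_def int_gauss_norm[of "Gauss_Int r s"]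
          del: gauss_int_components)
    moreover have "(2 * \<bar>r\<bar>)\<^sup>2 \<le> n\<^sup>2" "(2 * \<bar>s\<bar>)\<^sup>2 \<le> n\<^sup>2"
      using round_div_bound[OF n] by (intro power_mono; simp add: r_def s_def)+
    moreover have "n\<^sup>2 > 0" using n by simp
    ultimately have "int (gauss_norm (a mod b)) * n < n * n"
      by (simp add: power_mult_distrib power2_eq_square)
    then have "int (gauss_norm (a mod b)) < n" using n by simp
    then show ?thesis by (simp add: euclidean_size_gauss_int_def n_def)
  qed
  have unit_units: "u dvd 1" if "u \<in> {1, - 1, gauss_i, - gauss_i}" for u
  proof -
    have "u * gauss_cnj u = 1" using that by (auto simp: gauss_int_eq_iff)
    then show ?thesis by (metis dvd_triv_left)
  qed
  have units: "u \<in> {1, - 1, gauss_i, - gauss_i}" if "u dvd 1" for u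
  proof -
    from that obtain w where "1 = u * w" by (rule dvdE)
    then have "gauss_norm u * gauss_norm w = 1" by (metis gauss_norm_mult gauss_norm_1)
    then have "gauss_norm u = 1" by simp
    then have eq: "(gre u)\<^sup>2 + (gim u)\<^sup>2 = 1" using int_gauss_norm[of u] by simp
    then have "(gre u)\<^sup>2 \<le> 1\<^sup>2" "(gim u)\<^sup>2 \<le> 1\<^sup>2"
      using zero_le_power2[of "gre u"] zero_le_power2[of "gim u"] unfolding power_one by linarith+
    then have "\<bar>gre u\<bar> \<le> 1" "\<bar>gim u\<bar> \<le> 1" by (simp_all add: abs_square_le_1)
    then have "gre u \<in> {-1, 0, 1}" "gim u \<in> {-1, 0, 1}" by auto
    then show ?thesis using eq by (auto simp: gauss_int_eq_iff)
  qed
  show "unit_factor (0 :: gauss_int) = 0"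
    by (simp add: unit_factor_gauss_int_def gauss_unit_factor_def)
  show "unit_factor a = a" if "a dvd 1"
    using units[OF that]
    by (auto simp: unit_factor_gauss_int_def gauss_unit_factor_def gauss_int_eq_iff)
  show "unit_factor a dvd 1" if "a \<noteq> 0"
    by (rule unit_units)
      (use that in \<open>auto simp: unit_factor_gauss_int_def gauss_unit_factor_def gauss_int_eq_iff\<close>)
  show "unit_factor (a * b) = a * unit_factor b" if "a dvd 1"
    using units[OF that]
    by (auto simp: unit_factor_gauss_int_def gauss_unit_factor_minus gauss_unit_factor_i_times)
  show "unit_factor a * normalize a = a"
    by (auto simp: unit_factor_gauss_int_def normalize_gauss_int_def gauss_unit_factor_def
        gauss_int_eq_iff)
  show "normalize (0 :: gauss_int) = 0"
    by (simp add: normalize_gauss_int_def)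
qed

end

section \<open>The quartic residue symbol\<close>

text \<open>
  The symbol is meant for prime \<open>p\<close> with \<^prop>\<open>gauss_norm p \<noteq> 2\<close>; then \<open>1, -1, i, -i\<close> are
  pairwise incongruent modulo \<open>p\<close> and \<open>gauss_norm p - 1\<close> is divisible by 4.
\<close>

definition quartic_symbol_prime :: "gauss_int \<Rightarrow> gauss_int \<Rightarrow> complex" where
  "quartic_symbol_prime a p =
     (if p dvd a then 0
      else complex_of_gauss (THE u. u \<in> {1, - 1, gauss_i, - gauss_i} \<and>
             p dvd a ^ ((gauss_norm p - 1) div 4) - u))"

text \<open>
  Multiplicative extension to all \<open>n\<close> of odd norm.  \<^term>\<open>prime_factorization n\<close> is a multiset of
  primes normalised to the first quadrant, whose product is an associate of \<open>n\<close>; the choice of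
  representatives is immaterial (\<open>quartic_symbol_associated\<close>).  For \<open>n\<close> of even norm the value
  is not meaningful.
\<close>

definition quartic_symbol :: "gauss_int \<Rightarrow> gauss_int \<Rightarrow> complex" where
  "quartic_symbol a n = (\<Prod>p\<in>#prime_factorization n. quartic_symbol_prime a p)"

lemma quartic_symbol_unit: "n dvd 1 \<Longrightarrow> quartic_symbol a n = 1"
  by (simp add: quartic_symbol_def prime_factorization_unit)

lemma quartic_symbol_mult:
  "m \<noteq> 0 \<Longrightarrow> n \<noteq> 0 \<Longrightarrow> quartic_symbol a (m * n) = quartic_symbol a m * quartic_symbol a n"
  by (simp add: quartic_symbol_def prime_factorization_mult)

lemma gauss_norm_dvd: "p dvd q \<Longrightarrow> gauss_norm p dvd gauss_norm q"
  by (auto simp: dvd_def gauss_norm_mult)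

lemma quartic_symbol_prime_associated:
  assumes "p dvd q" "q dvd p"
  shows "quartic_symbol_prime a p = quartic_symbol_prime a q"
proof -
  have "gauss_norm p = gauss_norm q"
    using assms by (intro dvd_antisym gauss_norm_dvd)
  moreover have "p dvd x \<longleftrightarrow> q dvd x" for x
    using assms dvd_trans by blast
  ultimately show ?thesis by (simp add: quartic_symbol_prime_def)
qed

lemma quartic_symbol_prime_elem:
  assumes "prime_elem p"
  shows "quartic_symbol a p = quartic_symbol_prime a p"
proof -
  have "quartic_symbol a p = quartic_symbol_prime a (normalize p)"
  proof -
    have "prime (normalize p)" using assms by simp
    then have "prime_factorization (normalize p) = {#normalize p#}"
      by (rule prime_factorization_prime)
    then show ?thesis by (simp add: quartic_symbol_def prime_factorization_normalize)
  qed
  also have "\<dots> = quartic_symbol_prime a p"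
    by (rule quartic_symbol_prime_associated) simp_all
  finally show ?thesis .
qed

lemma quartic_symbol_associated:
  assumes "m dvd n" "n dvd m"
  shows "quartic_symbol a m = quartic_symbol a n"
proof -
  have "normalize m = normalize n"
    using assms by (rule associatedI)
  then have "prime_factorization m = prime_factorization n"
    by (metis prime_factorization_normalize)
  then show ?thesis by (simp add: quartic_symbol_def)
qed

lemma quartic_unit_unique:
  assumes "prime_elem p" "gauss_norm p \<noteq> 2"
    and "u \<in> {1, - 1, gauss_i, - gauss_i}" "v \<in> {1, - 1, gauss_i, - gauss_i}"
    and "p dvd x - u" "p dvd x - v"
  shows "u = v"
proof (rule ccontr)
  assume "u \<noteq> v"
  define c where "c = 1 + gauss_i"
  have prime_norm: "gauss_norm p \<noteq> 1"
  proof
    assume "gauss_norm p = 1"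
    then have "(gre p)\<^sup>2 + (gim p)\<^sup>2 = 1" using int_gauss_norm[of p] by simp
    then have "p * gauss_cnj p = 1" by (simp add: gauss_int_eq_iff power2_eq_square)
    then show False using assms(1) by (metis dvd_triv_left prime_elem_def)
  qed
  have "p dvd (x - v) - (x - u)" using assms(6,5) by (rule dvd_diff)
  then have uv: "p dvd u - v" by (simp add: algebra_simps)
  have "u - v dvd c * c"
  proof -
    define d where "d = u - v"
    have "d = c * c * gauss_i \<or> d = - (c * c * gauss_i) \<or> d = c * c \<or> d = - (c * c)
      \<or> d * (gauss_cnj d * gauss_i) = c * c"
      using assms(3,4) \<open>u \<noteq> v\<close> unfolding insert_iff empty_iff
      by (elim disjE) (simp_all add: gauss_int_eq_iff c_def d_def)
    moreover have "c * c = c * c * gauss_i * (- gauss_i)" "c * c = - (c * c * gauss_i) * gauss_i"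
      by (simp_all add: gauss_int_eq_iff c_def)
    ultimately have "d dvd c * c"
      by (elim disjE) (metis dvd_triv_left, metis dvd_triv_left, simp, simp, metis dvd_triv_left)
    then show ?thesis by (simp add: d_def)
  qed
  with uv have "p dvd c * c" by (rule dvd_trans)
  then have "p dvd c" using assms(1) by (simp add: prime_elem_dvd_mult_iff)
  then have "gauss_norm p dvd gauss_norm c" by (rule gauss_norm_dvd)
  moreover have "gauss_norm c = 2" by (simp add: c_def gauss_norm_def)
  ultimately have "gauss_norm p dvd 2" by simp
  then have "gauss_norm p \<le> 2" "gauss_norm p \<noteq> 0" by (auto dest: dvd_imp_le intro!: Nat.gr0I)
  then show False using assms(2) prime_norm by linarith
qed

section \<open>The ranges of summation\<close>

definition gauss_upto :: "nat \<Rightarrow> gauss_int set" where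
  "gauss_upto X = {n. gauss_norm n \<le> X}"

text \<open>The range of the starred sums.\<close>

definition gauss_star_upto :: "nat \<Rightarrow> gauss_int set" where
  "gauss_star_upto X = {n. gauss_norm n \<le> X \<and> squarefree n \<and> (1 + gauss_i) ^ 3 dvd n - 1}"

lemma finite_gauss_upto: "finite (gauss_upto X)"
proof (rule finite_subset)
  let ?I = "{- int X..int X}"
  show "gauss_upto X \<subseteq> (\<lambda>(a, b). Gauss_Int a b) ` (?I \<times> ?I)"
  proof
    fix z assume "z \<in> gauss_upto X"
    then have le: "(gre z)\<^sup>2 + (gim z)\<^sup>2 \<le> int X"
      by (simp add: gauss_upto_def flip: int_gauss_norm)
    have abs_le: "\<bar>k\<bar> \<le> k\<^sup>2" for k :: int
      using self_le_power[of "\<bar>k\<bar>" 2] by (cases "k = 0") auto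
    have "\<bar>gre z\<bar> \<le> int X" "\<bar>gim z\<bar> \<le> int X"
      using le abs_le[of "gre z"] abs_le[of "gim z"] zero_le_power2[of "gre z"]
        zero_le_power2[of "gim z"] by linarith+
    then show "z \<in> (\<lambda>(a, b). Gauss_Int a b) ` (?I \<times> ?I)"
      by (intro image_eqI[of _ _ "(gre z, gim z)"]) auto
  qed
qed simp

lemma finite_gauss_star_upto: "finite (gauss_star_upto X)"
  by (rule finite_subset[OF _ finite_gauss_upto[of X]])
    (auto simp: gauss_star_upto_def gauss_upto_def)

end

theory Submission
  imports Defs "HOL-Probability.Probability"
begin

text \<open>
  Square-free elements congruent to \<open>1\<close> modulo \<open>(1 + i)\<^sup>3\<close> are products of distinct primary primes,
  so a modulus is represented by its finite set \<open>P\<close> of primary prime factors, and \<open>chi P q\<close> is the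
  symbol of \<open>q\<close> modulo \<open>\<Prod>P\<close>.  Write \<open>L\<close> for the longer and \<open>s\<close> for the shorter of the two ranges.
  Quartic reciprocity (\<open>reciprocity_sets\<close>) exchanges the two arguments up to a sign that depends only
  on two parities, and the operator norm of a matrix is that of its transpose (\<open>duality\<close>), so one may
  decide freely which range carries the moduli.

  The main estimate is \<open>recursive_large_sieve\<close>.  It bounds the mean square, over \<^emph>\<open>all\<close> Gaussian
  integers \<open>q\<close> of norm up to \<open>Q\<close>, of a combination of the characters with moduli of norm up to \<open>M\<close>, by
  \<open>O(M\<^bsup>\<epsilon>\<^esup> (Q + Q\<^bsup>3/4\<^esup> M\<^bsup>1/2\<^esup> + M\<^sup>3 / Q))\<close> times the energy of the coefficients.  Because \<open>q\<close> runs over all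
  integers, the square can be opened, smoothed by a Gaussian and transformed by Poisson summation
  (\<open>poisson_char\<close>).  The diagonal gives \<open>Q\<close>.  Off the diagonal, the Gauss sum of a product of two
  coprime moduli factors, reciprocity making the mixed factor a sign that is constant on a parity
  class; hence the dual sum, over frequencies \<open>k\<close> of norm up to about \<open>M\<^sup>2 / Q\<close>, is again bilinear in
  the two moduli once the Gaussian weight is separated by a Taylor expansion (\<open>separation_exp\<close>).

  The dual sum is bounded by a large sieve over all nonzero \<open>k\<close> (\<open>all_large_sieve\<close>).  Write \<open>k\<close> as a unit
  times a power of \<open>1 + i\<close> times a fourth power times a product of distinct primary primes with
  exponents \<open>1, 2, 3\<close>.  For the last factor, reciprocity turns the problem into the classical large
  sieve for primitive characters (\<open>mult_large_sieve\<close>), of strength \<open>X + K\<^sup>2\<close>; there are \<open>O(K\<^bsup>1/4\<^esup>)\<close>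
  choices for the other factors, which gives \<open>X K\<^bsup>1/4\<^esup> + K\<^sup>2\<close>.

  In the conclusion, if \<open>s \<le> L\<^bsup>7/9\<^esup>\<close> then \<open>recursive_large_sieve\<close> with \<open>Q = L\<close> and \<open>M = s\<close> suffices,
  since \<open>s\<^sup>3 / L \<le> (L s)\<^bsup>3/4\<^esup>\<close>.  Otherwise let the moduli be long, and apply Cauchy--Schwarz to the sum
  over moduli: the square of the inner sum is a sum over \<^emph>\<open>all\<close> integers of norm up to \<open>s\<^sup>2\<close>, to which
  the dual of \<open>recursive_large_sieve\<close> with \<open>Q = s\<^sup>2\<close> and \<open>M = L\<close> applies.  This gives
  \<open>L\<^bsup>1/2\<^esup> s + (L s)\<^bsup>3/4\<^esup> + L\<^sup>2 / s\<close>, which is \<open>O((L s)\<^bsup>3/4\<^esup>)\<close> as soon as \<open>s \<ge> L\<^bsup>5/7\<^esup>\<close>.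
\<close>

section \<open>Arithmetic of the Gaussian integers\<close>

abbreviation (input) cg :: "gauss_int \<Rightarrow> complex" where
  "cg \<equiv> complex_of_gauss"

abbreviation (input) rnorm :: "gauss_int \<Rightarrow> real" where
  "rnorm z \<equiv> real (gauss_norm z)"

abbreviation (input) sqmod :: "complex \<Rightarrow> real" where
  "sqmod z \<equiv> (cmod z)\<^sup>2"

abbreviation (input) ell2 :: "'a set \<Rightarrow> ('a \<Rightarrow> complex) \<Rightarrow> real" where
  "ell2 A b \<equiv> (\<Sum>j\<in>A. sqmod (b j))"

lemma complex_of_gauss_simps [simp]:
  "cg 0 = 0" "cg 1 = 1" "cg gauss_i = \<i>"
  "cg (x + y) = cg x + cg y"
  "cg (x - y) = cg x - cg y"
  "cg (- x) = - cg x"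
  "cg (x * y) = cg x * cg y"
  "cg (gauss_cnj x) = cnj (cg x)"
  by (simp_all add: complex_of_gauss_def complex_eq_iff)

lemma complex_of_gauss_power [simp]: "cg (x ^ n) = cg x ^ n"
  by (induction n) auto

lemma complex_of_gauss_sum: "cg (sum f A) = (\<Sum>x\<in>A. cg (f x))"
  by (induction A rule: infinite_finite_induct) auto

lemma complex_of_gauss_eq_iff [simp]: "cg x = cg y \<longleftrightarrow> x = y"
  by (auto simp: complex_of_gauss_def gauss_int_eq_iff)

lemma complex_of_gauss_eq_0_iff [simp]: "cg x = 0 \<longleftrightarrow> x = 0"
  using complex_of_gauss_eq_iff[of x 0] by simp

lemma Re_complex_of_gauss [simp]: "Re (cg z) = of_int (gre z)"
  and Im_complex_of_gauss [simp]: "Im (cg z) = of_int (gim z)"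
  by (simp_all add: complex_of_gauss_def)

lemma real_gauss_norm: "rnorm z = (real_of_int (gre z))\<^sup>2 + (real_of_int (gim z))\<^sup>2"
  using arg_cong[OF int_gauss_norm[of z], of real_of_int] by simp

lemma cmod_complex_of_gauss_sq: "sqmod (cg z) = rnorm z"
  by (simp add: cmod_power2 real_gauss_norm)

lemma gauss_of_nat [simp]: "gre (of_nat k) = int k" "gim (of_nat k) = 0"
  by (induction k) auto

lemma gauss_of_int [simp]: "gre (of_int k) = k" "gim (of_int k) = 0"
  by (cases k; simp)+

lemma complex_of_gauss_of_int [simp]: "cg (of_int k) = of_int k"
  by (simp add: complex_eq_iff)

lemma complex_of_gauss_of_nat [simp]: "cg (of_nat k) = of_nat k"
  by (simp add: complex_eq_iff)

lemma gauss_numeral [simp]: "gre (numeral k) = numeral k" "gim (numeral k) = 0"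
  using gauss_of_int[of "numeral k"] by (simp_all del: gauss_of_int)

lemma gauss_norm_cnj [simp]: "gauss_norm (gauss_cnj z) = gauss_norm z"
  by (simp add: gauss_norm_def)

lemma gauss_norm_minus [simp]: "gauss_norm (- z) = gauss_norm z"
  by (simp add: gauss_norm_def)

lemma gauss_norm_power: "gauss_norm (z ^ k) = gauss_norm z ^ k"
  by (induction k) (auto simp: gauss_norm_mult)

lemma gauss_norm_prod: "gauss_norm (prod f A) = (\<Prod>x\<in>A. gauss_norm (f x))"
  by (induction A rule: infinite_finite_induct) (auto simp: gauss_norm_mult)

lemma gauss_mult_cnj: "z * gauss_cnj z = of_nat (gauss_norm z)"
  by (simp add: gauss_int_eq_iff int_gauss_norm power2_eq_square)

lemma gauss_cnj_simps [simp]: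
  "gauss_cnj (x * y) = gauss_cnj x * gauss_cnj y" "gauss_cnj (x + y) = gauss_cnj x + gauss_cnj y"
  "gauss_cnj (x - y) = gauss_cnj x - gauss_cnj y" "gauss_cnj (gauss_cnj x) = x"
  "gauss_cnj 0 = 0" "gauss_cnj 1 = 1" "gauss_cnj (- x) = - gauss_cnj x"
  "gauss_cnj gauss_i = - gauss_i"
  by (simp_all add: gauss_int_eq_iff)

lemma gauss_cnj_power [simp]: "gauss_cnj (x ^ k) = gauss_cnj x ^ k"
  by (induction k) auto

lemma gauss_cnj_of_int [simp]: "gauss_cnj (of_int k) = of_int k"
  by (simp add: gauss_int_eq_iff)

lemma gauss_cnj_eq_0_iff [simp]: "gauss_cnj x = 0 \<longleftrightarrow> x = 0"
  by (auto simp: gauss_int_eq_iff)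

lemma gauss_cnj_dvd_iff: "gauss_cnj x dvd gauss_cnj y \<longleftrightarrow> x dvd y"
  by (metis dvd_def gauss_cnj_simps(1,4))

lemma gauss_unit_iff: "u dvd (1 :: gauss_int) \<longleftrightarrow> u \<in> {1, - 1, gauss_i, - gauss_i}"
proof
  assume "u dvd 1"
  then have "gauss_norm u = 1"
    using gauss_norm_dvd[of u 1] by simp
  then have eq: "(gre u)\<^sup>2 + (gim u)\<^sup>2 = 1" using int_gauss_norm[of u] by simp
  then have "(gre u)\<^sup>2 \<le> 1\<^sup>2" "(gim u)\<^sup>2 \<le> 1\<^sup>2"
    using zero_le_power2[of "gre u"] zero_le_power2[of "gim u"] unfolding power_one by linarith+
  then have "\<bar>gre u\<bar> \<le> 1" "\<bar>gim u\<bar> \<le> 1" by (simp_all add: abs_square_le_1)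
  then have "gre u \<in> {-1, 0, 1}" "gim u \<in> {-1, 0, 1}" by auto
  then show "u \<in> {1, - 1, gauss_i, - gauss_i}" using eq by (auto simp: gauss_int_eq_iff)
next
  assume "u \<in> {1, - 1, gauss_i, - gauss_i}"
  then have "u * gauss_cnj u = 1" by (auto simp: gauss_int_eq_iff)
  then show "u dvd 1" by (metis dvd_triv_left)
qed

lemma gauss_norm_eq_1_iff: "gauss_norm z = 1 \<longleftrightarrow> z dvd 1"
proof
  assume "gauss_norm z = 1"
  then have "z * gauss_cnj z = 1" by (simp add: gauss_mult_cnj)
  then show "z dvd 1" by (metis dvd_triv_left)
qed (use gauss_norm_dvd[of z 1] in simp)

lemma gauss_of_int_dvd_iff: "(of_int k :: gauss_int) dvd z \<longleftrightarrow> k dvd gre z \<and> k dvd gim z"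
proof
  assume "of_int k dvd z"
  then show "k dvd gre z \<and> k dvd gim z" by (auto elim!: dvdE)
next
  assume "k dvd gre z \<and> k dvd gim z"
  then obtain a b where "gre z = k * a" "gim z = k * b" by (auto elim!: dvdE)
  then have "z = of_int k * Gauss_Int a b" by (simp add: gauss_int_eq_iff)
  then show "of_int k dvd z" by simp
qed

section \<open>Residue systems and additive characters\<close>

lemma round_div_add:
  assumes "b > 0"
  shows "round_div (a + k * b) b = round_div a b + k"
proof -
  have "2 * (a + k * b) + b = (2 * a + b) + k * (2 * b)" by (simp add: algebra_simps)
  moreover have "((2 * a + b) + k * (2 * b)) div (2 * b) = k + (2 * a + b) div (2 * b)"
    by (rule div_mult_self1) (use assms in simp)
  ultimately show ?thesis unfolding round_div_def by presburger
qed

lemma gauss_mod_eq_iff: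
  fixes n :: gauss_int
  assumes "n \<noteq> 0"
  shows "x mod n = y mod n \<longleftrightarrow> n dvd x - y"
proof
  assume "x mod n = y mod n"
  then have "x - y = (x div n - y div n) * n"
    by (simp add: modulo_gauss_int_def algebra_simps)
  then show "n dvd x - y" by simp
next
  assume "n dvd x - y"
  then obtain k where k: "x = y + k * n" by (metis add.commute diff_add_cancel dvdE mult.commute)
  have pos: "int (gauss_norm n) > 0" using assms by (simp add: zero_less_iff_neq_zero)
  have e: "gre (x * gauss_cnj n) = gre (y * gauss_cnj n) + gre k * int (gauss_norm n)"
    "gim (x * gauss_cnj n) = gim (y * gauss_cnj n) + gim k * int (gauss_norm n)"
    by (simp_all add: k int_gauss_norm power2_eq_square algebra_simps)
  have "x div n = y div n + k"
    unfolding divide_gauss_int_def e round_div_add[OF pos] using assms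
    by (simp add: plus_gauss_int_def)
  then show "x mod n = y mod n" by (simp add: modulo_gauss_int_def k algebra_simps)
qed

lemma gauss_dvd_diff_mod: "(n :: gauss_int) dvd x - x mod n"
  by (simp add: modulo_gauss_int_def)

definition gres :: "gauss_int \<Rightarrow> gauss_int set" where
  "gres n = range (\<lambda>x. x mod n)"

lemma mod_in_gres [simp]: "x mod n \<in> gres n" by (simp add: gres_def)

lemma finite_gres [simp]: "n \<noteq> 0 \<Longrightarrow> finite (gres n)"
proof -
  assume "n \<noteq> 0"
  have "gres n \<subseteq> gauss_upto (gauss_norm n)"
    using mod_size_less[OF \<open>n \<noteq> 0\<close>]
    by (auto simp: gres_def gauss_upto_def euclidean_size_gauss_int_def less_imp_le)
  then show ?thesis using finite_gauss_upto finite_subset by blast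
qed

lemma gres_mod_id: "n \<noteq> 0 \<Longrightarrow> x \<in> gres n \<Longrightarrow> x mod n = x"
  by (auto simp: gres_def) (metis gauss_dvd_diff_mod gauss_mod_eq_iff)

lemma gres_inj: "n \<noteq> 0 \<Longrightarrow> x \<in> gres n \<Longrightarrow> y \<in> gres n \<Longrightarrow> n dvd x - y \<Longrightarrow> x = y"
  by (metis gres_mod_id gauss_mod_eq_iff)

lemma bij_betw_gres:
  assumes "n \<noteq> 0"
    and "\<And>a b. a \<in> A \<Longrightarrow> b \<in> A \<Longrightarrow> n dvd h a - h b \<Longrightarrow> a = b"
    and "\<And>x. \<exists>a\<in>A. n dvd x - h a"
  shows "bij_betw (\<lambda>a. h a mod n) A (gres n)"
proof (rule bij_betwI')
  show "\<exists>x\<in>A. y = h x mod n" if "y \<in> gres n" for y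
    using assms(3)[of y] gres_mod_id[OF assms(1) that] gauss_mod_eq_iff[OF assms(1)] by metis
qed (use assms in \<open>auto simp: gauss_mod_eq_iff\<close>)

lemma sum_gres_reindex:
  assumes "n \<noteq> 0"
    and "\<And>a b. a \<in> A \<Longrightarrow> b \<in> A \<Longrightarrow> n dvd h a - h b \<Longrightarrow> a = b"
    and "\<And>x. \<exists>a\<in>A. n dvd x - h a"
    and per: "\<And>x y. n dvd x - y \<Longrightarrow> f x = f y"
  shows "(\<Sum>x\<in>gres n. f x) = (\<Sum>a\<in>A. f (h a))"
proof -
  have "(\<Sum>x\<in>gres n. f x) = (\<Sum>a\<in>A. f (h a mod n))"
    by (rule sum.reindex_bij_betw[symmetric, OF bij_betw_gres[OF assms(1-3)]])
  also have "\<dots> = (\<Sum>a\<in>A. f (h a))"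
    by (intro sum.cong refl per[symmetric] gauss_dvd_diff_mod)
  finally show ?thesis .
qed

lemma inj_mod_imp_surj_mod:
  assumes "n \<noteq> 0" and inj: "\<And>a b. n dvd g a - g b \<Longrightarrow> n dvd a - b"
  shows "\<exists>a\<in>gres n. n dvd x - g a"
proof -
  have "inj_on (\<lambda>a. g a mod n) (gres n)"
    using assms by (intro inj_onI) (metis gauss_mod_eq_iff gres_inj)
  moreover have "(\<lambda>a. g a mod n) ` gres n \<subseteq> gres n" by auto
  ultimately have "(\<lambda>a. g a mod n) ` gres n = gres n"
    using endo_inj_surj finite_gres[OF assms(1)] by blast
  then have "x mod n \<in> (\<lambda>a. g a mod n) ` gres n" by simp
  then show ?thesis using gauss_mod_eq_iff[OF assms(1)] by auto
qed

lemma sum_gres_transform: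
  assumes "n \<noteq> 0" and inj: "\<And>a b. n dvd g a - g b \<Longrightarrow> n dvd a - b"
    and per: "\<And>x y. n dvd x - y \<Longrightarrow> f x = f y"
  shows "(\<Sum>x\<in>gres n. f (g x)) = (\<Sum>x\<in>gres n. f x)"
  by (rule sum_gres_reindex[symmetric, OF assms(1) _ inj_mod_imp_surj_mod[OF assms(1,2)] per])
     (use assms gres_inj in blast)+

lemma card_gres_eqI:
  assumes "n \<noteq> 0"
    and "\<And>a b. a \<in> A \<Longrightarrow> b \<in> A \<Longrightarrow> n dvd h a - h b \<Longrightarrow> a = b"
    and "\<And>x. \<exists>a\<in>A. n dvd x - h a"
  shows "card (gres n) = card A"
  using bij_betw_same_card[OF bij_betw_gres[OF assms]] by simp

lemma card_gres_mult:
  assumes "m \<noteq> 0" "n \<noteq> 0"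
  shows "card (gres (m * n)) = card (gres m) * card (gres n)"
proof -
  have "card (gres (m * n)) = card (gres m \<times> gres n)"
  proof (rule card_gres_eqI[where h = "\<lambda>(x, y). x + m * y"])
    fix a b assume a: "a \<in> gres m \<times> gres n" and b: "b \<in> gres m \<times> gres n"
      and d: "m * n dvd (case a of (x, y) \<Rightarrow> x + m * y) - (case b of (x, y) \<Rightarrow> x + m * y)"
    obtain x y x' y' where ab: "a = (x, y)" "b = (x', y')" by (metis surj_pair)
    have d': "m * n dvd (x - x') + m * (y - y')" using d by (simp add: ab algebra_simps)
    then have "m dvd (x - x') + m * (y - y')" using dvd_mult_left by blast
    then have "m dvd x - x'" by (simp add: dvd_add_left_iff)
    then have "x = x'" using a b assms by (auto simp: ab intro: gres_inj)
    then have "n dvd y - y'" using d' assms by simp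
    then have "y = y'" using a b assms by (auto simp: ab intro: gres_inj)
    with \<open>x = x'\<close> show "a = b" by (simp add: ab)
  next
    fix x
    obtain k where k: "x - x mod m = m * k" using gauss_dvd_diff_mod[of m x] unfolding dvd_def by blast
    obtain l where l: "k - k mod n = n * l" using gauss_dvd_diff_mod[of n k] unfolding dvd_def by blast
    have "x - (x mod m + m * (k mod n)) = m * (k - k mod n)" using k by (simp add: algebra_simps)
    also have "\<dots> = m * n * l" by (simp add: l)
    finally have "m * n dvd x - (x mod m + m * (k mod n))" by simp
    then show "\<exists>a\<in>gres m \<times> gres n. m * n dvd x - (case a of (x, y) \<Rightarrow> x + m * y)"
      by (intro bexI[of _ "(x mod m, k mod n)"]) auto
  qed (use assms in auto)
  then show ?thesis by (simp add: card_cartesian_product)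
qed

lemma card_gres_cnj:
  assumes "n \<noteq> 0"
  shows "card (gres (gauss_cnj n)) = card (gres n)"
proof (rule card_gres_eqI[where h = gauss_cnj])
  show "\<exists>a\<in>gres n. gauss_cnj n dvd x - gauss_cnj a" for x
    using gauss_dvd_diff_mod[of n "gauss_cnj x"]
    by (intro bexI[of _ "gauss_cnj x mod n"]) (metis gauss_cnj_dvd_iff gauss_cnj_simps(3,4), simp)
qed (use assms gres_inj gauss_cnj_dvd_iff gauss_cnj_simps(3) in \<open>auto, metis\<close>)

lemma card_gres_of_nat:
  assumes "k > 0"
  shows "card (gres (of_nat k)) = k ^ 2"
proof -
  have nz: "(of_nat k :: gauss_int) \<noteq> 0" using assms by (simp add: gauss_int_eq_iff)
  have dvd: "(of_nat k :: gauss_int) dvd z \<longleftrightarrow> int k dvd gre z \<and> int k dvd gim z" for z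
    using gauss_of_int_dvd_iff[of "int k" z] by simp
  have "card (gres (of_nat k)) = card ({0..<int k} \<times> {0..<int k})"
  proof (rule card_gres_eqI[OF nz, where h = "\<lambda>(a, b). Gauss_Int a b"])
    fix x
    show "\<exists>a\<in>{0..<int k} \<times> {0..<int k}. of_nat k dvd x - (case a of (a, b) \<Rightarrow> Gauss_Int a b)"
      using assms by (intro bexI[of _ "(gre x mod int k, gim x mod int k)"])
        (auto simp: dvd mod_eq_dvd_iff[symmetric])
  next
    fix a b assume "a \<in> {0..<int k} \<times> {0..<int k}" "b \<in> {0..<int k} \<times> {0..<int k}"
      "of_nat k dvd (case a of (a, b) \<Rightarrow> Gauss_Int a b) - (case b of (a, b) \<Rightarrow> Gauss_Int a b)"
    then show "a = b"
      by (auto simp: dvd mod_eq_dvd_iff[symmetric])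
  qed
  then show ?thesis by (simp add: card_cartesian_product power2_eq_square)
qed

text \<open>The count is multiplicative, invariant under conjugation, and equal to \<open>k\<^sup>2\<close> for a positive
  rational integer \<open>k\<close>; apply this to \<open>n * gauss_cnj n = gauss_norm n\<close>.\<close>

lemma card_gres:
  assumes "n \<noteq> 0"
  shows "card (gres n) = gauss_norm n"
proof -
  have "card (gres n) ^ 2 = card (gres (n * gauss_cnj n))"
    using assms by (simp add: card_gres_mult card_gres_cnj power2_eq_square)
  also have "\<dots> = gauss_norm n ^ 2"
    using assms card_gres_of_nat[of "gauss_norm n"]
    by (simp add: gauss_mult_cnj zero_less_iff_neq_zero)
  finally show ?thesis by simp
qed

text \<open>At \<open>x / n\<close> this is the basic additive character modulo \<open>n\<close>.\<close>

definition echar :: "complex \<Rightarrow> complex" where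
  "echar z = cis (2 * pi * Re z)"

lemma echar_add: "echar (z + w) = echar z * echar w"
  by (simp add: echar_def cis_mult distrib_left)

lemma echar_0 [simp]: "echar 0 = 1" by (simp add: echar_def)

lemma echar_gauss [simp]: "echar (cg k) = 1"
  by (simp add: echar_def cis_multiple_2pi)

lemma norm_echar [simp]: "cmod (echar z) = 1" by (simp add: echar_def)

lemma cnj_echar: "cnj (echar z) = echar (- z)"
  by (simp add: echar_def cis_cnj)

lemma echar_eq_1_iff: "echar z = 1 \<longleftrightarrow> Re z \<in> \<int>"
proof
  assume "echar z = 1"
  then have "cos (2 * pi * Re z) = 1" by (metis cis.simps(1) echar_def one_complex.simps(1))
  then obtain n :: int where "2 * pi * Re z = of_int n * 2 * pi" using cos_one_2pi_int by auto
  then have "Re z = of_int n" by simp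
  then show "Re z \<in> \<int>" by simp
next
  assume "Re z \<in> \<int>"
  then obtain n where "Re z = of_int n" by (auto elim: Ints_cases)
  then show "echar z = 1" by (simp add: echar_def cis_multiple_2pi)
qed

definition achar :: "gauss_int \<Rightarrow> gauss_int \<Rightarrow> complex" where
  "achar n x = echar (cg x / cg n)"

lemma achar_add: "achar n (x + y) = achar n x * achar n y"
  by (simp add: achar_def echar_add add_divide_distrib)

lemma achar_0 [simp]: "achar n 0 = 1" by (simp add: achar_def)

lemma norm_achar [simp]: "cmod (achar n x) = 1" by (simp add: achar_def)

lemma cnj_achar: "cnj (achar n x) = achar n (- x)"
  by (simp add: achar_def cnj_echar)

lemma achar_eq_1: "n dvd x \<Longrightarrow> achar n x = 1"
  by (cases "n = 0") (auto simp: achar_def elim!: dvdE)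

lemma achar_cong: "n dvd x - y \<Longrightarrow> achar n x = achar n y"
  using achar_add[of n "x - y" y] achar_eq_1[of n "x - y"] by simp

lemma achar_nontrivial:
  assumes "n \<noteq> 0" "\<not> n dvd k"
  shows "\<exists>x. achar n (k * x) \<noteq> 1"
proof (rule ccontr)
  assume "\<not> ?thesis"
  then have all: "achar n (k * x) = 1" for x by blast
  define z where "z = cg k / cg n"
  have "Re z \<in> \<int>" using all[of 1] by (simp add: achar_def echar_eq_1_iff z_def)
  moreover have "Re (z * \<i>) \<in> \<int>" using all[of gauss_i]
    by (simp add: achar_def echar_eq_1_iff z_def)
  ultimately obtain a b where ab: "Re z = of_int a" "Im z = of_int b"
    by (metis Ints_cases Ints_minus Re_i_times mult.commute add.inverse_inverse)
  then have "z = cg (Gauss_Int a b)" by (simp add: complex_eq_iff)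
  then have "cg k = cg (n * Gauss_Int a b)"
    using assms(1) by (simp add: z_def field_simps)
  then have "k = n * Gauss_Int a b" by (simp only: complex_of_gauss_eq_iff)
  then show False using assms(2) by simp
qed

lemma sum_achar:
  assumes "n \<noteq> 0"
  shows "(\<Sum>x\<in>gres n. achar n (k * x)) = (if n dvd k then of_nat (gauss_norm n) else 0)"
proof (cases "n dvd k")
  case True
  then show ?thesis using assms by (simp add: achar_eq_1 card_gres)
next
  case False
  obtain y where y: "achar n (k * y) \<noteq> 1" using achar_nontrivial[OF assms False] by blast
  have "(\<Sum>x\<in>gres n. achar n (k * (x + y))) = (\<Sum>x\<in>gres n. achar n (k * x))"
  proof (rule sum_gres_transform[OF assms, where f = "\<lambda>x. achar n (k * x)"])
    show "achar n (k * x) = achar n (k * y)" if "n dvd x - y" for x y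
      by (rule achar_cong) (metis that dvd_mult right_diff_distrib)
  qed auto
  then have "(\<Sum>x\<in>gres n. achar n (k * x)) * achar n (k * y) = (\<Sum>x\<in>gres n. achar n (k * x))"
    by (simp add: achar_add distrib_left sum_distrib_right)
  then have "(\<Sum>x\<in>gres n. achar n (k * x)) * (achar n (k * y) - 1) = 0"
    by (simp add: right_diff_distrib)
  then show ?thesis using y False by simp
qed

section \<open>Primary elements and factorisation\<close>

definition primary :: "gauss_int \<Rightarrow> bool" where
  "primary z \<longleftrightarrow> (1 + gauss_i) ^ 3 dvd z - 1"

lemma primary_iff: "primary z \<longleftrightarrow> even (gim z) \<and> 4 dvd gre z + gim z - 1"
proof -
  have c: "(1 + gauss_i) ^ 3 = Gauss_Int (- 2) 2"
    by (simp add: gauss_int_eq_iff eval_nat_numeral)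
  show ?thesis
  proof
    assume "primary z"
    then obtain w where "z - 1 = Gauss_Int (- 2) 2 * w" unfolding primary_def c by (auto elim: dvdE)
    then have e: "gre z - 1 = - 2 * gre w - 2 * gim w" "gim z = - 2 * gim w + 2 * gre w"
      by (simp_all add: gauss_int_eq_iff)
    then have "gre z + gim z - 1 = 4 * (- gim w)" by simp
    then show "even (gim z) \<and> 4 dvd gre z + gim z - 1" using e(2) by (metis dvd_triv_left dvd_add_right_iff even_mult_iff even_numeral even_minus minus_mult_left)
  next
    assume h: "even (gim z) \<and> 4 dvd gre z + gim z - 1"
    then obtain b where b: "gim z = 2 * b" by (auto elim: evenE)
    from h obtain k where k: "gre z + gim z - 1 = 4 * k" by (auto elim: dvdE)
    have "z - 1 = Gauss_Int (- 2) 2 * Gauss_Int (b - k) (- k)"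
      using b k by (simp add: gauss_int_eq_iff)
    then show "primary z" unfolding primary_def c by (metis dvd_triv_left)
  qed
qed

lemma primary_1 [simp]: "primary 1" by (simp add: primary_def)

lemma primary_mult: "primary x \<Longrightarrow> primary y \<Longrightarrow> primary (x * y)"
proof -
  assume "primary x" "primary y"
  then have "(1 + gauss_i) ^ 3 dvd (x - 1) * y + (y - 1)" unfolding primary_def by (intro dvd_add dvd_mult2)
  then show ?thesis by (simp add: primary_def algebra_simps)
qed

lemma primary_prod: "(\<And>x. x \<in> A \<Longrightarrow> primary (f x)) \<Longrightarrow> primary (prod f A)"
  by (induction A rule: infinite_finite_induct) (auto intro: primary_mult)

lemma primary_unit_mult: "primary (u * z) \<Longrightarrow> primary z \<Longrightarrow> u dvd 1 \<Longrightarrow> u = 1"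
  unfolding gauss_unit_iff primary_iff by auto presburger+

lemma odd_norm_iff: "odd (gauss_norm z) \<longleftrightarrow> odd (gre z + gim z)"
proof -
  have "odd (gauss_norm z) \<longleftrightarrow> odd (int (gauss_norm z))" by simp
  also have "\<dots> \<longleftrightarrow> odd (gre z + gim z)" unfolding int_gauss_norm by simp
  finally show ?thesis .
qed

lemma primary_odd_norm: "primary z \<Longrightarrow> odd (gauss_norm z)"
  unfolding primary_iff odd_norm_iff by presburger

lemma exists_primary_associate:
  assumes "odd (gauss_norm z)"
  shows "\<exists>u. u dvd 1 \<and> primary (u * z)"
proof -
  have "odd (gre z + gim z)" using assms by (simp add: odd_norm_iff)
  then have "primary (1 * z) \<or> primary ((- 1) * z) \<or> primary (gauss_i * z) \<or> primary ((- gauss_i) * z)"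
    unfolding primary_iff by simp presburger
  then show ?thesis unfolding gauss_unit_iff by blast
qed

lemma one_plus_i_dvd_iff: "1 + gauss_i dvd z \<longleftrightarrow> even (gauss_norm z)"
proof
  assume "1 + gauss_i dvd z"
  then have "gauss_norm (1 + gauss_i) dvd gauss_norm z" by (rule gauss_norm_dvd)
  then show "even (gauss_norm z)" by (simp add: gauss_norm_def)
next
  assume "even (gauss_norm z)"
  then have "even (gre z + gim z)" using odd_norm_iff by blast
  then obtain k where "gre z + gim z = 2 * k" by (rule evenE)
  then have "z = (1 + gauss_i) * Gauss_Int k (gim z - k)" by (simp add: gauss_int_eq_iff)
  then show "1 + gauss_i dvd z" by (metis dvd_triv_left)
qed

lemma prime_elem_even_norm:
  assumes "prime_elem p" "even (gauss_norm p)"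
  shows "\<exists>u. u dvd 1 \<and> p = u * (1 + gauss_i)"
proof -
  obtain w where w: "p = (1 + gauss_i) * w" using assms(2) one_plus_i_dvd_iff by (auto elim: dvdE)
  have "\<not> 1 + gauss_i dvd 1" using one_plus_i_dvd_iff[of 1] by simp
  then have "w dvd 1" using irreducibleD[OF prime_elem_imp_irreducible[OF assms(1)] w] by simp
  then show ?thesis using w by (metis mult.commute)
qed

text \<open>The primary primes represent the primes of odd norm up to units.\<close>

definition PP :: "gauss_int set" where
  "PP = {p. prime_elem p \<and> primary p}"

lemma PP_prime: "p \<in> PP \<Longrightarrow> prime_elem p" and PP_primary: "p \<in> PP \<Longrightarrow> primary p"
  by (auto simp: PP_def)

lemma PP_nonzero: "p \<in> PP \<Longrightarrow> p \<noteq> 0" using PP_prime by force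

lemma odd_norm_mod_4: "odd (gauss_norm z) \<Longrightarrow> gauss_norm z mod 4 = 1"
proof -
  assume "odd (gauss_norm z)"
  then have o: "odd (gre z + gim z)" by (simp add: odd_norm_iff)
  have sq: "x\<^sup>2 mod 4 = (if even x then 0 else 1)" for x :: int
  proof (cases "even x")
    case True then show ?thesis by (auto elim!: evenE simp: power2_eq_square)
  next
    case False
    then obtain k where "x = 2 * k + 1" by (auto elim: oddE)
    then have "x\<^sup>2 = 1 + 4 * (k * k + k)" by (simp add: power2_eq_square algebra_simps)
    then show ?thesis using False by presburger
  qed
  have "int (gauss_norm z) mod 4 = 1"
    unfolding int_gauss_norm using o sq[of "gre z"] sq[of "gim z"] mod_add_eq[of "(gre z)\<^sup>2" 4 "(gim z)\<^sup>2"]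
    by (auto split: if_splits)
  then show ?thesis by (metis of_nat_1 of_nat_eq_iff of_nat_mod of_nat_numeral)
qed

lemma PP_norm_mod_4: "p \<in> PP \<Longrightarrow> gauss_norm p mod 4 = 1"
  using odd_norm_mod_4 PP_primary primary_odd_norm by blast

lemma PP_not_unit: "p \<in> PP \<Longrightarrow> \<not> p dvd 1"
  using PP_prime prime_elem_def by blast

lemma PP_norm_ge_5: "p \<in> PP \<Longrightarrow> gauss_norm p \<ge> 5"
proof -
  assume p: "p \<in> PP"
  have "gauss_norm p \<noteq> 1" using PP_not_unit[OF p] gauss_norm_eq_1_iff by blast
  then show ?thesis using PP_norm_mod_4[OF p] by presburger
qed

lemma PP_dvd_PP: "p \<in> PP \<Longrightarrow> q \<in> PP \<Longrightarrow> p dvd q \<Longrightarrow> p = q"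
proof -
  assume p: "p \<in> PP" and q: "q \<in> PP" and "p dvd q"
  then obtain w where w: "q = p * w" by (auto elim: dvdE)
  then have "w dvd 1" using irreducibleD[OF prime_elem_imp_irreducible[OF PP_prime[OF q]] w] PP_not_unit[OF p] by blast
  then have "w = 1" using primary_unit_mult[of w p] PP_primary[OF p] PP_primary[OF q] w by (simp add: mult.commute)
  then show "p = q" using w by simp
qed

lemma prime_elem_dvd_prod:
  assumes "finite A" "prime_elem p"
  shows "p dvd prod f A \<longleftrightarrow> (\<exists>x\<in>A. p dvd f x)"
  using assms by (induction A) (auto simp: prime_elem_dvd_mult_iff dest: prime_elem_not_unit)

lemma PP_dvd_prod_iff:
  assumes "p \<in> PP" "finite P" "P \<subseteq> PP"
  shows "p dvd \<Prod>P \<longleftrightarrow> p \<in> P"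
  using prime_elem_dvd_prod[OF assms(2) PP_prime[OF assms(1)], of "\<lambda>x. x"] assms PP_dvd_PP
  by (metis dvd_refl subsetD)

lemma PP_prod_dvd_iff:
  assumes "finite P" "P \<subseteq> PP"
  shows "\<Prod>P dvd z \<longleftrightarrow> (\<forall>p\<in>P. p dvd z)"
  using assms
proof (induction P arbitrary: z)
  case (insert p P)
  have p: "p \<in> PP" using insert by auto
  show ?case
  proof
    assume "\<Prod>(insert p P) dvd z"
    then show "\<forall>q\<in>insert p P. q dvd z"
      using insert by (metis dvd_mult_left dvd_mult_right insert_iff insert_subset prod.insert)
  next
    assume h: "\<forall>q\<in>insert p P. q dvd z"
    then have "\<Prod>P dvd z" using insert by blast
    then obtain w where w: "z = \<Prod>P * w" unfolding dvd_def by blast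
    have "\<not> p dvd \<Prod>P" using PP_dvd_prod_iff[OF p] insert by auto
    then have "p dvd w" using h w PP_prime[OF p] by (auto simp: prime_elem_dvd_mult_iff)
    then show "\<Prod>(insert p P) dvd z" using w insert by (simp add: mult.commute mult_dvd_mono)
  qed
qed simp

lemma prod_PP_nonzero: "P \<subseteq> PP \<Longrightarrow> \<Prod>P \<noteq> 0"
  by (cases "finite P") (auto dest: PP_nonzero)

lemma prod_PP_inj:
  assumes "finite P" "P \<subseteq> PP" "finite Q" "Q \<subseteq> PP" "\<Prod>P = \<Prod>Q"
  shows "P = Q"
  using PP_dvd_prod_iff assms by (metis subsetD subsetI subset_antisym)

lemma norm_prod_PP_pos: "P \<subseteq> PP \<Longrightarrow> gauss_norm (\<Prod>P) \<ge> 1"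
  using prod_PP_nonzero[of P] by (simp add: Suc_le_eq zero_less_iff_neq_zero)

lemma prime_elem_associate:
  assumes "prime_elem q"
  shows "\<exists>u. u dvd 1 \<and> (q = u * (1 + gauss_i) \<or> (\<exists>p\<in>PP. q = u * p))"
proof (cases "even (gauss_norm q)")
  case True
  then show ?thesis using prime_elem_even_norm[OF assms] by blast
next
  case False
  then obtain u where u: "u dvd 1" "primary (u * q)" using exists_primary_associate by blast
  then obtain v where v: "1 = u * v" by (auto elim: dvdE)
  have "prime_elem (u * q)" using u assms by (simp add: prime_elem_mult_unit_left)
  then have "u * q \<in> PP" using u by (simp add: PP_def)
  moreover have "q = v * (u * q)" using v by (metis mult.assoc mult.commute mult_1)
  moreover have "v dvd 1" using v by (metis dvd_triv_right)
  ultimately show ?thesis by blast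
qed

text \<open>Every prime is a unit times \<open>1 + i\<close> or a unit times a primary prime; the units are collected in \<open>u\<close>.\<close>

lemma gauss_factorization:
  assumes "k \<noteq> (0 :: gauss_int)"
  shows "\<exists>u j P f. u dvd 1 \<and> finite P \<and> P \<subseteq> PP \<and> k = u * (1 + gauss_i) ^ j * (\<Prod>p\<in>P. p ^ f p)"
  using assms
proof (induction k rule: prime_divisors_induct)
  case zero then show ?case by simp
next
  case (unit x)
  then show ?case by (intro exI[of _ x] exI[of _ 0] exI[of _ "{}"]) auto
next
  case (factor q x)
  then obtain u j P f where IH: "u dvd 1" "finite P" "P \<subseteq> PP"
    "x = u * (1 + gauss_i) ^ j * (\<Prod>p\<in>P. p ^ f p)" by auto
  obtain v where v: "v dvd 1" "q = v * (1 + gauss_i) \<or> (\<exists>p\<in>PP. q = v * p)"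
    using prime_elem_associate factor by (metis prime_imp_prime_elem)
  have vu: "v * u dvd 1" using IH(1) v(1) by (metis mult_dvd_mono mult_1)
  from v(2) show ?case
  proof
    assume "q = v * (1 + gauss_i)"
    then have "q * x = (v * u) * (1 + gauss_i) ^ Suc j * (\<Prod>p\<in>P. p ^ f p)"
      using IH by (simp add: mult_ac)
    then show ?thesis using vu IH by blast
  next
    assume "\<exists>p\<in>PP. q = v * p"
    then obtain p where p: "p \<in> PP" "q = v * p" by blast
    define f' where "f' = (if p \<in> P then f(p := Suc (f p)) else f(p := 1))"
    have "(\<Prod>r\<in>insert p P. r ^ f' r) = p * (\<Prod>r\<in>P. r ^ f r)"
    proof (cases "p \<in> P")
      case True
      have "(\<Prod>r\<in>P - {p}. r ^ f' r) = (\<Prod>r\<in>P - {p}. r ^ f r)"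
        using True by (intro prod.cong) (auto simp: f'_def)
      then show ?thesis using IH(2) True
        by (simp add: insert_absorb prod.remove[of P p] mult_ac) (simp add: f'_def)
    next
      case False
      then have "(\<Prod>r\<in>P. r ^ f' r) = (\<Prod>r\<in>P. r ^ f r)" by (intro prod.cong) (auto simp: f'_def)
      then show ?thesis using False IH(2) by (simp add: f'_def)
    qed
    then have "q * x = (v * u) * (1 + gauss_i) ^ j * (\<Prod>r\<in>insert p P. r ^ f' r)"
      using IH p by (simp add: mult_ac)
    then show ?thesis using vu IH(2,3) p(1) by (metis finite_insert insert_subset)
  qed
qed

lemma squarefree_primary_is_prod:
  assumes "squarefree n" "primary n"
  shows "\<exists>P. finite P \<and> P \<subseteq> PP \<and> n = \<Prod>P"
proof -
  have "n \<noteq> 0" using assms(2) by (auto simp: primary_iff)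
  then obtain u j P f where n: "u dvd 1" "finite P" "P \<subseteq> PP"
    "n = u * (1 + gauss_i) ^ j * (\<Prod>p\<in>P. p ^ f p)" using gauss_factorization[OF \<open>n \<noteq> 0\<close>] by blast
  have "j = 0"
  proof (rule ccontr)
    assume "j \<noteq> 0"
    then have "1 + gauss_i dvd n" using n(4) by (metis dvd_mult dvd_mult2 dvd_power gr0I)
    then show False using one_plus_i_dvd_iff primary_odd_norm[OF assms(2)] by blast
  qed
  have f: "f p \<le> 1" if "p \<in> P" for p
  proof (rule ccontr)
    assume "\<not> f p \<le> 1"
    then have "p ^ 2 dvd p ^ f p" by (intro le_imp_power_dvd) simp
    also have "p ^ f p dvd n" using n that by (metis dvd_mult dvd_prodI)
    finally have "p dvd 1" using assms(1) by (simp add: squarefree_def)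
    then show False using PP_not_unit that n(3) by blast
  qed
  define P' where "P' = {p\<in>P. f p = 1}"
  have "(\<Prod>p\<in>P. p ^ f p) = (\<Prod>p\<in>P. if p \<in> P' then p else 1)"
  proof (intro prod.cong refl)
    fix p assume "p \<in> P"
    then show "p ^ f p = (if p \<in> P' then p else 1)"
      using f[of p] by (cases "f p"; cases "f p = 1") (auto simp: P'_def)
  qed
  also have "\<dots> = \<Prod>P'" using n(2) by (simp add: P'_def prod.If_cases Int_def conj_commute)
  finally have "n = u * \<Prod>P'" using n \<open>j = 0\<close> by simp
  moreover have "P' \<subseteq> PP" "finite P'" using n by (auto simp: P'_def)
  moreover have "u = 1"
    using primary_unit_mult[of u "\<Prod>P'"] calculation assms n(1) primary_prod[of P' "\<lambda>x. x"] PP_primary by auto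
  ultimately show ?thesis by auto
qed

lemma prod_PP_primary: "P \<subseteq> PP \<Longrightarrow> primary (\<Prod>P)"
  using primary_prod[of P "\<lambda>x. x"] PP_primary by auto

lemma prod_PP_squarefree:
  assumes "finite P" "P \<subseteq> PP"
  shows "squarefree (\<Prod>P)"
proof (rule squarefreeI)
  fix x assume x: "x\<^sup>2 dvd \<Prod>P"
  have "x \<noteq> 0" using x prod_PP_nonzero[OF assms(2)] by auto
  show "x dvd 1"
  proof (rule ccontr)
    assume nu: "\<not> x dvd 1"
    obtain q where q: "prime q" "q dvd x" using prime_divisor_exists[OF \<open>x \<noteq> 0\<close> nu] by blast
    then have q2: "q * q dvd \<Prod>P" using x by (metis dvd_trans mult_dvd_mono power2_eq_square)
    then have "q dvd \<Prod>P" using dvd_mult_left by blast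
    then obtain p where p: "p \<in> P" "q dvd p"
      using prime_elem_dvd_prod[OF assms(1), of q "\<lambda>x. x"] q by auto
    then obtain w where w: "p = q * w" by (auto elim: dvdE)
    have "\<not> q dvd 1" using q by auto
    then have "w dvd 1" using irreducibleD[OF prime_elem_imp_irreducible w] PP_prime p assms by blast
    then have "p dvd q" using w by (simp add: mult_unit_dvd_iff)
    then have "p * p dvd \<Prod>P" using q2 by (metis dvd_trans mult_dvd_mono)
    also have "\<Prod>P = p * \<Prod>(P - {p})" using assms p by (simp add: prod.remove)
    finally have "p dvd \<Prod>(P - {p})" using p assms PP_nonzero by auto
    then show False using PP_dvd_prod_iff[of p "P - {p}"] p assms by auto
  qed
qed

definition psets :: "nat \<Rightarrow> gauss_int set set" where
  "psets X = {P. finite P \<and> P \<subseteq> PP \<and> gauss_norm (\<Prod>P) \<le> X}"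

text \<open>The congruence condition removes the unit and the power of \<open>1 + i\<close> from the factorisation, so that
  the product determines the set of primes and conversely.\<close>

lemma bij_betw_psets: "bij_betw (\<lambda>P. \<Prod>P) (psets X) (gauss_star_upto X)"
proof (rule bij_betwI')
  show "\<Prod>P = \<Prod>Q \<longleftrightarrow> P = Q" if "P \<in> psets X" "Q \<in> psets X" for P Q
    using that prod_PP_inj[of P Q] by (auto simp: psets_def)
  show "\<Prod>P \<in> gauss_star_upto X" if "P \<in> psets X" for P
    using that prod_PP_squarefree prod_PP_primary
    by (auto simp: psets_def gauss_star_upto_def primary_def[symmetric])
  show "\<exists>P\<in>psets X. n = \<Prod>P" if "n \<in> gauss_star_upto X" for n
    using that squarefree_primary_is_prod[of n]
    by (auto simp: psets_def gauss_star_upto_def primary_def[symmetric])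
qed

lemma finite_psets: "finite (psets X)"
  using bij_betw_finite[OF bij_betw_psets] finite_gauss_star_upto by blast

section \<open>The quartic residue symbol modulo a primary prime\<close>

lemma dvd_prod_diff:
  fixes n :: "'a :: comm_ring_1"
  assumes "\<And>x. x \<in> A \<Longrightarrow> n dvd f x - g x"
  shows "n dvd prod f A - prod g A"
  using assms
proof (induction A rule: infinite_finite_induct)
  case (insert x A)
  have "n dvd (f x - g x) * prod f A + g x * (prod f A - prod g A)"
    using insert by (intro dvd_add dvd_mult dvd_mult2) auto
  also have "(f x - g x) * prod f A + g x * (prod f A - prod g A) = prod f (insert x A) - prod g (insert x A)"
    using insert by (simp add: algebra_simps)
  finally show ?case .
qed auto

lemma dvd_power_diff: "(n :: 'a :: comm_ring_1) dvd x - y \<Longrightarrow> n dvd x ^ k - y ^ k"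
  using dvd_prod_diff[of "{..<k}" n "\<lambda>_. x" "\<lambda>_. y"] by simp

lemma dvd_mult_diff:
  "(n :: 'a :: comm_ring_1) dvd x - y \<Longrightarrow> n dvd x' - y' \<Longrightarrow> n dvd x * x' - y * y'"
proof -
  assume "n dvd x - y" "n dvd x' - y'"
  then have "n dvd (x - y) * x' + y * (x' - y')" by (intro dvd_add dvd_mult dvd_mult2)
  then show ?thesis by (simp add: algebra_simps)
qed

lemma dvd_diff_trans: "(n :: 'a :: comm_ring_1) dvd x - y \<Longrightarrow> n dvd y - z \<Longrightarrow> n dvd x - z"
  using dvd_add[of n "x - y" "y - z"] by simp

lemma dvd_diff_sym: "(n :: 'a :: comm_ring_1) dvd x - y \<Longrightarrow> n dvd y - x"
  using dvd_minus_iff[of n "x - y"] by simp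

lemma dvd_diff_cong: "(n :: 'a :: comm_ring_1) dvd x - y \<Longrightarrow> n dvd x \<longleftrightarrow> n dvd y"
  using dvd_add_right_iff[of n "x - y" y] by simp

lemma PP_dvd_mult_iff: "p \<in> PP \<Longrightarrow> p dvd a * b \<longleftrightarrow> p dvd a \<or> p dvd b"
  using PP_prime prime_elem_dvd_mult_iff by blast

lemma PP_dvd_power_iff: "p \<in> PP \<Longrightarrow> p dvd a ^ k \<longleftrightarrow> p dvd a \<and> k > 0"
proof (induction k)
  case 0
  then show ?case using PP_not_unit by auto
qed (auto simp: PP_dvd_mult_iff)

definition gunits :: "gauss_int \<Rightarrow> gauss_int set" where
  "gunits p = {x \<in> gres p. \<not> p dvd x}"

lemma finite_gunits: "p \<in> PP \<Longrightarrow> finite (gunits p)"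
  using PP_nonzero by (auto simp: gunits_def)

lemma card_gunits: "p \<in> PP \<Longrightarrow> card (gunits p) = gauss_norm p - 1"
proof -
  assume p: "p \<in> PP"
  have "p dvd x \<longleftrightarrow> x = 0 mod p" if "x \<in> gres p" for x
    using gres_mod_id[OF PP_nonzero[OF p] that] gauss_mod_eq_iff[OF PP_nonzero[OF p], of x 0] by simp
  then have "gunits p = gres p - {0 mod p}" by (auto simp: gunits_def)
  then show ?thesis using card_gres[OF PP_nonzero[OF p]] finite_gres[OF PP_nonzero[OF p]]
    by (metis card_Diff_singleton mod_in_gres)
qed

lemma gauss_fermat:
  assumes p: "p \<in> PP" and a: "\<not> p dvd a"
  shows "p dvd a ^ (gauss_norm p - 1) - 1"
proof -
  have nz: "p \<noteq> 0" using PP_nonzero[OF p] .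
  have inj: "inj_on (\<lambda>x. a * x mod p) (gunits p)"
  proof (rule inj_onI)
    fix x y assume xy: "x \<in> gunits p" "y \<in> gunits p" "a * x mod p = a * y mod p"
    then have "p dvd a * (x - y)" using nz by (simp add: gauss_mod_eq_iff right_diff_distrib)
    then have "p dvd x - y" using a p by (simp add: PP_dvd_mult_iff)
    then show "x = y" using xy nz gres_inj by (auto simp: gunits_def)
  qed
  have "(\<lambda>x. a * x mod p) ` gunits p \<subseteq> gunits p"
  proof safe
    fix x assume x: "x \<in> gunits p"
    have "p dvd a * x mod p \<longleftrightarrow> p dvd a * x"
      by (metis dvd_diff_cong gauss_dvd_diff_mod)
    then show "a * x mod p \<in> gunits p" using x a p by (auto simp: gunits_def PP_dvd_mult_iff)
  qed
  then have img: "(\<lambda>x. a * x mod p) ` gunits p = gunits p"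
    using endo_inj_surj[OF finite_gunits[OF p] _ inj] by blast
  have "\<Prod>(gunits p) = (\<Prod>x\<in>gunits p. a * x mod p)"
    using prod.reindex[OF inj, of "\<lambda>x. x"] img by simp
  moreover have "p dvd (\<Prod>x\<in>gunits p. a * x) - (\<Prod>x\<in>gunits p. a * x mod p)"
    by (intro dvd_prod_diff gauss_dvd_diff_mod)
  moreover have "(\<Prod>x\<in>gunits p. a * x) = a ^ (gauss_norm p - 1) * \<Prod>(gunits p)"
    by (simp add: prod.distrib card_gunits[OF p])
  ultimately have "p dvd (a ^ (gauss_norm p - 1) - 1) * \<Prod>(gunits p)"
    by (simp add: left_diff_distrib)
  moreover have "\<not> p dvd \<Prod>(gunits p)"
    using prime_elem_dvd_prod[OF finite_gunits[OF p] PP_prime[OF p], of "\<lambda>x. x"]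
    by (auto simp: gunits_def)
  ultimately show ?thesis using p by (simp add: PP_dvd_mult_iff)
qed

text \<open>Lagrange's bound on the number of roots in the residue field.\<close>

lemma roots_modulo_prime:
  fixes f :: "gauss_int poly"
  assumes "p \<in> PP" "degree f \<le> d" "finite A" "card A > d"
    and "\<And>x. x \<in> A \<Longrightarrow> p dvd poly f x"
    and "\<And>x y. x \<in> A \<Longrightarrow> y \<in> A \<Longrightarrow> p dvd x - y \<Longrightarrow> x = y"
  shows "p dvd coeff f i"
  using assms(2-)
proof (induction d arbitrary: f A i)
  case 0
  then obtain x where x: "x \<in> A" by fastforce
  obtain c where "f = [:c:]" using 0(1) degree_0_id by (metis le_zero_eq)
  then show ?case using 0(4)[OF x] by (cases i) auto
next
  case (Suc d)
  obtain a where a: "a \<in> A" using Suc.prems(3) by fastforce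
  define g where "g = synthetic_div f a"
  have f: "f = [:- a, 1:] * g + [:poly f a:]"
    using synthetic_div_correct'[of a f] by (simp add: g_def)
  have "p dvd coeff g i" for i
  proof (rule Suc.IH)
    show "degree g \<le> d" using Suc.prems(1) by (simp add: g_def degree_synthetic_div)
    show "finite (A - {a})" using Suc.prems by simp
    show "d < card (A - {a})" using Suc.prems a by simp
    show "p dvd poly g x" if "x \<in> A - {a}" for x
    proof -
      have "p dvd poly f x - poly f a" using Suc.prems(4) a that by (intro dvd_diff) auto
      also have "poly f x - poly f a = (x - a) * poly g x" by (subst f) (simp add: algebra_simps)
      finally show ?thesis using Suc.prems(5)[of x a] that a assms(1) by (auto simp: PP_dvd_mult_iff)
    qed
  qed (use Suc.prems(5) in auto)
  moreover have "coeff f i = coeff (pCons 0 g) i - a * coeff g i + coeff [:poly f a:] i"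
    by (subst f) simp
  moreover have "p dvd poly f a" using Suc.prems(4) a by blast
  ultimately show ?case
    by (auto simp: coeff_pCons split: nat.splits intro!: dvd_add dvd_diff)
qed

lemma exists_nonroot:
  assumes p: "p \<in> PP" and d: "0 < d" "d < gauss_norm p - 1"
  shows "\<exists>u. \<not> p dvd u \<and> \<not> p dvd u ^ d - 1"
proof (rule ccontr)
  assume "\<not> ?thesis"
  then have r: "p dvd poly (monom 1 d - 1) u" if "u \<in> gunits p" for u
    using that by (auto simp: gunits_def poly_monom)
  have "p dvd coeff (monom 1 d - 1) d"
  proof (rule roots_modulo_prime[OF p _ finite_gunits[OF p]])
    show "degree (monom (1::gauss_int) d - 1) \<le> d"
      by (rule degree_diff_le) (auto simp: degree_monom_le)
    show "d < card (gunits p)" using d card_gunits[OF p] by simp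
  qed (use r gres_inj PP_nonzero[OF p] in \<open>auto simp: gunits_def\<close>)
  then show False using d PP_not_unit[OF p] by (simp add: coeff_1)
qed

abbreviation qchi :: "gauss_int \<Rightarrow> gauss_int \<Rightarrow> complex" where
  "qchi p a \<equiv> quartic_symbol_prime a p"

lemma PP_norm_neq_2: "p \<in> PP \<Longrightarrow> gauss_norm p \<noteq> 2"
  using PP_norm_ge_5 by force

lemma PP_norm_minus_1: "p \<in> PP \<Longrightarrow> gauss_norm p - 1 = (gauss_norm p - 1) div 4 * 4"
  using PP_norm_mod_4[of p] PP_norm_ge_5[of p] by presburger

lemma qchi_eqI:
  assumes p: "p \<in> PP" and "\<not> p dvd a" "u dvd 1" "p dvd a ^ ((gauss_norm p - 1) div 4) - u"
  shows "qchi p a = cg u"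
proof -
  have "(THE u. u \<in> {1, - 1, gauss_i, - gauss_i} \<and> p dvd a ^ ((gauss_norm p - 1) div 4) - u) = u"
  proof (rule the_equality)
    show u: "u \<in> {1, - 1, gauss_i, - gauss_i} \<and> p dvd a ^ ((gauss_norm p - 1) div 4) - u"
      using assms(3,4) unfolding gauss_unit_iff by blast
    show "v = u" if "v \<in> {1, - 1, gauss_i, - gauss_i} \<and> p dvd a ^ ((gauss_norm p - 1) div 4) - v" for v
      using quartic_unit_unique[OF PP_prime[OF p] PP_norm_neq_2[OF p]] u that by blast
  qed
  then show ?thesis using assms by (simp add: quartic_symbol_prime_def)
qed

lemma qchi_ex:
  assumes p: "p \<in> PP" and a: "\<not> p dvd a"
  shows "\<exists>u. u dvd 1 \<and> p dvd a ^ ((gauss_norm p - 1) div 4) - u"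
proof -
  define y where "y = a ^ ((gauss_norm p - 1) div 4)"
  have "p dvd y ^ 4 - 1"
    using gauss_fermat[OF assms] PP_norm_minus_1[OF p] by (metis power_mult y_def)
  also have "y ^ 4 - 1 = (y - 1) * (y - (- 1)) * (y - gauss_i) * (y - (- gauss_i))"
  proof -
    have i: "gauss_i * gauss_i = - 1" by (simp add: gauss_int_eq_iff)
    have "(y - gauss_i) * (y - (- gauss_i)) = y * y - gauss_i * gauss_i" by (simp add: algebra_simps)
    then show ?thesis by (simp add: i mult.assoc) (simp add: algebra_simps eval_nat_numeral)
  qed
  finally show ?thesis using p unfolding y_def[symmetric] gauss_unit_iff PP_dvd_mult_iff[OF p] by blast
qed

lemma qchi_spec:
  assumes p: "p \<in> PP" and a: "\<not> p dvd a"
  obtains u where "u dvd 1" "p dvd a ^ ((gauss_norm p - 1) div 4) - u" "qchi p a = cg u"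
  using qchi_ex[OF assms] qchi_eqI[OF assms] by blast

lemma qchi_dvd: "p dvd a \<Longrightarrow> qchi p a = 0"
  by (simp add: quartic_symbol_prime_def)

lemma unit_power4: "u dvd 1 \<Longrightarrow> cg u ^ 4 = 1"
  by (auto simp: gauss_unit_iff eval_nat_numeral)

lemma qchi_power4: "p \<in> PP \<Longrightarrow> \<not> p dvd a \<Longrightarrow> qchi p a ^ 4 = 1"
  using qchi_spec unit_power4 by metis

lemma qchi_norm: "p \<in> PP \<Longrightarrow> \<not> p dvd a \<Longrightarrow> cmod (qchi p a) = 1"
  using power_eq_1_iff[of "qchi p a" 4] qchi_power4[of p a] by simp

lemma qchi_mult: "p \<in> PP \<Longrightarrow> qchi p (a * b) = qchi p a * qchi p b"
proof (cases "p dvd a \<or> p dvd b")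
  case False
  assume p: "p \<in> PP"
  obtain u where u: "u dvd 1" "p dvd a ^ ((gauss_norm p - 1) div 4) - u" "qchi p a = cg u"
    using qchi_spec[OF p] False by blast
  obtain v where v: "v dvd 1" "p dvd b ^ ((gauss_norm p - 1) div 4) - v" "qchi p b = cg v"
    using qchi_spec[OF p] False by blast
  have "qchi p (a * b) = cg (u * v)"
  proof (rule qchi_eqI[OF p])
    show "\<not> p dvd a * b" using False p by (simp add: PP_dvd_mult_iff)
    show "u * v dvd 1" using u v by (metis mult_1 mult_dvd_mono)
    show "p dvd (a * b) ^ ((gauss_norm p - 1) div 4) - u * v"
      using dvd_mult_diff[OF u(2) v(2)] by (simp add: power_mult_distrib)
  qed
  then show ?thesis using u v by simp
qed (auto simp: qchi_dvd)

lemma qchi_cong: "p dvd a - b \<Longrightarrow> qchi p a = qchi p b"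
proof -
  assume d: "p dvd a - b"
  have "p dvd a ^ k - u \<longleftrightarrow> p dvd b ^ k - u" for k u
    using dvd_power_diff[OF d, of k] by (metis dvd_diff_sym dvd_diff_trans)
  then show ?thesis using dvd_diff_cong[OF d] by (simp add: quartic_symbol_prime_def)
qed

lemma qchi_1 [simp]: "p \<in> PP \<Longrightarrow> qchi p 1 = 1"
  using qchi_eqI[of p 1 1] PP_not_unit by simp

lemma qchi_cnj: "p \<in> PP \<Longrightarrow> cnj (qchi p a) = qchi p a ^ 3"
proof (cases "p dvd a")
  case False
  assume p: "p \<in> PP"
  have "qchi p a * cnj (qchi p a) = 1" using qchi_norm[OF p False] complex_norm_square[of "qchi p a"] by simp
  moreover have "qchi p a * qchi p a ^ 3 = 1" using qchi_power4[OF p False] by (simp add: eval_nat_numeral mult.assoc)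
  ultimately show ?thesis by (metis mult.assoc mult.commute mult_1)
qed (simp add: qchi_dvd)

lemma qchi_power_mod_4: "p \<in> PP \<Longrightarrow> \<not> p dvd a \<Longrightarrow> qchi p a ^ k = qchi p a ^ (k mod 4)"
proof -
  assume "p \<in> PP" "\<not> p dvd a"
  then have "qchi p a ^ (4 * (k div 4) + k mod 4) = qchi p a ^ (k mod 4)"
    unfolding power_add power_mult using qchi_power4 by simp
  then show ?thesis by simp
qed

lemma qchi_power:
  "p \<in> PP \<Longrightarrow> qchi p (a ^ k) = qchi p a ^ k"
  by (induction k) (auto simp: qchi_mult)

lemma qchi_prod: "p \<in> PP \<Longrightarrow> qchi p (prod f A) = (\<Prod>x\<in>A. qchi p (f x))"
  by (induction A rule: infinite_finite_induct) (auto simp: qchi_mult)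

text \<open>The symbol has exact order four, hence its powers with exponents \<open>1, 2, 3\<close> are nontrivial characters.\<close>

lemma exists_qchi_i:
  assumes p: "p \<in> PP"
  shows "\<exists>u. \<not> p dvd u \<and> (qchi p u)\<^sup>2 = - 1"
proof -
  define m where "m = (gauss_norm p - 1) div 4"
  have "m > 0" "2 * m < gauss_norm p - 1"
    using PP_norm_minus_1[OF p] PP_norm_ge_5[OF p] unfolding m_def by linarith+
  then obtain u where u: "\<not> p dvd u" "\<not> p dvd u ^ (2 * m) - 1"
    using exists_nonroot[OF p, of "2 * m"] by auto
  obtain v where v: "v dvd 1" "p dvd u ^ m - v" "qchi p u = cg v"
    using qchi_spec[OF p u(1)] unfolding m_def by blast
  have "p dvd (u ^ m) ^ 2 - v ^ 2" using v(2) by (rule dvd_power_diff)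
  then have "v ^ 2 \<noteq> 1" using u(2) by (metis mult.commute power_mult)
  then have "v = gauss_i \<or> v = - gauss_i" using v(1) unfolding gauss_unit_iff by auto
  then have "(qchi p u)\<^sup>2 = - 1" using v(3) by auto
  with u show ?thesis by blast
qed

section \<open>Characters to squarefree moduli and their Gauss sums\<close>

text \<open>Exponents, rather than products of symbols and conjugates, let one definition cover a symbol, the
  product of a symbol with the conjugate of another one, and the characters attached to
  fourth-power-free numbers.\<close>

definition chiE :: "gauss_int set \<Rightarrow> (gauss_int \<Rightarrow> nat) \<Rightarrow> gauss_int \<Rightarrow> complex" where
  "chiE P e a = (\<Prod>p\<in>P. qchi p a ^ e p)"

lemma chiE_mult: "P \<subseteq> PP \<Longrightarrow> chiE P e (a * b) = chiE P e a * chiE P e b"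
  unfolding chiE_def by (subst prod.distrib[symmetric], rule prod.cong) (auto simp: qchi_mult power_mult_distrib)

lemma chiE_1 [simp]: "P \<subseteq> PP \<Longrightarrow> chiE P e 1 = 1"
  unfolding chiE_def by (intro prod.neutral) auto

lemma chiE_empty [simp]: "chiE {} e a = 1"
  by (simp add: chiE_def)

lemma chiE_cong_mod:
  assumes "finite P" "P \<subseteq> PP" "\<Prod>P dvd a - b"
  shows "chiE P e a = chiE P e b"
  unfolding chiE_def
proof (rule prod.cong[OF refl])
  fix p assume "p \<in> P"
  then have "p dvd a - b" using PP_prod_dvd_iff[OF assms(1,2)] assms(3) by blast
  then show "qchi p a ^ e p = qchi p b ^ e p" using qchi_cong by metis
qed

lemma chiE_norm:
  assumes "P \<subseteq> PP" "\<And>p. p \<in> P \<Longrightarrow> \<not> p dvd a"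
  shows "cmod (chiE P e a) = 1"
  unfolding chiE_def using assms qchi_norm by (subst prod_norm[symmetric]) (intro prod.neutral, auto simp: norm_power)

lemma chiE_norm_le: "P \<subseteq> PP \<Longrightarrow> cmod (chiE P e a) \<le> 1"
  unfolding chiE_def prod_norm[symmetric]
proof (intro prod_le_1 conjI)
  fix p assume "P \<subseteq> PP" "p \<in> P"
  then have "cmod (qchi p a) \<le> 1" by (cases "p dvd a") (auto simp: qchi_dvd qchi_norm)
  then show "cmod (qchi p a ^ e p) \<le> 1" by (simp add: norm_power power_le_one)
qed auto

lemma chiE_zero:
  assumes "finite P" "p \<in> P" "e p > 0" "p dvd a"
  shows "chiE P e a = 0"
  unfolding chiE_def by (rule prod_zero[OF assms(1)], rule bexI[OF _ assms(2)]) (use assms in \<open>simp add: qchi_dvd\<close>)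

lemma chiE_union: "finite P \<Longrightarrow> finite Q \<Longrightarrow> P \<inter> Q = {} \<Longrightarrow> chiE (P \<union> Q) e a = chiE P e a * chiE Q e a"
  by (simp add: chiE_def prod.union_disjoint)

lemma chiE_cong: "(\<And>p. p \<in> P \<Longrightarrow> e p = e' p) \<Longrightarrow> chiE P e a = chiE P e' a"
  unfolding chiE_def by (intro prod.cong) auto

text \<open>For these exponents \<open>chiE P e\<close> is a primitive character modulo \<open>\<Prod>P\<close>.\<close>

definition valid_exps :: "gauss_int set \<Rightarrow> (gauss_int \<Rightarrow> nat) \<Rightarrow> bool" where
  "valid_exps P e \<longleftrightarrow> finite P \<and> P \<subseteq> PP \<and> (\<forall>p\<in>P. 1 \<le> e p \<and> e p \<le> 3)"

lemma chiE_cnj: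
  assumes "valid_exps P e"
  shows "cnj (chiE P e a) = chiE P (\<lambda>p. 4 - e p) a"
  unfolding chiE_def cnj_prod
proof (rule prod.cong[OF refl])
  fix p assume p: "p \<in> P"
  then have P: "p \<in> PP" and e: "1 \<le> e p" "e p \<le> 3" using assms by (auto simp: valid_exps_def)
  show "cnj (qchi p a ^ e p) = qchi p a ^ (4 - e p)"
  proof (cases "p dvd a")
    case False
    have "cnj (qchi p a ^ e p) = qchi p a ^ (3 * e p)" using qchi_cnj[OF P] by (simp add: power_mult)
    also have "\<dots> = qchi p a ^ (3 * e p mod 4)" using qchi_power_mod_4[OF P False] .
    also have "3 * e p mod 4 = 4 - e p"
    proof -
      have "e p = 1 \<or> e p = 2 \<or> e p = 3" using e by linarith
      then show ?thesis by auto
    qed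
    finally show ?thesis .
  qed (use e in \<open>simp add: qchi_dvd power_0_left\<close>)
qed

lemma valid_exps_cnj: "valid_exps P e \<Longrightarrow> valid_exps P (\<lambda>p. 4 - e p)"
  unfolding valid_exps_def by force

lemma exists_inverse_mod:
  assumes "finite P" "P \<subseteq> PP" "\<And>p. p \<in> P \<Longrightarrow> \<not> p dvd c"
  shows "\<exists>v. \<Prod>P dvd x - c * v"
proof -
  have "\<Prod>P dvd a - b" if "\<Prod>P dvd c * a - c * b" for a b
  proof -
    have "\<forall>p\<in>P. p dvd c * (a - b)"
      using that PP_prod_dvd_iff[OF assms(1,2)] by (simp add: right_diff_distrib)
    then have "\<forall>p\<in>P. p dvd a - b" using assms(2,3) PP_dvd_mult_iff by (meson subsetD)
    then show ?thesis using PP_prod_dvd_iff[OF assms(1,2)] by blast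
  qed
  from inj_mod_imp_surj_mod[of "\<Prod>P" "\<lambda>v. c * v", OF prod_PP_nonzero[OF assms(2)] this]
  show ?thesis by blast
qed

text \<open>A residue that is \<open>1\<close> modulo the other primes sees the local factor at \<open>p\<close> alone.\<close>

lemma chiE_nontrivial:
  assumes "finite P" "P \<subseteq> PP" "p \<in> P" "\<not> 4 dvd e p"
  shows "\<exists>u. (\<forall>q\<in>P. \<not> q dvd u) \<and> \<Prod>(P - {p}) dvd u - 1 \<and> chiE P e u \<noteq> 1"
proof -
  have p: "p \<in> PP" using assms by auto
  obtain w where w: "\<not> p dvd w" "(qchi p w)\<^sup>2 = - 1" using exists_qchi_i[OF p] by blast
  define c where "c = \<Prod>(P - {p})"
  have "\<not> p dvd c" unfolding c_def using PP_dvd_prod_iff[OF p, of "P - {p}"] assms by auto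
  then obtain v where v: "p dvd (w - 1) - c * v" using exists_inverse_mod[of "{p}" c "w - 1"] p by auto
  define u where "u = 1 + c * v"
  have pu: "p dvd u - w" using dvd_diff_sym[OF v] by (simp add: u_def algebra_simps)
  have cu: "c dvd u - 1" by (simp add: u_def)
  have nd: "\<not> q dvd u" if "q \<in> P" for q
  proof (cases "q = p")
    case True
    then show ?thesis using pu w dvd_diff_cong by blast
  next
    case False
    then have "q dvd c" unfolding c_def using that assms by (intro dvd_prodI) auto
    then have "q dvd u - 1" using cu dvd_trans by blast
    then show ?thesis using dvd_diff_cong[of q u 1] PP_not_unit that assms by blast
  qed
  have "chiE P e u = qchi p u ^ e p * chiE (P - {p}) e u"
    unfolding chiE_def using assms by (simp add: prod.remove)
  also have "chiE (P - {p}) e u = chiE (P - {p}) e 1"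
    using cu assms unfolding c_def by (intro chiE_cong_mod) auto
  also have "chiE (P - {p}) e 1 = 1" using assms by (intro chiE_1) auto
  finally have 1: "chiE P e u = qchi p w ^ e p" using qchi_cong[OF pu] by simp
  have "qchi p w ^ e p \<noteq> 1"
  proof
    assume one: "qchi p w ^ e p = 1"
    define q where "q = qchi p w"
    have q2: "q * q = - 1" using w(2) by (simp add: q_def power2_eq_square)
    have r: "q ^ (e p mod 4) = 1" using one qchi_power_mod_4[OF p w(1), of "e p"] by (simp add: q_def)
    have "e p mod 4 = 1 \<or> e p mod 4 = 2 \<or> e p mod 4 = 3" using assms(4) by presburger
    then show False
    proof (elim disjE)
      assume "e p mod 4 = 1"
      then have "q = 1" using r by simp
      then show False using q2 by simp
    next
      assume "e p mod 4 = 2"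
      then show False using r q2 by (simp add: power2_eq_square)
    next
      assume "e p mod 4 = 3"
      then have "q * q * q = 1" using r by (simp add: power3_eq_cube)
      then have "- q = 1" using q2 by simp
      then have "q = - 1" by (metis add.inverse_inverse)
      then show False using q2 by simp
    qed
  qed
  then show ?thesis using nd cu 1 unfolding c_def by metis
qed

lemma sum_gres_mult_unit:
  assumes P: "finite P" "P \<subseteq> PP" and u: "\<And>p. p \<in> P \<Longrightarrow> \<not> p dvd u"
    and per: "\<And>x y. \<Prod>P dvd x - y \<Longrightarrow> f x = f y"
  shows "(\<Sum>x\<in>gres (\<Prod>P). f (u * x)) = (\<Sum>x\<in>gres (\<Prod>P). f x)"
proof (rule sum_gres_transform[OF prod_PP_nonzero[OF P(2)] _ per])
  fix a b assume "\<Prod>P dvd u * a - u * b"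
  then have "\<forall>p\<in>P. p dvd u * (a - b)" using PP_prod_dvd_iff[OF P] by (simp add: right_diff_distrib)
  then show "\<Prod>P dvd a - b" using PP_prod_dvd_iff[OF P] PP_dvd_mult_iff P u by blast
qed

lemma sum_chiE_eq_0:
  assumes "finite P" "P \<subseteq> PP" "p \<in> P" "\<not> 4 dvd e p"
  shows "(\<Sum>x\<in>gres (\<Prod>P). chiE P e x) = 0"
proof -
  obtain u where u: "\<forall>q\<in>P. \<not> q dvd u" "chiE P e u \<noteq> 1" using chiE_nontrivial[where e = e, OF assms] by blast
  have "(\<Sum>x\<in>gres (\<Prod>P). chiE P e (u * x)) = (\<Sum>x\<in>gres (\<Prod>P). chiE P e x)"
    using u chiE_cong_mod[OF assms(1,2)] by (intro sum_gres_mult_unit assms) auto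
  then have "chiE P e u * (\<Sum>x\<in>gres (\<Prod>P). chiE P e x) = (\<Sum>x\<in>gres (\<Prod>P). chiE P e x)"
    using assms by (simp add: chiE_mult sum_distrib_left)
  then show ?thesis using u by simp
qed

lemma chiE_orthogonal:
  assumes e: "valid_exps P e" and f: "valid_exps P f" and "p \<in> P" "e p \<noteq> f p"
  shows "(\<Sum>x\<in>gres (\<Prod>P). chiE P e x * cnj (chiE P f x)) = 0"
proof -
  have "(\<Sum>x\<in>gres (\<Prod>P). chiE P e x * cnj (chiE P f x)) = (\<Sum>x\<in>gres (\<Prod>P). chiE P (\<lambda>p. e p + (4 - f p)) x)"
    unfolding chiE_cnj[OF f] by (intro sum.cong refl) (simp add: chiE_def power_add prod.distrib)
  also have "\<dots> = 0"
  proof (rule sum_chiE_eq_0)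
    have "1 \<le> e p" "e p \<le> 3" "1 \<le> f p" "f p \<le> 3" using assms by (auto simp: valid_exps_def)
    then show "\<not> 4 dvd e p + (4 - f p)" using assms(4) by presburger
  qed (use assms in \<open>auto simp: valid_exps_def\<close>)
  finally show ?thesis .
qed

definition gsum :: "gauss_int set \<Rightarrow> (gauss_int \<Rightarrow> nat) \<Rightarrow> gauss_int \<Rightarrow> complex" where
  "gsum P e k = (\<Sum>x\<in>gres (\<Prod>P). chiE P e x * achar (\<Prod>P) (k * x))"

lemma achar_mult_cong: "n dvd x - y \<Longrightarrow> achar n (k * x) = achar n (k * y)"
  by (rule achar_cong) (metis dvd_mult right_diff_distrib)

text \<open>For \<open>k\<close> coprime to the modulus this is a change of variable.  If \<open>p\<close> divides \<open>k\<close>, multiplying the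
  variable by a unit that is \<open>1\<close> modulo the other primes leaves the additive character unchanged and
  multiplies the sum by a number other than \<open>1\<close>, so both sides vanish.\<close>

lemma gsum_twist:
  assumes e: "valid_exps P e"
  shows "gsum P e k = cnj (chiE P e k) * gsum P e 1"
proof -
  have P: "finite P" "P \<subseteq> PP" using e by (auto simp: valid_exps_def)
  define n where "n = \<Prod>P"
  show ?thesis
  proof (cases "\<exists>p\<in>P. p dvd k")
    case False
    have "gsum P e 1 = (\<Sum>x\<in>gres n. chiE P e (k * x) * achar n (k * x))"
      unfolding gsum_def n_def mult_1
      using False by (intro sum_gres_mult_unit[symmetric] P) (auto intro!: arg_cong2[of _ _ _ _ "(*)"] chiE_cong_mod[OF P] achar_cong)
    also have "\<dots> = chiE P e k * gsum P e k"
      unfolding gsum_def n_def by (simp add: chiE_mult[OF P(2)] sum_distrib_left mult_ac)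
    finally have "cnj (chiE P e k) * gsum P e 1 = (chiE P e k * cnj (chiE P e k)) * gsum P e k" by simp
    also have "chiE P e k * cnj (chiE P e k) = 1"
      using chiE_norm[OF P(2), of k e] False complex_norm_square[of "chiE P e k"] by auto
    finally show ?thesis by simp
  next
    case True
    then obtain p where p: "p \<in> P" "p dvd k" by blast
    have pe: "\<not> 4 dvd e p" "e p > 0" using e p(1) by (auto simp: valid_exps_def dest!: bspec dvd_imp_le)
    obtain u where u: "\<forall>q\<in>P. \<not> q dvd u" "\<Prod>(P - {p}) dvd u - 1" "chiE P e u \<noteq> 1"
      using chiE_nontrivial[where e = e, OF P p(1) pe(1)] by blast
    have n: "n = p * \<Prod>(P - {p})" using P p by (simp add: n_def prod.remove)
    have "n dvd k * (u - 1)" unfolding n using p(2) u(2) by (rule mult_dvd_mono)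
    then have "n dvd k * (u * x) - k * x" for x
      using dvd_mult2[of n "k * (u - 1)" x] by (simp add: algebra_simps)
    then have ac: "achar n (k * (u * x)) = achar n (k * x)" for x by (intro achar_cong)
    have "gsum P e k = (\<Sum>x\<in>gres n. chiE P e (u * x) * achar n (k * (u * x)))"
      unfolding gsum_def n_def
      using u(1) by (intro sum_gres_mult_unit[symmetric] P) (auto intro!: arg_cong2[of _ _ _ _ "(*)"] chiE_cong_mod[OF P] achar_mult_cong)
    also have "\<dots> = chiE P e u * gsum P e k"
      unfolding gsum_def n_def[symmetric] ac by (simp add: chiE_mult[OF P(2)] sum_distrib_left mult_ac)
    finally have "gsum P e k = 0" using u(3) by simp
    then show ?thesis using chiE_zero[where e = e, OF P(1) p(1) pe(2) p(2)] by simp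
  qed
qed

text \<open>Both \<open>gsum_twist\<close> and orthogonality of the additive characters evaluate the mean square of
  \<open>gsum P e k\<close> over \<open>k\<close>.\<close>

lemma gsum_norm_sq:
  assumes e: "valid_exps P e"
  shows "sqmod (gsum P e 1) = rnorm (\<Prod>P)"
proof -
  have P: "finite P" "P \<subseteq> PP" using e by (auto simp: valid_exps_def)
  define n where "n = \<Prod>P"
  have nz: "n \<noteq> 0" using prod_PP_nonzero[OF P(2)] by (simp add: n_def)
  define S where "S = (\<Sum>x\<in>gres n. chiE P e x * cnj (chiE P e x))"
  define Nn where "Nn = (of_nat (gauss_norm n) :: complex)"
  have "(\<Sum>k\<in>gres n. gsum P e k * cnj (gsum P e k)) =
    (\<Sum>k\<in>gres n. \<Sum>x\<in>gres n. \<Sum>y\<in>gres n. chiE P e x * cnj (chiE P e y) * achar n ((x - y) * k))"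
  proof (intro sum.cong refl)
    fix k
    have "achar n (k * x) * cnj (achar n (k * y)) = achar n ((x - y) * k)" for x y
      by (simp add: cnj_achar achar_add[symmetric] algebra_simps)
    then show "gsum P e k * cnj (gsum P e k) =
      (\<Sum>x\<in>gres n. \<Sum>y\<in>gres n. chiE P e x * cnj (chiE P e y) * achar n ((x - y) * k))"
      unfolding gsum_def n_def[symmetric] cnj_sum sum_product
      by (intro sum.cong refl) (metis (no_types, lifting) complex_cnj_mult mult.assoc mult.left_commute)
  qed
  also have "\<dots> = (\<Sum>x\<in>gres n. \<Sum>y\<in>gres n. \<Sum>k\<in>gres n. chiE P e x * cnj (chiE P e y) * achar n ((x - y) * k))"
    by (rule trans[OF sum.swap sum.cong[OF refl sum.swap]])
  also have "\<dots> = (\<Sum>x\<in>gres n. \<Sum>y\<in>gres n. if x = y then chiE P e x * cnj (chiE P e x) * Nn else 0)"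
    unfolding sum_distrib_left[symmetric] sum_achar[OF nz]
    using gres_inj[OF nz] by (intro sum.cong refl) (auto simp: Nn_def)
  also have "\<dots> = S * Nn" using nz by (simp add: S_def sum_distrib_right)
  finally have 1: "(\<Sum>k\<in>gres n. gsum P e k * cnj (gsum P e k)) = S * Nn" .
  have "(\<Sum>k\<in>gres n. gsum P e k * cnj (gsum P e k)) = S * (gsum P e 1 * cnj (gsum P e 1))"
    unfolding S_def sum_distrib_right
  proof (rule sum.cong[OF refl])
    fix k
    show "gsum P e k * cnj (gsum P e k) = chiE P e k * cnj (chiE P e k) * (gsum P e 1 * cnj (gsum P e 1))"
      unfolding gsum_twist[OF e, of k] complex_cnj_mult complex_cnj_cnj by (simp only: mult_ac)
  qed
  with 1 have "S * (gsum P e 1 * cnj (gsum P e 1)) = S * Nn" by simp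
  moreover have "S \<noteq> 0"
  proof -
    have S: "S = of_real (\<Sum>x\<in>gres n. sqmod (chiE P e x))"
      by (simp add: S_def complex_norm_square[symmetric])
    have "chiE P e (1 mod n) = 1"
      using chiE_cong_mod[OF P, of "1 mod n" 1] dvd_diff_sym[OF gauss_dvd_diff_mod[of n 1]] P by (simp add: n_def)
    then have "(1::real) \<le> (\<Sum>x\<in>gres n. sqmod (chiE P e x))"
      using member_le_sum[of "1 mod n" "gres n" "\<lambda>x. sqmod (chiE P e x)"] nz by simp
    then show ?thesis unfolding S by (metis not_one_le_zero of_real_eq_0_iff)
  qed
  ultimately have "gsum P e 1 * cnj (gsum P e 1) = Nn" by simp
  then show ?thesis unfolding n_def[symmetric] Nn_def complex_norm_square[symmetric]
    by (metis of_real_eq_iff of_real_of_nat_eq)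
qed

lemma gsum_nonzero: "valid_exps P e \<Longrightarrow> gsum P e 1 \<noteq> 0"
proof
  assume e: "valid_exps P e" and "gsum P e 1 = 0"
  then have "gauss_norm (\<Prod>P) = 0" using gsum_norm_sq[OF e] by (metis norm_zero of_nat_eq_0_iff zero_power2)
  then show False using norm_prod_PP_pos[of P] e unfolding valid_exps_def by linarith
qed

text \<open>The Chinese remainder theorem in the form \<open>z = x * \<Prod>Q + y * \<Prod>P\<close>.\<close>

lemma gsum_union:
  assumes e: "valid_exps (P \<union> Q) e" and disj: "P \<inter> Q = {}"
  shows "gsum (P \<union> Q) e 1 = chiE P e (\<Prod>Q) * chiE Q e (\<Prod>P) * gsum P e 1 * gsum Q e 1"
proof -
  have P: "finite P" "P \<subseteq> PP" and Q: "finite Q" "Q \<subseteq> PP" using e by (auto simp: valid_exps_def)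
  define m n where "m = \<Prod>P" and "n = \<Prod>Q"
  have nz: "m \<noteq> 0" "n \<noteq> 0" using prod_PP_nonzero[OF P(2)] prod_PP_nonzero[OF Q(2)] by (simp_all only: m_def n_def not_False_eq_True)
  have un: "\<Prod>(P \<union> Q) = m * n" using P Q disj by (simp add: m_def n_def prod.union_disjoint)
  have nd: "\<not> p dvd n" if "p \<in> P" for p unfolding n_def using PP_dvd_prod_iff[of p Q] that P Q disj by auto
  have nd': "\<not> p dvd m" if "p \<in> Q" for p unfolding m_def using PP_dvd_prod_iff[of p P] that P Q disj by auto
  have cop: "m dvd x" if "m dvd x * n" for x
    using that unfolding m_def PP_prod_dvd_iff[OF P] using nd P PP_dvd_mult_iff by blast
  have cop': "n dvd x" if "n dvd x * m" for x
    using that unfolding n_def PP_prod_dvd_iff[OF Q] using nd' Q PP_dvd_mult_iff by blast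
  define h where "h = (\<lambda>(x, y). x * n + y * m)"
  have inj: "a = b" if ab: "a \<in> gres m \<times> gres n" "b \<in> gres m \<times> gres n" "m * n dvd h a - h b" for a b
  proof -
    obtain x y x' y' where xy: "a = (x, y)" "b = (x', y')" by (metis surj_pair)
    have d: "m * n dvd (x - x') * n + (y - y') * m" using ab(3) by (simp add: h_def xy algebra_simps)
    have "m dvd (x - x') * n" using dvd_mult_left[OF d] by (simp add: dvd_add_left_iff)
    then have 1: "m dvd x - x'" by (rule cop)
    have "n dvd (y - y') * m" using dvd_mult_right[OF d] by (simp add: dvd_add_right_iff)
    then have 2: "n dvd y - y'" by (rule cop')
    have "x = x'" using ab(1,2) 1 by (intro gres_inj[OF nz(1)]) (simp_all add: xy)
    moreover have "y = y'" using ab(1,2) 2 by (intro gres_inj[OF nz(2)]) (simp_all add: xy)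
    ultimately show ?thesis by (simp add: xy)
  qed
  have surj: "\<exists>a\<in>gres m \<times> gres n. m * n dvd x - h a" for x
  proof -
    have "(\<lambda>a. h a mod (m * n)) ` (gres m \<times> gres n) = gres (m * n)"
    proof (rule card_subset_eq)
      have "inj_on (\<lambda>a. h a mod (m * n)) (gres m \<times> gres n)"
        by (intro inj_onI) (use inj nz gauss_mod_eq_iff[of "m * n"] in auto)
      then show "card ((\<lambda>a. h a mod (m * n)) ` (gres m \<times> gres n)) = card (gres (m * n))"
        using nz by (simp add: card_image card_cartesian_product card_gres_mult)
    qed (use nz in auto)
    then have "x mod (m * n) \<in> (\<lambda>a. h a mod (m * n)) ` (gres m \<times> gres n)" by simp
    then show ?thesis using gauss_mod_eq_iff[of "m * n"] nz by auto
  qed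
  have fin: "finite (P \<union> Q)" "P \<union> Q \<subseteq> PP" using P Q by auto
  have "gsum (P \<union> Q) e 1 = (\<Sum>a\<in>gres m \<times> gres n. chiE (P \<union> Q) e (h a) * achar (m * n) (h a))"
    unfolding gsum_def un mult_1
  proof (rule sum_gres_reindex)
    show "chiE (P \<union> Q) e x * achar (m * n) x = chiE (P \<union> Q) e y * achar (m * n) y" if "m * n dvd x - y" for x y
      using chiE_cong_mod[OF fin, of x y] achar_cong[OF that] that un by simp
  qed (use nz inj surj in auto)
  also have "\<dots> = (\<Sum>(x, y)\<in>gres m \<times> gres n. (chiE P e (x * n) * achar m x) * (chiE Q e (y * m) * achar n y))"
  proof (intro sum.cong refl)
    fix a assume "a \<in> gres m \<times> gres n"
    obtain x y where a: "a = (x, y)" by (metis surj_pair)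
    have "chiE P e (x * n + y * m) = chiE P e (x * n)" "chiE Q e (x * n + y * m) = chiE Q e (y * m)"
      by (intro chiE_cong_mod P Q; simp add: m_def n_def)+
    moreover have "achar (m * n) (x * n + y * m) = achar m x * achar n y"
      using nz by (simp add: achar_def echar_add[symmetric] add_divide_distrib)
    ultimately show "chiE (P \<union> Q) e (h a) * achar (m * n) (h a) =
      (case a of (x, y) \<Rightarrow> (chiE P e (x * n) * achar m x) * (chiE Q e (y * m) * achar n y))"
      by (simp add: a h_def chiE_union[OF P(1) Q(1) disj])
  qed
  also have "\<dots> = (\<Sum>x\<in>gres m. chiE P e (x * n) * achar m x) * (\<Sum>y\<in>gres n. chiE Q e (y * m) * achar n y)"
    by (simp add: sum_product sum.cartesian_product)
  also have "(\<Sum>x\<in>gres m. chiE P e (x * n) * achar m x) = chiE P e n * gsum P e 1"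
    unfolding gsum_def m_def[symmetric] mult_1 chiE_mult[OF P(2)] by (simp add: sum_distrib_left mult_ac)
  also have "(\<Sum>y\<in>gres n. chiE Q e (y * m) * achar n y) = chiE Q e m * gsum Q e 1"
    unfolding gsum_def n_def[symmetric] mult_1 chiE_mult[OF Q(2)] by (simp add: sum_distrib_left mult_ac)
  also have "chiE P e n * gsum P e 1 * (chiE Q e m * gsum Q e 1) = chiE P e n * chiE Q e m * gsum P e 1 * gsum Q e 1"
    by (simp only: mult_ac)
  finally show ?thesis by (simp add: m_def n_def)
qed

section \<open>Quartic reciprocity\<close>

subsection \<open>The Frobenius map\<close>

lemma frobenius_add:
  fixes R :: "('k \<Rightarrow> 'a :: comm_ring_1) set"
  assumes q: "prime (q :: nat)"
    and const: "\<And>n :: nat. (\<lambda>_. of_nat n) \<in> R"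
    and add: "\<And>f g. f \<in> R \<Longrightarrow> g \<in> R \<Longrightarrow> (\<lambda>k. f k + g k) \<in> R"
    and mult: "\<And>f g. f \<in> R \<Longrightarrow> g \<in> R \<Longrightarrow> (\<lambda>k. f k * g k) \<in> R"
    and f: "f \<in> R" and g: "g \<in> R"
  shows "\<exists>h\<in>R. \<forall>k. (f k + g k) ^ q = f k ^ q + g k ^ q + of_nat q * h k"
proof -
  have pow: "(\<lambda>k. u k ^ j) \<in> R" if "u \<in> R" for u j
    by (induction j) (use const[of 1] mult that in auto)
  have sm: "(\<lambda>k. \<Sum>j\<in>A. u j k) \<in> R" if "\<And>j. j \<in> A \<Longrightarrow> u j \<in> R" for u and A :: "nat set"
    using that by (induction A rule: infinite_finite_induct) (use const[of 0] add in auto)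
  define h where "h = (\<lambda>k. \<Sum>j\<in>{1..<q}. of_nat ((q choose j) div q) * (f k ^ j * g k ^ (q - j)))"
  have "h \<in> R" unfolding h_def
    by (rule sm, rule mult[OF const mult[OF pow[OF f] pow[OF g]]])
  moreover have "(f k + g k) ^ q = f k ^ q + g k ^ q + of_nat q * h k" for k
  proof -
    have q2: "q \<ge> 2" using q prime_ge_2_nat by blast
    have "{..q} = insert 0 (insert q {1..<q})" using q2 by auto
    then have "(f k + g k) ^ q = g k ^ q + (f k ^ q + (\<Sum>j\<in>{1..<q}. of_nat (q choose j) * f k ^ j * g k ^ (q - j)))"
      unfolding binomial_ring using q2 by simp
    also have "(\<Sum>j\<in>{1..<q}. of_nat (q choose j) * f k ^ j * g k ^ (q - j)) = of_nat q * h k"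
      unfolding h_def sum_distrib_left
    proof (rule sum.cong[OF refl])
      fix j assume "j \<in> {1..<q}"
      then have "q dvd (q choose j)" using q by (intro dvd_choose_prime) auto
      then have "q choose j = q * ((q choose j) div q)" by simp
      then have "(of_nat (q choose j) :: 'a) = of_nat q * of_nat ((q choose j) div q)" by (metis of_nat_mult)
      then show "of_nat (q choose j) * f k ^ j * g k ^ (q - j) =
          of_nat q * (of_nat ((q choose j) div q) * (f k ^ j * g k ^ (q - j)))" by (simp add: mult_ac)
    qed
    finally show ?thesis by (simp add: add_ac)
  qed
  ultimately show ?thesis by blast
qed

text \<open>Later the summands are values of characters, and the error term must stay in a ring in which
  divisibility by \<open>q\<close> is meaningful; so the congruence is stated for an arbitrary ring \<open>R\<close> of functions.\<close>

lemma frobenius_sum: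
  fixes R :: "('k \<Rightarrow> 'a :: comm_ring_1) set"
  assumes q: "prime (q :: nat)"
    and const: "\<And>n :: nat. (\<lambda>_. of_nat n) \<in> R"
    and add: "\<And>f g. f \<in> R \<Longrightarrow> g \<in> R \<Longrightarrow> (\<lambda>k. f k + g k) \<in> R"
    and mult: "\<And>f g. f \<in> R \<Longrightarrow> g \<in> R \<Longrightarrow> (\<lambda>k. f k * g k) \<in> R"
    and "finite A" and f: "\<And>x. x \<in> A \<Longrightarrow> f x \<in> R"
  shows "\<exists>h\<in>R. \<forall>k. (\<Sum>x\<in>A. f x k) ^ q = (\<Sum>x\<in>A. f x k ^ q) + of_nat q * h k"
  using \<open>finite A\<close> f
proof (induction A)
  case empty
  then show ?case using const[of 0] q by (intro bexI[of _ "\<lambda>_. of_nat 0"]) (auto simp: prime_gt_0_nat power_0_left)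
next
  case (insert a A)
  have sm: "(\<lambda>k. \<Sum>x\<in>A. f x k) \<in> R"
    using \<open>finite A\<close> insert.prems by (induction A) (use const[of 0] add in auto)
  obtain h where h: "h \<in> R" "\<forall>k. (\<Sum>x\<in>A. f x k) ^ q = (\<Sum>x\<in>A. f x k ^ q) + of_nat q * h k"
    using insert by auto
  have "\<exists>h\<in>R. \<forall>k. (f a k + (\<Sum>x\<in>A. f x k)) ^ q = f a k ^ q + (\<Sum>x\<in>A. f x k) ^ q + of_nat q * h k"
    by (rule frobenius_add[where R = R and f = "f a" and g = "\<lambda>k. \<Sum>x\<in>A. f x k", OF q const add mult _ sm])
       (simp_all add: insert.prems)
  then obtain h' where h': "h' \<in> R" "\<forall>k. (f a k + (\<Sum>x\<in>A. f x k)) ^ q = f a k ^ q + (\<Sum>x\<in>A. f x k) ^ q + of_nat q * h' k"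
    by blast
  show ?case
    using insert(1,2) h h' add[OF h(1) h'(1)]
    by (intro bexI[of _ "\<lambda>k. h k + h' k"]) (auto simp: algebra_simps)
qed

lemma gauss_frobenius:
  assumes q: "prime (q :: nat)"
  shows "of_nat q dvd (x + y) ^ q - (x ^ q + y ^ q :: gauss_int)"
proof -
  obtain h :: "unit \<Rightarrow> gauss_int" where "\<forall>k. (x + y) ^ q = x ^ q + y ^ q + of_nat q * h k"
    using frobenius_add[OF q, of "UNIV :: (unit \<Rightarrow> gauss_int) set" "\<lambda>_. x" "\<lambda>_. y"] by auto
  then have "(x + y) ^ q - (x ^ q + y ^ q) = of_nat q * h ()" by auto
  then show ?thesis by simp
qed

lemma gauss_frobenius_of_nat:
  assumes q: "prime (q :: nat)"
  shows "of_nat q dvd (of_nat a) ^ q - (of_nat a :: gauss_int)"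
proof (induction a)
  case 0
  then show ?case using q by (simp add: prime_gt_0_nat power_0_left)
next
  case (Suc a)
  have "of_nat q dvd ((of_nat a + 1) ^ q - (of_nat a ^ q + 1 ^ q)) + (of_nat a ^ q - (of_nat a :: gauss_int))"
    by (intro dvd_add gauss_frobenius q Suc)
  then show ?case by (simp add: algebra_simps)
qed

lemma gauss_frobenius_of_int:
  assumes q: "prime (q :: nat)" "odd q"
  shows "of_nat q dvd (of_int a) ^ q - (of_int a :: gauss_int)"
proof (cases "a \<ge> 0")
  case True
  then show ?thesis using gauss_frobenius_of_nat[OF q(1), of "nat a"] by simp
next
  case False
  then obtain b where b: "a = - int b" by (metis nat_0_le linear minus_minus neg_0_le_iff_le)
  have "of_int a ^ q - (of_int a :: gauss_int) = - (of_nat b ^ q - of_nat b)"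
    using q(2) by (simp add: b)
  then show ?thesis using gauss_frobenius_of_nat[OF q(1), of b] by (metis dvd_minus_iff)
qed

lemma gauss_int_decomp: "z = of_int (gre z) + of_int (gim z) * gauss_i"
  by (simp add: gauss_int_eq_iff)

lemma gauss_i_power4: "gauss_i ^ 4 = 1"
  by (simp add: gauss_int_eq_iff eval_nat_numeral)

text \<open>The Frobenius map modulo \<open>q\<close> fixes the rational integers and sends \<open>i\<close> to \<open>i\<^sup>q\<close>.\<close>

lemma gauss_frobenius_conj:
  assumes q: "prime (q :: nat)" "odd q"
  shows "of_nat q dvd z ^ q - (if q mod 4 = 1 then z else gauss_cnj z)"
proof -
  define a b where "a = (of_int (gre z) :: gauss_int)" and "b = (of_int (gim z) :: gauss_int)"
  have z: "z = a + b * gauss_i" using gauss_int_decomp[of z] by (simp add: a_def b_def)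
  have iq: "gauss_i ^ q = (if q mod 4 = 1 then gauss_i else - gauss_i)"
  proof -
    have "gauss_i ^ q = (gauss_i ^ 4) ^ (q div 4) * gauss_i ^ (q mod 4)"
      by (simp flip: power_mult power_add)
    moreover have "q mod 4 = 1 \<or> q mod 4 = 3" using q(2) by presburger
    moreover have "gauss_i ^ 3 = - gauss_i" by (simp add: gauss_int_eq_iff eval_nat_numeral)
    ultimately show ?thesis by (elim disjE) (simp_all add: gauss_i_power4)
  qed
  have 1: "of_nat q dvd z ^ q - (a ^ q + (b * gauss_i) ^ q)" unfolding z by (rule gauss_frobenius[OF q(1)])
  have 2: "of_nat q dvd (a ^ q + b ^ q * gauss_i ^ q) - (a + b * gauss_i ^ q)"
  proof -
    have "of_nat q dvd (a ^ q - a) + (b ^ q - b) * gauss_i ^ q"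
      unfolding a_def b_def by (intro dvd_add dvd_mult2 gauss_frobenius_of_int q)
    then show ?thesis by (simp add: algebra_simps)
  qed
  have "of_nat q dvd z ^ q - (a + b * gauss_i ^ q)"
    using dvd_diff_trans[OF 1[unfolded power_mult_distrib] 2] .
  moreover have "a + b * gauss_i ^ q = (if q mod 4 = 1 then z else gauss_cnj z)"
    unfolding iq by (simp add: gauss_int_eq_iff a_def b_def)
  ultimately show ?thesis by simp
qed

subsection \<open>Jacobi sums\<close>

text \<open>The value of the symbol as a Gaussian integer, so that it can occur in congruences.\<close>

definition qunit :: "gauss_int \<Rightarrow> gauss_int \<Rightarrow> gauss_int" where
  "qunit p a = (if p dvd a then 0 else (SOME u. u dvd 1 \<and> p dvd a ^ ((gauss_norm p - 1) div 4) - u \<and> qchi p a = cg u))"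

lemma qunit_spec:
  assumes "p \<in> PP" "\<not> p dvd a"
  shows "qunit p a dvd 1 \<and> p dvd a ^ ((gauss_norm p - 1) div 4) - qunit p a \<and> qchi p a = cg (qunit p a)"
proof -
  have "\<exists>u. u dvd 1 \<and> p dvd a ^ ((gauss_norm p - 1) div 4) - u \<and> qchi p a = cg u"
    using qchi_spec[OF assms] by metis
  from someI_ex[OF this] show ?thesis using assms(2) by (simp add: qunit_def)
qed

lemma qchi_qunit: "p \<in> PP \<Longrightarrow> qchi p a = cg (qunit p a)"
  using qunit_spec[of p a] by (cases "p dvd a") (auto simp: qunit_def qchi_dvd)

lemma qunit_cong:
  assumes p: "p \<in> PP"
  shows "p dvd a ^ ((gauss_norm p - 1) div 4) - qunit p a"
proof (cases "p dvd a")
  case True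
  have "(gauss_norm p - 1) div 4 > 0" using PP_norm_ge_5[OF p] by simp
  then have "p dvd a ^ ((gauss_norm p - 1) div 4)" using True PP_dvd_power_iff[OF p] by blast
  then show ?thesis using True by (simp add: qunit_def)
qed (use qunit_spec[OF p] in blast)

text \<open>Multiplying the variable by some \<open>u\<close> with \<open>u ^ j\<close> incongruent to \<open>1\<close> multiplies the sum by \<open>u ^ j\<close>.\<close>

lemma power_sum_modulo_prime:
  assumes p: "p \<in> PP" and j: "j < gauss_norm p - 1"
  shows "p dvd (\<Sum>x\<in>gres p. x ^ j)"
proof (cases "j = 0")
  case True
  have "p dvd of_nat (gauss_norm p)" using gauss_mult_cnj[of p] by (metis dvd_triv_left)
  then show ?thesis using True card_gres[OF PP_nonzero[OF p]] by simp
next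
  case False
  obtain u where u: "\<not> p dvd u" "\<not> p dvd u ^ j - 1" using exists_nonroot[OF p, of j] j False by auto
  have nz: "p \<noteq> 0" using PP_nonzero[OF p] .
  have e: "(\<Sum>x\<in>gres p. (u * x) ^ j mod p) = (\<Sum>x\<in>gres p. x ^ j mod p)"
  proof (rule sum_gres_transform[OF nz, where f = "\<lambda>x. x ^ j mod p"])
    show "p dvd a - b" if "p dvd u * a - u * b" for a b
      using that u p by (simp add: PP_dvd_mult_iff flip: right_diff_distrib)
    show "x ^ j mod p = y ^ j mod p" if "p dvd x - y" for x y
      using dvd_power_diff[OF that] gauss_mod_eq_iff[OF nz] by blast
  qed
  have d: "p dvd (\<Sum>x\<in>gres p. f x) - (\<Sum>x\<in>gres p. f x mod p)" for f
    unfolding sum_subtractf[symmetric] by (intro dvd_sum gauss_dvd_diff_mod)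
  have "p dvd (\<Sum>x\<in>gres p. (u * x) ^ j) - (\<Sum>x\<in>gres p. x ^ j mod p)"
    using d[of "\<lambda>x. (u * x) ^ j"] unfolding e .
  then have "p dvd (\<Sum>x\<in>gres p. (u * x) ^ j) - (\<Sum>x\<in>gres p. x ^ j)"
    by (rule dvd_diff_trans[OF _ dvd_diff_sym[OF d]])
  also have "(\<Sum>x\<in>gres p. (u * x) ^ j) - (\<Sum>x\<in>gres p. x ^ j) = (u ^ j - 1) * (\<Sum>x\<in>gres p. x ^ j)"
    by (simp add: power_mult_distrib left_diff_distrib flip: sum_distrib_left)
  finally show ?thesis using u(2) p by (simp add: PP_dvd_mult_iff)
qed

lemma poly_sum_modulo_prime:
  assumes p: "p \<in> PP" and f: "degree f < gauss_norm p - 1"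
  shows "p dvd (\<Sum>x\<in>gres p. poly f x)"
proof -
  have "(\<Sum>x\<in>gres p. poly f x) = (\<Sum>i\<le>degree f. coeff f i * (\<Sum>x\<in>gres p. x ^ i))"
    unfolding poly_altdef by (subst sum.swap) (simp add: sum_distrib_left)
  also have "p dvd \<dots>" using f by (intro dvd_sum dvd_mult power_sum_modulo_prime[OF p]) auto
  finally show ?thesis .
qed

definition jacobi :: "gauss_int \<Rightarrow> gauss_int" where
  "jacobi p = (\<Sum>x\<in>gres p. qunit p x * qunit p (1 - x))"

text \<open>Modulo \<open>p\<close> the Jacobi sum is the sum of the values of \<open>x\<^sup>m (1 - x)\<^sup>m\<close>, where \<open>4 m = gauss_norm p - 1\<close>,
  and this polynomial has degree smaller than \<open>gauss_norm p - 1\<close>.\<close>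

lemma jacobi_dvd:
  assumes p: "p \<in> PP"
  shows "p dvd jacobi p"
proof -
  define m where "m = (gauss_norm p - 1) div 4"
  have m: "gauss_norm p - 1 = 4 * m" "m > 0"
    using PP_norm_minus_1[OF p] PP_norm_ge_5[OF p] by (auto simp: m_def)
  define f :: "gauss_int poly" where "f = [:0, 1:] ^ m * [:1, - 1:] ^ m"
  have "degree f \<le> m + m"
    unfolding f_def
    by (rule order.trans[OF degree_mult_le], intro add_mono order.trans[OF degree_power_le]) auto
  then have "p dvd (\<Sum>x\<in>gres p. poly f x)" using m by (intro poly_sum_modulo_prime[OF p]) linarith
  moreover have "p dvd (\<Sum>x\<in>gres p. poly f x) - jacobi p"
    unfolding jacobi_def sum_subtractf[symmetric]
  proof (rule dvd_sum)
    fix x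
    have "p dvd x ^ m * (1 - x) ^ m - qunit p x * qunit p (1 - x)"
      unfolding m_def by (intro dvd_mult_diff qunit_cong[OF p])
    then show "p dvd poly f x - qunit p x * qunit p (1 - x)" by (simp add: f_def)
  qed
  ultimately show ?thesis using dvd_diff_cong by blast
qed

lemma sum_qchi_eq_0:
  assumes p: "p \<in> PP" and "\<not> 4 dvd j"
  shows "(\<Sum>x\<in>gres p. qchi p x ^ j) = 0"
  using sum_chiE_eq_0[of "{p}" p "\<lambda>_. j"] assms by (simp add: chiE_def)

text \<open>Units are congruent to \<open>1\<close> modulo \<open>1 + i\<close>, so each product \<open>(f x - 1) * (f (1 - x) - 1)\<close> below is
  divisible by \<open>(1 + i)\<^sup>2\<close>, an associate of \<open>2\<close>; expanding the products expresses the Jacobi sum.\<close>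

lemma jacobi_mod_2:
  assumes p: "p \<in> PP"
  shows "2 dvd jacobi p - 1"
proof -
  have nz: "p \<noteq> 0" using PP_nonzero[OF p] .
  define f where "f = (\<lambda>x. qunit p x)"
  define A where "A = {x \<in> gres p. \<not> p dvd x \<and> \<not> p dvd 1 - x}"
  have S0: "(\<Sum>x\<in>gres p. f x) = 0"
    using sum_qchi_eq_0[OF p, of 1] unfolding f_def
    by (simp add: qchi_qunit[OF p] flip: complex_of_gauss_sum)
  have q1: "f x = 1" if "p dvd x - 1" for x
    using qchi_cong[OF that] qchi_1[OF p] qchi_qunit[OF p, of x] unfolding f_def
    by (metis complex_of_gauss_eq_iff complex_of_gauss_simps(2))
  have q0: "f x = 0" if "p dvd x" for x using that by (simp add: f_def qunit_def)
  have fcong: "f x = f y" if "p dvd x - y" for x y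
    using qchi_cong[OF that] unfolding f_def qchi_qunit[OF p] by simp
  have S1: "(\<Sum>x\<in>gres p. f (1 - x)) = 0"
  proof -
    have "(\<Sum>x\<in>gres p. f (1 - x)) = (\<Sum>x\<in>gres p. f x)"
      by (rule sum_gres_transform[OF nz, of "\<lambda>x. 1 - x" f]) (auto intro: fcong dest: dvd_diff_sym)
    then show ?thesis using S0 by simp
  qed
  have split: "gres p = A \<union> {0 mod p, 1 mod p}" "0 mod p \<notin> A" "1 mod p \<notin> A" "0 mod p \<noteq> 1 mod p"
  proof -
    have e: "x = y mod p" if "x \<in> gres p" "p dvd x - y" for x y
      using that gres_mod_id[OF nz] gauss_mod_eq_iff[OF nz] by metis
    show "0 mod p \<noteq> 1 mod p" using gauss_mod_eq_iff[OF nz, of 0 1] PP_not_unit[OF p] by simp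
    have d: "p dvd 0 mod p" "p dvd 1 - 1 mod p" using gauss_dvd_diff_mod[of p 0] gauss_dvd_diff_mod[of p 1] by auto
    then show "0 mod p \<notin> A" "1 mod p \<notin> A" by (auto simp: A_def)
    show "gres p = A \<union> {0 mod p, 1 mod p}"
    proof (intro equalityI subsetI)
      fix x assume x: "x \<in> gres p"
      have "x = 0 mod p" if "p dvd x" using e[OF x, of 0] that by simp
      moreover have "x = 1 mod p" if "p dvd 1 - x" using e[OF x, of 1] dvd_diff_sym[OF that] by simp
      ultimately show "x \<in> A \<union> {0 mod p, 1 mod p}" using x unfolding A_def by blast
    next
      fix x assume "x \<in> A \<union> {0 mod p, 1 mod p}"
      then show "x \<in> gres p" using mod_in_gres[of 0 p] mod_in_gres[of 1 p] unfolding A_def by blast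
    qed
  qed
  have finA: "finite A" using nz by (simp add: A_def)
  have S: "(\<Sum>x\<in>gres p. g x) = g (0 mod p) + (g (1 mod p) + (\<Sum>x\<in>A. g x))" for g :: "gauss_int \<Rightarrow> gauss_int"
    using split finA by (subst split(1)) simp
  have v: "f (0 mod p) = 0" "f (1 mod p) = 1" "f (1 - 0 mod p) = 1" "f (1 - 1 mod p) = 0"
    using q0 q1 gauss_dvd_diff_mod[of p 0] gauss_dvd_diff_mod[of p 1] dvd_diff_sym[OF gauss_dvd_diff_mod[of p 1]]
    by auto
  have cardA: "of_nat (gauss_norm p) = 2 + (of_nat (card A) :: gauss_int)"
    using S[of "\<lambda>_. 1"] card_gres[OF nz] by simp
  have two: "2 dvd (f x - 1) * (f (1 - x) - 1)" if "x \<in> A" for x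
  proof -
    have u: "1 + gauss_i dvd v - 1" if "v dvd 1" for v
      using that unfolding one_plus_i_dvd_iff odd_norm_iff[THEN arg_cong[of _ _ Not], simplified] gauss_unit_iff by auto
    have "f x dvd 1" "f (1 - x) dvd 1" using that qunit_spec[OF p] by (auto simp: A_def f_def)
    then have "(1 + gauss_i) * (1 + gauss_i) dvd (f x - 1) * (f (1 - x) - 1)" by (intro mult_dvd_mono u)
    moreover have "(1 + gauss_i) * (1 + gauss_i) = 2 * gauss_i" by (simp add: gauss_int_eq_iff)
    ultimately show ?thesis by (metis dvd_mult_left)
  qed
  have "2 dvd (\<Sum>x\<in>A. (f x - 1) * (f (1 - x) - 1))" by (intro dvd_sum two)
  also have "(\<Sum>x\<in>A. (f x - 1) * (f (1 - x) - 1)) = (\<Sum>x\<in>A. f x * f (1 - x)) - (\<Sum>x\<in>A. f x) - (\<Sum>x\<in>A. f (1 - x)) + of_nat (card A)"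
    by (simp add: algebra_simps sum.distrib sum_subtractf)
  also have "(\<Sum>x\<in>A. f x * f (1 - x)) = jacobi p" using S[of "\<lambda>x. f x * f (1 - x)"] v by (simp add: jacobi_def f_def)
  also have "(\<Sum>x\<in>A. f x) = - 1" using S[of f] v S0 by (simp add: eq_neg_iff_add_eq_0 add.commute)
  also have "(\<Sum>x\<in>A. f (1 - x)) = - 1" using S[of "\<lambda>x. f (1 - x)"] v S1 by (simp add: eq_neg_iff_add_eq_0 add.commute)
  finally have 2: "2 dvd jacobi p + of_nat (gauss_norm p)" by (simp add: cardA algebra_simps)
  obtain k where k: "gauss_norm p = 2 * k + 1" using primary_odd_norm[OF PP_primary[OF p]] by (auto elim: oddE)
  have "2 dvd (jacobi p + of_nat (gauss_norm p)) - 2 * (of_nat k + 1)" using 2 by (intro dvd_diff) auto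
  also have "(jacobi p + of_nat (gauss_norm p)) - 2 * (of_nat k + 1) = jacobi p - 1" by (simp add: k algebra_simps)
  finally show ?thesis .
qed

subsection \<open>The Gauss sum of the quartic symbol\<close>

abbreviation G :: "gauss_int \<Rightarrow> nat \<Rightarrow> gauss_int \<Rightarrow> complex" where
  "G p j k \<equiv> gsum {p} (\<lambda>_. j) k"

lemma G_eq: "G p j k = (\<Sum>x\<in>gres p. qchi p x ^ j * achar p (k * x))"
  by (simp add: gsum_def chiE_def)

lemma G_twist: "p \<in> PP \<Longrightarrow> j \<in> {1, 2, 3} \<Longrightarrow> G p j k = cnj (qchi p k ^ j) * G p j 1"
  using gsum_twist[of "{p}" "\<lambda>_. j" k] by (auto simp: valid_exps_def chiE_def)

lemma G_mult_cnj: "p \<in> PP \<Longrightarrow> j \<in> {1, 2, 3} \<Longrightarrow> G p j 1 * cnj (G p j 1) = of_nat (gauss_norm p)"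
proof -
  assume "p \<in> PP" "j \<in> {1, 2, 3}"
  then have "sqmod (G p j 1) = rnorm p"
    using gsum_norm_sq[of "{p}" "\<lambda>_. j"] by (auto simp: valid_exps_def)
  then show ?thesis by (metis complex_norm_square of_real_of_nat_eq)
qed

lemma G_cnj:
  assumes p: "p \<in> PP" and j: "j \<in> {1, 2, 3}"
  shows "cnj (G p j 1) = qchi p (- 1) ^ j * G p (4 - j) 1"
proof -
  have "valid_exps {p} (\<lambda>_. j)" using p j by (auto simp: valid_exps_def)
  from chiE_cnj[OF this] have c: "cnj (qchi p x ^ j) = qchi p x ^ (4 - j)" for x by (simp add: chiE_def)
  have "cnj (G p j 1) = G p (4 - j) (- 1)"
    unfolding G_eq by (simp add: cnj_achar c del: complex_cnj_power)
  also have "\<dots> = cnj (qchi p (- 1) ^ (4 - j)) * G p (4 - j) 1"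
    by (rule G_twist[OF p]) (use j in auto)
  also have "cnj (qchi p (- 1) ^ (4 - j)) = qchi p (- 1) ^ j" by (metis c complex_cnj_cnj)
  finally show ?thesis .
qed

lemma qchi_minus_1_sq: "p \<in> PP \<Longrightarrow> qchi p (- 1) * qchi p (- 1) = 1"
  using qchi_mult[of p "- 1" "- 1"] by simp

lemma G_square:
  assumes p: "p \<in> PP"
  shows "G p 1 1 * G p 1 1 = cg (jacobi p) * G p 2 1"
proof -
  have nz: "p \<noteq> 0" using PP_nonzero[OF p] .
  define c where "c = (\<lambda>t. \<Sum>x\<in>gres p. qchi p x * qchi p (t - x))"
  have c_eq: "c t = (qchi p t)\<^sup>2 * cg (jacobi p)" for t
  proof (cases "p dvd t")
    case True
    have "c t = (\<Sum>x\<in>gres p. qchi p (- 1) * qchi p x ^ 2)"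
      unfolding c_def
    proof (intro sum.cong refl)
      fix x
      have "qchi p (t - x) = qchi p ((- 1) * x)" by (rule qchi_cong) (use True in simp)
      then show "qchi p x * qchi p (t - x) = qchi p (- 1) * qchi p x ^ 2"
        unfolding qchi_mult[OF p] by (simp add: power2_eq_square)
    qed
    also have "\<dots> = 0" using sum_qchi_eq_0[OF p, of 2] by (simp flip: sum_distrib_left)
    finally show ?thesis using True by (simp add: qchi_dvd)
  next
    case False
    have "c t = (\<Sum>x\<in>gres p. qchi p (t * x) * qchi p (t - t * x))"
      unfolding c_def
    proof (rule sum_gres_transform[OF nz, symmetric, where f = "\<lambda>x. qchi p x * qchi p (t - x)"])
      show "p dvd a - b" if "p dvd t * a - t * b" for a b
        using that False p by (simp add: PP_dvd_mult_iff flip: right_diff_distrib)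
      show "qchi p x * qchi p (t - x) = qchi p y * qchi p (t - y)" if "p dvd x - y" for x y
        using qchi_cong[OF that] qchi_cong[of p "t - x" "t - y"] dvd_diff_sym[OF that] by simp
    qed
    also have "\<dots> = (\<Sum>x\<in>gres p. (qchi p t)\<^sup>2 * (qchi p x * qchi p (1 - x)))"
    proof (intro sum.cong refl)
      fix x
      have "t - t * x = t * (1 - x)" by (simp add: algebra_simps)
      then show "qchi p (t * x) * qchi p (t - t * x) = (qchi p t)\<^sup>2 * (qchi p x * qchi p (1 - x))"
        by (simp add: qchi_mult[OF p] power2_eq_square)
    qed
    also have "\<dots> = (qchi p t)\<^sup>2 * cg (jacobi p)"
      by (simp add: jacobi_def complex_of_gauss_sum sum_distrib_left qchi_qunit[OF p])
    finally show ?thesis .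
  qed
  have "G p 1 1 * G p 1 1 = (\<Sum>x\<in>gres p. \<Sum>y\<in>gres p. qchi p x * qchi p y * achar p (x + y))"
    unfolding G_eq sum_product by (intro sum.cong refl) (simp add: achar_add)
  also have "\<dots> = (\<Sum>x\<in>gres p. \<Sum>t\<in>gres p. qchi p x * qchi p (t - x) * achar p t)"
  proof (rule sum.cong[OF refl])
    fix x
    have "(\<Sum>y\<in>gres p. (\<lambda>t. qchi p x * qchi p (t - x) * achar p t) (x + y)) = (\<Sum>t\<in>gres p. qchi p x * qchi p (t - x) * achar p t)"
    proof (rule sum_gres_transform[OF nz])
      show "qchi p x * qchi p (s - x) * achar p s = qchi p x * qchi p (t - x) * achar p t" if "p dvd s - t" for s t
        using achar_cong[OF that] qchi_cong[of p "s - x" "t - x"] that by simp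
    qed simp
    then show "(\<Sum>y\<in>gres p. qchi p x * qchi p y * achar p (x + y)) = (\<Sum>t\<in>gres p. qchi p x * qchi p (t - x) * achar p t)" by simp
  qed
  also have "\<dots> = (\<Sum>t\<in>gres p. c t * achar p t)"
    unfolding c_def by (subst sum.swap) (simp add: sum_distrib_right)
  also have "\<dots> = cg (jacobi p) * G p 2 1"
    unfolding c_eq G_eq by (simp add: sum_distrib_left mult_ac)
  finally show ?thesis .
qed

lemma G2_square:
  assumes p: "p \<in> PP"
  shows "G p 2 1 * G p 2 1 = of_nat (gauss_norm p)"
  using G_mult_cnj[OF p, of 2] G_cnj[OF p, of 2] qchi_minus_1_sq[OF p] by (simp add: power2_eq_square)

lemma gauss_norm_jacobi:
  assumes p: "p \<in> PP"
  shows "gauss_norm (jacobi p) = gauss_norm p"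
proof -
  have a: "sqmod (G p j 1) = gauss_norm p" if "j \<in> {1, 2, 3}" for j
    using gsum_norm_sq[of "{p}" "\<lambda>_. j"] that p by (auto simp: valid_exps_def)
  have a1: "sqmod (G p 1 1) = gauss_norm p" and a2: "sqmod (G p 2 1) = gauss_norm p"
    by (rule a, simp)+
  have "sqmod (G p 1 1 * G p 1 1) = sqmod (cg (jacobi p) * G p 2 1)"
    by (simp only: G_square[OF p])
  then have "sqmod (G p 1 1) * sqmod (G p 1 1) = rnorm (jacobi p) * sqmod (G p 2 1)"
    by (simp only: norm_mult power_mult_distrib cmod_complex_of_gauss_sq)
  then have "rnorm p * rnorm p = rnorm (jacobi p) * rnorm p"
    using a1 a2 by (simp only:)
  then show ?thesis using PP_nonzero[OF p] by simp
qed

text \<open>The Jacobi sum is divisible by \<open>p\<close> and has the same norm, so it is \<open>p\<close> up to a unit, and the congruence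
  modulo \<open>2\<close> leaves only the units \<open>1\<close> and \<open>-1\<close>.\<close>

lemma jacobi_square:
  assumes p: "p \<in> PP"
  shows "jacobi p ^ 2 = p ^ 2"
proof -
  obtain w where w: "jacobi p = p * w" using jacobi_dvd[OF p] by (auto elim: dvdE)
  have "gauss_norm w = 1" using gauss_norm_jacobi[OF p] PP_nonzero[OF p] by (simp add: w gauss_norm_mult)
  then have wu: "w dvd 1" by (rule gauss_norm_eq_1_iff[THEN iffD1])
  have "of_int 2 dvd p * w - 1" using jacobi_mod_2[OF p] w by simp
  then have "even (gre (p * w) - 1)" unfolding gauss_of_int_dvd_iff by simp
  moreover have "even (gim p)" "odd (gre p)" using PP_primary[OF p] unfolding primary_iff by presburger+
  ultimately have "w = 1 \<or> w = - 1" using wu unfolding gauss_unit_iff by auto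
  then show ?thesis using w by auto
qed

lemma G_power4:
  assumes p: "p \<in> PP"
  shows "G p 1 1 ^ 4 = cg (p ^ 2 * of_nat (gauss_norm p))"
proof -
  have "G p 1 1 ^ 4 = (G p 1 1 * G p 1 1) * (G p 1 1 * G p 1 1)" by (simp add: eval_nat_numeral mult_ac)
  also have "\<dots> = cg (jacobi p ^ 2) * (G p 2 1 * G p 2 1)"
    unfolding G_square[OF p] by (simp add: power2_eq_square mult_ac)
  finally show ?thesis by (simp add: jacobi_square[OF p] G2_square[OF p] del: complex_of_gauss_power)
qed

text \<open>The ring of functions \<open>k \<mapsto> \<Sum> c\<^sub>y \<psi>(k y)\<close> with Gaussian integer coefficients plays the
  part of the group ring; reading off the coefficient at \<open>y = 1\<close> keeps congruences inside the
  Gaussian integers.\<close>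

inductive_set char_ring :: "gauss_int \<Rightarrow> (gauss_int \<Rightarrow> complex) set" for p where
  base: "(\<lambda>k. cg c * achar p (k * y)) \<in> char_ring p"
| add: "f \<in> char_ring p \<Longrightarrow> g \<in> char_ring p \<Longrightarrow> (\<lambda>k. f k + g k) \<in> char_ring p"

lemma char_ring_const: "(\<lambda>_. of_nat n) \<in> char_ring p"
  using char_ring.base[of "of_nat n" p 0] by simp

lemma char_ring_mult:
  assumes "f \<in> char_ring p" "g \<in> char_ring p"
  shows "(\<lambda>k. f k * g k) \<in> char_ring p"
  using assms(1)
proof induction
  case (base c y)
  from assms(2) show ?case
  proof induction
    case (base d z)
    have "(\<lambda>k. cg (c * d) * achar p (k * (y + z))) \<in> char_ring p" by (rule char_ring.base)
    then show ?case by (simp add: distrib_left achar_add mult_ac)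
  next
    case (add f g)
    then show ?case using char_ring.add[OF add.IH] by (simp add: distrib_left)
  qed
next
  case (add f g)
  then show ?case using char_ring.add[OF add.IH] by (simp add: distrib_right)
qed

definition coeff_at_1 :: "gauss_int \<Rightarrow> (gauss_int \<Rightarrow> complex) \<Rightarrow> complex" where
  "coeff_at_1 p f = (\<Sum>k\<in>gres p. f k * achar p (- k)) / of_nat (gauss_norm p)"

lemma coeff_at_1_base:
  assumes p: "p \<in> PP"
  shows "coeff_at_1 p (\<lambda>k. c * achar p (k * y)) = (if p dvd y - 1 then c else 0)"
proof -
  have "(\<Sum>k\<in>gres p. c * achar p (k * y) * achar p (- k)) = c * (\<Sum>k\<in>gres p. achar p ((y - 1) * k))"
    unfolding sum_distrib_left by (intro sum.cong refl) (simp add: achar_add[symmetric] algebra_simps)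
  then show ?thesis using sum_achar[OF PP_nonzero[OF p], of "y - 1"] PP_nonzero[OF p] by (simp add: coeff_at_1_def)
qed

lemma coeff_at_1_add: "coeff_at_1 p (\<lambda>k. f k + g k) = coeff_at_1 p f + coeff_at_1 p g"
  by (simp add: coeff_at_1_def distrib_right sum.distrib add_divide_distrib)

lemma coeff_at_1_char_ring:
  assumes p: "p \<in> PP" and "f \<in> char_ring p"
  shows "\<exists>c. coeff_at_1 p f = cg c"
  using assms(2)
proof induction
  case (base c y)
  then show ?case using coeff_at_1_base[OF p] complex_of_gauss_simps(1) by metis
next
  case (add f g)
  then show ?case unfolding coeff_at_1_add by (metis complex_of_gauss_simps(4))
qed

lemma coeff_at_1_G:
  assumes p: "p \<in> PP"
  shows "coeff_at_1 p (G p j) = 1"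
proof -
  have "coeff_at_1 p (G p j) = (\<Sum>x\<in>gres p. coeff_at_1 p (\<lambda>k. qchi p x ^ j * achar p (k * x)))"
    unfolding coeff_at_1_def G_eq sum_divide_distrib[symmetric] sum_distrib_right
    by (subst sum.swap) simp
  also have "\<dots> = (\<Sum>x\<in>gres p. if x = 1 mod p then 1 else 0)"
  proof (intro sum.cong refl)
    fix x assume x: "x \<in> gres p"
    have iff: "p dvd x - 1 \<longleftrightarrow> x = 1 mod p"
      using gauss_mod_eq_iff[OF PP_nonzero[OF p], of x 1] gres_mod_id[OF PP_nonzero[OF p] x] by simp
    have "qchi p x = 1" if "p dvd x - 1" using qchi_cong[OF that] p by simp
    then show "coeff_at_1 p (\<lambda>k. qchi p x ^ j * achar p (k * x)) = (if x = 1 mod p then 1 else 0)"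
      unfolding coeff_at_1_base[OF p] iff by auto
  qed
  also have "\<dots> = 1" using PP_nonzero[OF p] by simp
  finally show ?thesis .
qed

text \<open>The \<open>q\<close>-th power of the Gauss sum is computed modulo \<open>q\<close> by the Frobenius map and compared with the
  exact value in the hypothesis; the coefficient at \<open>y = 1\<close> turns this into a congruence between
  Gaussian integers.\<close>

lemma G_frobenius:
  assumes p: "p \<in> PP" and q: "prime (q :: nat)" "odd q" and j: "j = q mod 4"
    and A: "\<And>k. G p 1 k ^ q = cg a * G p j k"
    and B: "qchi p (of_nat q) ^ j = cg b"
    and nd: "\<not> p dvd of_nat q"
  shows "of_nat q dvd a - gauss_cnj b"
proof -
  have j13: "j \<in> {1, 2, 3}" using q(2) unfolding j by simp presburger
  obtain h where h: "h \<in> char_ring p" "\<forall>k. (\<Sum>x\<in>gres p. qchi p x * achar p (k * x)) ^ q =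
    (\<Sum>x\<in>gres p. (qchi p x * achar p (k * x)) ^ q) + of_nat q * h k"
    using frobenius_sum[OF q(1), of "char_ring p" "gres p" "\<lambda>x k. qchi p x * achar p (k * x)"]
      char_ring_const char_ring.add char_ring_mult char_ring.base PP_nonzero[OF p]
    unfolding qchi_qunit[OF p] by auto
  have "(cg a - cg (gauss_cnj b)) * G p j k = of_nat q * h k" for k
  proof -
    have "(qchi p x * achar p (k * x)) ^ q = qchi p x ^ j * achar p (k * of_nat q * x)" for x
    proof -
      have "qchi p x ^ q = qchi p x ^ j"
        using qchi_power_mod_4[OF p, of x q] j13 q by (cases "p dvd x") (auto simp: j qchi_dvd power_0_left)
      moreover have "achar p y ^ n = achar p (of_nat n * y)" for y n
        by (induction n) (auto simp: achar_add distrib_right)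
      ultimately show ?thesis by (simp add: power_mult_distrib mult_ac)
    qed
    then have "(\<Sum>x\<in>gres p. (qchi p x * achar p (k * x)) ^ q) = G p j (k * of_nat q)"
      by (simp add: G_eq)
    also have "\<dots> = cnj (qchi p (of_nat q) ^ j) * G p j k"
      using G_twist[OF p j13, of "k * of_nat q"] G_twist[OF p j13, of k]
      by (simp add: qchi_mult[OF p] power_mult_distrib mult_ac)
    finally have "G p 1 k ^ q = cnj (qchi p (of_nat q) ^ j) * G p j k + of_nat q * h k"
      using h(2) by (simp add: G_eq[of p])
    then show ?thesis using A[of k] unfolding B by (simp add: algebra_simps)
  qed
  then have "coeff_at_1 p (\<lambda>k. (cg a - cg (gauss_cnj b)) * G p j k) = coeff_at_1 p (\<lambda>k. of_nat q * h k)"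
    by simp
  then have "(cg a - cg (gauss_cnj b)) * coeff_at_1 p (G p j) = of_nat q * coeff_at_1 p h"
    unfolding coeff_at_1_def by (simp add: mult.assoc flip: sum_distrib_left)
  moreover obtain c where "coeff_at_1 p h = cg c" using coeff_at_1_char_ring[OF p h(1)] by blast
  ultimately have "cg (a - gauss_cnj b) = cg (of_nat q * c)"
    using coeff_at_1_G[OF p] by simp
  then have "a - gauss_cnj b = of_nat q * c" by (simp only: complex_of_gauss_eq_iff)
  then show ?thesis by simp
qed

lemma rational_congruence_1:
  assumes p: "p \<in> PP" and q: "prime (q :: nat)" "q mod 4 = 1" and nd: "\<not> p dvd of_nat q"
  shows "of_nat q dvd (p ^ 2 * of_nat (gauss_norm p)) ^ ((q - 1) div 4) - gauss_cnj (qunit p (of_nat q))"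
proof (rule G_frobenius[OF p q(1) _ refl _ _ nd])
  show "odd q" using q(2) by presburger
  show "qchi p (of_nat q) ^ (q mod 4) = cg (qunit p (of_nat q))" using q qchi_qunit[OF p] by simp
  fix k
  have e: "q = 4 * ((q - 1) div 4) + 1" using q(2) by presburger
  have "cnj (qchi p k) ^ q = cnj (qchi p k)"
  proof (cases "p dvd k")
    case False
    have "qchi p k ^ q = qchi p k" using qchi_power_mod_4[OF p False, of q] q by simp
    then show ?thesis by (metis complex_cnj_power)
  qed (use q in \<open>simp add: qchi_dvd prime_gt_0_nat\<close>)
  moreover have "G p 1 1 ^ q = cg ((p ^ 2 * of_nat (gauss_norm p)) ^ ((q - 1) div 4)) * G p 1 1"
    by (subst e) (simp only: power_add power_mult G_power4[OF p] power_one_right complex_of_gauss_power)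
  ultimately show "G p 1 k ^ q = cg ((p ^ 2 * of_nat (gauss_norm p)) ^ ((q - 1) div 4)) * G p (q mod 4) k"
    using G_twist[OF p, of 1 k] q by (simp add: power_mult_distrib mult_ac)
qed

lemma rational_congruence_3:
  assumes p: "p \<in> PP" and q: "prime (q :: nat)" "q mod 4 = 3" and nd: "\<not> p dvd of_nat q"
  shows "of_nat q dvd (p ^ 2 * of_nat (gauss_norm p)) ^ (q div 4) * (p ^ 2 * qunit p (- 1)) - qunit p (of_nat q)"
proof -
  define a where "a = (p ^ 2 * of_nat (gauss_norm p)) ^ (q div 4) * (p ^ 2 * qunit p (- 1))"
  have "of_nat q dvd a - gauss_cnj (gauss_cnj (qunit p (of_nat q)))"
  proof (rule G_frobenius[OF p q(1) _ refl _ _ nd])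
    show "odd q" using q(2) by presburger
    show "qchi p (of_nat q) ^ (q mod 4) = cg (gauss_cnj (qunit p (of_nat q)))"
      using q qchi_cnj[OF p, of "of_nat q"] qchi_qunit[OF p] by simp
    fix k
    have e: "q = 4 * (q div 4) + 3" using q(2) by presburger
    have 1: "cnj (qchi p k) ^ q = cnj (qchi p k ^ 3)"
    proof (cases "p dvd k")
      case False
      have "qchi p k ^ q = qchi p k ^ 3" using qchi_power_mod_4[OF p False, of q] q by simp
      then show ?thesis by (metis complex_cnj_power)
    qed (use q in \<open>simp add: qchi_dvd prime_gt_0_nat\<close>)
    define g where "g = G p 1 1"
    have m1: "qchi p (- 1) * qchi p (- 1) = 1" using qchi_minus_1_sq[OF p] .
    have gg3: "g * (qchi p (- 1) * G p 3 1) = of_nat (gauss_norm p)"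
      using G_mult_cnj[OF p, of 1] G_cnj[OF p, of 1] by (simp add: g_def)
    have gnz: "g \<noteq> 0" using gsum_nonzero[of "{p}" "\<lambda>_. 1"] p by (simp add: g_def valid_exps_def)
    have "g * g ^ 3 = g ^ 4" by (simp add: eval_nat_numeral)
    also have "\<dots> = cg (p ^ 2) * of_nat (gauss_norm p)" using G_power4[OF p] by (simp add: g_def)
    also have "\<dots> = g * (cg (p ^ 2) * qchi p (- 1) * G p 3 1)" unfolding gg3[symmetric] by (simp only: mult_ac)
    finally have g3: "g ^ 3 = cg (p ^ 2) * qchi p (- 1) * G p 3 1" using gnz by (simp only: mult_cancel_left) auto
    have "g ^ q = (g ^ 4) ^ (q div 4) * g ^ 3" by (subst e) (simp only: power_add power_mult)
    also have "\<dots> = cg a * G p 3 1"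
      unfolding g3 unfolding g_def G_power4[OF p] by (simp add: a_def qchi_qunit[OF p])
    finally have "g ^ q = cg a * G p 3 1" .
    then show "G p 1 k ^ q = cg a * G p (q mod 4) k"
      using G_twist[OF p, of 1 k] G_twist[OF p, of 3 k] q 1 by (simp add: power_mult_distrib g_def mult_ac)
  qed
  then show ?thesis by (simp add: a_def)
qed

subsection \<open>Rational arguments\<close>

lemma PP_cnj: "p \<in> PP \<Longrightarrow> gauss_cnj p \<in> PP"
proof -
  assume p: "p \<in> PP"
  have "prime_elem (gauss_cnj p)"
  proof (rule prime_elemI)
    show "gauss_cnj p \<noteq> 0" using PP_nonzero[OF p] by simp
    show "\<not> gauss_cnj p dvd 1" using PP_not_unit[OF p] gauss_cnj_dvd_iff[of p 1] by simp
    fix a b assume "gauss_cnj p dvd a * b"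
    then have "p dvd gauss_cnj a * gauss_cnj b"
      using gauss_cnj_dvd_iff[of p "gauss_cnj a * gauss_cnj b"] by simp
    then have "p dvd gauss_cnj a \<or> p dvd gauss_cnj b" using p by (simp add: PP_dvd_mult_iff)
    then show "gauss_cnj p dvd a \<or> gauss_cnj p dvd b"
      using gauss_cnj_dvd_iff[of p "gauss_cnj a"] gauss_cnj_dvd_iff[of p "gauss_cnj b"] by simp
  qed
  moreover have "primary (gauss_cnj p)"
    using PP_primary[OF p] unfolding primary_iff by simp presburger
  ultimately show ?thesis by (simp add: PP_def)
qed

lemma qchi_gauss_cnj:
  assumes p: "p \<in> PP"
  shows "qchi (gauss_cnj p) (gauss_cnj a) = cnj (qchi p a)"
proof (cases "p dvd a")
  case True
  then show ?thesis using gauss_cnj_dvd_iff[of p a] by (simp add: qchi_dvd)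
next
  case False
  have u: "qunit p a dvd 1" "p dvd a ^ ((gauss_norm p - 1) div 4) - qunit p a"
    using qunit_spec[OF p False] by auto
  have "qchi (gauss_cnj p) (gauss_cnj a) = cg (gauss_cnj (qunit p a))"
  proof (rule qchi_eqI[OF PP_cnj[OF p]])
    show "\<not> gauss_cnj p dvd gauss_cnj a" using False gauss_cnj_dvd_iff by blast
    show "gauss_cnj (qunit p a) dvd 1" using u(1) gauss_cnj_dvd_iff[of "qunit p a" 1] by simp
    show "gauss_cnj p dvd gauss_cnj a ^ ((gauss_norm (gauss_cnj p) - 1) div 4) - gauss_cnj (qunit p a)"
      using u(2) gauss_cnj_dvd_iff[of p "a ^ ((gauss_norm p - 1) div 4) - qunit p a"] by simp
  qed
  then show ?thesis by (simp add: qchi_qunit[OF p])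
qed

lemma PP_above_rational_prime:
  assumes q: "prime (q :: nat)" "odd q"
  obtains l where "l \<in> PP" "l dvd of_nat q" "gauss_norm l = q \<or> gauss_norm l = q\<^sup>2"
proof -
  have Nq: "gauss_norm (of_nat q) = q\<^sup>2" by (simp add: gauss_norm_def nat_power_eq)
  have "(of_nat q :: gauss_int) \<noteq> 0" using q(1) Nq by (metis gauss_norm_0 not_prime_0 power_eq_0_iff)
  moreover have "\<not> (of_nat q :: gauss_int) dvd 1"
  proof
    assume "(of_nat q :: gauss_int) dvd 1"
    then have "q * q = 1" using gauss_norm_eq_1_iff[THEN iffD2] Nq by (metis power2_eq_square)
    then show False using prime_gt_1_nat[OF q(1)] by simp
  qed
  ultimately obtain r where r: "prime r" "r dvd (of_nat q :: gauss_int)" using prime_divisor_exists by blast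
  obtain u where u: "u dvd 1" "r = u * (1 + gauss_i) \<or> (\<exists>p\<in>PP. r = u * p)"
    using prime_elem_associate[of r] r(1) by auto
  have "\<not> 1 + gauss_i dvd of_nat q" unfolding one_plus_i_dvd_iff Nq using q(2) by simp
  then have "r \<noteq> u * (1 + gauss_i)" using r(2) by (metis dvd_mult_right)
  then obtain l where l: "l \<in> PP" "r = u * l" using u by blast
  then have ld: "l dvd of_nat q" using r(2) by (metis dvd_mult_right)
  then have "gauss_norm l dvd q\<^sup>2" using gauss_norm_dvd[OF ld] Nq by simp
  then obtain k where k: "k \<le> 2" "gauss_norm l = q ^ k" using divides_primepow_nat[OF q(1)] by blast
  have "k \<noteq> 0" using k(2) PP_norm_ge_5[OF l(1)] by (intro notI) simp
  then have "k = 1 \<or> k = 2" using k(1) by linarith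
  then show ?thesis using that[OF l(1) ld] k(2) by auto
qed

lemma inert_prime:
  assumes q: "prime (q :: nat)" "q mod 4 = 3"
  shows "- of_nat q \<in> PP"
proof -
  have "odd q" using q(2) by presburger
  then obtain l where l: "l \<in> PP" "l dvd of_nat q" "gauss_norm l = q \<or> gauss_norm l = q\<^sup>2"
    using PP_above_rational_prime[OF q(1)] by blast
  have nq: "gauss_norm l = q\<^sup>2" using l(3) PP_norm_mod_4[OF l(1)] q(2) by auto
  obtain w where w: "of_nat q = l * w" using l(2) by (auto elim: dvdE)
  have "gauss_norm (of_nat q) = q\<^sup>2" by (simp add: gauss_norm_def nat_power_eq)
  then have "q\<^sup>2 * gauss_norm w = q\<^sup>2"
    using arg_cong[OF w, of gauss_norm] nq by (simp add: gauss_norm_mult)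
  then have "gauss_norm w = 1" using q(1) by (auto dest: prime_gt_0_nat)
  then have wu: "- w dvd 1" using gauss_norm_eq_1_iff[of w] by simp
  have "primary (- of_nat q)" unfolding primary_iff using q(2) by simp presburger
  then have "primary ((- w) * l)" using w by (simp add: mult.commute)
  then have "- w = 1" using primary_unit_mult PP_primary[OF l(1)] wu by blast
  then have "- of_nat q = l" using w by (metis minus_minus mult.right_neutral mult_minus_right)
  then show ?thesis using l(1) by simp
qed

text \<open>If \<open>q\<close> stayed prime, the Frobenius congruence \<open>u ^ q = u\<close> would give \<open>u ^ (q - 1) - 1\<close> too many roots.\<close>

lemma split_prime:
  assumes q: "prime (q :: nat)" "q mod 4 = 1"
  obtains l where "l \<in> PP" "gauss_norm l = q" "of_nat q = l * gauss_cnj l"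
proof -
  have oq: "odd q" using q(2) by presburger
  obtain l where l: "l \<in> PP" "l dvd of_nat q" "gauss_norm l = q \<or> gauss_norm l = q\<^sup>2"
    using PP_above_rational_prime[OF q(1) oq] by blast
  have q5: "q \<ge> 5" using q prime_ge_2_nat[OF q(1)] by presburger
  have "gauss_norm l \<noteq> q\<^sup>2"
  proof
    assume nq: "gauss_norm l = q\<^sup>2"
    have "q * 5 \<le> q\<^sup>2" using q5 by (simp add: power2_eq_square)
    then have "0 < q - 1" "q - 1 < gauss_norm l - 1" using q5 nq by linarith+
    then obtain u where u: "\<not> l dvd u" "\<not> l dvd u ^ (q - 1) - 1"
      using exists_nonroot[OF l(1)] by blast
    have "of_nat q dvd u ^ q - u" using gauss_frobenius_conj[OF q(1) oq, of u] q(2) by simp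
    then have "l dvd u ^ q - u" using l(2) dvd_trans by blast
    also have "u ^ q - u = u * (u ^ (q - 1) - 1)"
      using q5 by (cases q) (auto simp: right_diff_distrib)
    finally show False using u l(1) by (simp add: PP_dvd_mult_iff)
  qed
  then show ?thesis using that[of l] l gauss_mult_cnj[of l] by auto
qed

text \<open>An integer congruent to \<open>1\<close> modulo \<open>4\<close> is a product of norms of split primes and of negatives of
  inert primes; with these signs every factor is again congruent to \<open>1\<close> modulo \<open>4\<close>.\<close>

lemma signed_prime_induct [consumes 1, case_names one split inert]:
  fixes a :: int
  assumes "a mod 4 = 1" and one: "P 1"
    and split: "\<And>b l. b mod 4 = 1 \<Longrightarrow> P b \<Longrightarrow> l \<in> PP \<Longrightarrow> prime (gauss_norm l) \<Longrightarrow> gauss_norm l mod 4 = 1 \<Longrightarrow> P (int (gauss_norm l) * b)"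
    and inert: "\<And>b q. b mod 4 = 1 \<Longrightarrow> P b \<Longrightarrow> prime (q :: nat) \<Longrightarrow> q mod 4 = 3 \<Longrightarrow> - of_nat q \<in> PP \<Longrightarrow> P (- int q * b)"
  shows "P a"
  using assms(1)
proof (induction "nat \<bar>a\<bar>" arbitrary: a rule: less_induct)
  case less
  show ?case
  proof (cases "\<bar>a\<bar> = 1")
    case True
    then have "a = 1 \<or> a = - 1" by linarith
    then have "a = 1" using less.prems by auto
    then show ?thesis using one by simp
  next
    case False
    then have "nat \<bar>a\<bar> \<noteq> 1" by linarith
    then obtain q where q: "prime q" "q dvd nat \<bar>a\<bar>" using prime_factor_nat by blast
    have nz: "a \<noteq> 0" using less.prems by auto
    have "int q dvd a" using q(2) by (simp add: nat_abs_dvd_iff[symmetric] int_dvd_int_iff[symmetric])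
    then obtain b where b: "a = int q * b" by (auto elim: dvdE)
    have bnz: "b \<noteq> 0" using nz b by auto
    have "odd a" using less.prems by presburger
    then have "odd q" using b by auto
    have "\<bar>b\<bar> < \<bar>a\<bar>" using b bnz prime_gt_1_nat[OF q(1)] by (simp add: abs_mult)
    then have lt: "nat \<bar>b\<bar> < nat \<bar>a\<bar>" "nat \<bar>- b\<bar> < nat \<bar>a\<bar>" using nz by auto
    have am: "((int q mod 4) * (b mod 4)) mod 4 = 1" using less.prems b by (simp add: mod_mult_eq)
    have "q mod 4 = 1 \<or> q mod 4 = 3" using \<open>odd q\<close> by presburger
    then show ?thesis
    proof
      assume q1: "q mod 4 = 1"
      then have "int q mod 4 = 1" by presburger
      then have b1: "b mod 4 = 1" using am by simp
      obtain l where l: "l \<in> PP" "gauss_norm l = q" using split_prime[OF q(1) q1] by blast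
      show ?thesis using split[OF b1 less.hyps[OF lt(1) b1] l(1)] l(2) q(1) q1 b by simp
    next
      assume q3: "q mod 4 = 3"
      then have "int q mod 4 = 3" by presburger
      then have b1: "(- b) mod 4 = 1" using am by simp presburger
      show ?thesis using inert[OF b1 less.hyps[OF lt(2) b1] q(1) q3 inert_prime[OF q(1) q3]] b by simp
    qed
  qed
qed

lemma of_int_nonzero: "(a :: int) mod 4 = 1 \<Longrightarrow> (of_int a :: gauss_int) \<noteq> 0"
  by (auto simp: gauss_int_eq_iff)

lemma quartic_symbol_1 [simp]: "quartic_symbol a 1 = 1"
  by (rule quartic_symbol_unit) simp

lemma quartic_symbol_split:
  assumes "b mod 4 = 1" "l \<in> PP"
  shows "quartic_symbol x (of_int (int (gauss_norm l) * b)) = qchi l x * qchi (gauss_cnj l) x * quartic_symbol x (of_int b)"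
proof -
  have "(of_int (int (gauss_norm l) * b) :: gauss_int) = l * gauss_cnj l * of_int b"
    by (simp add: gauss_mult_cnj)
  then show ?thesis
    using PP_nonzero[OF assms(2)] of_int_nonzero[OF assms(1)] PP_prime[OF assms(2)] PP_prime[OF PP_cnj[OF assms(2)]]
    by (simp add: quartic_symbol_mult quartic_symbol_prime_elem del: of_int_mult)
qed

lemma quartic_symbol_inert:
  assumes "b mod 4 = 1" "- of_nat q \<in> PP"
  shows "quartic_symbol x (of_int (- int q * b)) = qchi (- of_nat q) x * quartic_symbol x (of_int b)"
proof -
  have "(of_int (- int q * b) :: gauss_int) = (- of_nat q) * of_int b" by simp
  then show ?thesis
    using PP_nonzero[OF assms(2)] of_int_nonzero[OF assms(1)] PP_prime[OF assms(2)]
    by (simp only: quartic_symbol_mult quartic_symbol_prime_elem not_False_eq_True)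
qed

lemma quartic_symbol_int_mult:
  "a mod 4 = 1 \<Longrightarrow> quartic_symbol (x * y) (of_int a) = quartic_symbol x (of_int a) * quartic_symbol y (of_int a)"
proof (induction a rule: signed_prime_induct)
  case (split b l)
  show ?case
    unfolding quartic_symbol_split[OF split.hyps(1,2)] split.IH qchi_mult[OF split.hyps(2)] qchi_mult[OF PP_cnj[OF split.hyps(2)]]
    by (simp only: mult_ac)
next
  case (inert b q)
  show ?case
    unfolding quartic_symbol_inert[OF inert.hyps(1,4)] inert.IH qchi_mult[OF inert.hyps(4)] by (simp only: mult_ac)
qed simp

lemma quartic_symbol_int_cnj:
  "a mod 4 = 1 \<Longrightarrow> quartic_symbol (gauss_cnj x) (of_int a) = cnj (quartic_symbol x (of_int a))"
proof (induction a rule: signed_prime_induct)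
  case (split b l)
  then show ?case using qchi_gauss_cnj[of l x] qchi_gauss_cnj[of "gauss_cnj l" x] PP_cnj[of l]
    by (simp only: quartic_symbol_split complex_cnj_mult gauss_cnj_simps(4)) (simp only: mult_ac)
next
  case (inert b q)
  have "gauss_cnj (- of_nat q) = - of_nat q" by (simp add: gauss_int_eq_iff)
  then show ?case using inert qchi_gauss_cnj[of "- of_nat q" x]
    by (simp only: quartic_symbol_inert complex_cnj_mult)
qed (simp add: of_int_1)

lemma quartic_symbol_int_cong:
  "a mod 4 = 1 \<Longrightarrow> of_int a dvd x - y \<Longrightarrow> quartic_symbol x (of_int a) = quartic_symbol y (of_int a)"
proof (induction a rule: signed_prime_induct)
  case (split b l)
  have "of_nat (gauss_norm l) dvd x - y" "of_int b dvd x - y"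
    using split.prems by (auto dest: dvd_mult_left dvd_mult_right)
  then have "l dvd x - y" "gauss_cnj l dvd x - y"
    using gauss_mult_cnj[of l] by (metis dvd_mult_left, metis dvd_mult_right)
  then show ?case using split.IH[OF \<open>of_int b dvd x - y\<close>] split.hyps qchi_cong
    by (simp only: quartic_symbol_split)
next
  case (inert b q)
  have "(of_int (- int q * b) :: gauss_int) = (- of_nat q) * of_int b" by simp
  then have "- of_nat q dvd x - y" "of_int b dvd x - y" using inert.prems
    by (metis dvd_mult_left, metis dvd_mult_right)
  then show ?case using inert.IH inert.hyps qchi_cong[of "- of_nat q" x y] by (simp only: quartic_symbol_inert)
qed simp

text \<open>At a split prime the two conjugate factors cancel.  At an inert prime \<open>q\<close> the exponent \<open>(q\<^sup>2 - 1) div 4\<close>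
  is a multiple of \<open>q - 1\<close>, so Fermat's little theorem applies.\<close>

lemma quartic_symbol_int_rational:
  "a mod 4 = 1 \<Longrightarrow> (\<And>m. m \<in> PP \<Longrightarrow> m dvd of_int a \<Longrightarrow> \<not> m dvd of_int x) \<Longrightarrow> quartic_symbol (of_int x) (of_int a) = 1"
proof (induction a rule: signed_prime_induct)
  case (split b l)
  have d: "(of_int (int (gauss_norm l) * b) :: gauss_int) = l * (gauss_cnj l * of_int b)" "(of_int (int (gauss_norm l) * b) :: gauss_int) = of_int b * of_nat (gauss_norm l)"
    by (simp_all add: gauss_mult_cnj mult.assoc[symmetric])
  have "\<not> l dvd of_int x" using split.prems[OF split.hyps(2)] d(1) by (metis dvd_triv_left)
  then have "qchi l (of_int x) * cnj (qchi l (of_int x)) = 1"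
    using qchi_norm[OF split.hyps(2)] complex_norm_square[of "qchi l (of_int x)"] by simp
  then have "qchi l (of_int x) * qchi (gauss_cnj l) (of_int x) = 1"
    using qchi_gauss_cnj[OF split.hyps(2), of "of_int x"] by simp
  moreover have "quartic_symbol (of_int x) (of_int b) = 1"
    using split.IH split.prems d(2) by (metis dvd_mult2)
  ultimately show ?case using split.hyps by (simp only: quartic_symbol_split) simp
next
  case (inert b q)
  define l where "l = (- of_nat q :: gauss_int)"
  have l: "l \<in> PP" using inert by (simp add: l_def)
  have d: "(of_int (- int q * b) :: gauss_int) = l * of_int b" by (simp add: l_def)
  have nd: "\<not> l dvd of_int x" using inert.prems[OF l] d by (metis dvd_triv_left)
  have oq: "odd q" using inert by presburger
  have "of_nat q dvd (of_int x) ^ q - (of_int x :: gauss_int)" by (rule gauss_frobenius_of_int) (use inert oq in auto)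
  then have "l dvd (of_int x) ^ q - of_int x" by (simp add: l_def)
  also have "(of_int x) ^ q - of_int x = (of_int x :: gauss_int) * (of_int x ^ (q - 1) - 1)"
    using prime_gt_0_nat[OF inert.hyps(2)] by (cases q) (auto simp: right_diff_distrib)
  finally have 1: "l dvd of_int x ^ (q - 1) - 1" using nd l by (simp add: PP_dvd_mult_iff)
  have Nl: "gauss_norm l = q\<^sup>2" by (simp add: l_def gauss_norm_def nat_power_eq)
  obtain k where k: "q = 4 * k + 3" using inert.hyps(3) by (metis div_mult_mod_eq mult.commute)
  have e: "(gauss_norm l - 1) div 4 = (q - 1) * (k + 1)"
    unfolding Nl k by (simp add: power2_eq_square algebra_simps)
  have "l dvd (of_int x ^ (q - 1)) ^ (k + 1) - 1 ^ (k + 1)" by (rule dvd_power_diff[OF 1])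
  then have "l dvd of_int x ^ ((gauss_norm l - 1) div 4) - 1" unfolding e power_mult power_one .
  then have "qchi l (of_int x) = 1" using qchi_eqI[OF l nd, of 1] by simp
  moreover have "quartic_symbol (of_int x) (of_int b) = 1"
    using inert.IH inert.prems d by (metis dvd_mult)
  ultimately show ?case using inert.hyps by (simp only: quartic_symbol_inert) (simp add: l_def)
qed simp

lemma qchi_i: "p \<in> PP \<Longrightarrow> qchi p gauss_i = \<i> ^ ((gauss_norm p - 1) div 4)"
proof -
  assume p: "p \<in> PP"
  have iu: "gauss_i dvd 1" by (simp add: gauss_unit_iff)
  have "gauss_i ^ k dvd 1" for k using dvd_power_same[OF iu, of k] by simp
  moreover have "\<not> p dvd gauss_i" using iu PP_not_unit[OF p] dvd_trans by blast
  ultimately show ?thesis using qchi_eqI[OF p, of gauss_i "gauss_i ^ ((gauss_norm p - 1) div 4)"] by simp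
qed

lemma i_power_even: "\<i> ^ (2 * k) = (- 1) ^ k"
  by (simp add: power_mult)

lemma quartic_symbol_int_i:
  "a mod 4 = 1 \<Longrightarrow> quartic_symbol gauss_i (of_int a) = (if a mod 8 = 1 then 1 else - 1)"
proof (induction a rule: signed_prime_induct)
  case (split b l)
  define k where "k = (gauss_norm l - 1) div 4"
  have q: "gauss_norm l = 4 * k + 1" unfolding k_def using split.hyps(4) by presburger
  have "\<i> ^ k * \<i> ^ k = (- 1 :: complex) ^ k" by (simp flip: power_mult_distrib)
  moreover have "qchi l gauss_i = \<i> ^ k" "qchi (gauss_cnj l) gauss_i = \<i> ^ k"
    using qchi_i[OF split.hyps(2)] qchi_i[OF PP_cnj[OF split.hyps(2)]] by (simp_all add: k_def)
  ultimately have 1: "quartic_symbol gauss_i (of_int (int (gauss_norm l) * b)) = (- 1) ^ k * (if b mod 8 = 1 then 1 else - 1)"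
    using split by (simp only: quartic_symbol_split)
  have bm: "b mod 8 = 1 \<or> b mod 8 = 5" using split.hyps(1) by presburger
  have m: "(int (gauss_norm l) * b) mod 8 = ((int (gauss_norm l) mod 8) * (b mod 8)) mod 8" by (simp add: mod_mult_eq)
  show ?case
  proof (cases "even k")
    case True
    then have "int (gauss_norm l) mod 8 = 1" unfolding q by presburger
    then show ?thesis using 1 m bm True by auto
  next
    case False
    then have "int (gauss_norm l) mod 8 = 5" unfolding q by presburger
    then show ?thesis using 1 m bm False by auto
  qed
next
  case (inert b q)
  define l where "l = (- of_nat q :: gauss_int)"
  have l: "l \<in> PP" using inert by (simp add: l_def)
  have Nl: "gauss_norm l = q\<^sup>2" by (simp add: l_def gauss_norm_def nat_power_eq)
  obtain k where k: "q = 4 * k + 3" using inert.hyps(3) by (metis div_mult_mod_eq mult.commute)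
  have e: "(gauss_norm l - 1) div 4 = 2 * ((2 * k + 1) * (k + 1))"
    unfolding Nl k by (simp add: power2_eq_square algebra_simps)
  have qi: "qchi l gauss_i = (- 1) ^ (k + 1)"
    unfolding qchi_i[OF l] e i_power_even by (simp add: power_mult power_add)
  have 1: "quartic_symbol gauss_i (of_int (- int q * b)) = (- 1) ^ (k + 1) * (if b mod 8 = 1 then 1 else - 1)"
    using inert qi unfolding l_def by (simp only: quartic_symbol_inert)
  have bm: "b mod 8 = 1 \<or> b mod 8 = 5" using inert.hyps(1) by presburger
  have m: "(- int q * b) mod 8 = (((- int q) mod 8) * (b mod 8)) mod 8" by (simp add: mod_mult_eq)
  show ?case
  proof (cases "even k")
    case True
    then have "(- int q) mod 8 = 5" unfolding k by presburger
    then show ?thesis using 1 m bm True by auto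
  next
    case False
    then have "(- int q) mod 8 = 1" unfolding k by presburger
    then show ?thesis using 1 m bm False by auto
  qed
qed simp

text \<open>At a split prime \<open>q = l * gauss_cnj l\<close> the congruence for \<open>G\<^sup>q\<close> is read modulo \<open>l\<close>.  At an inert prime
  \<open>gauss_cnj p\<close> is congruent to \<open>p ^ q\<close>, and the exponents of \<open>p\<close> add up to \<open>(q\<^sup>2 - 1) div 4\<close>.\<close>

lemma rational_reciprocity:
  "a mod 4 = 1 \<Longrightarrow> p \<in> PP \<Longrightarrow> \<not> p dvd of_int a \<Longrightarrow> qchi p (of_int a) = quartic_symbol p (of_int a)"
proof (induction a rule: signed_prime_induct)
  case one
  then show ?case by simp
next
  case (split b l)
  have p: "p \<in> PP" and l: "l \<in> PP" using split by auto
  define q where "q = gauss_norm l"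
  have q: "prime q" "q mod 4 = 1" using split by (auto simp: q_def)
  have e: "(of_int (int (gauss_norm l) * b) :: gauss_int) = of_nat q * of_int b" by (simp add: q_def)
  have nd: "\<not> p dvd of_nat q" "\<not> p dvd of_int b" using split.prems(2) unfolding e by auto
  have ll: "of_nat q = l * gauss_cnj l" by (simp add: gauss_mult_cnj q_def)
  define v where "v = qunit p (of_nat q)"
  have v: "v dvd 1" "qchi p (of_nat q) = cg v" using qunit_spec[OF p nd(1)] by (auto simp: v_def)
  have "l \<noteq> p" "gauss_cnj l \<noteq> p" using nd(1) unfolding ll by auto
  then have nl: "\<not> l dvd p" "\<not> l dvd gauss_cnj p"
    using PP_dvd_PP[OF l p] PP_dvd_PP[OF l PP_cnj[OF p]] by auto
  have "qchi l (p ^ 2 * of_nat (gauss_norm p)) = cg (gauss_cnj v)"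
  proof (rule qchi_eqI[OF l])
    show "\<not> l dvd p ^ 2 * of_nat (gauss_norm p)"
      unfolding gauss_mult_cnj[symmetric] using nl l by (simp add: PP_dvd_mult_iff PP_dvd_power_iff)
    show "gauss_cnj v dvd 1" using v(1) gauss_cnj_dvd_iff[of v 1] by simp
    have "of_nat q dvd (p ^ 2 * of_nat (gauss_norm p)) ^ ((q - 1) div 4) - gauss_cnj v"
      unfolding v_def by (rule rational_congruence_1[OF p q nd(1)])
    then show "l dvd (p ^ 2 * of_nat (gauss_norm p)) ^ ((gauss_norm l - 1) div 4) - gauss_cnj v"
      unfolding ll q_def[symmetric] by (rule dvd_mult_left)
  qed
  also have "qchi l (p ^ 2 * of_nat (gauss_norm p)) = qchi l p ^ 3 * qchi l (gauss_cnj p)"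
    unfolding gauss_mult_cnj[symmetric] by (simp add: qchi_mult[OF l] power2_eq_square power3_eq_cube)
  also have "\<dots> = cnj (qchi l p * qchi (gauss_cnj l) p)"
    using qchi_cnj[OF l, of p] qchi_gauss_cnj[OF PP_cnj[OF l], of p] by simp
  finally have "cnj (qchi l p * qchi (gauss_cnj l) p) = cnj (qchi p (of_nat q))" by (simp only: v(2) complex_of_gauss_simps)
  then have "qchi l p * qchi (gauss_cnj l) p = qchi p (of_nat q)" by (simp only: complex_cnj_cancel_iff)
  then show ?case using split.IH[OF p nd(2)]
    unfolding quartic_symbol_split[OF split.hyps(1) l] unfolding e qchi_mult[OF p] by simp
next
  case (inert b q)
  have p: "p \<in> PP" using inert by simp
  define l where "l = (- of_nat q :: gauss_int)"
  have l: "l \<in> PP" using inert by (simp add: l_def)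
  have e: "(of_int (- int q * b) :: gauss_int) = l * of_int b" by (simp add: l_def)
  have nd: "\<not> p dvd l" "\<not> p dvd of_int b" using inert.prems(2) unfolding e by auto
  have nq: "\<not> p dvd of_nat q" using nd(1) by (simp add: l_def)
  have Nl: "gauss_norm l = q\<^sup>2" by (simp add: l_def gauss_norm_def nat_power_eq)
  obtain k where k: "q = 4 * k + 3" using inert.hyps(3) by (metis div_mult_mod_eq mult.commute)
  define u v where "u = qunit p (- 1)" and "v = qunit p (of_nat q)"
  have p1: "\<not> p dvd - 1" using PP_not_unit[OF p] by simp
  have u: "u dvd 1" "qchi p (- 1) = cg u" using qunit_spec[OF p p1] by (auto simp: u_def)
  have v: "v dvd 1" "qchi p (of_nat q) = cg v" using qunit_spec[OF p nq] by (auto simp: v_def)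
  have "cg (u * u) = cg 1" using qchi_minus_1_sq[OF p] u(2) by simp
  then have uu: "u * u = 1" by (simp only: complex_of_gauss_eq_iff)
  have nl: "\<not> l dvd p" using PP_dvd_PP[OF l p] nd(1) by auto
  have "odd q" "q mod 4 \<noteq> 1" using inert.hyps(3) by presburger+
  then have "of_nat q dvd p ^ q - gauss_cnj p"
    using gauss_frobenius_conj[OF inert.hyps(2), of p] by simp
  then have c: "l dvd p ^ q - gauss_cnj p" by (simp add: l_def)
  have d: "l dvd (p ^ 2 * of_nat (gauss_norm p)) ^ k * (p ^ 2 * u) - v"
  proof -
    have "q div 4 = k" using k by simp
    then have "of_nat q dvd (p ^ 2 * of_nat (gauss_norm p)) ^ k * (p ^ 2 * u) - v"
      using rational_congruence_3[OF p inert.hyps(2,3) nq] by (simp only: u_def v_def)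
    then show ?thesis by (simp add: l_def)
  qed
  have "l dvd (p ^ 2 * (p * p ^ q)) ^ k - (p ^ 2 * of_nat (gauss_norm p)) ^ k"
    unfolding gauss_mult_cnj[symmetric] by (intro dvd_power_diff dvd_mult_diff c) auto
  then have "l dvd (p ^ 2 * (p * p ^ q)) ^ k * (p ^ 2 * u) - (p ^ 2 * of_nat (gauss_norm p)) ^ k * (p ^ 2 * u)"
    by (intro dvd_mult_diff) auto
  then have "l dvd (p ^ 2 * (p * p ^ q)) ^ k * (p ^ 2 * u) - v" using d by (rule dvd_diff_trans)
  then have "l dvd (p ^ 2 * (p * p ^ q)) ^ k * (p ^ 2 * u) * u - v * u"
    by (intro dvd_mult_diff) auto
  also have "(p ^ 2 * (p * p ^ q)) ^ k * (p ^ 2 * u) * u = (p ^ 2 * (p * p ^ q)) ^ k * p ^ 2 * (u * u)" by (simp only: mult_ac)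
  also have "\<dots> = p ^ ((gauss_norm l - 1) div 4)"
  proof -
    have "p ^ 2 * (p * p ^ q) = p ^ (q + 3)" by (simp add: power_add eval_nat_numeral mult_ac)
    then have "(p ^ 2 * (p * p ^ q)) ^ k * p ^ 2 = p ^ ((q + 3) * k + 2)"
      by (simp only: power_mult[symmetric] power_add[symmetric])
    moreover have "(q + 3) * k + 2 = (gauss_norm l - 1) div 4"
      unfolding Nl k by (simp add: power2_eq_square algebra_simps)
    ultimately show ?thesis by (simp only: uu mult_1_right)
  qed
  finally have "l dvd p ^ ((gauss_norm l - 1) div 4) - v * u" .
  moreover have "v * u dvd 1" using u v by (metis mult_1 mult_dvd_mono)
  ultimately have "qchi l p = cg (v * u)" using qchi_eqI[OF l nl] by blast
  also have "\<dots> = qchi p (of_nat q * (- 1))" unfolding qchi_mult[OF p] u(2) v(2) by (simp only: complex_of_gauss_simps)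
  finally have "qchi l p = qchi p l" by (simp add: l_def)
  then show ?case using inert.IH[OF p nd(2)]
    unfolding quartic_symbol_inert[OF inert.hyps(1,4)] unfolding e qchi_mult[OF p] l_def by simp
qed

subsection \<open>The reciprocity law\<close>

text \<open>Only the parity of this number matters: it decides the value of the symbol at \<open>-1\<close>.\<close>

definition par :: "gauss_int \<Rightarrow> nat" where
  "par p = (gauss_norm p - 1) div 4"

lemma qchi_minus_1: "p \<in> PP \<Longrightarrow> qchi p (- 1) = (- 1) ^ par p"
proof -
  assume p: "p \<in> PP"
  have "(- 1 :: gauss_int) dvd 1" by simp
  then have "(- 1 :: gauss_int) ^ k dvd 1" for k using dvd_power_same[of "- 1" "1::gauss_int" k] by simp
  then show ?thesis using qchi_eqI[OF p, of "- 1" "(- 1) ^ par p"] PP_not_unit[OF p] by (simp add: par_def)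
qed

lemma par_sign:
  assumes p: "p \<in> PP"
  shows "(- 1 :: complex) ^ par p = (if gre p mod 4 = 1 then 1 else - 1)"
proof -
  have pr: "even (gim p)" "4 dvd gre p + gim p - 1" using PP_primary[OF p] by (auto simp: primary_iff)
  obtain b where b: "gim p = 2 * b" using pr(1) by (auto elim: evenE)
  have "odd (gre p)" using pr by presburger
  then obtain a where a: "gre p = 2 * a + 1" by (auto elim: oddE)
  define t where "t = a * (a + 1) + b * b"
  have "int (gauss_norm p) = 4 * t + 1"
    unfolding int_gauss_norm a b t_def by (simp add: power2_eq_square algebra_simps)
  moreover have "int (gauss_norm p) = 4 * int (par p) + 1"
    using PP_norm_minus_1[OF p] PP_norm_ge_5[OF p] unfolding par_def by linarith
  ultimately have ip: "int (par p) = a * (a + 1) + b * b" unfolding t_def[symmetric] by linarith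
  have "even (par p) \<longleftrightarrow> even (int (par p))" by simp
  also have "\<dots> \<longleftrightarrow> even b" unfolding ip by simp
  also have "\<dots> \<longleftrightarrow> gre p mod 4 = 1" using pr(2) a b by presburger
  finally show ?thesis by simp
qed

lemma sign_power_mult:
  assumes "x = (- 1 :: complex) ^ m" "y = (- 1 :: complex) ^ n"
  shows "(- 1 :: complex) ^ (m * n) = (if x = - 1 \<and> y = - 1 then - 1 else 1)"
  unfolding assms by (cases "even m"; cases "even n") (simp_all add: minus_one_power_iff)

text \<open>If \<open>p\<close> or \<open>l\<close> is a rational integer this is \<open>rational_reciprocity\<close>.  Otherwise write \<open>p = a + b i\<close> and
  \<open>l = c + d i\<close>; the rational integer \<open>e = a c + b d\<close> satisfies \<open>c p = e\<close> modulo \<open>l\<close> and \<open>a l = e\<close> modulo \<open>p\<close>,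
  which reduces both symbols to symbols of rational integers.\<close>

lemma quartic_reciprocity:
  assumes p: "p \<in> PP" and l: "l \<in> PP"
  shows "qchi l p = (- 1) ^ (par p * par l) * qchi p l"
proof (cases "p = l")
  case False
  define a b c d where "a = gre p" and "b = gim p" and "c = gre l" and "d = gim l"
  have pp: "p = of_int a + of_int b * gauss_i" and ll: "l = of_int c + of_int d * gauss_i"
    using gauss_int_decomp[of p] gauss_int_decomp[of l] by (simp_all add: a_def b_def c_def d_def)
  have pr: "even b" "4 dvd a + b - 1" "even d" "4 dvd c + d - 1"
    using PP_primary[OF p] PP_primary[OF l] by (auto simp: primary_iff a_def b_def c_def d_def)
  have nlp: "\<not> l dvd p" "\<not> p dvd l" using PP_dvd_PP[OF l p] PP_dvd_PP[OF p l] False by auto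
  define sp sl :: complex where "sp = (- 1) ^ par p" and "sl = (- 1) ^ par l"
  have sp: "sp = (if a mod 4 = 1 then 1 else - 1)" and sl: "sl = (if c mod 4 = 1 then 1 else - 1)"
    using par_sign[OF p] par_sign[OF l] by (auto simp: sp_def sl_def a_def c_def)
  have sgn: "(- 1 :: complex) ^ (par p * par l) = (if sp = - 1 \<and> sl = - 1 then - 1 else 1)"
    by (rule sign_power_mult[OF sp_def sl_def])
  show ?thesis
  proof (cases "b = 0 \<or> d = 0")
    case True
    then show ?thesis
    proof
      assume b: "b = 0"
      then have a1: "a mod 4 = 1" using pr by presburger
      have "qchi l p = quartic_symbol l p"
        using rational_reciprocity[OF a1 l] nlp pp b by simp
      then show ?thesis using quartic_symbol_prime_elem[OF PP_prime[OF p]] sgn sp a1 by simp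
    next
      assume d: "d = 0"
      then have c1: "c mod 4 = 1" using pr by presburger
      have "qchi p l = quartic_symbol p l"
        using rational_reciprocity[OF c1 p] nlp ll d by simp
      then show ?thesis using quartic_symbol_prime_elem[OF PP_prime[OF l]] sgn sl c1 by simp
    qed
  next
    case bd: False
    have odd: "odd a" "odd c" using pr by presburger+
    \<comment> \<open>\<open>e\<close> is the real part of \<open>p * gauss_cnj l\<close>.\<close>
    define e where "e = a * c + b * d"
    have key: "\<not> r dvd of_int (gre r)" if r: "r \<in> PP" "gim r \<noteq> 0" "odd (gre r)" for r
    proof
      assume "r dvd of_int (gre r)"
      then have "gauss_norm r dvd gauss_norm (of_int (gre r))" by (rule gauss_norm_dvd)
      then have "int (gauss_norm r) dvd int (gauss_norm (of_int (gre r)))" by presburger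
      then have "(gre r)\<^sup>2 + (gim r)\<^sup>2 dvd (gre r)\<^sup>2" by (simp add: int_gauss_norm)
      moreover have "(gre r)\<^sup>2 > 0" using r(3) by auto
      moreover have "(gim r)\<^sup>2 > 0" using r(2) by simp
      ultimately show False using zdvd_imp_le[of "(gre r)\<^sup>2 + (gim r)\<^sup>2" "(gre r)\<^sup>2"] by linarith
    qed
    have npa: "\<not> p dvd of_int a" using key[OF p] bd odd by (simp add: a_def b_def)
    have nlc: "\<not> l dvd of_int c" using key[OF l] bd odd by (simp add: c_def d_def)
    have ide: "of_int c * p - of_int e = of_int b * gauss_i * l" "of_int a * l - of_int e = of_int d * gauss_i * p"
      unfolding pp ll e_def by (simp_all add: gauss_int_eq_iff algebra_simps)
    have dl: "l dvd of_int c * p - of_int e" and dp: "p dvd of_int a * l - of_int e" unfolding ide by simp_all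
    have nle: "\<not> l dvd of_int e" using dvd_diff_cong[OF dl] nlc nlp l by (simp add: PP_dvd_mult_iff)
    have npe: "\<not> p dvd of_int e" using dvd_diff_cong[OF dp] npa nlp p by (simp add: PP_dvd_mult_iff)
    define s :: "int \<Rightarrow> int" where "s = (\<lambda>x. if x mod 4 = 1 then 1 else - 1)"
    have bdm: "(b * d) mod 8 = (if a mod 4 = 3 \<and> c mod 4 = 3 then 4 else 0)"
    proof -
      obtain b' d' where b': "b = 2 * b'" "d = 2 * d'" using pr by (auto elim!: evenE)
      have "even b' \<longleftrightarrow> a mod 4 \<noteq> 3" "even d' \<longleftrightarrow> c mod 4 \<noteq> 3" using pr b' by presburger+
      moreover have "(b * d) mod 8 = 4 * ((b' * d') mod 2)" using b' by (simp add: mult_mod_right)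
      ultimately show ?thesis by (cases "even b'"; cases "even d'") (auto simp: mod2_eq_if)
    qed
    have em: "e mod 8 = (((a mod 8) * (c mod 8)) mod 8 + (b * d) mod 8) mod 8"
      unfolding e_def by (simp add: mod_add_eq mod_mult_eq)
    have am: "a mod 8 = 1 \<or> a mod 8 = 3 \<or> a mod 8 = 5 \<or> a mod 8 = 7"
      and cm: "c mod 8 = 1 \<or> c mod 8 = 3 \<or> c mod 8 = 5 \<or> c mod 8 = 7" using odd by presburger+
    have m4: "x mod 4 = (x mod 8) mod 4" for x :: int by (simp add: mod_mod_cancel)
    have em8: "e mod 8 = 1 \<or> e mod 8 = 3 \<or> e mod 8 = 5 \<or> e mod 8 = 7"
    proof -
      have "odd e" using odd pr by (simp add: e_def)
      then show ?thesis by presburger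
    qed
    have s1: "(s x * x) mod 4 = 1" if "x mod 8 = 1 \<or> x mod 8 = 3 \<or> x mod 8 = 5 \<or> x mod 8 = 7" for x
      using that m4[of x] unfolding s_def by (elim disjE) (simp_all add: zmod_zminus1_eq_if)
    have s8: "(s x * x) mod 8 = 1 \<longleftrightarrow> x mod 8 = 1 \<or> x mod 8 = 7" if "x mod 8 = 1 \<or> x mod 8 = 3 \<or> x mod 8 = 5 \<or> x mod 8 = 7" for x
      using that m4[of x] unfolding s_def by (elim disjE) (simp_all add: zmod_zminus1_eq_if)
    have sx: "x = s x * (s x * x)" for x by (simp add: s_def)
    have qs: "qchi r (of_int x) = (if x mod 4 = 1 then 1 else (- 1) ^ par r) * quartic_symbol r (of_int (s x * x))"
      if r: "r \<in> PP" "\<not> r dvd of_int x" "x mod 8 = 1 \<or> x mod 8 = 3 \<or> x mod 8 = 5 \<or> x mod 8 = 7" for r x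
    proof -
      have "qchi r (of_int x) = qchi r (of_int (s x)) * qchi r (of_int (s x * x))"
        by (subst sx) (simp only: of_int_mult qchi_mult[OF r(1)])
      also have "qchi r (of_int (s x)) = (if x mod 4 = 1 then 1 else (- 1) ^ par r)"
        using qchi_minus_1[OF r(1)] r(1) by (simp add: s_def)
      also have "qchi r (of_int (s x * x)) = quartic_symbol r (of_int (s x * x))"
        by (rule rational_reciprocity[OF s1[OF r(3)] r(1)]) (use r(2) in \<open>auto simp: s_def split: if_splits\<close>)
      finally show ?thesis .
    qed
    define ep :: "int \<Rightarrow> complex" where "ep = (\<lambda>x. if x mod 8 = 1 \<or> x mod 8 = 7 then 1 else - 1)"
    have isym: "quartic_symbol gauss_i (of_int (s x * x)) = ep x"
      if "x mod 8 = 1 \<or> x mod 8 = 3 \<or> x mod 8 = 5 \<or> x mod 8 = 7" for x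
      using quartic_symbol_int_i[OF s1[OF that]] s8[OF that] by (simp add: ep_def)
    have dvs: "of_int (s x * x) dvd z \<longleftrightarrow> of_int x dvd z" for x and z :: gauss_int
      by (simp add: s_def)
    have own: "quartic_symbol r (of_int (s (gre r) * gre r)) = ep (gre r)"
      if r: "r \<in> PP" "gim r \<noteq> 0" "gre r mod 8 = 1 \<or> gre r mod 8 = 3 \<or> gre r mod 8 = 5 \<or> gre r mod 8 = 7" for r
    proof -
      define x where "x = gre r"
      have x8: "x mod 8 = 1 \<or> x mod 8 = 3 \<or> x mod 8 = 5 \<or> x mod 8 = 7" using r(3) by (simp add: x_def)
      have x1: "(s x * x) mod 4 = 1" using s1[OF x8] .
      have "of_int (s x * x) dvd r - of_int (gim r) * gauss_i"
      proof -
        have "r - of_int (gim r) * gauss_i = of_int x" by (simp add: gauss_int_eq_iff x_def)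
        then show ?thesis unfolding dvs by simp
      qed
      then have "quartic_symbol r (of_int (s x * x)) = quartic_symbol (of_int (gim r) * gauss_i) (of_int (s x * x))"
        by (rule quartic_symbol_int_cong[OF x1])
      also have "\<dots> = quartic_symbol (of_int (gim r)) (of_int (s x * x)) * ep x"
        by (simp only: quartic_symbol_int_mult[OF x1] isym[OF x8])
      also have "quartic_symbol (of_int (gim r)) (of_int (s x * x)) = 1"
      proof (rule quartic_symbol_int_rational[OF x1], rule notI)
        fix m assume m: "m \<in> PP" "m dvd of_int (s x * x)" "m dvd of_int (gim r)"
        have "m dvd of_int x" using m(2) by (auto simp: s_def split: if_splits)
        then have "m dvd of_int (gre r) + of_int (gim r) * gauss_i" using m(3) by (auto simp: x_def)
        then have "m dvd r" using gauss_int_decomp[of r] by simp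
        then have "m = r" using PP_dvd_PP[OF m(1) r(1)] by simp
        moreover have "odd x" using x8 by presburger
        ultimately show False using key[OF r(1,2)] \<open>m dvd of_int x\<close> by (simp add: x_def)
      qed
      finally show ?thesis by (simp add: x_def)
    qed
    define X Y El Ep where "X = qchi l p" and "Y = qchi p l" and "El = quartic_symbol l (of_int (s e * e))"
      and "Ep = quartic_symbol p (of_int (s e * e))"
    have e1: "(s e * e) mod 4 = 1" using s1[OF em8] .
    have "qchi l (of_int c) * X = qchi l (of_int e)"
      unfolding X_def qchi_mult[OF l, symmetric] by (rule qchi_cong[OF dl])
    moreover have "qchi l (of_int c) = sl * ep c"
      using qs[OF l nlc cm] own[OF l] bd cm sl by (simp add: c_def d_def sl_def)
    moreover have "qchi l (of_int e) = (if e mod 4 = 1 then 1 else sl) * El"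
      using qs[OF l nle em8] by (simp add: El_def sl_def)
    ultimately have eq1: "sl * ep c * X = (if e mod 4 = 1 then 1 else sl) * El" by simp
    have "qchi p (of_int a) * Y = qchi p (of_int e)"
      unfolding Y_def qchi_mult[OF p, symmetric] by (rule qchi_cong[OF dp])
    moreover have "qchi p (of_int a) = sp * ep a"
      using qs[OF p npa am] own[OF p] bd am sp by (simp add: a_def b_def sp_def)
    moreover have "qchi p (of_int e) = (if e mod 4 = 1 then 1 else sp) * Ep"
      using qs[OF p npe em8] by (simp add: Ep_def sp_def)
    ultimately have eq2: "sp * ep a * Y = (if e mod 4 = 1 then 1 else sp) * Ep" by simp
    \<comment> \<open>Modulo \<open>e\<close> the product \<open>p * gauss_cnj l\<close> is a rational integer times \<open>i\<close>, so its symbol is that of \<open>i\<close>.\<close>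
    have eq3: "Ep * cnj El = ep e"
    proof -
      define f where "f = b * c - a * d"
      have pl: "p * gauss_cnj l = of_int e + of_int f * gauss_i"
        unfolding pp ll e_def f_def by (simp add: gauss_int_eq_iff algebra_simps)
      have "Ep * cnj El = quartic_symbol (p * gauss_cnj l) (of_int (s e * e))"
        unfolding quartic_symbol_int_mult[OF e1] quartic_symbol_int_cnj[OF e1] Ep_def El_def ..
      also have "\<dots> = quartic_symbol (of_int f * gauss_i) (of_int (s e * e))"
        by (rule quartic_symbol_int_cong[OF e1]) (simp only: dvs pl, simp)
      also have "\<dots> = quartic_symbol (of_int f) (of_int (s e * e)) * ep e"
        by (simp only: quartic_symbol_int_mult[OF e1] isym[OF em8])
      also have "quartic_symbol (of_int f) (of_int (s e * e)) = 1"
      proof (rule quartic_symbol_int_rational[OF e1], rule notI)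
        fix m assume m: "m \<in> PP" "m dvd of_int (s e * e)" "m dvd of_int f"
        have me: "m dvd of_int e" using m(2) by (auto simp: s_def split: if_splits)
        then have "m dvd p * gauss_cnj l" using m(3) unfolding pl by simp
        then have "m dvd p \<or> m dvd gauss_cnj l" using m(1) by (simp add: PP_dvd_mult_iff)
        then have "m = p \<or> m = gauss_cnj l" using PP_dvd_PP m(1) p PP_cnj[OF l] by blast
        then show False
        proof
          assume "m = p" then show False using me npe by simp
        next
          assume "m = gauss_cnj l"
          then have "l dvd of_int e" using me gauss_cnj_dvd_iff[of l "of_int e"] by simp
          then show False using nle by simp
        qed
      qed
      finally show ?thesis by simp
    qed
    have epsq: "ep x * ep x = 1" for x by (simp add: ep_def)
    have spsq: "sp * sp = 1" "sl * sl = 1" by (simp_all add: sp sl)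
    have cnj_ep: "ep x \<noteq> 0" "cnj (ep x) = ep x" for x by (simp_all add: ep_def)
    have ElEl: "El * cnj El = 1"
    proof -
      have "X * cnj X = 1" using qchi_norm[OF l nlp(1)] complex_norm_square[of X] by (simp add: X_def)
      moreover have "cnj sl = sl" by (simp add: sl)
      then have "(sl * ep c * X) * cnj (sl * ep c * X) = (sl * sl) * (ep c * ep c) * (X * cnj X)"
        by (simp only: complex_cnj_mult cnj_ep mult_ac)
      ultimately have "(sl * ep c * X) * cnj (sl * ep c * X) = 1"
        using epsq[of c] spsq by simp
      then show ?thesis unfolding eq1 by (auto simp: sl split: if_splits)
    qed
    have "ep e * El = Ep * (El * cnj El)" using eq3 by (simp add: mult_ac)
    then have ElEp: "El = ep e * Ep" using ElEl epsq[of e] by (metis mult.assoc mult_1_left mult_1_right)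
    define te where "te = (e mod 4 = 1)"
    have "X = (sl * sl) * (ep c * ep c) * X" by (simp add: spsq epsq)
    also have "\<dots> = sl * ep c * (sl * ep c * X)" by (simp only: mult_ac)
    also have "\<dots> = sl * ep c * (if te then 1 else sl) * ep e * Ep" unfolding eq1 ElEp te_def by (simp only: mult_ac)
    also have "Ep = (if te then 1 else sp) * ((if te then 1 else sp) * Ep)" using spsq by (simp add: mult.assoc[symmetric])
    also have "(if te then 1 else sp) * Ep = sp * ep a * Y" using eq2 by (simp add: te_def)
    finally have X: "X = (sl * ep c * (if te then 1 else sl) * ep e * (if te then 1 else sp) * sp * ep a) * Y" by (simp only: mult_ac)
    have "sl * ep c * (if te then 1 else sl) * ep e * (if te then 1 else sp) * sp * ep a = (if sp = - 1 \<and> sl = - 1 then - 1 else 1)"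
    proof -
      have r4: "x mod 4 = (if x mod 8 = 1 \<or> x mod 8 = 5 then 1 else 3)"
        if "x mod 8 = 1 \<or> x mod 8 = 3 \<or> x mod 8 = 5 \<or> x mod 8 = 7" for x :: int
        using that by presburger
      show ?thesis
        unfolding sp sl ep_def te_def r4[OF em8] r4[OF am] r4[OF cm] em bdm
        using am cm by (elim disjE) simp_all
    qed
    then show ?thesis using X sgn by (simp add: X_def Y_def)
  qed
qed (simp add: qchi_dvd)

definition parE :: "gauss_int set \<Rightarrow> (gauss_int \<Rightarrow> nat) \<Rightarrow> nat" where
  "parE P e = (\<Sum>p\<in>P. e p * par p)"

text \<open>The sign is a power of \<open>-1\<close> whose exponent is a product of a number depending on \<open>P\<close> and a number
  depending on \<open>Q\<close>.  Fixing the parity of one of them leaves a sign that depends on the other set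
  alone and can be absorbed into coefficients.\<close>

lemma reciprocity_sets:
  assumes "P \<subseteq> PP" "Q \<subseteq> PP"
  shows "chiE P (\<lambda>_. 1) (\<Prod>q\<in>Q. q ^ e q) = (- 1) ^ (parE P (\<lambda>_. 1) * parE Q e) * chiE Q e (\<Prod>P)"
proof -
  have "chiE P (\<lambda>_. 1) (\<Prod>q\<in>Q. q ^ e q) = (\<Prod>p\<in>P. \<Prod>q\<in>Q. qchi p q ^ e q)"
    unfolding chiE_def by (intro prod.cong refl) (use assms in \<open>auto simp: qchi_prod qchi_power\<close>)
  also have "\<dots> = (\<Prod>p\<in>P. \<Prod>q\<in>Q. (- 1) ^ (par p * (e q * par q)) * qchi q p ^ e q)"
  proof (intro prod.cong refl)
    fix p q assume "p \<in> P" "q \<in> Q"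
    then have "qchi p q = (- 1) ^ (par q * par p) * qchi q p" using quartic_reciprocity[of q p] assms by blast
    then show "qchi p q ^ e q = (- 1) ^ (par p * (e q * par q)) * qchi q p ^ e q"
      by (simp add: power_mult_distrib mult_ac flip: power_mult)
  qed
  also have "\<dots> = (\<Prod>p\<in>P. (- 1) ^ (par p * parE Q e)) * (\<Prod>p\<in>P. \<Prod>q\<in>Q. qchi q p ^ e q)"
    by (simp add: prod.distrib parE_def sum_distrib_left power_sum)
  also have "(\<Prod>p\<in>P. (- 1 :: complex) ^ (par p * parE Q e)) = (- 1) ^ (parE P (\<lambda>_. 1) * parE Q e)"
    by (simp add: parE_def[of P] sum_distrib_right flip: power_sum)
  also have "(\<Prod>p\<in>P. \<Prod>q\<in>Q. qchi q p ^ e q) = chiE Q e (\<Prod>P)"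
    unfolding chiE_def by (subst prod.swap, intro prod.cong refl) (use assms in \<open>auto simp: qchi_prod prod_power_distrib\<close>)
  finally show ?thesis .
qed

section \<open>Sums of Gaussians\<close>

lemma sum_inverse_squares_le:
  assumes "K > 0"
  shows "(\<Sum>k\<in>{Suc K..<n}. 1 / (real k)\<^sup>2) \<le> 1 / real K"
proof -
  have "(\<Sum>k\<in>{Suc K..<n}. 1 / (real k)\<^sup>2) \<le> 1 / real K - 1 / real (n - 1)" if "n > K" for n
    using that
  proof (induction n)
    case (Suc n)
    show ?case
    proof (cases "n = K")
      case False
      then have n: "n > K" using Suc by simp
      have n1: "real (n - 1) = real n - 1" "real n > 1" using n assms by auto
      have "1 / (real n)\<^sup>2 \<le> 1 / (real n - 1) - 1 / real n"
        using n1(2) by (simp add: field_simps power2_eq_square)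
      then show ?thesis using Suc.IH[OF n] n n1 by simp
    qed simp
  qed simp
  note * = this
  show ?thesis
  proof (cases "n > K")
    case True
    have "1 / real K - 1 / real (n - 1) \<le> 1 / real K" by simp
    with *[OF True] show ?thesis by (rule order.trans)
  qed simp
qed

lemma exp_minus_le_inverse: "y > 0 \<Longrightarrow> exp (- y) \<le> 1 / (y :: real)"
  using exp_ge_add_one_self[of y] by (simp add: exp_minus field_simps del: exp_ge_add_one_self)

lemma gauss_nat_sum_le:
  assumes a: "a > 0"
  shows "(\<Sum>k<n. exp (- a * (real k)\<^sup>2)) \<le> 2 * (1 + 1 / sqrt a)"
proof -
  define K where "K = nat \<lceil>1 / sqrt a\<rceil>"
  have sa: "sqrt a > 0" using a by simp
  have K: "K > 0" "1 / sqrt a \<le> real K" "real K \<le> 1 / sqrt a + 1"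
  proof -
    have pos: "1 / sqrt a > 0" using sa by simp
    then have "real K = of_int \<lceil>1 / sqrt a\<rceil>" by (simp add: K_def)
    then show "1 / sqrt a \<le> real K" "real K \<le> 1 / sqrt a + 1"
      using le_of_int_ceiling[of "1 / sqrt a"] of_int_ceiling_le_add_one[of "1 / sqrt a"] by linarith+
    then have "0 < real K" using pos by linarith
    then show "K > 0" by simp
  qed
  have "(\<Sum>k<n. exp (- a * (real k)\<^sup>2)) \<le> (\<Sum>k<max n (Suc K). exp (- a * (real k)\<^sup>2))"
    by (rule sum_mono2) auto
  also have "{..<max n (Suc K)} = {..<Suc K} \<union> {Suc K..<max n (Suc K)}" by auto
  also have "(\<Sum>k\<in>{..<Suc K} \<union> {Suc K..<max n (Suc K)}. exp (- a * (real k)\<^sup>2)) =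
    (\<Sum>k<Suc K. exp (- a * (real k)\<^sup>2)) + (\<Sum>k\<in>{Suc K..<max n (Suc K)}. exp (- a * (real k)\<^sup>2))"
    by (rule sum.union_disjoint) auto
  also have "(\<Sum>k<Suc K. exp (- a * (real k)\<^sup>2)) \<le> (\<Sum>k<Suc K. 1)"
    by (rule sum_mono) (use a in simp)
  also have "(\<Sum>k\<in>{Suc K..<max n (Suc K)}. exp (- a * (real k)\<^sup>2)) \<le> (\<Sum>k\<in>{Suc K..<max n (Suc K)}. 1 / a * (1 / (real k)\<^sup>2))"
  proof (rule sum_mono)
    fix k assume "k \<in> {Suc K..<max n (Suc K)}"
    then have "a * (real k)\<^sup>2 > 0" using a by simp
    from exp_minus_le_inverse[OF this] show "exp (- a * (real k)\<^sup>2) \<le> 1 / a * (1 / (real k)\<^sup>2)" by simp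
  qed
  also have "\<dots> = 1 / a * (\<Sum>k\<in>{Suc K..<max n (Suc K)}. 1 / (real k)\<^sup>2)" by (simp only: sum_distrib_left)
  also have "\<dots> \<le> 1 / a * (1 / real K)" by (intro mult_left_mono sum_inverse_squares_le K) (use a in simp)
  also have "\<dots> \<le> 1 / a * sqrt a"
  proof (rule mult_left_mono)
    have "1 \<le> real K * sqrt a" using K(2) sa by (simp add: pos_divide_le_eq)
    then show "1 / real K \<le> sqrt a" using K(1) by (simp add: pos_divide_le_eq mult.commute)
  qed (use a in simp)
  also have "1 / a * sqrt a = 1 / sqrt a" using sa a by (simp add: field_simps flip: power2_eq_square)
  finally show ?thesis using K(3) by simp
qed

lemma gauss_int_sum_le:
  fixes F :: "int set"
  assumes a: "a > 0" and F: "finite F"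
  shows "(\<Sum>l\<in>F. exp (- a * (of_int l - x)\<^sup>2)) \<le> 4 * (1 + 1 / sqrt a)"
proof -
  have half: "(\<Sum>l\<in>A. exp (- a * (of_int l - x)\<^sup>2)) \<le> 2 * (1 + 1 / sqrt a)"
    if A: "finite A" "inj_on f A" "\<And>l. l \<in> A \<Longrightarrow> real (f l) \<le> \<bar>of_int l - x\<bar>" for A :: "int set" and f :: "int \<Rightarrow> nat"
  proof -
    have "(\<Sum>l\<in>A. exp (- a * (of_int l - x)\<^sup>2)) \<le> (\<Sum>l\<in>A. exp (- a * (real (f l))\<^sup>2))"
    proof (rule sum_mono)
      fix l assume "l \<in> A"
      then have "(real (f l))\<^sup>2 \<le> \<bar>of_int l - x\<bar>\<^sup>2" using A(3) by (intro power_mono) auto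
      then show "exp (- a * (of_int l - x)\<^sup>2) \<le> exp (- a * (real (f l))\<^sup>2)" using a by simp
    qed
    also have "\<dots> = (\<Sum>k\<in>f ` A. exp (- a * (real k)\<^sup>2))" using A(2) by (simp add: sum.reindex)
    also have "\<dots> \<le> (\<Sum>k<Suc (Max (f ` A)). exp (- a * (real k)\<^sup>2))"
      using A(1) by (intro sum_mono2) (auto simp: less_Suc_eq_le)
    also have "\<dots> \<le> 2 * (1 + 1 / sqrt a)" by (rule gauss_nat_sum_le[OF a])
    finally show ?thesis .
  qed
  define A B where "A = {l\<in>F. of_int l \<ge> x}" and "B = {l\<in>F. of_int l < x}"
  have AB: "F = A \<union> B" "A \<inter> B = {}" "finite A" "finite B" using F by (auto simp: A_def B_def)
  have "(\<Sum>l\<in>A. exp (- a * (of_int l - x)\<^sup>2)) \<le> 2 * (1 + 1 / sqrt a)"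
  proof (rule half[of A "\<lambda>l. nat (l - \<lceil>x\<rceil>)"])
    have ge: "l \<ge> \<lceil>x\<rceil>" if "l \<in> A" for l using that by (simp add: A_def ceiling_le_iff)
    show "inj_on (\<lambda>l. nat (l - \<lceil>x\<rceil>)) A"
    proof (rule inj_onI)
      fix k l assume "k \<in> A" "l \<in> A" "nat (k - \<lceil>x\<rceil>) = nat (l - \<lceil>x\<rceil>)"
      then show "k = l" using ge[of k] ge[of l] by (simp add: eq_nat_nat_iff)
    qed
    show "real (nat (l - \<lceil>x\<rceil>)) \<le> \<bar>of_int l - x\<bar>" if "l \<in> A" for l
      using ge[OF that] le_of_int_ceiling[of x] abs_ge_self[of "of_int l - x"] by (simp del: le_of_int_ceiling)
  qed (use AB in auto)
  moreover have "(\<Sum>l\<in>B. exp (- a * (of_int l - x)\<^sup>2)) \<le> 2 * (1 + 1 / sqrt a)"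
  proof (rule half[of B "\<lambda>l. nat (\<lceil>x\<rceil> - 1 - l)"])
    have ge: "l \<le> \<lceil>x\<rceil> - 1" if "l \<in> B" for l
    proof -
      have "l < \<lceil>x\<rceil>" using that by (simp add: B_def less_ceiling_iff)
      then show ?thesis by simp
    qed
    show "inj_on (\<lambda>l. nat (\<lceil>x\<rceil> - 1 - l)) B"
    proof (rule inj_onI)
      fix k l assume "k \<in> B" "l \<in> B" "nat (\<lceil>x\<rceil> - 1 - k) = nat (\<lceil>x\<rceil> - 1 - l)"
      then show "k = l" using ge[of k] ge[of l] by (simp add: eq_nat_nat_iff)
    qed
    show "real (nat (\<lceil>x\<rceil> - 1 - l)) \<le> \<bar>of_int l - x\<bar>" if "l \<in> B" for l
      using ge[OF that] of_int_ceiling_le_add_one[of x] that by (simp add: B_def)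
  qed (use AB in auto)
  ultimately show ?thesis unfolding AB(1) using AB by (simp add: sum.union_disjoint)
qed

lemma gauss_int_summable:
  fixes a x :: real
  assumes a: "a > 0"
  shows "(\<lambda>l :: int. exp (- a * (of_int l - x)\<^sup>2)) summable_on UNIV"
  by (rule nonneg_bdd_above_summable_on) (auto intro!: bdd_aboveI2[where M = "4 * (1 + 1 / sqrt a)"] gauss_int_sum_le[OF a, simplified])

lemma sum_gauss_box:
  fixes F :: "(int \<times> int) set"
  assumes "finite F" "\<And>l. f l \<ge> 0" "\<And>l. g l \<ge> (0 :: real)"
    and "\<And>A. finite A \<Longrightarrow> sum f A \<le> B" "\<And>A. finite A \<Longrightarrow> sum g A \<le> C"
  shows "(\<Sum>(l, k)\<in>F. f l * g k) \<le> B * C"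
proof -
  have "(\<Sum>(l, k)\<in>F. f l * g k) \<le> (\<Sum>(l, k)\<in>fst ` F \<times> snd ` F. f l * g k)"
    using assms by (intro sum_mono2) (auto simp: image_iff split: prod.splits; force)+
  also have "\<dots> = sum f (fst ` F) * sum g (snd ` F)" by (simp add: sum_product sum.cartesian_product)
  also have "\<dots> \<le> B * C" using assms by (intro mult_mono) (auto intro: sum_nonneg order.trans[OF sum_nonneg assms(4)[of "{}"]])
  finally show ?thesis .
qed

text \<open>The factor \<open>1 / sqrt a\<close> is the length on which the Gaussian is essentially constant; the added \<open>1\<close> covers
  the case that this length is below the mesh of the lattice.\<close>

lemma gaussian_sum_le:
  fixes F :: "gauss_int set"
  assumes a: "a > 0" and F: "finite F"
  shows "(\<Sum>m\<in>F. exp (- a * sqmod (cg m - w))) \<le> (4 * (1 + 1 / sqrt a))\<^sup>2"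
proof -
  define h where "h = (\<lambda>m. (gre m, gim m))"
  have inj: "inj_on h F" by (auto simp: inj_on_def h_def gauss_int_eq_iff)
  have "(\<Sum>m\<in>F. exp (- a * sqmod (cg m - w))) =
    (\<Sum>m\<in>F. (case h m of (l, k) \<Rightarrow> exp (- a * (of_int l - Re w)\<^sup>2) * exp (- a * (of_int k - Im w)\<^sup>2)))"
    by (intro sum.cong refl) (simp add: h_def cmod_power2 distrib_left exp_add[symmetric])
  also have "\<dots> = (\<Sum>(l, k)\<in>h ` F. exp (- a * (of_int l - Re w)\<^sup>2) * exp (- a * (of_int k - Im w)\<^sup>2))"
    using inj by (simp add: sum.reindex)
  also have "\<dots> \<le> (4 * (1 + 1 / sqrt a)) * (4 * (1 + 1 / sqrt a))"
    using F a by (intro sum_gauss_box gauss_int_sum_le) auto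
  finally show ?thesis by (simp add: power2_eq_square)
qed

lemma gaussian_summable:
  assumes a: "a > 0"
  shows "(\<lambda>m. exp (- a * sqmod (cg m - w))) summable_on UNIV"
  by (rule nonneg_bdd_above_summable_on) (auto intro!: bdd_aboveI2[where M = "(4 * (1 + 1 / sqrt a))\<^sup>2"] gaussian_sum_le[OF a, simplified])

section \<open>Poisson summation for Gaussians\<close>

lemma termwise_integration:
  fixes u :: "'i \<Rightarrow> real \<Rightarrow> complex"
  assumes cont: "\<And>l. continuous_on {0..1} (u l)"
    and bound: "\<And>l x. x \<in> {0..1} \<Longrightarrow> norm (u l x) \<le> M l"
    and M: "M summable_on UNIV"
  shows "continuous_on {0..1} (\<lambda>x. \<Sum>\<^sub>\<infinity>l. u l x)"
    and "((\<lambda>l. integral {0..1} (u l)) has_sum integral {0..1} (\<lambda>x. \<Sum>\<^sub>\<infinity>l. u l x)) UNIV"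
proof -
  have ul: "uniform_limit {0..1} (\<lambda>X x. \<Sum>l\<in>X. u l x) (\<lambda>x. \<Sum>\<^sub>\<infinity>l. u l x) (finite_subsets_at_top UNIV)"
    by (rule Weierstrass_m_test_general[OF bound M])
  have c: "continuous_on {0..1} (\<lambda>x. \<Sum>l\<in>X. u l x)" for X by (intro continuous_on_sum cont)
  show "continuous_on {0..1} (\<lambda>x. \<Sum>\<^sub>\<infinity>l. u l x)"
    by (rule uniform_limit_theorem[OF _ ul]) (auto intro: always_eventually c)
  obtain I J where IJ: "\<And>X. ((\<lambda>x. \<Sum>l\<in>X. u l x) has_integral I X) {0..1}"
    "((\<lambda>x. \<Sum>\<^sub>\<infinity>l. u l x) has_integral J) {0..1}" "(I \<longlongrightarrow> J) (finite_subsets_at_top UNIV)"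
    using uniform_limit_integral[OF ul c] by auto
  have "I X = (\<Sum>l\<in>X. integral {0..1} (u l))" if "finite X" for X
  proof -
    have "((\<lambda>x. \<Sum>l\<in>X. u l x) has_integral (\<Sum>l\<in>X. integral {0..1} (u l))) {0..1}"
      using that by (intro has_integral_sum integrable_integral integrable_continuous_interval cont)
    then show ?thesis using IJ(1) has_integral_unique by blast
  qed
  then have "((\<lambda>X. \<Sum>l\<in>X. integral {0..1} (u l)) \<longlongrightarrow> J) (finite_subsets_at_top UNIV)"
    by (intro Lim_transform_eventually[OF IJ(3)]) (auto simp: eventually_finite_subsets_at_top intro!: exI[of _ "{}"])
  then show "((\<lambda>l. integral {0..1} (u l)) has_sum integral {0..1} (\<lambda>x. \<Sum>\<^sub>\<infinity>l. u l x)) UNIV"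
    using IJ(2) by (simp add: has_sum_def integral_unique)
qed

definition ec :: "int \<Rightarrow> real \<Rightarrow> complex" where
  "ec m x = cis (2 * pi * of_int m * x)"

lemma ec_mult: "ec m x * ec n x = ec (m + n) x"
  by (simp add: ec_def cis_mult algebra_simps)

lemma ec_add: "ec m (x + y) = ec m x * ec m y"
  by (simp add: ec_def cis_mult algebra_simps)

lemma ec_of_int [simp]: "ec m (of_int k) = 1"
proof -
  have "2 * pi * of_int m * of_int k = 2 * pi * of_int (m * k)" by simp
  then show ?thesis unfolding ec_def by (simp only: cis_multiple_2pi Ints_of_int)
qed

lemma norm_ec [simp]: "cmod (ec m x) = 1" by (simp add: ec_def)

lemma continuous_on_ec [continuous_intros]: "continuous_on A (ec m)"
  unfolding ec_def by (intro continuous_intros)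

lemma ec_0 [simp]: "ec 0 x = 1" "ec m 0 = 1" by (simp_all add: ec_def)

lemma integral_ec: "integral {0..1} (ec m) = (if m = 0 then 1 else 0)"
proof (cases "m = 0")
  case False
  define c where "c = \<i> * complex_of_real (2 * pi * of_int m)"
  have c: "c \<noteq> 0" using False by (simp add: c_def)
  have e: "ec m x = exp (c * of_real x)" for x by (simp add: ec_def c_def cis_conv_exp mult_ac)
  have "(ec m has_integral (exp (c * of_real 1) / c - exp (c * of_real 0) / c)) {0..1}"
  proof (rule fundamental_theorem_of_calculus)
    fix x :: real
    have "((\<lambda>z. exp (c * z) / c) has_field_derivative exp (c * of_real x)) (at (of_real x))"
      using c by (auto intro!: derivative_eq_intros)
    then have "((\<lambda>x. exp (c * of_real x) / c) has_vector_derivative exp (c * of_real x)) (at x within {0..1})"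
      by (rule has_vector_derivative_real_field)
    then show "((\<lambda>x. exp (c * of_real x) / c) has_vector_derivative ec m x) (at x within {0..1})" by (simp add: e)
  qed simp
  moreover have "exp (c * of_real 1) = 1" using e[of 1] ec_of_int[of m 1] by simp
  ultimately show ?thesis using False by (auto dest: integral_unique)
next
  case True
  then have "ec m = (\<lambda>_. 1)" by auto
  then show ?thesis using True by simp
qed

text \<open>Uniqueness of Fourier coefficients: the trigonometric polynomials \<open>cos\<^sup>2\<^sup>n (\<pi> (x - y))\<close>
  concentrate at \<open>y\<close>, so a continuous function orthogonal to all of them vanishes.\<close>

lemma cos_power_trig_poly:
  "complex_of_real (cos (pi * (x - y)) ^ (2 * n)) =
    (\<Sum>j\<le>2 * n. of_nat (2 * n choose j) * (1 / 2 ^ (2 * n)) * cnj (ec (int j - int n) y) * ec (int j - int n) x)"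
proof -
  define z where "z = cis (pi * (x - y))"
  have "complex_of_real (cos (pi * (x - y))) = (z + cnj z) / 2"
    by (simp add: z_def complex_eq_iff)
  then have "complex_of_real (cos (pi * (x - y)) ^ (2 * n)) = (z + cnj z) ^ (2 * n) / 2 ^ (2 * n)"
    by (simp only: of_real_power power_divide)
  also have "\<dots> = (\<Sum>j\<le>2 * n. of_nat (2 * n choose j) * z ^ j * cnj z ^ (2 * n - j)) / 2 ^ (2 * n)"
    by (simp add: binomial_ring)
  also have "\<dots> = (\<Sum>j\<le>2 * n. of_nat (2 * n choose j) * (1 / 2 ^ (2 * n)) * cnj (ec (int j - int n) y) * ec (int j - int n) x)"
    unfolding sum_divide_distrib
  proof (rule sum.cong[OF refl])
    fix j assume "j \<in> {..2 * n}"
    then have j: "j \<le> 2 * n" by simp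
    have "z ^ j * cnj z ^ (2 * n - j) = cis (real j * (pi * (x - y)) + real (2 * n - j) * (- (pi * (x - y))))"
      unfolding z_def cis_cnj Complex.DeMoivre cis_mult ..
    also have "real j * (pi * (x - y)) + real (2 * n - j) * (- (pi * (x - y))) = 2 * pi * of_int (int j - int n) * (x - y)"
      using j by (simp add: of_nat_diff algebra_simps)
    also have "cis \<dots> = ec (int j - int n) x * cnj (ec (int j - int n) y)"
      unfolding ec_def cis_cnj cis_mult by (simp add: algebra_simps)
    finally show "of_nat (2 * n choose j) * z ^ j * cnj z ^ (2 * n - j) / 2 ^ (2 * n) =
        of_nat (2 * n choose j) * (1 / 2 ^ (2 * n)) * cnj (ec (int j - int n) y) * ec (int j - int n) x"
      by (simp add: mult_ac)
  qed
  finally show ?thesis .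
qed

lemma cos_pi_abs: "cos (pi * \<bar>z\<bar>) = cos (pi * z)"
  by (cases "z \<ge> 0") simp_all

lemma fourier_uniqueness_real:
  fixes r :: "real \<Rightarrow> real"
  assumes cont: "continuous_on {0..1} r"
    and orth: "\<And>n y. integral {0..1} (\<lambda>x. r x * cos (pi * (x - y)) ^ (2 * n)) = 0"
    and y: "0 < y" "y < 1"
  shows "r y \<le> 0"
proof (rule ccontr)
  assume "\<not> r y \<le> 0"
  then have ry: "r y > 0" by simp
  have "compact (r ` {0..1})" using compact_continuous_image[OF cont] by simp
  then obtain B where B: "\<And>x. x \<in> {0..1} \<Longrightarrow> \<bar>r x\<bar> \<le> B" "B > 0"
    by (metis bounded_pos compact_imp_bounded image_eqI real_norm_def)
  have dex: "\<exists>d>0. \<forall>x\<in>{0..1}. dist x y < d \<longrightarrow> dist (r x) (r y) < r y / 2"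
    using cont[unfolded continuous_on_iff, rule_format, of y "r y / 2"] y ry by simp
  then obtain d0 where d0: "d0 > 0" "\<And>x. x \<in> {0..1} \<Longrightarrow> \<bar>x - y\<bar> < d0 \<Longrightarrow> r x > r y / 2"
  proof -
    obtain d where d: "d > 0" "\<forall>x\<in>{0..1}. dist x y < d \<longrightarrow> dist (r x) (r y) < r y / 2"
      using dex by blast
    have "r x > r y / 2" if "x \<in> {0..1}" "\<bar>x - y\<bar> < d" for x
    proof -
      have "\<bar>r x - r y\<bar> < r y / 2" using d(2) that by (simp add: dist_real_def)
      then show ?thesis unfolding abs_less_iff by linarith
    qed
    then show ?thesis using that d(1) by blast
  qed
  define d where "d = min (d0 / 2) (min (min y (1 - y)) (1 / 4))"
  have d: "d > 0" "d < d0" "d \<le> y" "d \<le> 1 - y" "d \<le> 1 / 4" using d0(1) y unfolding d_def by linarith+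
  define p q where "p = (cos (pi * d))\<^sup>2" and "q = (cos (pi * (d / 2)))\<^sup>2"
  have cpos: "cos (pi * d) > 0" using d by (intro cos_gt_zero) (auto simp: field_simps)
  have "cos (pi * d) < cos (pi * (d / 2))" using d by (intro cos_monotone_0_pi) (auto simp: field_simps)
  then have pq: "0 < p" "p < q" using cpos by (auto simp: p_def q_def intro!: power_strict_mono)
  have kern: "cos (pi * (x - y)) ^ (2 * n) = ((cos (pi * (x - y)))\<^sup>2) ^ n" for x n by (simp add: power_mult)
  have far: "(cos (pi * (x - y)))\<^sup>2 \<le> p" if x: "x \<in> {0..1}" "\<bar>x - y\<bar> \<ge> d" for x
  proof -
    define v where "v = \<bar>x - y\<bar>"
    have v: "d \<le> v" "v \<le> 1 - d" using x d y by (auto simp: v_def abs_if)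
    have cv: "(cos (pi * (x - y)))\<^sup>2 = (cos (pi * v))\<^sup>2"
      unfolding v_def cos_pi_abs ..
    have "cos (pi * v) \<le> cos (pi * d)" using v d by (intro cos_monotone_0_pi_le) auto
    moreover have "cos (pi * (1 - d)) \<le> cos (pi * v)" using v d by (intro cos_monotone_0_pi_le) auto
    moreover have "cos (pi * (1 - d)) = - cos (pi * d)" by (simp add: right_diff_distrib cos_diff)
    ultimately have "\<bar>cos (pi * v)\<bar> \<le> \<bar>cos (pi * d)\<bar>" using cpos by (auto simp: abs_le_iff)
    then show ?thesis unfolding cv p_def by (simp add: abs_le_square_iff)
  qed
  have near: "q \<le> (cos (pi * (x - y)))\<^sup>2" if "\<bar>x - y\<bar> \<le> d / 2" for x
  proof -
    have "cos (pi * (d / 2)) \<le> cos (pi * \<bar>x - y\<bar>)" using that d by (intro cos_monotone_0_pi_le) auto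
    moreover have "cos (pi * (d / 2)) > 0" using d by (intro cos_gt_zero) (auto simp: field_simps)
    ultimately show ?thesis unfolding q_def cos_pi_abs by (intro power_mono) auto
  qed
  define I where "I = {y - d / 2..y + d / 2}"
  have I: "I \<subseteq> {0..1}" using d by (auto simp: I_def)
  have main: "r y / 2 * q ^ n * d \<le> B * p ^ n" for n
  proof -
    define s where "s = (\<lambda>x. (if x \<in> I then r y / 2 * q ^ n else 0) - B * p ^ n)"
    have le: "s x \<le> r x * cos (pi * (x - y)) ^ (2 * n)" if x: "x \<in> {0..1}" for x
    proof (cases "\<bar>x - y\<bar> \<ge> d")
      case True
      then have "x \<notin> I" using d by (auto simp: I_def abs_if split: if_splits)
      have "\<bar>r x * cos (pi * (x - y)) ^ (2 * n)\<bar> \<le> B * p ^ n"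
        unfolding kern abs_mult using far[OF x True] B(1)[OF x] B(2)
        by (intro mult_mono) (auto intro!: power_mono)
      then show ?thesis using \<open>x \<notin> I\<close> by (simp add: s_def abs_le_iff)
    next
      case False
      then have rx: "r x > r y / 2" using d0(2)[OF x] d by auto
      have k0: "cos (pi * (x - y)) ^ (2 * n) \<ge> 0" unfolding kern by simp
      show ?thesis
      proof (cases "x \<in> I")
        case True
        then have "\<bar>x - y\<bar> \<le> d / 2" by (auto simp: I_def abs_if)
        then have "q ^ n \<le> cos (pi * (x - y)) ^ (2 * n)" unfolding kern using near pq by (intro power_mono) auto
        then have "r y / 2 * q ^ n \<le> r x * cos (pi * (x - y)) ^ (2 * n)"
          using rx ry pq by (intro mult_mono) auto
        moreover have "0 \<le> B * p ^ n" using B(2) pq by simp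
        ultimately show ?thesis using True unfolding s_def by simp
      next
        case False
        have "0 \<le> B * p ^ n" "0 \<le> r x * cos (pi * (x - y)) ^ (2 * n)"
          using rx ry k0 B(2) pq by simp_all
        then show ?thesis using False by (simp add: s_def)
      qed
    qed
    have "((\<lambda>x. r y / 2 * q ^ n) has_integral (r y / 2 * q ^ n * d)) I"
      using has_integral_const_real[of "r y / 2 * q ^ n" "y - d / 2" "y + d / 2"] d by (simp add: I_def mult_ac)
    then have "((\<lambda>x. if x \<in> I then r y / 2 * q ^ n else 0) has_integral (r y / 2 * q ^ n * d)) {0..1}"
      by (subst has_integral_restrict[OF I])
    moreover have "((\<lambda>x::real. B * p ^ n) has_integral (B * p ^ n)) {0..1}"
      using has_integral_const_real[of "B * p ^ n" 0 1] by simp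
    ultimately have "(s has_integral (r y / 2 * q ^ n * d - B * p ^ n)) {0..1}"
      unfolding s_def by (rule has_integral_diff)
    moreover have "((\<lambda>x. r x * cos (pi * (x - y)) ^ (2 * n)) has_integral 0) {0..1}"
    proof -
      have "(\<lambda>x. r x * cos (pi * (x - y)) ^ (2 * n)) integrable_on {0..1}"
        by (intro integrable_continuous_interval continuous_intros cont)
      from integrable_integral[OF this] show ?thesis unfolding orth .
    qed
    ultimately have "r y / 2 * q ^ n * d - B * p ^ n \<le> 0" using le by (rule has_integral_le)
    then show ?thesis by simp
  qed
  have "r y / 2 * d / B \<le> (p / q) ^ n" for n
    using main[of n] B(2) pq by (simp add: field_simps power_divide)
  moreover have "(\<lambda>n. (p / q) ^ n) \<longlonglongrightarrow> 0" using pq by (intro LIMSEQ_power_zero) auto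
  ultimately have "r y / 2 * d / B \<le> 0" by (meson LIMSEQ_le_const)
  moreover have "r y / 2 * d / B > 0" using ry d B by simp
  ultimately show False by simp
qed

lemma fourier_uniqueness:
  fixes h :: "real \<Rightarrow> complex"
  assumes cont: "continuous_on {0..1} h"
    and orth: "\<And>m. integral {0..1} (\<lambda>x. h x * ec m x) = 0"
    and y: "0 \<le> y" "y \<le> 1"
  shows "h y = 0"
proof -
  have zero: "integral {0..1} (\<lambda>x. h x * complex_of_real (cos (pi * (x - v)) ^ (2 * n))) = 0" for v n
  proof -
    have "((\<lambda>x. \<Sum>j\<le>2 * n. of_nat (2 * n choose j) * (1 / 2 ^ (2 * n)) * cnj (ec (int j - int n) v) * (h x * ec (int j - int n) x))
      has_integral (\<Sum>j\<le>2 * n. of_nat (2 * n choose j) * (1 / 2 ^ (2 * n)) * cnj (ec (int j - int n) v) * 0)) {0..1}"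
    proof (intro has_integral_sum has_integral_mult_right)
      fix j
      have "(\<lambda>x. h x * ec (int j - int n) x) integrable_on {0..1}"
        by (intro integrable_continuous_interval continuous_intros cont)
      from integrable_integral[OF this] show "((\<lambda>x. h x * ec (int j - int n) x) has_integral 0) {0..1}" unfolding orth .
    qed simp
    then have "((\<lambda>x. h x * complex_of_real (cos (pi * (x - v)) ^ (2 * n))) has_integral 0) {0..1}"
      unfolding cos_power_trig_poly by (simp add: sum_distrib_left mult_ac)
    then show ?thesis by (rule integral_unique)
  qed
  have cz: "Re (c * h v) \<le> 0" if v: "0 < v" "v < 1" for c v
  proof (rule fourier_uniqueness_real[OF _ _ v, where r = "\<lambda>x. Re (c * h x)"])
    show "continuous_on {0..1} (\<lambda>x. Re (c * h x))" by (intro continuous_intros cont)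
    fix n w
    have "(\<lambda>x. h x * complex_of_real (cos (pi * (x - w)) ^ (2 * n))) integrable_on {0..1}"
      by (intro integrable_continuous_interval continuous_intros cont)
    from integrable_integral[OF this]
    have "((\<lambda>x. h x * complex_of_real (cos (pi * (x - w)) ^ (2 * n))) has_integral 0) {0..1}"
      unfolding zero .
    from has_integral_linear[OF has_integral_mult_right[OF this, of c] bounded_linear_Re]
    have "((\<lambda>x. Re (c * h x) * cos (pi * (x - w)) ^ (2 * n)) has_integral 0) {0..1}"
      by (simp add: o_def mult.assoc[symmetric] del: of_real_power)
    then show "integral {0..1} (\<lambda>x. Re (c * h x) * cos (pi * (x - w)) ^ (2 * n)) = 0" by (rule integral_unique)
  qed
  have inner: "h v = 0" if v: "0 < v" "v < 1" for v
  proof -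
    have "Re (cnj (h v) * h v) \<le> 0" by (rule cz[OF v])
    then have "sqmod (h v) \<le> 0" unfolding cmod_power2 by (simp add: power2_eq_square)
    then show ?thesis by simp
  qed
  have "h constant_on closure {0<..<1::real}"
  proof (rule constant_on_closureI)
    show "h constant_on {0<..<1}" unfolding constant_on_def using inner by auto
  qed (use cont in simp)
  then obtain c where "\<forall>x\<in>{0..1}. h x = c" unfolding constant_on_def by auto
  then have "h y = h (1/2)" using y by auto
  then show ?thesis using inner[of "1/2"] by simp
qed

lemma gaussian_fourier:
  fixes m :: int
  assumes s: "s > 0"
  shows "integrable lborel (\<lambda>x. of_real (exp (- pi * s * x\<^sup>2)) * ec m x)"
    and "(LINT x|lborel. of_real (exp (- pi * s * x\<^sup>2)) * ec m x) = of_real (exp (- pi * (of_int m)\<^sup>2 / s) / sqrt s)"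
proof -
  define c where "c = sqrt (2 * pi * s)"
  have c: "c > 0" "c\<^sup>2 = 2 * pi * s" using s by (simp_all add: c_def)
  define t where "t = 2 * pi * of_int m / c"
  define f where "f = (\<lambda>x. std_normal_density x *\<^sub>R iexp (t * x))"
  have "integrable lborel (\<lambda>x. std_normal_density x)" by simp
  then have intf: "integrable lborel f" unfolding f_def
    by (rule Bochner_Integration.integrable_bound) (auto simp: norm_mult)
  have fv: "f (0 + c * x) = of_real (1 / sqrt (2 * pi)) * (of_real (exp (- pi * s * x\<^sup>2)) * ec m x)" for x
  proof -
    have "std_normal_density (c * x) = 1 / sqrt (2 * pi) * exp (- pi * s * x\<^sup>2)"
      unfolding std_normal_density_def power_mult_distrib c(2) by simp
    moreover have "iexp (t * (c * x)) = ec m x"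
      using c(1) by (simp add: t_def ec_def cis_conv_exp mult_ac)
    ultimately show ?thesis by (simp add: f_def scaleR_conv_of_real)
  qed
  have "integrable lborel (\<lambda>x. f (0 + c * x))" using intf c(1) by (intro lborel_integrable_real_affine) auto
  then have "integrable lborel (\<lambda>x. of_real (sqrt (2 * pi)) * f (0 + c * x))" by simp
  then show "integrable lborel (\<lambda>x. of_real (exp (- pi * s * x\<^sup>2)) * ec m x)"
    unfolding fv by (simp add: mult.assoc[symmetric])
  have "complex_of_real (exp (- (t\<^sup>2) / 2)) = (LINT x|std_normal_distribution. iexp (t * x))"
    using fun_cong[OF char_std_normal_distribution, of t] by (simp add: char_def)
  also have "\<dots> = (LINT x|lborel. f x)"
    unfolding f_def by (subst integral_density) (auto simp: normal_density_nonneg)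
  also have "\<dots> = \<bar>c\<bar> *\<^sub>R (LINT x|lborel. f (0 + c * x))"
    by (rule lborel_integral_real_affine) (use c in simp)
  also have "\<dots> = of_real (c / sqrt (2 * pi)) * (LINT x|lborel. of_real (exp (- pi * s * x\<^sup>2)) * ec m x)"
    unfolding fv using c(1) by (simp add: scaleR_conv_of_real)
  also have "c / sqrt (2 * pi) = sqrt s" by (simp add: c_def real_sqrt_mult)
  finally have "complex_of_real (exp (- (t\<^sup>2) / 2)) = of_real (sqrt s) * (LINT x|lborel. of_real (exp (- pi * s * x\<^sup>2)) * ec m x)" .
  moreover have "- (t\<^sup>2) / 2 = - pi * (of_int m)\<^sup>2 / s"
    unfolding t_def power_divide power_mult_distrib c(2) using s by (simp add: field_simps power2_eq_square)
  ultimately have "complex_of_real (exp (- pi * (of_int m)\<^sup>2 / s)) = of_real (sqrt s) * (LINT x|lborel. of_real (exp (- pi * s * x\<^sup>2)) * ec m x)"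
    by simp
  then show "(LINT x|lborel. of_real (exp (- pi * s * x\<^sup>2)) * ec m x) = of_real (exp (- pi * (of_int m)\<^sup>2 / s) / sqrt s)"
    using s by (simp add: field_simps)
qed

text \<open>The integrals over the translates of the unit interval add up to an integral over the real line.\<close>

lemma periodised_gaussian_coefficient:
  fixes m :: int
  assumes s: "s > 0"
  shows "integral {0..1} (\<lambda>x. of_real (\<Sum>\<^sub>\<infinity>l::int. exp (- pi * s * (of_int l - x)\<^sup>2)) * ec m x)
    = of_real (exp (- pi * (of_int m)\<^sup>2 / s) / sqrt s)"
    and "continuous_on {0..1} (\<lambda>x. of_real (\<Sum>\<^sub>\<infinity>l::int. exp (- pi * s * (of_int l - x)\<^sup>2)) :: complex)"
proof -
  define F where "F = (\<lambda>x. complex_of_real (exp (- pi * s * x\<^sup>2)) * ec m x)"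
  define u where "u = (\<lambda>(l::int) x. complex_of_real (exp (- pi * s * (of_int l - x)\<^sup>2)) * ec m x)"
  define u0 where "u0 = (\<lambda>(l::int) x. complex_of_real (exp (- pi * s * (of_int l - x)\<^sup>2)))"
  define M where "M = (\<lambda>l::int. exp (pi * s) * exp (- (pi * s / 2) * (of_int l - 0)\<^sup>2))"
  have ps: "pi * s > 0" "pi * s / 2 > 0" using s by simp_all
  have Mle: "exp (- pi * s * (of_int l - x)\<^sup>2) \<le> M l" if x: "x \<in> {0..1}" for l x
  proof -
    have "(of_int l - x)\<^sup>2 - ((of_int l)\<^sup>2 / 2 - x\<^sup>2) = (of_int l - 2 * x)\<^sup>2 / 2"
      by (simp add: power2_eq_square field_simps)
    then have "(of_int l)\<^sup>2 / 2 - x\<^sup>2 \<le> (of_int l - x)\<^sup>2"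
      using zero_le_power2[of "of_int l - 2 * x"] by linarith
    moreover have "x\<^sup>2 \<le> 1" using x by (simp add: power_le_one)
    ultimately have "(of_int l)\<^sup>2 / 2 - 1 \<le> (of_int l - x)\<^sup>2" by simp
    then have "pi * s * ((of_int l)\<^sup>2 / 2 - 1) \<le> pi * s * (of_int l - x)\<^sup>2" using ps by (intro mult_left_mono) auto
    then show ?thesis unfolding M_def exp_add[symmetric] exp_le_cancel_iff by (simp add: algebra_simps)
  qed
  have Msum: "M summable_on UNIV"
    unfolding M_def by (intro summable_on_cmult_right gauss_int_summable ps)
  have c: "continuous_on {0..1} (u l)" "continuous_on {0..1} (u0 l)" for l unfolding u_def u0_def by (intro continuous_intros)+
  have b: "norm (u l x) \<le> M l" "norm (u0 l x) \<le> M l" if "x \<in> {0..1}" for l x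
    using Mle[OF that] by (simp_all add: u_def u0_def norm_mult)
  have inf0: "(\<Sum>\<^sub>\<infinity>l. u0 l x) = of_real (\<Sum>\<^sub>\<infinity>l::int. exp (- pi * s * (of_int l - x)\<^sup>2))" for x
  proof -
    have "(\<lambda>l::int. exp (- pi * s * (of_int l - x)\<^sup>2)) summable_on UNIV"
      using gauss_int_summable[of "pi * s" x] s by simp
    from infsumI[OF has_sum_of_real[OF has_sum_infsum[OF this]]] show ?thesis by (simp add: u0_def)
  qed
  have inf: "(\<Sum>\<^sub>\<infinity>l. u l x) = of_real (\<Sum>\<^sub>\<infinity>l::int. exp (- pi * s * (of_int l - x)\<^sup>2)) * ec m x" for x
    unfolding inf0[symmetric] u_def u0_def by (rule infsum_cmult_left')
  show "continuous_on {0..1} (\<lambda>x. of_real (\<Sum>\<^sub>\<infinity>l::int. exp (- pi * s * (of_int l - x)\<^sup>2)) :: complex)"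
    using termwise_integration(1)[of u0 M, OF c(2) b(2) Msum] by (simp only: inf0)
  have hs: "((\<lambda>l. integral {0..1} (u l)) has_sum integral {0..1} (\<lambda>x. \<Sum>\<^sub>\<infinity>l. u l x)) UNIV"
    by (rule termwise_integration(2)[of u M, OF c(1) b(1) Msum])
  have contF: "continuous_on A F" for A unfolding F_def by (intro continuous_intros)
  have Fint: "F integrable_on {a..b}" for a b by (intro integrable_continuous_interval contF)
  have shift: "integral {0..1} (u l) = integral {- of_int l..1 - of_int l} F" for l
  proof -
    have "u l = F \<circ> (+) (- of_int l)"
    proof
      fix x
      have "ec m (- of_int l + x) = ec m x" using ec_of_int[of m "- l"] ec_add[of m "- of_int l" x] by simp
      then show "u l x = (F \<circ> (+) (- of_int l)) x" by (simp add: u_def F_def power2_commute)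
    qed
    then show ?thesis using integral_shift_Icc_real[of 0 1 F "- of_int l"] by simp
  qed
  have fin: "(\<Sum>l\<in>{- int n..int n}. integral {0..1} (u l)) = integral {- real n..real n + 1} F" for n
  proof (induction n)
    case 0
    show ?case by (simp add: shift)
  next
    case (Suc n)
    have e1: "- real n - 1 = - 1 - real n" by simp
    have "{- int (Suc n)..int (Suc n)} = insert (- int (Suc n)) (insert (int (Suc n)) {- int n..int n})" by auto
    then have "(\<Sum>l\<in>{- int (Suc n)..int (Suc n)}. integral {0..1} (u l)) =
      integral {real n + 1..real n + 2} F + (integral {- real n - 1..- real n} F + integral {- real n..real n + 1} F)"
      using Suc unfolding e1 by (simp add: shift add_ac)
    also have "integral {- real n - 1..- real n} F + integral {- real n..real n + 1} F = integral {- real n - 1..real n + 1} F"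
      by (rule Henstock_Kurzweil_Integration.integral_combine) (auto intro: Fint)
    also have "integral {real n + 1..real n + 2} F + integral {- real n - 1..real n + 1} F = integral {- real n - 1..real n + 2} F"
      by (subst add.commute, rule Henstock_Kurzweil_Integration.integral_combine) (auto intro: Fint)
    finally show ?case unfolding e1 by (simp add: add_ac)
  qed
  have lim1: "(\<lambda>n. \<Sum>l\<in>{- int n..int n}. integral {0..1} (u l)) \<longlonglongrightarrow> integral {0..1} (\<lambda>x. \<Sum>\<^sub>\<infinity>l. u l x)"
  proof -
    have "filterlim (\<lambda>n. {- int n..int n}) (finite_subsets_at_top UNIV) sequentially"
      unfolding filterlim_finite_subsets_at_top
    proof (intro allI impI)
      fix X :: "int set" assume X: "finite X \<and> X \<subseteq> UNIV"
      then have "finite ((\<lambda>l. nat \<bar>l\<bar>) ` X)" by simp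
      then obtain N where N: "\<And>l. l \<in> X \<Longrightarrow> nat \<bar>l\<bar> \<le> N"
        using finite_nat_set_iff_bounded_le by (metis imageI)
      show "\<forall>\<^sub>F n in sequentially. finite {- int n..int n} \<and> X \<subseteq> {- int n..int n} \<and> {- int n..int n} \<subseteq> UNIV"
        using eventually_ge_at_top[of N] by eventually_elim (use N in \<open>force simp: abs_le_iff\<close>)
    qed
    then show ?thesis using hs unfolding has_sum_def by (rule filterlim_compose[rotated])
  qed
  have lim2: "(\<lambda>n. integral {- real n..real n + 1} F) \<longlonglongrightarrow> (LINT x|lborel. F x)"
  proof -
    have intF: "integrable lborel F" unfolding F_def by (rule gaussian_fourier(1)[OF s])
    have eq: "integral {- real n..real n + 1} F = (LINT x|lborel. indicator {- real n..real n + 1} x *\<^sub>R F x)" for n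
    proof -
      have "set_integrable lborel {- real n..real n + 1} F"
        unfolding set_integrable_def using intF by (intro integrable_mult_indicator) auto
      from set_borel_integral_eq_integral(2)[OF this] show ?thesis by (simp add: set_lebesgue_integral_def)
    qed
    have "(\<lambda>n. LINT x|lborel. indicator {- real n..real n + 1} x *\<^sub>R F x) \<longlonglongrightarrow> (LINT x|lborel. F x)"
    proof (rule integral_dominated_convergence[where w = "\<lambda>x. norm (F x)"])
      show "integrable lborel (\<lambda>x. norm (F x))" using intF by simp
      show "F \<in> borel_measurable lborel" using intF by simp
      show "(\<lambda>x. indicator {- real n..real n + 1} x *\<^sub>R F x) \<in> borel_measurable lborel" for n using intF by simp
      show "AE x in lborel. norm (indicator {- real n..real n + 1} x *\<^sub>R F x) \<le> norm (F x)" for n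
        by (auto simp: indicator_def)
      show "AE x in lborel. (\<lambda>n. indicator {- real n..real n + 1} x *\<^sub>R F x) \<longlonglongrightarrow> F x"
      proof (rule AE_I2)
        fix x :: real
        obtain N where N: "\<bar>x\<bar> \<le> real N" using real_arch_simple by blast
        have "\<forall>\<^sub>F n in sequentially. indicator {- real n..real n + 1} x *\<^sub>R F x = F x"
          using eventually_ge_at_top[of N]
        proof eventually_elim
          case (elim n)
          then have "real N \<le> real n" by simp
          then have "x \<in> {- real n..real n + 1}" using N by auto
          then show ?case by simp
        qed
        then show "(\<lambda>n. indicator {- real n..real n + 1} x *\<^sub>R F x) \<longlonglongrightarrow> F x" by (rule tendsto_eventually)
      qed
    qed
    then show ?thesis unfolding eq .
  qed
  have "integral {0..1} (\<lambda>x. \<Sum>\<^sub>\<infinity>l. u l x) = (LINT x|lborel. F x)"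
    using LIMSEQ_unique[OF lim1] lim2 unfolding fin by blast
  then show "integral {0..1} (\<lambda>x. of_real (\<Sum>\<^sub>\<infinity>l::int. exp (- pi * s * (of_int l - x)\<^sup>2)) * ec m x)
    = of_real (exp (- pi * (of_int m)\<^sup>2 / s) / sqrt s)"
    unfolding inf F_def gaussian_fourier(2)[OF s] .
qed

text \<open>Both sides are continuous and have the same Fourier coefficients.\<close>

lemma poisson_1d_unit_interval:
  assumes t: "t > 0" and x: "0 \<le> x" "x \<le> 1"
  shows "(\<Sum>\<^sub>\<infinity>n::int. of_real (exp (- pi * t * (of_int n)\<^sup>2)) * ec n x)
    = complex_of_real (1 / sqrt t * (\<Sum>\<^sub>\<infinity>l::int. exp (- pi / t * (of_int l - x)\<^sup>2)))"
proof -
  define s where "s = 1 / t"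
  have s: "s > 0" using t by (simp add: s_def)
  define f where "f = (\<lambda>x. complex_of_real (\<Sum>\<^sub>\<infinity>l::int. exp (- pi * s * (of_int l - x)\<^sup>2)))"
  define a where "a = (\<lambda>n::int. exp (- pi * t * (of_int n)\<^sup>2))"
  define g where "g = (\<lambda>x. \<Sum>\<^sub>\<infinity>n. complex_of_real (a n) * ec n x)"
  have a_sum: "a summable_on UNIV"
    using gauss_int_summable[of "pi * t" 0] t by (simp add: a_def)
  have gm: "integral {0..1} (\<lambda>x. g x * ec m x) = of_real (a m)" "continuous_on {0..1} g" for m
  proof -
    have c: "continuous_on {0..1} (\<lambda>x. complex_of_real (a n) * ec n x * ec m x)"
      "continuous_on {0..1} (\<lambda>x. complex_of_real (a n) * ec n x)" for n by (intro continuous_intros)+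
    have b: "norm (complex_of_real (a n) * ec n x * ec m x) \<le> a n" "norm (complex_of_real (a n) * ec n x) \<le> a n" for n x
      by (simp_all add: norm_mult a_def)
    show "continuous_on {0..1} g" unfolding g_def using termwise_integration(1)[OF c(2) b(2) a_sum] .
    have "((\<lambda>n. integral {0..1} (\<lambda>x. complex_of_real (a n) * ec n x * ec m x)) has_sum
      integral {0..1} (\<lambda>x. \<Sum>\<^sub>\<infinity>n. complex_of_real (a n) * ec n x * ec m x)) UNIV"
      using termwise_integration(2)[OF c(1) b(1) a_sum] .
    moreover have "(\<Sum>\<^sub>\<infinity>n. complex_of_real (a n) * ec n x * ec m x) = g x * ec m x" for x
      unfolding g_def by (rule infsum_cmult_left')
    moreover have "integral {0..1} (\<lambda>x. complex_of_real (a n) * ec n x * ec m x) = (if n = - m then of_real (a m) else 0)" for n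
    proof (cases "n = - m")
      case True
      then show ?thesis by (simp add: mult.assoc ec_mult integral_ec a_def)
    next
      case False
      then have "n + m \<noteq> 0" by simp
      then show ?thesis using False by (simp add: mult.assoc ec_mult integral_ec)
    qed
    moreover have "((\<lambda>n. if n = - m then complex_of_real (a m) else 0) has_sum of_real (a m)) UNIV"
      using has_sum_finite_neutralI[of "{- m}" UNIV "\<lambda>n. if n = - m then complex_of_real (a m) else 0" "complex_of_real (a m)"] by simp
    ultimately show "integral {0..1} (\<lambda>x. g x * ec m x) = of_real (a m)" using has_sum_unique by auto
  qed
  have fc: "continuous_on {0..1} f" unfolding f_def by (rule periodised_gaussian_coefficient(2)[OF s])
  have fm: "integral {0..1} (\<lambda>x. f x * ec m x) = of_real (a m * sqrt t)" for m
    using periodised_gaussian_coefficient(1)[OF s, of m] by (simp add: f_def a_def s_def real_sqrt_divide mult_ac)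
  define h where "h = (\<lambda>x. f x - of_real (sqrt t) * g x)"
  have "h x = 0"
  proof (rule fourier_uniqueness[OF _ _ x])
    show hc: "continuous_on {0..1} h" unfolding h_def by (intro continuous_intros fc gm(2))
    fix m
    have "((\<lambda>x. f x * ec m x - of_real (sqrt t) * (g x * ec m x)) has_integral (of_real (a m * sqrt t) - of_real (sqrt t) * of_real (a m))) {0..1}"
    proof (intro has_integral_diff has_integral_mult_right)
      have "(\<lambda>x. f x * ec m x) integrable_on {0..1}" "(\<lambda>x. g x * ec m x) integrable_on {0..1}"
        by (intro integrable_continuous_interval continuous_intros fc gm(2))+
      from this[THEN integrable_integral]
      show "((\<lambda>x. f x * ec m x) has_integral of_real (a m * sqrt t)) {0..1}"
        "((\<lambda>x. g x * ec m x) has_integral of_real (a m)) {0..1}"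
        unfolding fm gm(1) .
    qed
    then show "integral {0..1} (\<lambda>x. h x * ec m x) = 0"
      by (auto dest!: integral_unique simp: h_def algebra_simps)
  qed
  then have "g x = of_real (1 / sqrt t) * f x" using t by (simp add: h_def field_simps)
  then show ?thesis by (simp add: g_def f_def a_def s_def)
qed

lemma infsum_int_shift:
  fixes f :: "int \<Rightarrow> 'a :: {topological_comm_monoid_add, t2_space}"
  shows "(\<Sum>\<^sub>\<infinity>l. f (l + k)) = (\<Sum>\<^sub>\<infinity>l. f l)"
  by (rule infsum_reindex_bij_witness[of _ "\<lambda>l. l - k" "\<lambda>l. l + k"]) auto

lemma poisson_1d:
  assumes t: "t > 0"
  shows "(\<Sum>\<^sub>\<infinity>n::int. of_real (exp (- pi * t * (of_int n)\<^sup>2)) * ec n x)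
    = complex_of_real (1 / sqrt t * (\<Sum>\<^sub>\<infinity>l::int. exp (- pi / t * (of_int l - x)\<^sup>2)))"
proof -
  define y where "y = frac x"
  have x: "x = y + of_int \<lfloor>x\<rfloor>" by (simp add: y_def frac_def)
  have "ec n x = ec n y" for n using ec_add[of n y "of_int \<lfloor>x\<rfloor>"] x by simp
  moreover have "(\<Sum>\<^sub>\<infinity>l::int. exp (- pi / t * (of_int l - x)\<^sup>2)) = (\<Sum>\<^sub>\<infinity>l::int. exp (- pi / t * (of_int l - y)\<^sup>2))"
    using infsum_int_shift[of "\<lambda>l. exp (- pi / t * (of_int l - x)\<^sup>2)" "\<lfloor>x\<rfloor>"] by (simp add: y_def frac_def algebra_simps)
  ultimately show ?thesis using poisson_1d_unit_interval[OF t, of y] by (simp add: y_def less_imp_le[OF frac_lt_1])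
qed

lemma has_sum_finite_sum:
  fixes f :: "'j \<Rightarrow> 'a \<Rightarrow> 'b :: topological_comm_monoid_add"
  assumes "\<And>j. j \<in> J \<Longrightarrow> (f j has_sum S j) A"
  shows "((\<lambda>a. \<Sum>j\<in>J. f j a) has_sum (\<Sum>j\<in>J. S j)) A"
  using assms by (induction J rule: infinite_finite_induct) (auto intro: has_sum_add)

lemma infsum_gauss_product:
  fixes f g :: "int \<Rightarrow> complex"
  assumes f: "\<And>A. finite A \<Longrightarrow> (\<Sum>l\<in>A. norm (f l)) \<le> B" and g: "\<And>A. finite A \<Longrightarrow> (\<Sum>l\<in>A. norm (g l)) \<le> C"
  shows "(\<Sum>\<^sub>\<infinity>m. f (gre m) * g (gim m)) = (\<Sum>\<^sub>\<infinity>l. f l) * (\<Sum>\<^sub>\<infinity>l. g l)"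
proof -
  have "(\<lambda>p. norm (case p of (l, k) \<Rightarrow> f l * g k)) summable_on (UNIV \<times> UNIV)"
  proof (rule nonneg_bdd_above_summable_on)
    show "bdd_above (sum (\<lambda>p. norm (case p of (l, k) \<Rightarrow> f l * g k)) ` {F. F \<subseteq> UNIV \<times> UNIV \<and> finite F})"
    proof (rule bdd_aboveI2)
      fix F :: "(int \<times> int) set" assume "F \<in> {F. F \<subseteq> UNIV \<times> UNIV \<and> finite F}"
      then have "(\<Sum>(l, k)\<in>F. norm (f l) * norm (g k)) \<le> B * C" using f g by (intro sum_gauss_box) auto
      then show "(\<Sum>p\<in>F. norm (case p of (l, k) \<Rightarrow> f l * g k)) \<le> B * C"
        by (simp add: case_prod_beta norm_mult)
    qed
  qed auto
  then have "(\<lambda>p. case p of (l, k) \<Rightarrow> f l * g k) summable_on (UNIV \<times> UNIV)"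
    by (rule Infinite_Sum.abs_summable_summable)
  from infsum_Sigma'_banach[OF this]
  have "(\<Sum>\<^sub>\<infinity>(l, k)\<in>UNIV \<times> UNIV. f l * g k) = (\<Sum>\<^sub>\<infinity>l. \<Sum>\<^sub>\<infinity>k. f l * g k)" by simp
  also have "\<dots> = (\<Sum>\<^sub>\<infinity>l. f l) * (\<Sum>\<^sub>\<infinity>l. g l)"
    by (simp add: infsum_cmult_right' infsum_cmult_left')
  also have "(\<Sum>\<^sub>\<infinity>(l, k)\<in>UNIV \<times> UNIV. f l * g k) = (\<Sum>\<^sub>\<infinity>m. f (gre m) * g (gim m))"
    by (rule infsum_reindex_bij_witness[of _ "\<lambda>m. (gre m, gim m)" "\<lambda>(l, k). Gauss_Int l k"]) auto
  finally show ?thesis .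
qed

lemma summable_gauss_norm:
  assumes "a > 0"
  shows "(\<lambda>m. exp (- a * rnorm m)) summable_on UNIV"
  using gaussian_summable[OF assms, of 0] by (simp add: cmod_complex_of_gauss_sq)

lemma poisson_2d:
  assumes t: "t > 0"
  shows "(\<Sum>\<^sub>\<infinity>m. of_real (exp (- pi * t * rnorm m)) * echar (cg m * w))
    = complex_of_real (1 / t * (\<Sum>\<^sub>\<infinity>k. exp (- (pi / t) * sqmod (cg k - w))))"
proof -
  define f where "f = (\<lambda>l. complex_of_real (exp (- pi * t * (of_int l)\<^sup>2)) * ec l (Re w))"
  define g where "g = (\<lambda>l. complex_of_real (exp (- pi * t * (of_int l)\<^sup>2)) * ec l (- Im w))"
  have pt: "pi * t > 0" "pi / t > 0" using t by simp_all
  have b: "(\<Sum>l\<in>A. norm (f l)) \<le> 4 * (1 + 1 / sqrt (pi * t))" "(\<Sum>l\<in>A. norm (g l)) \<le> 4 * (1 + 1 / sqrt (pi * t))"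
    if "finite A" for A
    using gauss_int_sum_le[OF pt(1) that, of 0] by (simp_all add: f_def g_def norm_mult)
  have "(\<Sum>\<^sub>\<infinity>m. of_real (exp (- pi * t * rnorm m)) * echar (cg m * w)) = (\<Sum>\<^sub>\<infinity>m. f (gre m) * g (gim m))"
  proof (rule infsum_cong)
    fix m
    have "complex_of_real (exp (- pi * t * rnorm m)) =
      of_real (exp (- pi * t * (of_int (gre m))\<^sup>2)) * of_real (exp (- pi * t * (of_int (gim m))\<^sup>2))"
      by (simp add: real_gauss_norm exp_add[symmetric] algebra_simps flip: of_real_mult)
    moreover have "echar (cg m * w) = ec (gre m) (Re w) * ec (gim m) (- Im w)"
      by (simp add: echar_def ec_def cis_mult algebra_simps)
    ultimately show "of_real (exp (- pi * t * rnorm m)) * echar (cg m * w) = f (gre m) * g (gim m)"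
      by (simp add: f_def g_def mult_ac)
  qed
  also have "\<dots> = (\<Sum>\<^sub>\<infinity>l. f l) * (\<Sum>\<^sub>\<infinity>l. g l)" by (rule infsum_gauss_product[OF b])
  also have "(\<Sum>\<^sub>\<infinity>l. f l) = of_real (1 / sqrt t * (\<Sum>\<^sub>\<infinity>l::int. exp (- pi / t * (of_int l - Re w)\<^sup>2)))"
    unfolding f_def by (rule poisson_1d[OF t])
  also have "(\<Sum>\<^sub>\<infinity>l. g l) = of_real (1 / sqrt t * (\<Sum>\<^sub>\<infinity>l::int. exp (- pi / t * (of_int l - (- Im w))\<^sup>2)))"
    unfolding g_def by (rule poisson_1d[OF t])
  also have "(\<Sum>\<^sub>\<infinity>l::int. exp (- pi / t * (of_int l - (- Im w))\<^sup>2)) = (\<Sum>\<^sub>\<infinity>l::int. exp (- pi / t * (of_int l - Im w)\<^sup>2))"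
    by (rule infsum_reindex_bij_witness[of _ uminus uminus]) (auto simp: power2_eq_square algebra_simps)
  also have "complex_of_real (1 / sqrt t * (\<Sum>\<^sub>\<infinity>l::int. exp (- pi / t * (of_int l - Re w)\<^sup>2))) *
      of_real (1 / sqrt t * (\<Sum>\<^sub>\<infinity>l::int. exp (- pi / t * (of_int l - Im w)\<^sup>2))) =
    of_real (1 / t) * ((\<Sum>\<^sub>\<infinity>l::int. of_real (exp (- pi / t * (of_int l - Re w)\<^sup>2))) * (\<Sum>\<^sub>\<infinity>l::int. of_real (exp (- pi / t * (of_int l - Im w)\<^sup>2))))"
  proof -
    have s: "(\<lambda>l::int. exp (- pi / t * (of_int l - x)\<^sup>2)) summable_on UNIV" for x
      using gauss_int_summable[OF pt(2), of x] by simp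
    have r: "complex_of_real (\<Sum>\<^sub>\<infinity>l::int. exp (- pi / t * (of_int l - x)\<^sup>2)) = (\<Sum>\<^sub>\<infinity>l::int. of_real (exp (- pi / t * (of_int l - x)\<^sup>2)))" for x
      by (rule infsumI[OF has_sum_of_real[OF has_sum_infsum[OF s]], symmetric])
    have "complex_of_real (1 / sqrt t * a) * of_real (1 / sqrt t * b) = of_real (1 / t) * (of_real a * of_real b)" for a b
    proof -
      have "(1 / sqrt t * a) * (1 / sqrt t * b) = 1 / t * (a * b)" using t by simp
      then show ?thesis by (simp only: of_real_mult[symmetric])
    qed
    then show ?thesis unfolding r[symmetric] .
  qed
  also have "(\<Sum>\<^sub>\<infinity>l::int. of_real (exp (- pi / t * (of_int l - Re w)\<^sup>2))) * (\<Sum>\<^sub>\<infinity>l::int. of_real (exp (- pi / t * (of_int l - Im w)\<^sup>2))) =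
    (\<Sum>\<^sub>\<infinity>m. complex_of_real (exp (- pi / t * (of_int (gre m) - Re w)\<^sup>2)) * of_real (exp (- pi / t * (of_int (gim m) - Im w)\<^sup>2)))"
  proof (rule infsum_gauss_product[symmetric])
    show "(\<Sum>l\<in>A. norm (complex_of_real (exp (- pi / t * (of_int l - Re w)\<^sup>2)))) \<le> 4 * (1 + 1 / sqrt (pi / t))" if "finite A" for A
      using gauss_int_sum_le[OF pt(2) that, of "Re w"] by simp
    show "(\<Sum>l\<in>A. norm (complex_of_real (exp (- pi / t * (of_int l - Im w)\<^sup>2)))) \<le> 4 * (1 + 1 / sqrt (pi / t))" if "finite A" for A
      using gauss_int_sum_le[OF pt(2) that, of "Im w"] by simp
  qed
  also have "\<dots> = (\<Sum>\<^sub>\<infinity>m. complex_of_real (exp (- (pi / t) * sqmod (cg m - w))))"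
    by (rule infsum_cong) (simp add: cmod_power2 exp_add[symmetric] distrib_left flip: of_real_mult)
  also have "\<dots> = of_real (\<Sum>\<^sub>\<infinity>k. exp (- (pi / t) * sqmod (cg k - w)))"
    by (rule infsumI[OF has_sum_of_real[OF has_sum_infsum[OF gaussian_summable[OF pt(2)]]]])
  finally show ?thesis by simp
qed

lemma sum_infsum_residues:
  fixes h :: "gauss_int \<Rightarrow> complex"
  assumes c: "c \<noteq> 0" and h: "(\<lambda>z. norm (h z)) summable_on UNIV"
  shows "(\<Sum>x\<in>gres c. \<Sum>\<^sub>\<infinity>k. h (x - c * k)) = (\<Sum>\<^sub>\<infinity>z. h z)"
proof -
  have bij: "bij_betw (\<lambda>(x, k). x - c * k) (gres c \<times> UNIV) UNIV"
  proof (rule bij_betwI')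
    fix a b :: "gauss_int \<times> gauss_int" assume ab: "a \<in> gres c \<times> UNIV" "b \<in> gres c \<times> UNIV"
    obtain x k y l where e: "a = (x, k)" "b = (y, l)" by (metis surj_pair)
    show "((case a of (x, k) \<Rightarrow> x - c * k) = (case b of (x, k) \<Rightarrow> x - c * k)) \<longleftrightarrow> a = b"
    proof
      assume "(case a of (x, k) \<Rightarrow> x - c * k) = (case b of (x, k) \<Rightarrow> x - c * k)"
      then have eq: "x - y = c * (k - l)" by (simp add: e algebra_simps)
      then have "c dvd x - y" by simp
      then have "x = y" using ab gres_inj[OF c] by (auto simp: e)
      then show "a = b" using eq c by (simp add: e)
    qed auto
  next
    fix z
    obtain k where k: "z - z mod c = c * k" using gauss_dvd_diff_mod[of c z] unfolding dvd_def by blast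
    show "\<exists>a\<in>gres c \<times> UNIV. z = (case a of (x, k) \<Rightarrow> x - c * k)"
      using k by (intro bexI[of _ "(z mod c, - k)"]) (auto simp: algebra_simps)
  qed auto
  have hs: "h summable_on UNIV" using h by (rule Infinite_Sum.abs_summable_summable)
  have s: "(\<lambda>p. case p of (x, k) \<Rightarrow> h (x - c * k)) summable_on (gres c \<times> UNIV)"
    using summable_on_reindex_bij_betw[OF bij, of h] hs by (simp add: case_prod_beta)
  have "(\<Sum>\<^sub>\<infinity>z. h z) = (\<Sum>\<^sub>\<infinity>p\<in>gres c \<times> UNIV. h (case p of (x, k) \<Rightarrow> x - c * k))"
    by (rule infsum_reindex_bij_betw[OF bij, symmetric])
  also have "\<dots> = (\<Sum>\<^sub>\<infinity>(x, k)\<in>gres c \<times> UNIV. h (x - c * k))" by (intro infsum_cong) auto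
  also have "\<dots> = (\<Sum>\<^sub>\<infinity>x\<in>gres c. \<Sum>\<^sub>\<infinity>k. h (x - c * k))"
    by (rule infsum_Sigma'_banach[OF s, symmetric])
  also have "\<dots> = (\<Sum>x\<in>gres c. \<Sum>\<^sub>\<infinity>k. h (x - c * k))" using c by simp
  finally show ?thesis by simp
qed

text \<open>A primitive character is, up to its Gauss sum, the finite Fourier transform of the conjugate character.\<close>

lemma chiE_expand:
  assumes e: "valid_exps P e"
  shows "chiE P e a = (\<Sum>x\<in>gres (\<Prod>P). chiE P (\<lambda>p. 4 - e p) x * achar (\<Prod>P) (a * x)) / gsum P (\<lambda>p. 4 - e p) 1"
proof -
  have v: "valid_exps P (\<lambda>p. 4 - e p)" by (rule valid_exps_cnj[OF e])
  have "cnj (chiE P (\<lambda>p. 4 - e p) a) = chiE P e a" using chiE_cnj[OF e, of a] by (metis complex_cnj_cnj)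
  then have "gsum P (\<lambda>p. 4 - e p) a = chiE P e a * gsum P (\<lambda>p. 4 - e p) 1" using gsum_twist[OF v, of a] by simp
  then show ?thesis using gsum_nonzero[OF v] by (simp add: gsum_def)
qed

text \<open>The functional equation behind the recursion: a smoothed character sum over all Gaussian
  integers turns into the dual sum with the conjugate character.\<close>

lemma poisson_char:
  assumes e: "valid_exps P e" and t: "t > 0"
  shows "(\<Sum>\<^sub>\<infinity>m. of_real (exp (- pi * t * rnorm m)) * chiE P e m)
    = (\<Sum>\<^sub>\<infinity>k. of_real (exp (- pi * rnorm k / (t * rnorm (\<Prod>P)))) * cnj (chiE P e k))
      / (of_real t * gsum P (\<lambda>p. 4 - e p) 1)"
proof -
  define c where "c = \<Prod>P"
  define e' where "e' = (\<lambda>p. 4 - e p)"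
  have P: "finite P" "P \<subseteq> PP" using e by (auto simp: valid_exps_def)
  have c: "c \<noteq> 0" using prod_PP_nonzero[OF P(2)] by (simp add: c_def)
  define N where "N = rnorm c"
  have N: "N > 0" using c by (simp add: N_def zero_less_iff_neq_zero)
  have pt: "pi * t > 0" "pi / t > 0" using t by simp_all
  have gs: "gsum P e' 1 \<noteq> 0" unfolding e'_def by (rule gsum_nonzero[OF valid_exps_cnj[OF e]])
  define w where "w = (\<lambda>m. complex_of_real (exp (- pi * t * rnorm m)))"
  have w_sum: "(\<lambda>m. norm (w m)) summable_on UNIV" using summable_gauss_norm[OF pt(1)] by (simp add: w_def)
  define h where "h = (\<lambda>z. chiE P e' z * of_real (exp (- pi * rnorm z / (t * N))))"
  have h_sum: "(\<lambda>z. norm (h z)) summable_on UNIV"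
  proof (rule Infinite_Sum.abs_summable_on_comparison_test')
    show "(\<lambda>z. exp (- (pi / (t * N)) * rnorm z)) summable_on UNIV"
      by (rule summable_gauss_norm) (use t N in simp)
    show "norm (h z) \<le> exp (- (pi / (t * N)) * rnorm z)" for z
      using chiE_norm_le[OF P(2), of e' z] by (simp add: h_def norm_mult mult_left_le_one_le)
  qed
  have "(\<Sum>\<^sub>\<infinity>m. w m * chiE P e m) = (\<Sum>\<^sub>\<infinity>m. (\<Sum>x\<in>gres c. chiE P e' x * (w m * echar (cg m * (cg x / cg c)))) * (1 / gsum P e' 1))"
  proof (rule infsum_cong)
    fix m
    define S where "S = (\<Sum>x\<in>gres c. chiE P e' x * echar (cg m * (cg x / cg c)))"
    have "chiE P e m = S / gsum P e' 1"
      using chiE_expand[OF e, of m] by (simp add: S_def e'_def c_def achar_def)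
    moreover have "(\<Sum>x\<in>gres c. chiE P e' x * (w m * echar (cg m * (cg x / cg c)))) = w m * S"
      unfolding S_def sum_distrib_left by (rule sum.cong[OF refl]) (simp only: mult_ac)
    ultimately show "w m * chiE P e m = (\<Sum>x\<in>gres c. chiE P e' x * (w m * echar (cg m * (cg x / cg c)))) * (1 / gsum P e' 1)"
      by simp
  qed
  also have "\<dots> = (\<Sum>\<^sub>\<infinity>m. \<Sum>x\<in>gres c. chiE P e' x * (w m * echar (cg m * (cg x / cg c)))) * (1 / gsum P e' 1)"
    by (rule infsum_cmult_left')
  also have "(\<Sum>\<^sub>\<infinity>m. \<Sum>x\<in>gres c. chiE P e' x * (w m * echar (cg m * (cg x / cg c)))) =
    (\<Sum>x\<in>gres c. \<Sum>\<^sub>\<infinity>m. chiE P e' x * (w m * echar (cg m * (cg x / cg c))))"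
  proof -
    define T where "T = (\<lambda>x m. chiE P e' x * (w m * echar (cg m * (cg x / cg c))))"
    have Ts: "T x summable_on UNIV" for x
    proof -
      have "(\<lambda>m. norm (w m * echar (cg m * (cg x / cg c)))) summable_on UNIV"
        using w_sum by (simp add: norm_mult)
      from Infinite_Sum.abs_summable_summable[OF this] show ?thesis
        unfolding T_def by (rule summable_on_cmult_right)
    qed
    have "((\<lambda>m. \<Sum>x\<in>gres c. T x m) has_sum (\<Sum>x\<in>gres c. infsum (T x) UNIV)) UNIV"
      by (rule has_sum_finite_sum) (rule has_sum_infsum[OF Ts])
    from infsumI[OF this] show ?thesis unfolding T_def .
  qed
  also have "\<dots> = (\<Sum>x\<in>gres c. of_real (1 / t) * (\<Sum>\<^sub>\<infinity>k. h (x - c * k)))"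
  proof (rule sum.cong[OF refl])
    fix x
    have "(\<Sum>\<^sub>\<infinity>m. chiE P e' x * (w m * echar (cg m * (cg x / cg c)))) =
      chiE P e' x * (\<Sum>\<^sub>\<infinity>m. w m * echar (cg m * (cg x / cg c)))"
      by (rule infsum_cmult_right')
    also have "\<dots> = chiE P e' x * of_real (1 / t * (\<Sum>\<^sub>\<infinity>k. exp (- (pi / t) * sqmod (cg k - cg x / cg c))))"
      unfolding w_def poisson_2d[OF t] ..
    also have "\<dots> = of_real (1 / t) * (chiE P e' x * (\<Sum>\<^sub>\<infinity>k. of_real (exp (- (pi / t) * sqmod (cg k - cg x / cg c)))))"
    proof -
      have "(\<Sum>\<^sub>\<infinity>k. complex_of_real (exp (- (pi / t) * sqmod (cg k - cg x / cg c)))) =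
        of_real (\<Sum>\<^sub>\<infinity>k. exp (- (pi / t) * sqmod (cg k - cg x / cg c)))"
        by (rule infsumI[OF has_sum_of_real[OF has_sum_infsum[OF gaussian_summable[OF pt(2)]]]])
      then show ?thesis by (simp only: of_real_mult mult_ac)
    qed
    also have "chiE P e' x * (\<Sum>\<^sub>\<infinity>k. of_real (exp (- (pi / t) * sqmod (cg k - cg x / cg c)))) =
      (\<Sum>\<^sub>\<infinity>k. chiE P e' x * of_real (exp (- (pi / t) * sqmod (cg k - cg x / cg c))))"
      by (rule infsum_cmult_right'[symmetric])
    also have "\<dots> = (\<Sum>\<^sub>\<infinity>k. h (x - c * k))"
    proof (rule infsum_cong)
      fix k
      have "chiE P e' x = chiE P e' (x - c * k)"
        using chiE_cong_mod[OF P, of x "x - c * k"] by (simp add: c_def)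
      moreover have "cg k - cg x / cg c = - cg (x - c * k) / cg c"
        using c by (simp add: field_simps)
      then have "sqmod (cg k - cg x / cg c) = rnorm (x - c * k) / N"
        by (simp only: norm_divide norm_minus_cancel power_divide cmod_complex_of_gauss_sq N_def)
      ultimately show "chiE P e' x * of_real (exp (- (pi / t) * sqmod (cg k - cg x / cg c))) = h (x - c * k)"
        by (simp add: h_def)
    qed
    finally show "(\<Sum>\<^sub>\<infinity>m. chiE P e' x * (w m * echar (cg m * (cg x / cg c)))) =
      of_real (1 / t) * (\<Sum>\<^sub>\<infinity>k. h (x - c * k))" .
  qed
  also have "\<dots> = of_real (1 / t) * (\<Sum>\<^sub>\<infinity>z. h z)"
    unfolding sum_distrib_left[symmetric] sum_infsum_residues[OF c h_sum] ..
  also have "(\<Sum>\<^sub>\<infinity>z. h z) = (\<Sum>\<^sub>\<infinity>k. of_real (exp (- pi * rnorm k / (t * N))) * cnj (chiE P e k))"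
    unfolding h_def e'_def chiE_cnj[OF e] by (simp add: mult.commute)
  finally show ?thesis using t by (simp add: w_def e'_def N_def c_def)
qed

section \<open>The large sieve for well-spaced points\<close>

lemma cauchy_schwarz_complex:
  "sqmod (\<Sum>i\<in>I. a i * b i) \<le> ell2 I a * ell2 I b"
proof -
  have "cmod (\<Sum>i\<in>I. a i * b i) \<le> (\<Sum>i\<in>I. cmod (a i) * cmod (b i))"
    by (rule order.trans[OF norm_sum]) (simp add: norm_mult)
  then have "sqmod (\<Sum>i\<in>I. a i * b i) \<le> (\<Sum>i\<in>I. cmod (a i) * cmod (b i))\<^sup>2"
    by (intro power_mono) auto
  also have "\<dots> \<le> ell2 I a * ell2 I b"
    by (rule Cauchy_Schwarz_ineq_sum)
  finally show ?thesis .
qed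

text \<open>A matrix and its transpose have the same operator norm.\<close>

lemma duality:
  fixes m :: "'i \<Rightarrow> 'j \<Rightarrow> complex"
  assumes L: "L \<ge> 0"
    and bound: "\<And>b. (\<Sum>i\<in>I. sqmod (\<Sum>j\<in>J. b j * m i j)) \<le> L * ell2 J b"
  shows "(\<Sum>j\<in>J. sqmod (\<Sum>i\<in>I. c i * m i j)) \<le> L * ell2 I c"
proof -
  define S where "S = (\<lambda>j. \<Sum>i\<in>I. c i * m i j)"
  define T where "T = ell2 J S"
  define n where "n = ell2 I c"
  have T0: "T \<ge> 0" "n \<ge> 0" unfolding T_def n_def by (auto intro: sum_nonneg)
  have "of_real T = (\<Sum>j\<in>J. S j * cnj (S j))"
    by (simp only: T_def of_real_sum complex_norm_square)
  also have "\<dots> = (\<Sum>i\<in>I. c i * (\<Sum>j\<in>J. cnj (S j) * m i j))"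
    unfolding S_def sum_distrib_right sum_distrib_left by (subst sum.swap) (simp add: mult_ac)
  finally have "T\<^sup>2 = sqmod (\<Sum>i\<in>I. c i * (\<Sum>j\<in>J. cnj (S j) * m i j))"
    by (metis norm_of_real power2_abs)
  also have "\<dots> \<le> n * (\<Sum>i\<in>I. sqmod (\<Sum>j\<in>J. cnj (S j) * m i j))"
    unfolding n_def by (rule cauchy_schwarz_complex)
  also have "\<dots> \<le> n * (L * (\<Sum>j\<in>J. sqmod (cnj (S j))))" by (intro mult_left_mono bound T0)
  also have "\<dots> = (L * n) * T" by (simp add: T_def)
  finally have "T * T \<le> (L * n) * T" by (simp add: power2_eq_square)
  then have "T \<le> L * n" using T0 L by (cases "T = 0") (auto simp: mult_le_cancel_right)
  then show ?thesis by (simp add: T_def S_def n_def)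
qed

text \<open>Rounding a separated set to a lattice of about half the spacing is injective and moves no point far,
  so the bound for lattices applies.\<close>

lemma spaced_gaussian_sum_le:
  fixes S :: "complex set"
  assumes S: "finite S" and d: "d > 0" and b: "b > 0"
    and sp: "\<And>z w. z \<in> S \<Longrightarrow> w \<in> S \<Longrightarrow> z \<noteq> w \<Longrightarrow> cmod (z - w) \<ge> d"
  shows "(\<Sum>z\<in>S. exp (- b * sqmod (z - v))) \<le> 64 * exp 4 * (1 + 8 / (b * d\<^sup>2))"
proof -
  \<comment> \<open>The cap on the mesh keeps the parameter \<open>a = b * r\<^sup>2 / 8\<close> of the rounded Gaussian at most \<open>1\<close>.\<close>
  define r where "r = min d (sqrt (8 / b))"
  have r: "r > 0" "r \<le> d" "r\<^sup>2 \<le> 8 / b" "1 / r\<^sup>2 \<le> 1 / d\<^sup>2 + b / 8"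
  proof -
    show "r > 0" "r \<le> d" using d b by (auto simp: r_def)
    have "r \<le> sqrt (8 / b)" by (simp add: r_def)
    then have "r\<^sup>2 \<le> (sqrt (8 / b))\<^sup>2" using \<open>r > 0\<close> by (intro power_mono) auto
    then show "r\<^sup>2 \<le> 8 / b" using b by simp
    show "1 / r\<^sup>2 \<le> 1 / d\<^sup>2 + b / 8"
    proof (cases "d \<le> sqrt (8 / b)")
      case True
      then have "r = d" by (simp add: r_def)
      then show ?thesis using b by simp
    next
      case False
      then have "r\<^sup>2 = 8 / b" using b by (simp add: r_def)
      then show ?thesis using b by simp
    qed
  qed
  define a where "a = b * r\<^sup>2 / 8"
  have a: "a > 0" "a \<le> 1" using r b by (auto simp: a_def field_simps)
  define h where "h = (\<lambda>z. Gauss_Int \<lfloor>2 * Re z / r\<rfloor> \<lfloor>2 * Im z / r\<rfloor>)"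
  define v' where "v' = Complex (2 * Re v / r) (2 * Im v / r)"
  have inj: "inj_on h S"
  proof (rule inj_onI, rule ccontr)
    fix z w assume zw: "z \<in> S" "w \<in> S" "h z = h w" "z \<noteq> w"
    have cell: "\<bar>x - y\<bar> < r / 2" if "\<lfloor>2 * x / r\<rfloor> = \<lfloor>2 * y / r\<rfloor>" for x y
    proof -
      have "\<bar>2 * x / r - 2 * y / r\<bar> < 1" using that by linarith
      then have "\<bar>(x - y) * (2 / r)\<bar> < 1" by (simp add: algebra_simps diff_divide_distrib)
      then have "\<bar>x - y\<bar> * (2 / r) < 1" using r(1) unfolding abs_mult by simp
      then show ?thesis using r(1) by (simp add: field_simps)
    qed
    have "\<bar>Re z - Re w\<bar> < r / 2" "\<bar>Im z - Im w\<bar> < r / 2"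
      using cell zw(3) by (auto simp: h_def)
    then have "cmod (z - w) < r" using cmod_le[of "z - w"] by simp
    then show False using sp[OF zw(1,2,4)] r(2) by simp
  qed
  have coord: "exp (- b * (x - y)\<^sup>2) \<le> exp 2 * exp (- a * (of_int \<lfloor>2 * x / r\<rfloor> - 2 * y / r)\<^sup>2)" for x y
  proof -
    define k p f where "k = \<lfloor>2 * x / r\<rfloor>" and "p = of_int k - 2 * y / r" and "f = 2 * x / r - of_int k"
    have f: "0 \<le> f" "f < 1" unfolding f_def k_def by linarith+
    have xy: "x - y = r / 2 * (p + f)" using r(1) by (simp add: p_def f_def field_simps)
    have "f\<^sup>2 \<le> 1" using f by (simp add: power_le_one)
    moreover have "(p + f)\<^sup>2 - (p\<^sup>2 / 2 - f\<^sup>2) = (p + 2 * f)\<^sup>2 / 2" by (simp add: power2_eq_square field_simps)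
    ultimately have "p\<^sup>2 / 2 - 1 \<le> (p + f)\<^sup>2" using zero_le_power2[of "p + 2 * f"] by linarith
    then have "2 * a * (p\<^sup>2 / 2 - 1) \<le> 2 * a * (p + f)\<^sup>2" using a by (intro mult_left_mono) auto
    moreover have "b * (x - y)\<^sup>2 = 2 * a * (p + f)\<^sup>2" by (simp add: xy a_def power_mult_distrib power_divide)
    ultimately have "a * p\<^sup>2 - 2 * a \<le> b * (x - y)\<^sup>2" by (simp add: algebra_simps)
    then have "- b * (x - y)\<^sup>2 \<le> 2 + - a * p\<^sup>2" using a by simp
    then show ?thesis unfolding exp_add[symmetric] exp_le_cancel_iff p_def k_def .
  qed
  have "(\<Sum>z\<in>S. exp (- b * sqmod (z - v))) \<le> (\<Sum>z\<in>S. exp 4 * exp (- a * sqmod (cg (h z) - v')))"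
  proof (rule sum_mono)
    fix z
    have "exp (- b * sqmod (z - v)) = exp (- b * (Re z - Re v)\<^sup>2) * exp (- b * (Im z - Im v)\<^sup>2)"
      by (simp add: cmod_power2 exp_add[symmetric] distrib_left)
    also have "\<dots> \<le> (exp 2 * exp (- a * (of_int \<lfloor>2 * Re z / r\<rfloor> - 2 * Re v / r)\<^sup>2)) * (exp 2 * exp (- a * (of_int \<lfloor>2 * Im z / r\<rfloor> - 2 * Im v / r)\<^sup>2))"
      by (intro mult_mono coord) auto
    also have "\<dots> = exp 4 * exp (- a * sqmod (cg (h z) - v'))"
      by (simp add: cmod_power2 h_def v'_def exp_add[symmetric] distrib_left)
    finally show "exp (- b * sqmod (z - v)) \<le> exp 4 * exp (- a * sqmod (cg (h z) - v'))" .
  qed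
  also have "\<dots> = exp 4 * (\<Sum>m\<in>h ` S. exp (- a * sqmod (cg m - v')))"
    using inj by (simp add: sum.reindex sum_distrib_left)
  also have "\<dots> \<le> exp 4 * (4 * (1 + 1 / sqrt a))\<^sup>2"
    using S by (intro mult_left_mono gaussian_sum_le[OF a(1)]) auto
  also have "(4 * (1 + 1 / sqrt a))\<^sup>2 \<le> (8 / sqrt a)\<^sup>2"
  proof (rule power_mono)
    have "1 \<le> 1 / sqrt a" using a by simp
    then show "4 * (1 + 1 / sqrt a) \<le> 8 / sqrt a" by simp
  qed (use a in simp)
  also have "(8 / sqrt a)\<^sup>2 = 64 * (1 / a)" using a by (simp add: power_divide)
  also have "1 / a \<le> 1 + 8 / (b * d\<^sup>2)"
  proof -
    have "1 / a = 8 / b * (1 / r\<^sup>2)" by (simp add: a_def)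
    also have "\<dots> \<le> 8 / b * (1 / d\<^sup>2 + b / 8)" using b by (intro mult_left_mono r) auto
    also have "\<dots> = 1 + 8 / (b * d\<^sup>2)" using b d by (simp add: field_simps)
    finally show ?thesis .
  qed
  finally show ?thesis by (simp add: mult.assoc mult.left_commute)
qed

lemma infsum_norm_square_expand:
  fixes f :: "'j \<Rightarrow> 'a \<Rightarrow> complex"
  assumes "finite J" and w: "\<And>a. w a \<ge> 0" "w summable_on UNIV" and f: "\<And>j a. cmod (f j a) \<le> 1"
  shows "(\<lambda>a. w a * sqmod (\<Sum>j\<in>J. b j * f j a)) summable_on UNIV"
    and "of_real (\<Sum>\<^sub>\<infinity>a. w a * sqmod (\<Sum>j\<in>J. b j * f j a)) =
      (\<Sum>i\<in>J. \<Sum>j\<in>J. b i * cnj (b j) * (\<Sum>\<^sub>\<infinity>a. of_real (w a) * (f i a * cnj (f j a))))"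
proof -
  have s: "(\<lambda>a. of_real (w a) * (f i a * cnj (f j a))) summable_on UNIV" for i j
  proof (rule Infinite_Sum.abs_summable_summable, rule Infinite_Sum.abs_summable_on_comparison_test')
    show "w summable_on UNIV" by fact
    show "norm (of_real (w a) * (f i a * cnj (f j a))) \<le> w a" for a
      using w(1)[of a] mult_mono[OF f[of i a] f[of j a]] by (simp add: norm_mult mult_left_le)
  qed
  have hs: "((\<lambda>a. \<Sum>i\<in>J. \<Sum>j\<in>J. b i * cnj (b j) * (of_real (w a) * (f i a * cnj (f j a)))) has_sum
    (\<Sum>i\<in>J. \<Sum>j\<in>J. b i * cnj (b j) * (\<Sum>\<^sub>\<infinity>a. of_real (w a) * (f i a * cnj (f j a))))) UNIV"
    by (intro has_sum_finite_sum has_sum_cmult_right has_sum_infsum s)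
  have eq: "(\<Sum>i\<in>J. \<Sum>j\<in>J. b i * cnj (b j) * (of_real (w a) * (f i a * cnj (f j a)))) = of_real (w a * sqmod (\<Sum>j\<in>J. b j * f j a))" for a
  proof -
    have "complex_of_real (sqmod (\<Sum>j\<in>J. b j * f j a)) = (\<Sum>i\<in>J. \<Sum>j\<in>J. (b i * f i a) * cnj (b j * f j a))"
      by (simp only: complex_norm_square cnj_sum sum_product)
    then show ?thesis by (simp add: sum_distrib_left mult_ac)
  qed
  have hs': "((\<lambda>a. complex_of_real (w a * sqmod (\<Sum>j\<in>J. b j * f j a))) has_sum
    (\<Sum>i\<in>J. \<Sum>j\<in>J. b i * cnj (b j) * (\<Sum>\<^sub>\<infinity>a. of_real (w a) * (f i a * cnj (f j a))))) UNIV"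
    using hs unfolding eq .
  show "(\<lambda>a. w a * sqmod (\<Sum>j\<in>J. b j * f j a)) summable_on UNIV"
    using has_sum_Re[OF hs'] by (simp only: Re_complex_of_real) (rule has_sum_imp_summable)
  then show "of_real (\<Sum>\<^sub>\<infinity>a. w a * sqmod (\<Sum>j\<in>J. b j * f j a)) =
      (\<Sum>i\<in>J. \<Sum>j\<in>J. b i * cnj (b j) * (\<Sum>\<^sub>\<infinity>a. of_real (w a) * (f i a * cnj (f j a))))"
    using has_sum_unique[OF hs' has_sum_of_real[OF has_sum_infsum]] by simp
qed

text \<open>Schur's test: \<open>|b\<^sub>i b\<^sub>j|\<close> is at most the mean of \<open>|b\<^sub>i|\<^sup>2\<close> and \<open>|b\<^sub>j|\<^sup>2\<close>, which leaves row and column sums.\<close>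

lemma schur_test:
  fixes F :: "'j \<Rightarrow> 'j \<Rightarrow> real"
  assumes F: "\<And>i j. F i j \<ge> 0" and K: "\<And>i j. cmod (K i j) \<le> F i j"
    and row: "\<And>i. i \<in> J \<Longrightarrow> (\<Sum>j\<in>J. F i j) \<le> B" and col: "\<And>j. j \<in> J \<Longrightarrow> (\<Sum>i\<in>J. F i j) \<le> B"
  shows "cmod (\<Sum>i\<in>J. \<Sum>j\<in>J. b i * cnj (b j) * K i j) \<le> B * ell2 J b"
proof -
  have "cmod (\<Sum>i\<in>J. \<Sum>j\<in>J. b i * cnj (b j) * K i j) \<le> (\<Sum>i\<in>J. \<Sum>j\<in>J. cmod (b i * cnj (b j) * K i j))"
    by (intro order.trans[OF norm_sum] sum_mono norm_sum)
  also have "\<dots> \<le> (\<Sum>i\<in>J. \<Sum>j\<in>J. sqmod (b i) / 2 * F i j + sqmod (b j) / 2 * F i j)"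
  proof (intro sum_mono)
    fix i j
    have "cmod (b i) * cmod (b j) \<le> sqmod (b i) / 2 + sqmod (b j) / 2"
      using sum_squares_bound[of "cmod (b i)" "cmod (b j)"] by simp
    then have "cmod (b i) * cmod (b j) * cmod (K i j) \<le> (sqmod (b i) / 2 + sqmod (b j) / 2) * F i j"
      using K by (intro mult_mono) auto
    then show "cmod (b i * cnj (b j) * K i j) \<le> sqmod (b i) / 2 * F i j + sqmod (b j) / 2 * F i j"
      by (simp add: norm_mult distrib_right)
  qed
  also have "\<dots> = (\<Sum>i\<in>J. sqmod (b i) / 2 * (\<Sum>j\<in>J. F i j)) + (\<Sum>j\<in>J. sqmod (b j) / 2 * (\<Sum>i\<in>J. F i j))"
    unfolding sum.distrib sum_distrib_left by (subst (2) sum.swap) simp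
  also have "\<dots> \<le> (\<Sum>i\<in>J. sqmod (b i) / 2 * B) + (\<Sum>j\<in>J. sqmod (b j) / 2 * B)"
    by (intro add_mono sum_mono mult_left_mono row col) auto
  also have "\<dots> = B * ell2 J b"
    by (simp add: sum_distrib_left sum_divide_distrib[symmetric] mult.commute flip: sum_distrib_right)
  finally show ?thesis .
qed

text \<open>After smoothing by a Gaussian and Poisson summation, the matrix of the quadratic form has nonnegative
  entries, and its row sums are Gaussian sums over separated points.\<close>

lemma dual_large_sieve:
  fixes \<theta> :: "'j \<Rightarrow> complex"
  assumes J: "finite J" and X: "X > 0" and d: "d > 0"
    and sp: "\<And>i j k. i \<in> J \<Longrightarrow> j \<in> J \<Longrightarrow> (i, 0) \<noteq> (j, k) \<Longrightarrow> cmod (\<theta> i - \<theta> j - cg k) \<ge> d"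
    and A: "finite A" "\<And>a. a \<in> A \<Longrightarrow> rnorm a \<le> X"
  shows "(\<Sum>a\<in>A. sqmod (\<Sum>j\<in>J. b j * echar (cg a * \<theta> j)))
    \<le> 64 * exp 4 * exp pi * (X + 3 / d\<^sup>2) * ell2 J b"
proof -
  define w where "w = (\<lambda>a. exp (- pi * (1 / X) * rnorm a))"
  have px: "pi * (1 / X) > 0" "pi / (1 / X) > 0" using X by simp_all
  have ws: "w summable_on UNIV" using summable_gauss_norm[OF px(1)] by (simp add: w_def)
  define f where "f = (\<lambda>j a. echar (cg a * \<theta> j))"
  define F where "F = (\<lambda>i j. X * (\<Sum>\<^sub>\<infinity>k. exp (- (pi / (1 / X)) * sqmod (cg k - (\<theta> i - \<theta> j)))))"
  define B where "B = 64 * exp 4 * (X + 3 / d\<^sup>2)"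
  have sl: "(\<lambda>a. w a * sqmod (\<Sum>j\<in>J. b j * f j a)) summable_on UNIV"
    and ex: "of_real (\<Sum>\<^sub>\<infinity>a. w a * sqmod (\<Sum>j\<in>J. b j * f j a)) =
      (\<Sum>i\<in>J. \<Sum>j\<in>J. b i * cnj (b j) * (\<Sum>\<^sub>\<infinity>a. of_real (w a) * (f i a * cnj (f j a))))"
    using infsum_norm_square_expand[OF J, of w f b] ws by (simp_all add: w_def f_def)
  have F0: "F i j \<ge> 0" for i j unfolding F_def using X by (intro mult_nonneg_nonneg infsum_nonneg) auto
  have K: "(\<Sum>\<^sub>\<infinity>a. of_real (w a) * (f i a * cnj (f j a))) = of_real (F i j)" for i j
  proof -
    have "f i a * cnj (f j a) = echar (cg a * (\<theta> i - \<theta> j))" for a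
      by (simp add: f_def cnj_echar echar_add[symmetric] right_diff_distrib)
    then show ?thesis using poisson_2d[of "1 / X" "\<theta> i - \<theta> j"] X by (simp add: w_def F_def)
  qed
  have gen: "(\<Sum>j\<in>J. X * (\<Sum>\<^sub>\<infinity>k. exp (- (pi / (1 / X)) * sqmod (cg k - (s * (v - \<theta> j)))))) \<le> B"
    if s: "s = 1 \<or> s = - 1" for s v
  proof -
    define g where "g = (\<lambda>j k. exp (- (pi * X) * sqmod (cg k - (s * (v - \<theta> j)))))"
    have gs: "g j summable_on UNIV" for j using gaussian_summable[OF px(2)] by (simp add: g_def)
    have "((\<lambda>k. \<Sum>j\<in>J. g j k) has_sum (\<Sum>j\<in>J. \<Sum>\<^sub>\<infinity>k. g j k)) UNIV"
      by (intro has_sum_finite_sum has_sum_infsum gs)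
    then have "(\<Sum>j\<in>J. \<Sum>\<^sub>\<infinity>k. g j k) \<le> 64 * exp 4 * (1 + 8 / (pi * X * d\<^sup>2))"
    proof (rule has_sum_le_finite_sums)
      fix Y :: "gauss_int set" assume Y: "finite Y" "Y \<subseteq> UNIV"
      define h where "h = (\<lambda>(j, k). \<theta> j + s * cg k)"
      have ss: "s * s = 1" "cmod s = 1" using s by auto
      have sep: "cmod (h p - h q) \<ge> d" if "p \<in> J \<times> Y" "q \<in> J \<times> Y" "p \<noteq> q" for p q
      proof -
        obtain j k j' k' where e: "p = (j, k)" "q = (j', k')" by (metis surj_pair)
        obtain k'' where k'': "s * cg k' - s * cg k = cg k''" "k'' = 0 \<longleftrightarrow> k = k'"
        proof (cases "s = 1")
          case True
          then show ?thesis using that[of "k' - k"] by auto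
        next
          case False
          then have "s = - 1" using s by simp
          then show ?thesis using that[of "k - k'"] by auto
        qed
        have "h p - h q = \<theta> j - \<theta> j' - cg k''"
          unfolding k''(1)[symmetric] by (simp add: h_def e)
        moreover have "(j, 0) \<noteq> (j', k'')" using that(3) k''(2) by (auto simp: e)
        ultimately show ?thesis using sp[of j j' k''] that by (simp add: e)
      qed
      have inj: "inj_on h (J \<times> Y)"
        by (rule inj_onI, rule ccontr) (use sep d in force)
      have "(\<Sum>k\<in>Y. \<Sum>j\<in>J. g j k) = (\<Sum>p\<in>J \<times> Y. exp (- (pi * X) * sqmod (h p - v)))"
      proof -
        have "g j k = exp (- (pi * X) * sqmod (h (j, k) - v))" for j k
        proof -
          have "h (j, k) - v = s * (cg k - s * (v - \<theta> j))"
            using ss(1) by (simp add: h_def algebra_simps mult.assoc[symmetric])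
          then show ?thesis by (simp add: g_def norm_mult ss(2))
        qed
        then show ?thesis by (subst sum.swap) (simp add: sum.cartesian_product)
      qed
      also have "\<dots> = (\<Sum>z\<in>h ` (J \<times> Y). exp (- (pi * X) * sqmod (z - v)))"
        using inj by (simp add: sum.reindex)
      also have "\<dots> \<le> 64 * exp 4 * (1 + 8 / (pi * X * d\<^sup>2))"
        by (rule spaced_gaussian_sum_le) (use J Y d X sep in auto)
      finally show "(\<Sum>k\<in>Y. \<Sum>j\<in>J. g j k) \<le> 64 * exp 4 * (1 + 8 / (pi * X * d\<^sup>2))" .
    qed
    then have "X * (\<Sum>j\<in>J. \<Sum>\<^sub>\<infinity>k. g j k) \<le> X * (64 * exp 4 * (1 + 8 / (pi * X * d\<^sup>2)))" using X by simp
    also have "\<dots> = 64 * exp 4 * (X + 8 / pi / d\<^sup>2)" using X d by (simp add: field_simps)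
    also have "\<dots> \<le> B"
    proof -
      have "8 / pi \<le> 3" using pi_gt3 by (simp add: field_simps)
      then have "8 / pi / d\<^sup>2 \<le> 3 / d\<^sup>2" by (rule divide_right_mono) simp
      then show ?thesis unfolding B_def by simp
    qed
    finally show ?thesis unfolding g_def by (simp add: sum_distrib_left)
  qed
  have row: "(\<Sum>j\<in>J. F i j) \<le> B" for i unfolding F_def using gen[of 1 "\<theta> i"] by simp
  have col: "(\<Sum>i\<in>J. F i j) \<le> B" for j unfolding F_def using gen[of "- 1" "\<theta> j"] by simp
  have main: "(\<Sum>\<^sub>\<infinity>a. w a * sqmod (\<Sum>j\<in>J. b j * f j a)) \<le> B * ell2 J b"
  proof -
    have "(\<Sum>\<^sub>\<infinity>a. w a * sqmod (\<Sum>j\<in>J. b j * f j a)) \<le> cmod (of_real (\<Sum>\<^sub>\<infinity>a. w a * sqmod (\<Sum>j\<in>J. b j * f j a)))" by simp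
    also have "\<dots> \<le> B * ell2 J b"
      unfolding ex K using F0 by (intro schur_test[of F] row col) auto
    finally show ?thesis .
  qed
  have "(\<Sum>a\<in>A. sqmod (\<Sum>j\<in>J. b j * f j a)) \<le> (\<Sum>a\<in>A. exp pi * (w a * sqmod (\<Sum>j\<in>J. b j * f j a)))"
  proof (rule sum_mono)
    fix a assume "a \<in> A"
    then have "rnorm a / X \<le> 1" using A(2) X by (simp add: field_simps)
    then have "pi * (rnorm a / X) \<le> pi * 1" by (intro mult_left_mono) auto
    then have "1 \<le> exp (pi + - pi * (1 / X) * rnorm a)" by simp
    then have "1 \<le> exp pi * w a" unfolding w_def exp_add .
    then have "1 * sqmod (\<Sum>j\<in>J. b j * f j a) \<le> (exp pi * w a) * sqmod (\<Sum>j\<in>J. b j * f j a)" by (intro mult_right_mono) auto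
    then show "sqmod (\<Sum>j\<in>J. b j * f j a) \<le> exp pi * (w a * sqmod (\<Sum>j\<in>J. b j * f j a))" by (simp add: mult.assoc)
  qed
  also have "\<dots> = exp pi * (\<Sum>a\<in>A. w a * sqmod (\<Sum>j\<in>J. b j * f j a))" by (simp add: sum_distrib_left)
  also have "\<dots> \<le> exp pi * (\<Sum>\<^sub>\<infinity>a. w a * sqmod (\<Sum>j\<in>J. b j * f j a))"
    by (intro mult_left_mono finite_sum_le_infsum sl A) (auto simp: w_def)
  also have "\<dots> \<le> exp pi * (B * ell2 J b)" by (intro mult_left_mono main) auto
  finally show ?thesis by (simp add: f_def B_def mult_ac)
qed

section \<open>The multiplicative large sieve\<close>

text \<open>The exponent function is \<open>0\<close> outside \<open>P\<close>, so different pairs are different characters.\<close>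

definition exps :: "nat \<Rightarrow> (gauss_int set \<times> (gauss_int \<Rightarrow> nat)) set" where
  "exps K = {(P, e). P \<in> psets K \<and> (\<forall>p\<in>P. e p \<in> {1, 2, 3}) \<and> (\<forall>p. p \<notin> P \<longrightarrow> e p = 0)}"

lemma exps_valid: "(P, e) \<in> exps K \<Longrightarrow> valid_exps P e"
  by (auto simp: exps_def valid_exps_def psets_def)

lemma finite_exps: "finite (exps K)"
proof -
  have "finite {e. (P, e) \<in> exps K}" for P
  proof (cases "P \<in> psets K")
    case True
    then have "finite P" by (simp add: psets_def)
    from finite_set_of_finite_funs[OF this, of "{1, 2, 3 :: nat}" 0]
    show ?thesis by (rule rev_finite_subset) (auto simp: exps_def)
  qed (simp add: exps_def)
  then have "finite (SIGMA P:psets K. {e. (P, e) \<in> exps K})" using finite_psets by (intro finite_SigmaI)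
  moreover have "exps K = (SIGMA P:psets K. {e. (P, e) \<in> exps K})" by (auto simp: exps_def)
  ultimately show ?thesis by simp
qed

definition C\<^sub>1 :: real where "C\<^sub>1 = 64 * exp 4 * exp pi"

lemma C1_pos: "C\<^sub>1 > 0" by (simp add: C\<^sub>1_def)

text \<open>The difference is a nonzero Gaussian integer divided by \<open>\<Prod>P * \<Prod>Q\<close>, which has
  absolute value at most \<open>K\<close>.\<close>

lemma farey_spacing:
  assumes P: "P \<in> psets K" "\<And>p. p \<in> P \<Longrightarrow> \<not> p dvd x" "x \<in> gres (\<Prod>P)"
    and Q: "Q \<in> psets K" "\<And>p. p \<in> Q \<Longrightarrow> \<not> p dvd y" "y \<in> gres (\<Prod>Q)"
    and ne: "((P, x), 0) \<noteq> ((Q, y), k)" and K: "K > 0"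
  shows "1 / real K \<le> cmod (cg x / cg (\<Prod>P) - cg y / cg (\<Prod>Q) - cg k)"
proof -
  define c d where "c = \<Prod>P" and "d = \<Prod>Q"
  have PP: "finite P" "P \<subseteq> PP" "gauss_norm c \<le> K" and QQ: "finite Q" "Q \<subseteq> PP" "gauss_norm d \<le> K"
    using P Q by (auto simp: psets_def c_def d_def)
  have nz: "c \<noteq> 0" "d \<noteq> 0" using prod_PP_nonzero[OF PP(2)] prod_PP_nonzero[OF QQ(2)] by (simp_all only: c_def d_def not_False_eq_True)
  define z where "z = x * d - y * c - k * (c * d)"
  have "z \<noteq> 0"
  proof
    assume z: "z = 0"
    have "P \<subseteq> Q"
    proof
      fix p assume p: "p \<in> P"
      have "p dvd c" using p PP by (auto simp: c_def intro: dvd_prodI)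
      moreover have "x * d = c * (y + k * d)" using z by (simp add: z_def algebra_simps)
      ultimately have "p dvd x * d" by simp
      then have "p dvd d" using P(2)[OF p] PP_dvd_mult_iff p PP by blast
      then show "p \<in> Q" using PP_dvd_prod_iff[of p Q] p PP QQ by (auto simp: d_def)
    qed
    moreover have "Q \<subseteq> P"
    proof
      fix p assume p: "p \<in> Q"
      have "p dvd d" using p QQ by (auto simp: d_def intro: dvd_prodI)
      moreover have "y * c = d * (x - k * c)" using z by (simp add: z_def algebra_simps)
      ultimately have "p dvd y * c" by simp
      then have "p dvd c" using Q(2)[OF p] PP_dvd_mult_iff p QQ by blast
      then show "p \<in> P" using PP_dvd_prod_iff[of p P] p PP QQ by (auto simp: c_def)
    qed
    ultimately have eq: "P = Q" by simp
    then have cd: "c = d" by (simp add: c_def d_def)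
    have "c * (x - y) = c * (k * c)" using z cd by (simp add: z_def algebra_simps)
    then have xy: "x - y = k * c" using nz by simp
    then have "x = y" using P(3) Q(3) gres_inj[OF nz(1)] eq by (simp add: c_def)
    moreover from this have "k = 0" using xy nz by simp
    ultimately show False using ne eq by simp
  qed
  then have "1 \<le> sqmod (cg z)"
    unfolding cmod_complex_of_gauss_sq by (simp add: Suc_le_eq zero_less_iff_neq_zero)
  then have "1\<^sup>2 \<le> sqmod (cg z)" by simp
  then have z1: "1 \<le> cmod (cg z)" by (rule power2_le_imp_le) simp
  have "sqmod (cg c * cg d) \<le> (real K)\<^sup>2"
    unfolding norm_mult power_mult_distrib cmod_complex_of_gauss_sq power2_eq_square[of "real K"]
    using PP(3) QQ(3) by (intro mult_mono) auto
  then have cdK: "cmod (cg c * cg d) \<le> real K" by (rule power2_le_imp_le) simp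
  have cdpos: "cmod (cg c * cg d) > 0" using nz by simp
  have "cg x / cg c - cg y / cg d - cg k =
    cg z / (cg c * cg d)"
    using nz by (simp add: z_def field_simps)
  then have "cmod (cg x / cg c - cg y / cg d - cg k) =
    cmod (cg z) / cmod (cg c * cg d)" by (simp only: norm_divide)
  also have "\<dots> \<ge> 1 / real K" using z1 cdK cdpos by (intro frac_le) auto
  finally show ?thesis unfolding c_def d_def .
qed

text \<open>Each primitive character is expanded into additive characters with frequencies in the Farey set.
  The coefficients do not gain energy: characters to the same modulus are orthogonal, and the Gauss
  sums in the denominators have squared modulus equal to the norm of the modulus.\<close>

lemma mult_large_sieve_dual:
  assumes E: "E \<subseteq> exps K" and K: "K > 0" and X: "X > 0"
    and A: "finite A" "\<And>a. a \<in> A \<Longrightarrow> rnorm a \<le> X"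
  shows "(\<Sum>a\<in>A. sqmod (\<Sum>pe\<in>E. b pe * chiE (fst pe) (snd pe) a))
    \<le> C\<^sub>1 * (X + 3 * (real K)\<^sup>2) * ell2 E b"
proof -
  define Ef where "Ef = (\<lambda>P. {e. (P, e) \<in> E})"
  have EE: "E = Sigma (psets K) Ef" using E by (auto simp: Ef_def exps_def)
  have finE: "finite E" using E finite_exps finite_subset by blast
  have finEf: "finite (Ef P)" for P
    by (rule finite_subset[OF _ finite_imageI[OF finE, of snd]]) (force simp: Ef_def)
  define R where "R = (\<lambda>P. {x \<in> gres (\<Prod>P). \<forall>p\<in>P. \<not> p dvd x})"
  define J where "J = Sigma (psets K) R"
  have finR: "finite (R P)" if "P \<in> psets K" for P
    using that prod_PP_nonzero[of P] unfolding R_def psets_def by (intro finite_subset[OF _ finite_gres[of "\<Prod>P"]]) auto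
  have finJ: "finite J" unfolding J_def using finite_psets finR by auto
  define \<theta> where "\<theta> = (\<lambda>(P, x). cg x / cg (\<Prod>P))"
  define e' where "e' = (\<lambda>e p. 4 - (e :: gauss_int \<Rightarrow> nat) p)"
  define \<gamma> where "\<gamma> = (\<lambda>(P, x). \<Sum>e\<in>Ef P. b (P, e) / gsum P (e' e) 1 * chiE P (e' e) x)"
  have ve: "valid_exps P e" "valid_exps P (e' e)" if "e \<in> Ef P" for P e
    using that E exps_valid valid_exps_cnj unfolding Ef_def e'_def by blast+
  have expand: "(\<Sum>pe\<in>E. b pe * chiE (fst pe) (snd pe) a) = (\<Sum>j\<in>J. \<gamma> j * echar (cg a * \<theta> j))" for a
  proof -
    have "(\<Sum>pe\<in>E. b pe * chiE (fst pe) (snd pe) a) = (\<Sum>P\<in>psets K. \<Sum>e\<in>Ef P. b (P, e) * chiE P e a)"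
      unfolding EE using finite_psets finEf by (subst sum.Sigma) (auto simp: case_prod_beta)
    also have "\<dots> = (\<Sum>P\<in>psets K. \<Sum>x\<in>R P. \<gamma> (P, x) * echar (cg a * \<theta> (P, x)))"
    proof (rule sum.cong[OF refl])
      fix P assume P: "P \<in> psets K"
      have fP: "finite P" "P \<subseteq> PP" using P by (auto simp: psets_def)
      have "(\<Sum>e\<in>Ef P. b (P, e) * chiE P e a) = (\<Sum>e\<in>Ef P. \<Sum>x\<in>R P. b (P, e) / gsum P (e' e) 1 * chiE P (e' e) x * achar (\<Prod>P) (a * x))"
      proof (rule sum.cong[OF refl])
        fix e assume e: "e \<in> Ef P"
        have "(\<Sum>x\<in>gres (\<Prod>P). chiE P (e' e) x * achar (\<Prod>P) (a * x)) = (\<Sum>x\<in>R P. chiE P (e' e) x * achar (\<Prod>P) (a * x))"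
        proof (rule sum.mono_neutral_right)
          show "\<forall>x\<in>gres (\<Prod>P) - R P. chiE P (e' e) x * achar (\<Prod>P) (a * x) = 0"
          proof
            fix x assume "x \<in> gres (\<Prod>P) - R P"
            then obtain p where p: "p \<in> P" "p dvd x" by (auto simp: R_def)
            have "e' e p > 0" using ve(2)[OF e] p by (force simp: valid_exps_def)
            then show "chiE P (e' e) x * achar (\<Prod>P) (a * x) = 0" using chiE_zero[OF fP(1) p(1) _ p(2)] by simp
          qed
        qed (use prod_PP_nonzero[OF fP(2)] in \<open>auto simp: R_def intro: finite_gres\<close>)
        then show "b (P, e) * chiE P e a = (\<Sum>x\<in>R P. b (P, e) / gsum P (e' e) 1 * chiE P (e' e) x * achar (\<Prod>P) (a * x))"
          using chiE_expand[OF ve(1)[OF e], of a] unfolding e'_def by (simp add: sum_distrib_left sum_divide_distrib mult_ac)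
      qed
      also have "\<dots> = (\<Sum>x\<in>R P. \<gamma> (P, x) * achar (\<Prod>P) (a * x))"
        by (subst sum.swap) (simp add: \<gamma>_def sum_distrib_right)
      finally show "(\<Sum>e\<in>Ef P. b (P, e) * chiE P e a) = (\<Sum>x\<in>R P. \<gamma> (P, x) * echar (cg a * \<theta> (P, x)))"
        by (simp add: \<theta>_def achar_def)
    qed
    also have "\<dots> = (\<Sum>j\<in>J. \<gamma> j * echar (cg a * \<theta> j))"
      unfolding J_def using finite_psets finR by (subst sum.Sigma) (auto simp: case_prod_beta)
    finally show ?thesis .
  qed
  have gam: "(\<Sum>j\<in>J. sqmod (\<gamma> j)) \<le> ell2 E b"
  proof -
    have "(\<Sum>x\<in>R P. sqmod (\<gamma> (P, x))) \<le> (\<Sum>e\<in>Ef P. sqmod (b (P, e)))" if P: "P \<in> psets K" for P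
    proof -
      have fP: "finite P" "P \<subseteq> PP" using P by (auto simp: psets_def)
      define c where "c = \<Prod>P"
      have c: "c \<noteq> 0" unfolding c_def by (rule prod_PP_nonzero[OF fP(2)])
      define g where "g = (\<lambda>e. b (P, e) / gsum P (e' e) 1)"
      have "(\<Sum>x\<in>R P. sqmod (\<gamma> (P, x))) \<le> (\<Sum>x\<in>gres c. sqmod (\<gamma> (P, x)))"
        using c by (intro sum_mono2) (auto simp: R_def c_def)
      also have "\<dots> = (\<Sum>e\<in>Ef P. sqmod (g e) * (\<Sum>x\<in>gres c. sqmod (chiE P (e' e) x)))"
      proof -
        have "complex_of_real (\<Sum>x\<in>gres c. sqmod (\<gamma> (P, x))) = (\<Sum>x\<in>gres c. \<Sum>e\<in>Ef P. \<Sum>f\<in>Ef P. g e * cnj (g f) * (chiE P (e' e) x * cnj (chiE P (e' f) x)))"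
          unfolding of_real_sum complex_norm_square
          by (intro sum.cong refl) (simp add: \<gamma>_def g_def sum_product cnj_sum mult_ac)
        also have "\<dots> = (\<Sum>e\<in>Ef P. \<Sum>f\<in>Ef P. g e * cnj (g f) * (\<Sum>x\<in>gres c. chiE P (e' e) x * cnj (chiE P (e' f) x)))"
          unfolding sum_distrib_left by (rule trans[OF sum.swap sum.cong[OF refl sum.swap]])
        also have "\<dots> = (\<Sum>e\<in>Ef P. \<Sum>f\<in>Ef P. if e = f then g e * cnj (g e) * (\<Sum>x\<in>gres c. chiE P (e' e) x * cnj (chiE P (e' e) x)) else 0)"
        proof (intro sum.cong refl)
          fix e f assume e: "e \<in> Ef P" and f: "f \<in> Ef P"
          show "g e * cnj (g f) * (\<Sum>x\<in>gres c. chiE P (e' e) x * cnj (chiE P (e' f) x)) =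
            (if e = f then g e * cnj (g e) * (\<Sum>x\<in>gres c. chiE P (e' e) x * cnj (chiE P (e' e) x)) else 0)"
          proof (cases "e = f")
            case False
            then obtain p where "e p \<noteq> f p" by auto
            have out: "h p = 0" if "h \<in> Ef P" "p \<notin> P" for h
              using that E by (auto simp: Ef_def exps_def)
            then have p: "p \<in> P" using \<open>e p \<noteq> f p\<close> e f by metis
            have "1 \<le> e p \<and> e p \<le> 3" "1 \<le> f p \<and> f p \<le> 3" using ve(1)[OF e] ve(1)[OF f] p by (auto simp: valid_exps_def)
            then have "e' e p \<noteq> e' f p" using \<open>e p \<noteq> f p\<close> unfolding e'_def by linarith
            from chiE_orthogonal[OF ve(2)[OF e] ve(2)[OF f] p this] False show ?thesis by (simp add: c_def)
          qed simp
        qed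
        also have "\<dots> = (\<Sum>e\<in>Ef P. g e * cnj (g e) * (\<Sum>x\<in>gres c. chiE P (e' e) x * cnj (chiE P (e' e) x)))"
          using finEf by simp
        also have "\<dots> = complex_of_real (\<Sum>e\<in>Ef P. sqmod (g e) * (\<Sum>x\<in>gres c. sqmod (chiE P (e' e) x)))"
          by (simp only: of_real_sum of_real_mult complex_norm_square)
        finally show ?thesis by (simp only: of_real_eq_iff)
      qed
      also have "\<dots> \<le> (\<Sum>e\<in>Ef P. sqmod (b (P, e)))"
      proof (rule sum_mono)
        fix e assume e: "e \<in> Ef P"
        have "(\<Sum>x\<in>gres c. sqmod (chiE P (e' e) x)) \<le> (\<Sum>x\<in>gres c. 1)"
          using chiE_norm_le[OF fP(2)] by (intro sum_mono) (simp add: power_le_one)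
        also have "\<dots> = rnorm c" using card_gres[OF c] by simp
        finally have "(\<Sum>x\<in>gres c. sqmod (chiE P (e' e) x)) \<le> rnorm c" .
        moreover have "sqmod (g e) = sqmod (b (P, e)) / rnorm c"
          using gsum_norm_sq[OF ve(2)[OF e]] by (simp add: g_def norm_divide power_divide c_def)
        moreover have "rnorm c > 0" using c by (simp add: zero_less_iff_neq_zero)
        ultimately show "sqmod (g e) * (\<Sum>x\<in>gres c. sqmod (chiE P (e' e) x)) \<le> sqmod (b (P, e))"
          by (simp add: divide_le_eq mult_left_mono)
      qed
      finally show ?thesis .
    qed
    then have "(\<Sum>P\<in>psets K. \<Sum>x\<in>R P. sqmod (\<gamma> (P, x))) \<le> (\<Sum>P\<in>psets K. \<Sum>e\<in>Ef P. sqmod (b (P, e)))"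
      by (rule sum_mono)
    then show ?thesis unfolding J_def EE using finite_psets finR finEf
      by (simp add: sum.Sigma case_prod_beta)
  qed
  have "(\<Sum>a\<in>A. sqmod (\<Sum>j\<in>J. \<gamma> j * echar (cg a * \<theta> j)))
    \<le> 64 * exp 4 * exp pi * (X + 3 / (1 / real K)\<^sup>2) * (\<Sum>j\<in>J. sqmod (\<gamma> j))"
  proof (rule dual_large_sieve[OF finJ X _ _ A])
    show "1 / real K > 0" using K by simp
    fix i j and k :: gauss_int assume i: "i \<in> J" and j: "j \<in> J" and ne: "(i, 0) \<noteq> (j, k)"
    obtain P x Q y where e: "i = (P, x)" "j = (Q, y)" by (metis surj_pair)
    show "1 / real K \<le> cmod (\<theta> i - \<theta> j - cg k)"
      using farey_spacing[of P K x Q y k] i j ne K by (auto simp: e \<theta>_def J_def R_def)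
  qed
  also have "\<dots> \<le> 64 * exp 4 * exp pi * (X + 3 / (1 / real K)\<^sup>2) * ell2 E b"
    using X by (intro mult_left_mono gam) auto
  also have "3 / (1 / real K)\<^sup>2 = 3 * (real K)\<^sup>2" by (simp add: power_divide)
  finally show ?thesis unfolding expand C\<^sub>1_def .
qed

lemma mult_large_sieve:
  assumes K: "K > 0" and X: "X > 0"
    and S: "finite S" "\<And>R. R \<in> S \<Longrightarrow> finite R \<and> R \<subseteq> PP \<and> rnorm (\<Prod>R) \<le> X"
  shows "(\<Sum>pe\<in>exps K. sqmod (\<Sum>R\<in>S. c R * chiE (fst pe) (snd pe) (\<Prod>R)))
    \<le> C\<^sub>1 * (X + 3 * (real K)\<^sup>2) * ell2 S c"
proof (rule duality)
  show "0 \<le> C\<^sub>1 * (X + 3 * (real K)\<^sup>2)" using C1_pos X by simp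
  fix b
  have inj: "inj_on Prod S" using S(2) prod_PP_inj by (intro inj_onI) blast
  have "(\<Sum>a\<in>Prod ` S. sqmod (\<Sum>pe\<in>exps K. b pe * chiE (fst pe) (snd pe) a))
    \<le> C\<^sub>1 * (X + 3 * (real K)\<^sup>2) * ell2 (exps K) b"
    by (rule mult_large_sieve_dual[OF order.refl K X]) (use S in auto)
  then show "(\<Sum>R\<in>S. sqmod (\<Sum>pe\<in>exps K. b pe * chiE (fst pe) (snd pe) (\<Prod>R)))
    \<le> C\<^sub>1 * (X + 3 * (real K)\<^sup>2) * ell2 (exps K) b"
    using inj by (simp add: sum.reindex)
qed

section \<open>The large sieve over all Gaussian integers\<close>

text \<open>Dividing a Gaussian integer by a suitable factor \<open>u * (1 + i)\<^sup>j * b\<^sup>4\<close> with a unit \<open>u\<close> leaves a product of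
  primary primes with exponents \<open>1, 2, 3\<close>; the factors of norm up to \<open>T\<close> are indexed here.\<close>

definition fourth_index :: "nat \<Rightarrow> (gauss_int \<times> nat \<times> gauss_int) set" where
  "fourth_index T = {(u, j, b). u \<in> {1, - 1, gauss_i, - gauss_i} \<and> b \<noteq> 0 \<and> 2 ^ j * gauss_norm b ^ 4 \<le> T}"

fun fourth_elt :: "gauss_int \<times> nat \<times> gauss_int \<Rightarrow> gauss_int" where
  "fourth_elt (u, j, b) = u * (1 + gauss_i) ^ j * b ^ 4"

fun fourth_norm :: "gauss_int \<times> nat \<times> gauss_int \<Rightarrow> nat" where
  "fourth_norm (u, j, b) = 2 ^ j * gauss_norm b ^ 4"

lemma gauss_norm_pos: "z \<noteq> 0 \<Longrightarrow> gauss_norm z \<ge> 1"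
  by (simp add: Suc_le_eq zero_less_iff_neq_zero)

lemma card_gauss_upto_le:
  assumes Y: "Y \<ge> 1"
  shows "real (card {b. b \<noteq> 0 \<and> rnorm b \<le> Y}) \<le> 64 * exp 1 * Y"
proof -
  define B where "B = {b. b \<noteq> 0 \<and> rnorm b \<le> Y}"
  have "B \<subseteq> gauss_upto (nat \<lfloor>Y\<rfloor>)" by (auto simp: B_def gauss_upto_def le_nat_floor)
  then have fin: "finite B" using finite_gauss_upto finite_subset by blast
  have "real (card B) = (\<Sum>b\<in>B. 1)" by simp
  also have "\<dots> \<le> (\<Sum>b\<in>B. exp 1 * exp (- (1 / Y) * sqmod (cg b - 0)))"
  proof (rule sum_mono)
    fix b assume "b \<in> B"
    then have "rnorm b / Y \<le> 1" using Y by (simp add: B_def)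
    then have "0 \<le> 1 + - (1 / Y) * sqmod (cg b - 0)" by (simp add: cmod_complex_of_gauss_sq)
    then show "1 \<le> exp 1 * exp (- (1 / Y) * sqmod (cg b - 0))"
      unfolding exp_add[symmetric] by simp
  qed
  also have "\<dots> = exp 1 * (\<Sum>b\<in>B. exp (- (1 / Y) * sqmod (cg b - 0)))" by (simp only: sum_distrib_left)
  also have "\<dots> \<le> exp 1 * (4 * (1 + 1 / sqrt (1 / Y)))\<^sup>2"
    using Y fin by (intro mult_left_mono gaussian_sum_le) auto
  also have "1 / sqrt (1 / Y) = sqrt Y" using Y by (simp add: real_sqrt_divide)
  also have "(4 * (1 + sqrt Y))\<^sup>2 \<le> (8 * sqrt Y)\<^sup>2" using Y by (intro power_mono) auto
  also have "(8 * sqrt Y)\<^sup>2 = 64 * Y" using Y by (simp add: power_mult_distrib)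
  finally show ?thesis by (simp add: B_def)
qed

lemma finite_fourth_index: "finite (fourth_index T)"
proof -
  have "fourth_index T \<subseteq> {1, - 1, gauss_i, - gauss_i} \<times> {..T} \<times> gauss_upto T"
  proof
    fix w assume w: "w \<in> fourth_index T"
    obtain u j b where w3: "w = (u, j, b)" by (cases w)
    then have h: "u \<in> {1, - 1, gauss_i, - gauss_i}" "b \<noteq> 0" "2 ^ j * gauss_norm b ^ 4 \<le> T" using w by (simp_all add: fourth_index_def)
    have b1: "gauss_norm b \<ge> 1" using gauss_norm_pos[OF h(2)] .
    have "j < 2 ^ j" by simp
    also have "(2::nat) ^ j = 2 ^ j * 1" by simp
    also have "\<dots> \<le> 2 ^ j * gauss_norm b ^ 4" using b1 by (intro mult_left_mono) auto
    finally have j: "j \<le> T" using h(3) by simp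
    have "gauss_norm b \<le> gauss_norm b ^ 4" using b1 by (intro self_le_power) auto
    also have "\<dots> = 1 * gauss_norm b ^ 4" by simp
    also have "\<dots> \<le> 2 ^ j * gauss_norm b ^ 4" by (intro mult_right_mono) auto
    finally have "b \<in> gauss_upto T" using h(3) by (simp add: gauss_upto_def)
    then show "w \<in> {1, - 1, gauss_i, - gauss_i} \<times> {..T} \<times> gauss_upto T" using w3 h(1) j by (simp only: mem_Times_iff fst_conv snd_conv atMost_iff simp_thms)
  qed
  then show ?thesis using finite_gauss_upto by (rule_tac finite_subset) auto
qed

definition C\<^sub>2 :: real where "C\<^sub>2 = 256 * exp 1 / (1 - 2 powr (- 1/4))"

lemma two_powr_less_1: "2 powr (- 1/4) < (1::real)"
  using powr_less_mono[of "- 1/4" 0 "2::real"] by simp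

lemma C2_pos: "C\<^sub>2 > 0" unfolding C\<^sub>2_def using two_powr_less_1 by simp

text \<open>For each \<open>j\<close> there are \<open>O((T / 2\<^sup>j)\<^bsup>1/4\<^esup>)\<close> choices of \<open>b\<close>, and these bounds form a geometric series.\<close>

lemma card_fourth_index:
  assumes T: "T \<ge> 1"
  shows "real (card (fourth_index T)) \<le> C\<^sub>2 * real T powr (1/4)"
proof -
  define r where "r = (2::real) powr (- 1/4)"
  have r: "0 < r" "r < 1" using two_powr_less_1 by (auto simp: r_def)
  define B where "B = (\<lambda>j. {b. b \<noteq> 0 \<and> 2 ^ j * gauss_norm b ^ 4 \<le> T})"
  have eq: "fourth_index T = {1, - 1, gauss_i, - gauss_i} \<times> (SIGMA j:UNIV. B j)"
    by (auto simp: fourth_index_def B_def)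
  have Bj: "real (card (B j)) \<le> 64 * exp 1 * real T powr (1/4) * r ^ j" for j
  proof (cases "2 ^ j \<le> T")
    case True
    define Y where "Y = (real T / 2 ^ j) powr (1/4)"
    have q: "real T / 2 ^ j \<ge> 1" using True by (simp add: of_nat_le_iff[symmetric] del: of_nat_le_iff)
    have Y: "Y \<ge> 1" unfolding Y_def using q by (intro ge_one_powr_ge_zero) auto
    have sub: "B j \<subseteq> {b. b \<noteq> 0 \<and> rnorm b \<le> Y}"
    proof
      fix b assume "b \<in> B j"
      then have b: "b \<noteq> 0" "2 ^ j * gauss_norm b ^ 4 \<le> T" by (auto simp: B_def)
      have n0: "rnorm b > 0" using b(1) by (simp add: zero_less_iff_neq_zero)
      have "real (2 ^ j * gauss_norm b ^ 4) \<le> real T" using b(2) by (simp only: of_nat_le_iff)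
      then have "rnorm b ^ 4 \<le> real T / 2 ^ j" by (simp add: field_simps)
      then have "(rnorm b ^ 4) powr (1/4) \<le> Y" unfolding Y_def by (intro powr_mono2) auto
      moreover have "(rnorm b ^ 4) powr (1/4) = rnorm b"
        using n0 by (simp add: powr_powr flip: powr_numeral)
      ultimately show "b \<in> {b. b \<noteq> 0 \<and> rnorm b \<le> Y}" using b by simp
    qed
    have fin: "finite {b. b \<noteq> 0 \<and> rnorm b \<le> Y}"
      by (rule finite_subset[OF _ finite_gauss_upto[of "nat \<lfloor>Y\<rfloor>"]]) (auto simp: gauss_upto_def le_nat_floor)
    have "real (card (B j)) \<le> 64 * exp 1 * Y"
      using card_mono[OF fin sub] card_gauss_upto_le[OF Y] by linarith
    also have "Y = real T powr (1/4) * r ^ j"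
    proof -
      have "(2 ^ j :: real) powr (1/4) = inverse (r ^ j)"
      proof -
        have "r ^ j = r powr real j" using r by (simp add: powr_realpow)
        also have "\<dots> = 2 powr (- (real j * (1/4)))" by (simp add: r_def powr_powr)
        also have "\<dots> = inverse ((2 powr real j) powr (1/4))" by (simp only: powr_minus powr_powr)
        finally show ?thesis by (simp only: powr_realpow[of 2, OF zero_less_numeral] inverse_inverse_eq)
      qed
      then have "real T powr (1/4) / (2 ^ j) powr (1/4) = real T powr (1/4) * r ^ j"
        by (simp only: divide_inverse inverse_inverse_eq)
      moreover have "(real T / 2 ^ j) powr (1/4) = real T powr (1/4) / (2 ^ j) powr (1/4)" by (simp add: powr_divide)
      ultimately show ?thesis by (simp only: Y_def)
    qed
    finally show ?thesis by (simp add: mult.assoc)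
  next
    case False
    have "B j = {}"
    proof (rule ccontr)
      assume "B j \<noteq> {}"
      then obtain b where b: "b \<noteq> 0" "2 ^ j * gauss_norm b ^ 4 \<le> T" by (auto simp: B_def)
      have "1 \<le> gauss_norm b ^ 4" using gauss_norm_pos[OF b(1)] by simp
      then have "2 ^ j * 1 \<le> 2 ^ j * gauss_norm b ^ 4" by (intro mult_left_mono) auto
      from order.trans[OF this b(2)] show False using False by (simp only: mult_1_right)
    qed
    then show ?thesis using r by simp
  qed
  have emp: "B j = {}" if "j > T" for j
  proof -
    have "(u, j, b) \<in> fourth_index T \<Longrightarrow> j \<le> T" for u b
    proof -
      assume "(u, j, b) \<in> fourth_index T"
      then have h: "b \<noteq> 0" "2 ^ j * gauss_norm b ^ 4 \<le> T" by (auto simp: fourth_index_def)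
      have "j < 2 ^ j * 1" by simp
      also have "2 ^ j * 1 \<le> 2 ^ j * gauss_norm b ^ 4" using gauss_norm_pos[OF h(1)] by (intro mult_left_mono) auto
      finally show ?thesis using h(2) by simp
    qed
    then show ?thesis using that unfolding eq by fastforce
  qed
  have finB: "finite (B j)" for j
    by (rule finite_subset[OF _ finite_imageI[OF finite_fourth_index[of T], of "\<lambda>(u, j, b). b"]])
       (force simp: B_def fourth_index_def image_iff)
  have S: "(SIGMA j:UNIV. B j) = (SIGMA j:{..T}. B j)"
  proof -
    have "j \<le> T" if "b \<in> B j" for j b using emp[of j] that by (cases "T < j") auto
    then show ?thesis by blast
  qed
  have "real (card (fourth_index T)) = 4 * (\<Sum>j\<le>T. real (card (B j)))"
    unfolding eq S card_cartesian_product using finB by (simp add: card_insert_if gauss_int_eq_iff)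
  also have "\<dots> \<le> 4 * (\<Sum>j\<le>T. 64 * exp 1 * real T powr (1/4) * r ^ j)"
    by (intro mult_left_mono sum_mono Bj) auto
  also have "\<dots> = 256 * exp 1 * real T powr (1/4) * (\<Sum>j\<le>T. r ^ j)" by (simp add: sum_distrib_left mult.assoc)
  also have "\<dots> \<le> 256 * exp 1 * real T powr (1/4) * (1 / (1 - r))"
  proof (rule mult_left_mono)
    have "(\<Sum>j\<le>T. r ^ j) = (1 - r ^ Suc T) / (1 - r)" using r by (subst sum_gp0) auto
    also have "\<dots> \<le> 1 / (1 - r)" using r by (intro divide_right_mono) auto
    finally show "(\<Sum>j\<le>T. r ^ j) \<le> 1 / (1 - r)" .
  qed simp
  finally show ?thesis by (simp add: C\<^sub>2_def r_def)
qed

lemma fourth_norm_pos: "w \<in> fourth_index T \<Longrightarrow> fourth_norm w \<ge> 1"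
  using gauss_norm_pos by (cases w) (auto simp: fourth_index_def Suc_le_eq)

lemma fourth_index_mem: "w \<in> fourth_index T \<Longrightarrow> fourth_norm w \<le> T'\<Longrightarrow> w \<in> fourth_index T'"
  by (cases w) (auto simp: fourth_index_def)

lemma fourth_norm_le: "w \<in> fourth_index T \<Longrightarrow> fourth_norm w \<le> T"
  by (cases w) (auto simp: fourth_index_def)

text \<open>Summation by parts: the square of \<open>n\<close> is at most the sum of \<open>2 * t\<close> over \<open>t\<close> up to \<open>n\<close>, and the number
  of indices \<open>w\<close> with \<open>t \<le> K div fourth_norm w\<close> is bounded by \<open>card_fourth_index\<close>.\<close>

lemma sum_fourth_index_squares:
  assumes K: "K \<ge> 1"
  shows "(\<Sum>w\<in>fourth_index K. (real (K div fourth_norm w))\<^sup>2) \<le> 2 * C\<^sub>2 * (real K)\<^sup>2"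
proof -
  have sq: "(real n)\<^sup>2 \<le> (\<Sum>t=1..n. 2 * real t)" for n :: nat
    by (induction n) (auto simp: power2_eq_square algebra_simps)
  have "(\<Sum>w\<in>fourth_index K. (real (K div fourth_norm w))\<^sup>2) \<le> (\<Sum>w\<in>fourth_index K. \<Sum>t=1..K div fourth_norm w. 2 * real t)"
    by (intro sum_mono sq)
  also have "\<dots> = (\<Sum>w\<in>fourth_index K. \<Sum>t=1..K. if w \<in> fourth_index (K div t) then 2 * real t else 0)"
  proof (rule sum.cong[OF refl])
    fix w assume w: "w \<in> fourth_index K"
    have iff: "w \<in> fourth_index (K div t) \<longleftrightarrow> t \<le> K div fourth_norm w" if "t \<ge> 1" for t
    proof -
      have "w \<in> fourth_index (K div t) \<longleftrightarrow> fourth_norm w \<le> K div t"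
        using fourth_index_mem[OF w] fourth_norm_le by blast
      also have "\<dots> \<longleftrightarrow> fourth_norm w * t \<le> K" using that by (simp add: less_eq_div_iff_mult_less_eq)
      also have "\<dots> \<longleftrightarrow> t \<le> K div fourth_norm w"
        using fourth_norm_pos[OF w] by (simp add: less_eq_div_iff_mult_less_eq mult.commute)
      finally show ?thesis .
    qed
    have "(\<Sum>t=1..K. if w \<in> fourth_index (K div t) then 2 * real t else 0) = (\<Sum>t\<in>{1..K} \<inter> {t. w \<in> fourth_index (K div t)}. 2 * real t)"
      by (simp add: sum.inter_restrict)
    also have "{1..K} \<inter> {t. w \<in> fourth_index (K div t)} = {1..K div fourth_norm w}"
      using iff order.trans[OF _ div_le_dividend[of K "fourth_norm w"]] by auto
    finally show "(\<Sum>t=1..K div fourth_norm w. 2 * real t) = (\<Sum>t=1..K. if w \<in> fourth_index (K div t) then 2 * real t else 0)" by simp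
  qed
  also have "\<dots> = (\<Sum>t=1..K. \<Sum>w\<in>fourth_index K. if w \<in> fourth_index (K div t) then 2 * real t else 0)" by (rule sum.swap)
  also have "\<dots> \<le> (\<Sum>t=1..K. 2 * C\<^sub>2 * real K)"
  proof (rule sum_mono)
    fix t assume t: "t \<in> {1..K}"
    have sub: "fourth_index (K div t) \<subseteq> fourth_index K"
    proof
      fix w assume w: "w \<in> fourth_index (K div t)"
      show "w \<in> fourth_index K" by (rule fourth_index_mem[OF w order.trans[OF fourth_norm_le[OF w] div_le_dividend]])
    qed
    have "(\<Sum>w\<in>fourth_index K. if w \<in> fourth_index (K div t) then 2 * real t else 0) = (\<Sum>w\<in>fourth_index K \<inter> fourth_index (K div t). 2 * real t)"
      by (rule sum.inter_restrict[OF finite_fourth_index, symmetric])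
    also have "\<dots> = 2 * real t * real (card (fourth_index (K div t)))" using sub by (simp add: Int_absorb1)
    also have "\<dots> \<le> 2 * real t * (C\<^sub>2 * real (K div t) powr (1/4))"
    proof (intro mult_left_mono card_fourth_index)
      show "1 \<le> K div t" using t by (simp add: less_eq_div_iff_mult_less_eq)
    qed simp
    also have "\<dots> \<le> 2 * real t * (C\<^sub>2 * (real K / real t))"
    proof (intro mult_left_mono)
      have "1 \<le> K div t" using t by (simp add: less_eq_div_iff_mult_less_eq)
      then have "real (K div t) powr (1/4) \<le> real (K div t) powr 1" by (intro powr_mono) auto
      also have "\<dots> \<le> real K / real t" using of_nat_div_le_of_nat[of K t] by simp
      finally show "real (K div t) powr (1/4) \<le> real K / real t" .
    qed (use C2_pos in auto)
    also have "\<dots> = 2 * C\<^sub>2 * real K" using t by simp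
    finally show "(\<Sum>w\<in>fourth_index K. if w \<in> fourth_index (K div t) then 2 * real t else 0) \<le> 2 * C\<^sub>2 * real K" .
  qed
  also have "\<dots> = 2 * C\<^sub>2 * (real K)\<^sup>2" by (simp add: power2_eq_square)
  finally show ?thesis .
qed

definition exps_elt :: "gauss_int set \<times> (gauss_int \<Rightarrow> nat) \<Rightarrow> gauss_int" where
  "exps_elt pe = (\<Prod>p\<in>fst pe. p ^ snd pe p)"

lemma fourth_power_decomposition:
  assumes k: "k \<noteq> 0" "gauss_norm k \<le> K"
  shows "\<exists>w\<in>fourth_index K. \<exists>pe\<in>exps (K div fourth_norm w). k = fourth_elt w * exps_elt pe"
proof -
  obtain u j P f where F: "u dvd 1" "finite P" "P \<subseteq> PP" "k = u * (1 + gauss_i) ^ j * (\<Prod>p\<in>P. p ^ f p)"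
    using gauss_factorization[OF k(1)] by blast
  define e where "e = (\<lambda>p. if p \<in> P then f p mod 4 else 0)"
  define P' where "P' = {p\<in>P. e p \<noteq> 0}"
  define b where "b = (\<Prod>p\<in>P. p ^ (f p div 4))"
  have P': "finite P'" "P' \<subseteq> PP" using F by (auto simp: P'_def)
  have e3: "e p \<in> {1, 2, 3}" if "p \<in> P'" for p
  proof -
    have "e p < 4" "e p \<noteq> 0" using that by (auto simp: e_def P'_def)
    then show ?thesis by auto
  qed
  have e0: "e p = 0" if "p \<notin> P'" for p using that by (auto simp: P'_def e_def)
  have prod: "(\<Prod>p\<in>P. p ^ f p) = b ^ 4 * (\<Prod>p\<in>P'. p ^ e p)"
  proof -
    have "(\<Prod>p\<in>P. p ^ f p) = (\<Prod>p\<in>P. (p ^ (f p div 4)) ^ 4 * p ^ e p)"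
      by (intro prod.cong refl) (simp add: e_def flip: power_mult power_add)
    also have "\<dots> = b ^ 4 * (\<Prod>p\<in>P. p ^ e p)" by (simp add: prod.distrib b_def prod_power_distrib)
    also have "(\<Prod>p\<in>P. p ^ e p) = (\<Prod>p\<in>P'. p ^ e p)"
      using F(2) by (intro prod.mono_neutral_right) (auto simp: P'_def)
    finally show ?thesis .
  qed
  have keq: "k = fourth_elt (u, j, b) * exps_elt (P', e)" using F(4) by (simp add: prod exps_elt_def mult_ac)
  have bnz: "b \<noteq> 0" using k(1) F(4) prod by auto
  have un: "gauss_norm u = 1" using F(1) gauss_norm_eq_1_iff by blast
  have "gauss_norm (1 + gauss_i) = 2" by (simp add: gauss_norm_def)
  then have nk: "gauss_norm k = fourth_norm (u, j, b) * gauss_norm (exps_elt (P', e))"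
    unfolding keq by (simp add: gauss_norm_mult gauss_norm_power un)
  have nle: "gauss_norm (\<Prod>P') \<le> gauss_norm (exps_elt (P', e))"
    unfolding exps_elt_def gauss_norm_prod fst_conv snd_conv
  proof (rule prod_mono)
    fix p assume p: "p \<in> P'"
    have "gauss_norm p \<ge> 5" using PP_norm_ge_5 p P' by blast
    then have "gauss_norm p ^ 1 \<le> gauss_norm p ^ e p" using e3[OF p] by (intro power_increasing) auto
    then show "0 \<le> gauss_norm p \<and> gauss_norm p \<le> gauss_norm (p ^ e p)" by (simp add: gauss_norm_power)
  qed
  have pos: "gauss_norm (\<Prod>P') \<ge> 1" using norm_prod_PP_pos[OF P'(2)] .
  have "fourth_norm (u, j, b) * gauss_norm (\<Prod>P') \<le> K" using nk nle k(2) by (metis mult_le_mono2 order.trans)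
  moreover have fpos: "fourth_norm (u, j, b) \<ge> 1" using gauss_norm_pos[OF bnz] by (simp add: Suc_le_eq)
  ultimately have "gauss_norm (\<Prod>P') \<le> K div fourth_norm (u, j, b)"
    by (simp add: less_eq_div_iff_mult_less_eq mult.commute del: fourth_norm.simps)
  then have "(P', e) \<in> exps (K div fourth_norm (u, j, b))"
    using P' e3 e0 by (auto simp: exps_def psets_def simp del: fourth_norm.simps)
  moreover have "fourth_norm (u, j, b) \<le> K"
    using \<open>fourth_norm (u, j, b) * gauss_norm (\<Prod>P') \<le> K\<close> pos
    by (metis mult.right_neutral mult_le_mono2 order.trans)
  then have "(u, j, b) \<in> fourth_index K" using F(1) bnz by (simp add: fourth_index_def gauss_unit_iff)
  ultimately show ?thesis using keq by blast
qed

lemma norm_add_sq_le: "sqmod (x + y) \<le> 2 * sqmod x + 2 * sqmod y"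
proof -
  have "sqmod (x + y) \<le> (cmod x + cmod y)\<^sup>2" by (intro power_mono norm_triangle_ineq) auto
  also have "\<dots> \<le> 2 * sqmod x + 2 * sqmod y"
    using sum_squares_bound[of "cmod x" "cmod y"] by (simp add: power2_sum)
  finally show ?thesis .
qed

abbreviation chi :: "gauss_int set \<Rightarrow> gauss_int \<Rightarrow> complex" where
  "chi P \<equiv> chiE P (\<lambda>_. 1)"

text \<open>Reciprocity turns \<open>chi R\<close> at \<open>\<Prod> p\<^bsup>e p\<^esup>\<close> into a primitive character modulo \<open>\<Prod>p\<close> evaluated at \<open>\<Prod>R\<close>.  The two
  parity classes of \<open>R\<close> are treated separately, so that the sign leaves the sum over \<open>R\<close>.\<close>

lemma fixed_fourth_part:
  assumes K: "K > 0" and X: "X > 0"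
    and S: "finite S" "\<And>R. R \<in> S \<Longrightarrow> finite R \<and> R \<subseteq> PP \<and> rnorm (\<Prod>R) \<le> X"
  shows "(\<Sum>pe\<in>exps K. sqmod (\<Sum>R\<in>S. c R * chi R (w * exps_elt pe)))
    \<le> 2 * C\<^sub>1 * (X + 3 * (real K)\<^sup>2) * ell2 S c"
proof -
  define S' where "S' = (\<lambda>s. {R\<in>S. even (parE R (\<lambda>_. 1)) = s})"
  define B where "B = C\<^sub>1 * (X + 3 * (real K)\<^sup>2)"
  have B0: "B \<ge> 0" using C1_pos X by (simp add: B_def)
  have SU: "S = S' True \<union> S' False" "S' True \<inter> S' False = {}" "finite (S' s)" for s using S(1) by (auto simp: S'_def)
  have one: "(\<Sum>pe\<in>exps K. sqmod (\<Sum>R\<in>S' s. c R * chi R (w * exps_elt pe))) \<le> B * ell2 (S' s) c" for s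
  proof -
    have "(\<Sum>pe\<in>exps K. sqmod (\<Sum>R\<in>S' s. c R * chi R (w * exps_elt pe))) =
      (\<Sum>pe\<in>exps K. sqmod (\<Sum>R\<in>S' s. (c R * chi R w) * chiE (fst pe) (snd pe) (\<Prod>R)))"
    proof (rule sum.cong[OF refl])
      fix pe assume pe: "pe \<in> exps K"
      have Q: "fst pe \<subseteq> PP" using pe by (auto simp: exps_def psets_def)
      define sg where "sg = (if s then 1 else (- 1 :: complex) ^ parE (fst pe) (snd pe))"
      have "c R * chi R (w * exps_elt pe) = sg * ((c R * chi R w) * chiE (fst pe) (snd pe) (\<Prod>R))" if R: "R \<in> S' s" for R
      proof -
        have RP: "R \<subseteq> PP" using R S(2) by (auto simp: S'_def)
        have "chi R (exps_elt pe) = (- 1) ^ (parE R (\<lambda>_. 1) * parE (fst pe) (snd pe)) * chiE (fst pe) (snd pe) (\<Prod>R)"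
          unfolding exps_elt_def by (rule reciprocity_sets[OF RP Q])
        also have "(- 1 :: complex) ^ (parE R (\<lambda>_. 1) * parE (fst pe) (snd pe)) = sg"
          using R by (cases s) (auto simp: S'_def sg_def power_mult minus_one_power_iff)
        finally show ?thesis by (simp add: chiE_mult[OF RP] mult_ac)
      qed
      then have "(\<Sum>R\<in>S' s. c R * chi R (w * exps_elt pe)) = sg * (\<Sum>R\<in>S' s. (c R * chi R w) * chiE (fst pe) (snd pe) (\<Prod>R))"
        by (simp only: sum_distrib_left cong: sum.cong)
      moreover have "cmod sg = 1" by (simp add: sg_def norm_power)
      ultimately show "sqmod (\<Sum>R\<in>S' s. c R * chi R (w * exps_elt pe)) = sqmod (\<Sum>R\<in>S' s. (c R * chi R w) * chiE (fst pe) (snd pe) (\<Prod>R))"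
        by (simp add: norm_mult)
    qed
    also have "\<dots> \<le> B * (\<Sum>R\<in>S' s. sqmod (c R * chi R w))"
      unfolding B_def by (rule mult_large_sieve[OF K X]) (use S in \<open>auto simp: S'_def\<close>)
    also have "\<dots> \<le> B * ell2 (S' s) c"
    proof (intro mult_left_mono sum_mono power_mono B0)
      fix R assume "R \<in> S' s"
      then have "R \<subseteq> PP" using S(2) by (auto simp: S'_def)
      then show "cmod (c R * chi R w) \<le> cmod (c R)" using chiE_norm_le[of R "\<lambda>_. 1" w] by (simp add: norm_mult mult_left_le)
    qed auto
    finally show ?thesis .
  qed
  have "(\<Sum>pe\<in>exps K. sqmod (\<Sum>R\<in>S. c R * chi R (w * exps_elt pe))) \<le>
    (\<Sum>pe\<in>exps K. 2 * sqmod (\<Sum>R\<in>S' True. c R * chi R (w * exps_elt pe)) + 2 * sqmod (\<Sum>R\<in>S' False. c R * chi R (w * exps_elt pe)))"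
    by (subst SU(1), subst sum.union_disjoint) (use SU in \<open>auto intro!: sum_mono norm_add_sq_le\<close>)
  also have "\<dots> \<le> 2 * (B * ell2 (S' True) c) + 2 * (B * ell2 (S' False) c)"
    unfolding sum.distrib sum_distrib_left[symmetric] by (intro add_mono mult_left_mono one) auto
  also have "\<dots> = 2 * B * ell2 S c"
  proof -
  have "ell2 S c = ell2 (S' True) c + ell2 (S' False) c"
    by (subst SU(1), rule sum.union_disjoint) (use SU in auto)
  then show ?thesis by (simp only: distrib_left mult.assoc)
  qed
  finally show ?thesis by (simp add: B_def mult.assoc)
qed

definition C\<^sub>3 :: real where "C\<^sub>3 = 12 * C\<^sub>1 * C\<^sub>2"

lemma C3_pos: "C\<^sub>3 > 0" by (simp add: C\<^sub>3_def C1_pos C2_pos)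

text \<open>For each fourth part \<open>w\<close> the remaining factor has norm at most \<open>K div fourth_norm w\<close>.  The number of \<open>w\<close>
  accounts for \<open>K\<^bsup>1/4\<^esup>\<close>, and the squares of the quotients sum to \<open>O(K\<^sup>2)\<close>.\<close>

lemma all_large_sieve:
  assumes K: "K \<ge> 1" and X: "X > 0"
    and S: "finite S" "\<And>R. R \<in> S \<Longrightarrow> finite R \<and> R \<subseteq> PP \<and> rnorm (\<Prod>R) \<le> X"
  shows "(\<Sum>k\<in>gauss_upto K - {0}. sqmod (\<Sum>R\<in>S. c R * chi R k))
    \<le> C\<^sub>3 * (X * real K powr (1/4) + (real K)\<^sup>2) * ell2 S c"
proof -
  define f where "f = (\<lambda>k. sqmod (\<Sum>R\<in>S. c R * chi R k))"
  define n where "n = ell2 S c"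
  have n0: "n \<ge> 0" by (auto simp: n_def intro: sum_nonneg)
  define I where "I = (SIGMA w:fourth_index K. exps (K div fourth_norm w))"
  define g where "g = (\<lambda>(w, pe). fourth_elt w * exps_elt pe)"
  have finI: "finite I" unfolding I_def using finite_fourth_index finite_exps by auto
  have "gauss_upto K - {0} \<subseteq> g ` I"
  proof
    fix k assume "k \<in> gauss_upto K - {0}"
    then obtain w pe where "w \<in> fourth_index K" "pe \<in> exps (K div fourth_norm w)" "k = fourth_elt w * exps_elt pe"
      using fourth_power_decomposition[of k K] by (auto simp: gauss_upto_def)
    then show "k \<in> g ` I" by (intro image_eqI[of _ _ "(w, pe)"]) (auto simp: g_def I_def)
  qed
  then have "(\<Sum>k\<in>gauss_upto K - {0}. f k) \<le> (\<Sum>k\<in>g ` I. f k)"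
    using finI by (intro sum_mono2) (auto simp: f_def)
  also have "\<dots> \<le> (\<Sum>i\<in>I. f (g i))" by (rule sum_image_le[OF finI, of f g, unfolded comp_def]) (simp add: f_def)
  also have "\<dots> = (\<Sum>w\<in>fourth_index K. \<Sum>pe\<in>exps (K div fourth_norm w). f (fourth_elt w * exps_elt pe))"
    unfolding I_def g_def using finite_fourth_index finite_exps by (subst sum.Sigma) (auto simp: case_prod_beta)
  also have "\<dots> \<le> (\<Sum>w\<in>fourth_index K. 2 * C\<^sub>1 * (X + 3 * (real (K div fourth_norm w))\<^sup>2) * n)"
  proof (rule sum_mono)
    fix w assume w: "w \<in> fourth_index K"
    have "K div fourth_norm w > 0"
      using fourth_norm_le[OF w] fourth_norm_pos[OF w] by (simp add: div_greater_zero_iff)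
    from fixed_fourth_part[OF this X S]
    show "(\<Sum>pe\<in>exps (K div fourth_norm w). f (fourth_elt w * exps_elt pe)) \<le> 2 * C\<^sub>1 * (X + 3 * (real (K div fourth_norm w))\<^sup>2) * n"
      by (simp add: f_def n_def)
  qed
  also have "\<dots> = 2 * C\<^sub>1 * n * (X * real (card (fourth_index K)) + 3 * (\<Sum>w\<in>fourth_index K. (real (K div fourth_norm w))\<^sup>2))"
    by (simp add: sum.distrib sum_distrib_left distrib_left distrib_right mult_ac)
  also have "\<dots> \<le> 2 * C\<^sub>1 * n * (X * (C\<^sub>2 * real K powr (1/4)) + 3 * (2 * C\<^sub>2 * (real K)\<^sup>2))"
    using C1_pos n0 X by (intro mult_left_mono add_mono card_fourth_index[OF K] sum_fourth_index_squares[OF K]) auto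
  also have "\<dots> \<le> C\<^sub>3 * (X * real K powr (1/4) + (real K)\<^sup>2) * n"
  proof -
    have "0 \<le> C\<^sub>1 * C\<^sub>2 * n * (X * real K powr (1/4))" using C1_pos C2_pos n0 X by simp
    then show ?thesis unfolding C\<^sub>3_def by (simp add: algebra_simps)
  qed
  finally show ?thesis by (simp add: f_def n_def)
qed

text \<open>A dyadic majorant with weights decaying faster than \<open>4\<^sup>-\<^sup>i\<close>, the rate at which the sieve bound grows
  with the range.  The constant is \<open>216 = 27 * 8\<close>, from \<open>exp (- x) \<le> 27 / x\<^sup>3\<close> and \<open>x > 2\<^bsup>i - 1\<^esup>\<close>.\<close>

lemma exp_minus_layers:
  assumes x: "0 \<le> x" "x \<le> 2 ^ n"
  shows "exp (- x) \<le> 216 * (\<Sum>i\<le>n. (1/8) ^ i * (if x \<le> 2 ^ i then 1 else 0 :: real))"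
proof -
  define i where "i = (LEAST i. x \<le> 2 ^ i)"
  have i: "x \<le> 2 ^ i" unfolding i_def using x(2) by (rule LeastI)
  have "i \<le> n" unfolding i_def using x(2) by (rule Least_le)
  have "exp (- x) \<le> 216 * (1/8) ^ i"
  proof (cases i)
    case 0
    have "exp (- x) \<le> 1" using x by simp
    also have "(1::real) \<le> 216 * (1/8) ^ i" using 0 by simp
    finally show ?thesis .
  next
    case (Suc j)
    have "\<not> x \<le> 2 ^ j" using not_less_Least[of j "\<lambda>i. x \<le> 2 ^ i"] Suc by (simp add: i_def)
    then have xj: "2 ^ j < x" by simp
    have xpos: "x > 0" using xj less_trans[of 0 "2 ^ j" x] by simp
    have "exp (- (x / 3)) \<le> 1 / (x / 3)" by (rule exp_minus_le_inverse) (use xpos in simp)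
    then have "exp (- (x / 3)) ^ 3 \<le> (1 / (x / 3)) ^ 3" by (intro power_mono) auto
    also have "exp (- (x / 3)) ^ 3 = exp (- x)" by (simp flip: exp_of_nat_mult)
    also have "(1 / (x / 3)) ^ 3 = 27 / x ^ 3" by (simp add: power_divide)
    also have "\<dots> \<le> 27 / (2 ^ j) ^ 3" using xj xpos by (intro divide_left_mono power_mono mult_pos_pos) auto
    also have "((2::real) ^ j) ^ 3 = 8 ^ j" by (subst power_mult[symmetric], subst mult.commute, subst power_mult) simp
    also have "27 / 8 ^ j = 216 * (1/8 :: real) ^ i" using Suc by (simp add: power_divide)
    finally show ?thesis .
  qed
  also have "(1/8) ^ i \<le> (\<Sum>i\<le>n. (1/8) ^ i * (if x \<le> 2 ^ i then 1 else 0 :: real))"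
    using member_le_sum[of i "{..n}" "\<lambda>i. (1/8) ^ i * (if x \<le> 2 ^ i then 1 else 0 :: real)"] i \<open>i \<le> n\<close> by simp
  finally show ?thesis by simp
qed

definition C\<^sub>4 :: real where "C\<^sub>4 = 432 * C\<^sub>3"

lemma C4_pos: "C\<^sub>4 > 0" by (simp add: C\<^sub>4_def C3_pos)

lemma weighted_large_sieve:
  assumes K: "K \<ge> 1" and X: "X > 0"
    and S: "finite S" "\<And>R. R \<in> S \<Longrightarrow> finite R \<and> R \<subseteq> PP \<and> rnorm (\<Prod>R) \<le> X"
    and F: "finite F" "0 \<notin> F"
  shows "(\<Sum>k\<in>F. exp (- rnorm k / K) * sqmod (\<Sum>R\<in>S. c R * chi R k))
    \<le> C\<^sub>4 * (X * K powr (1/4) + K\<^sup>2) * ell2 S c"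
proof -
  define f where "f = (\<lambda>k. sqmod (\<Sum>R\<in>S. c R * chi R k))"
  define m where "m = ell2 S c"
  have m0: "m \<ge> 0" by (auto simp: m_def intro: sum_nonneg)
  obtain n where n: "\<And>k. k \<in> F \<Longrightarrow> rnorm k / K \<le> 2 ^ n"
  proof -
    define M where "M = Max (insert 0 (gauss_norm ` F))"
    obtain n where "real M < 2 ^ n" using real_arch_pow[of 2 "real M"] by auto
    have "rnorm k / K \<le> 2 ^ n" if "k \<in> F" for k
    proof -
      have "gauss_norm k \<le> M" unfolding M_def using F that by (intro Max_ge) auto
      then have "rnorm k / K \<le> real M / 1" using K by (intro frac_le) auto
      then show ?thesis using \<open>real M < 2 ^ n\<close> by linarith
    qed
    then show ?thesis using that by blast
  qed
  have lay: "(\<Sum>k\<in>F. (if rnorm k / K \<le> 2 ^ i then 1 else 0) * f k) \<le> C\<^sub>3 * (X * (2 ^ i * K powr (1/4)) + 4 ^ i * K\<^sup>2) * m" for i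
  proof -
    define T where "T = nat \<lfloor>2 ^ i * K\<rfloor>"
    have "(1::real) * 1 \<le> 2 ^ i * K" using K by (intro mult_mono) auto
    then have T: "T \<ge> 1" "real T \<le> 2 ^ i * K" unfolding T_def by (auto simp: le_nat_floor)
    have "(\<Sum>k\<in>F. (if rnorm k / K \<le> 2 ^ i then 1 else 0) * f k) = (\<Sum>k\<in>F \<inter> {k. rnorm k / K \<le> 2 ^ i}. f k)"
      using F(1) by (subst sum.inter_restrict) (auto intro: sum.cong)
    also have "\<dots> \<le> (\<Sum>k\<in>gauss_upto T - {0}. f k)"
    proof (rule sum_mono2)
      show "F \<inter> {k. rnorm k / K \<le> 2 ^ i} \<subseteq> gauss_upto T - {0}"
        using F(2) K by (auto simp: gauss_upto_def T_def le_nat_floor pos_divide_le_eq)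
    qed (use finite_gauss_upto in \<open>auto simp: f_def\<close>)
    also have "\<dots> \<le> C\<^sub>3 * (X * real T powr (1/4) + (real T)\<^sup>2) * m"
      unfolding f_def m_def by (rule all_large_sieve[OF T(1) X S])
    also have "\<dots> \<le> C\<^sub>3 * (X * (2 ^ i * K powr (1/4)) + 4 ^ i * K\<^sup>2) * m"
    proof (intro mult_right_mono mult_left_mono add_mono m0)
      have "real T powr (1/4) \<le> (2 ^ i * K) powr (1/4)" using T by (intro powr_mono2) auto
      also have "\<dots> = (2 ^ i) powr (1/4) * K powr (1/4)" using K by (simp add: powr_mult)
      also have "\<dots> \<le> 2 ^ i * K powr (1/4)"
        using powr_mono[of "1/4" 1 "2 ^ i :: real"] by (intro mult_right_mono) auto
      finally show "real T powr (1/4) \<le> 2 ^ i * K powr (1/4)" .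
      have "(real T)\<^sup>2 \<le> (2 ^ i * K)\<^sup>2" using T by (intro power_mono) auto
      also have "\<dots> = 4 ^ i * K\<^sup>2" by (simp add: power_mult_distrib power2_eq_square flip: power_mult_distrib)
      finally show "(real T)\<^sup>2 \<le> 4 ^ i * K\<^sup>2" .
    qed (use X C3_pos in auto)
    finally show ?thesis .
  qed
  have "(\<Sum>k\<in>F. exp (- rnorm k / K) * f k) \<le>
    (\<Sum>k\<in>F. (216 * (\<Sum>i\<le>n. (1/8) ^ i * (if rnorm k / K \<le> 2 ^ i then 1 else 0))) * f k)"
  proof (intro sum_mono mult_right_mono)
    fix k assume "k \<in> F"
    then show "exp (- rnorm k / K) \<le> 216 * (\<Sum>i\<le>n. (1/8) ^ i * (if rnorm k / K \<le> 2 ^ i then 1 else 0))"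
      using exp_minus_layers[of "rnorm k / K" n] n K by simp
  qed (simp add: f_def)
  also have "\<dots> = 216 * (\<Sum>i\<le>n. (1/8) ^ i * (\<Sum>k\<in>F. (if rnorm k / K \<le> 2 ^ i then 1 else 0) * f k))"
    unfolding sum_distrib_left sum_distrib_right by (subst sum.swap) (simp only: mult_ac)
  also have "\<dots> \<le> 216 * (\<Sum>i\<le>n. (1/8) ^ i * (C\<^sub>3 * (X * (2 ^ i * K powr (1/4)) + 4 ^ i * K\<^sup>2) * m))"
    by (intro mult_left_mono sum_mono lay) auto
  also have "\<dots> \<le> 216 * (\<Sum>i\<le>n. C\<^sub>3 * (X * K powr (1/4) + K\<^sup>2) * m * (1/2) ^ i)"
  proof (intro mult_left_mono sum_mono)
    fix i
    have e: "(1/8::real) ^ i * 2 ^ i = (1/4) ^ i" "(1/8::real) ^ i * 4 ^ i = (1/2) ^ i" by (simp_all flip: power_mult_distrib)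
    have "(1/8) ^ i * (X * (2 ^ i * K powr (1/4)) + 4 ^ i * K\<^sup>2) = X * K powr (1/4) * ((1/8) ^ i * 2 ^ i) + K\<^sup>2 * ((1/8) ^ i * 4 ^ i)"
      by (simp add: algebra_simps)
    also have "\<dots> \<le> X * K powr (1/4) * (1/2) ^ i + K\<^sup>2 * (1/2) ^ i"
      unfolding e using X by (intro add_mono mult_left_mono power_mono) auto
    finally have le: "(1/8) ^ i * (X * (2 ^ i * K powr (1/4)) + 4 ^ i * K\<^sup>2) \<le> (X * K powr (1/4) + K\<^sup>2) * (1/2) ^ i" by (simp add: distrib_right)
    have "(1/8) ^ i * (C\<^sub>3 * (X * (2 ^ i * K powr (1/4)) + 4 ^ i * K\<^sup>2) * m) = C\<^sub>3 * m * ((1/8) ^ i * (X * (2 ^ i * K powr (1/4)) + 4 ^ i * K\<^sup>2))" by (simp only: mult_ac)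
    also have "\<dots> \<le> C\<^sub>3 * m * ((X * K powr (1/4) + K\<^sup>2) * (1/2) ^ i)" using C3_pos m0 by (intro mult_left_mono le) auto
    finally show "(1/8) ^ i * (C\<^sub>3 * (X * (2 ^ i * K powr (1/4)) + 4 ^ i * K\<^sup>2) * m) \<le> C\<^sub>3 * (X * K powr (1/4) + K\<^sup>2) * m * (1/2) ^ i" by (simp only: mult_ac)
  qed simp
  also have "\<dots> = 216 * (C\<^sub>3 * (X * K powr (1/4) + K\<^sup>2) * m * (\<Sum>i\<le>n. (1/2) ^ i))" by (simp only: sum_distrib_left)
  also have "\<dots> \<le> 216 * (C\<^sub>3 * (X * K powr (1/4) + K\<^sup>2) * m * 2)"
  proof (intro mult_left_mono)
    have "(\<Sum>i\<le>n. (1/2::real) ^ i) = 2 - (1/2) ^ n" by (induction n) auto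
    then show "(\<Sum>i\<le>n. (1/2::real) ^ i) \<le> 2" by simp
  qed (use C3_pos m0 X in auto)
  finally show ?thesis by (simp add: f_def m_def C\<^sub>4_def mult_ac)
qed

section \<open>Separation of variables\<close>

text \<open>Each factor \<open>\<delta> r + \<delta> t + \<delta> r * \<delta> t\<close> is a sum of three products of a function of \<open>r\<close> and a function of \<open>t\<close>,
  which can be moved into the coefficients at the cost of a factor at most \<open>\<eta>\<close> each.\<close>

lemma separation_power:
  fixes \<phi> :: "'r \<Rightarrow> 'k \<Rightarrow> complex" and \<delta> :: "'r \<Rightarrow> real"
  assumes \<omega>: "\<And>k. \<omega> k \<ge> 0" and L: "L \<ge> 0" and \<eta>: "\<eta> \<le> 1"
    and \<delta>: "\<And>r. r \<in> S \<Longrightarrow> 0 \<le> \<delta> r \<and> \<delta> r \<le> \<eta>"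
    and bound: "\<And>c. (\<Sum>k\<in>F. \<omega> k * sqmod (\<Sum>r\<in>S. c r * \<phi> r k)) \<le> L * ell2 S c"
    and \<eta>0: "\<eta> \<ge> 0"
  shows "cmod (\<Sum>k\<in>F. of_real (\<omega> k) * (\<Sum>r\<in>S. \<Sum>t\<in>S. c r * \<phi> r k * cnj (d t * \<phi> t k) * of_real ((\<delta> r + \<delta> t + \<delta> r * \<delta> t) ^ s)))
    \<le> L * (3 * \<eta>) ^ s * sqrt (ell2 S c) * sqrt (ell2 S d)"
proof (induction s arbitrary: c d)
  case 0
  define A where "A = (\<lambda>c k. \<Sum>r\<in>S. c r * \<phi> r k)"
  have "(\<Sum>k\<in>F. of_real (\<omega> k) * (\<Sum>r\<in>S. \<Sum>t\<in>S. c r * \<phi> r k * cnj (d t * \<phi> t k) * of_real ((\<delta> r + \<delta> t + \<delta> r * \<delta> t) ^ 0))) =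
    (\<Sum>k\<in>F. (of_real (sqrt (\<omega> k)) * A c k) * (of_real (sqrt (\<omega> k)) * cnj (A d k)))"
  proof (rule sum.cong[OF refl])
    fix k
    have "(\<Sum>r\<in>S. \<Sum>t\<in>S. c r * \<phi> r k * cnj (d t * \<phi> t k) * of_real ((\<delta> r + \<delta> t + \<delta> r * \<delta> t) ^ 0)) = A c k * cnj (A d k)"
      by (simp only: A_def cnj_sum sum_product power_0 of_real_1 mult_1_right)
    moreover have "complex_of_real (\<omega> k) = of_real (sqrt (\<omega> k)) * of_real (sqrt (\<omega> k))"
      using \<omega>[of k] by (simp flip: of_real_mult)
    ultimately show "of_real (\<omega> k) * (\<Sum>r\<in>S. \<Sum>t\<in>S. c r * \<phi> r k * cnj (d t * \<phi> t k) * of_real ((\<delta> r + \<delta> t + \<delta> r * \<delta> t) ^ 0)) =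
      (of_real (sqrt (\<omega> k)) * A c k) * (of_real (sqrt (\<omega> k)) * cnj (A d k))"
      by (simp only: mult_ac)
  qed
  also have "(cmod \<dots>)\<^sup>2 \<le> (\<Sum>k\<in>F. sqmod (of_real (sqrt (\<omega> k)) * A c k)) * (\<Sum>k\<in>F. sqmod (of_real (sqrt (\<omega> k)) * cnj (A d k)))"
    by (rule cauchy_schwarz_complex)
  also have "\<dots> = (\<Sum>k\<in>F. \<omega> k * sqmod (A c k)) * (\<Sum>k\<in>F. \<omega> k * sqmod (A d k))"
    using \<omega> by (simp add: norm_mult power_mult_distrib)
  also have "\<dots> \<le> (L * ell2 S c) * (L * ell2 S d)"
    unfolding A_def using \<omega> L by (intro mult_mono bound) (auto intro!: sum_nonneg mult_nonneg_nonneg)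
  also have "\<dots> = (L * sqrt (ell2 S c) * sqrt (ell2 S d))\<^sup>2"
  proof -
    have "(L * a) * (L * b) = (L * sqrt a * sqrt b)\<^sup>2" if "a \<ge> 0" "b \<ge> 0" for a b
      using that by (simp add: power_mult_distrib) (simp add: power2_eq_square)
    from this[OF sum_nonneg[OF zero_le_power2] sum_nonneg[OF zero_le_power2]] show ?thesis .
  qed
  finally show ?case unfolding power_0[of "3 * \<eta>"] mult_1_right[of L]
    by (rule power2_le_imp_le) (intro mult_nonneg_nonneg L real_sqrt_ge_zero sum_nonneg zero_le_power2)
next
  case (Suc s)
  define H where "H = (\<lambda>c d. \<Sum>k\<in>F. of_real (\<omega> k) * (\<Sum>r\<in>S. \<Sum>t\<in>S. c r * \<phi> r k * cnj (d t * \<phi> t k) * complex_of_real ((\<delta> r + \<delta> t + \<delta> r * \<delta> t) ^ s)))"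
  define m where "m = (\<lambda>c. \<lambda>r. complex_of_real (\<delta> r) * c r)"
  define N where "N = (\<lambda>c. sqrt (ell2 S c))"
  have N0: "N c \<ge> 0" for c by (simp add: N_def sum_nonneg)
  have Nm: "N (m c) \<le> \<eta> * N c" for c
  proof -
    have "(\<Sum>r\<in>S. sqmod (m c r)) \<le> (\<Sum>r\<in>S. \<eta>\<^sup>2 * sqmod (c r))"
      unfolding m_def norm_mult power_mult_distrib
      using \<delta> by (intro sum_mono mult_right_mono) (auto intro!: power_mono)
    also have "\<dots> = \<eta>\<^sup>2 * ell2 S c" by (simp only: sum_distrib_left)
    finally have "N (m c) \<le> sqrt (\<eta>\<^sup>2 * ell2 S c)" by (simp add: N_def)
    then show ?thesis using \<eta>0 by (simp add: N_def real_sqrt_mult)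
  qed
  have IH: "cmod (H c d) \<le> L * (3 * \<eta>) ^ s * N c * N d" for c d unfolding H_def N_def by (rule Suc.IH)
  have "(\<Sum>k\<in>F. of_real (\<omega> k) * (\<Sum>r\<in>S. \<Sum>t\<in>S. c r * \<phi> r k * cnj (d t * \<phi> t k) * complex_of_real ((\<delta> r + \<delta> t + \<delta> r * \<delta> t) ^ Suc s))) =
    H (m c) d + H c (m d) + H (m c) (m d)"
    unfolding H_def m_def sum.distrib[symmetric] distrib_left[symmetric]
    by (intro sum.cong refl arg_cong2[of _ _ _ _ "(*)"]) (simp add: algebra_simps)
  also have "cmod \<dots> \<le> cmod (H (m c) d) + cmod (H c (m d)) + cmod (H (m c) (m d))"
    by (intro order.trans[OF norm_triangle_ineq] add_mono norm_triangle_ineq order.refl)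
  also have "\<dots> \<le> L * (3 * \<eta>) ^ s * (\<eta> * N c) * N d + L * (3 * \<eta>) ^ s * N c * (\<eta> * N d) + L * (3 * \<eta>) ^ s * (\<eta> * N c) * (1 * N d)"
  proof (intro add_mono)
    have P0: "L * (3 * \<eta>) ^ s \<ge> 0" using L \<eta>0 by simp
    show "cmod (H (m c) d) \<le> L * (3 * \<eta>) ^ s * (\<eta> * N c) * N d"
      by (rule order.trans[OF IH]) (intro mult_right_mono mult_left_mono Nm P0 N0)
    show "cmod (H c (m d)) \<le> L * (3 * \<eta>) ^ s * N c * (\<eta> * N d)"
      by (rule order.trans[OF IH]) (intro mult_left_mono Nm mult_nonneg_nonneg P0 N0)
    have "N (m d) \<le> 1 * N d" using Nm[of d] \<eta> N0[of d] mult_right_mono[of \<eta> 1 "N d"] by linarith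
    then show "cmod (H (m c) (m d)) \<le> L * (3 * \<eta>) ^ s * (\<eta> * N c) * (1 * N d)"
      by (intro order.trans[OF IH] mult_mono mult_left_mono Nm mult_nonneg_nonneg P0 N0 \<eta>0)
  qed
  also have "\<dots> = L * (3 * \<eta>) ^ Suc s * N c * N d" by (simp add: algebra_simps)
  finally show ?case by (simp only: N_def)
qed

text \<open>In \<open>(1 + \<delta> r) * (1 + \<delta> t) = 1 + \<kappa> r t\<close> the exponential of \<open>- y k * \<kappa> r t\<close> is expanded into its Taylor series,
  whose terms are covered by \<open>separation_power\<close>.  The weight \<open>y\<^sup>s exp (- y) / s!\<close> is at most
  \<open>2\<^sup>s exp (- y / 2)\<close>, and with \<open>\<delta> \<le> 1 / 12\<close> the \<open>s\<close>-th term is at most \<open>(2 * 3 / 12)\<^sup>s = 2\<^sup>-\<^sup>s\<close> times the bound.\<close>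

lemma separation_exp:
  fixes \<phi> :: "'r \<Rightarrow> 'k \<Rightarrow> complex" and \<delta> :: "'r \<Rightarrow> real"
  assumes y: "\<And>k. y k \<ge> 0" and L: "L \<ge> 0"
    and \<delta>: "\<And>r. r \<in> S \<Longrightarrow> 0 \<le> \<delta> r \<and> \<delta> r \<le> 1 / 12"
    and bound: "\<And>c. (\<Sum>k\<in>F. exp (- y k / 2) * sqmod (\<Sum>r\<in>S. c r * \<phi> r k)) \<le> L * ell2 S c"
  shows "cmod (\<Sum>k\<in>F. \<Sum>r\<in>S. \<Sum>t\<in>S. c r * \<phi> r k * cnj (d t * \<phi> t k) * of_real (exp (- y k * ((1 + \<delta> r) * (1 + \<delta> t)))))
    \<le> 2 * L * sqrt (ell2 S c) * sqrt (ell2 S d)"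
proof -
  define N where "N = sqrt (ell2 S c) * sqrt (ell2 S d)"
  have N0: "N \<ge> 0" by (simp add: N_def sum_nonneg)
  define \<kappa> where "\<kappa> = (\<lambda>r t. \<delta> r + \<delta> t + \<delta> r * \<delta> t)"
  define \<omega> where "\<omega> = (\<lambda>s k. exp (- y k) * (y k ^ s / fact s))"
  define z where "z = (\<lambda>k r t. c r * \<phi> r k * cnj (d t * \<phi> t k))"
  define G where "G = (\<lambda>s. \<Sum>k\<in>F. of_real (\<omega> s k) * (\<Sum>r\<in>S. \<Sum>t\<in>S. z k r t * of_real (\<kappa> r t ^ s)))"
  have \<omega>0: "\<omega> s k \<ge> 0" for s k using y[of k] by (simp add: \<omega>_def)
  have \<omega>le: "\<omega> s k \<le> 2 ^ s * exp (- y k / 2)" for s k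
  proof -
    have "(y k / 2) ^ s / fact s \<le> exp (y k / 2)"
    proof -
      have "(\<Sum>n\<in>{s}. (y k / 2) ^ n /\<^sub>R fact n) \<le> (\<Sum>n. (y k / 2) ^ n /\<^sub>R fact n)"
        proof (rule sum_le_suminf[OF summable_exp_generic])
        fix n show "0 \<le> (y k / 2) ^ n /\<^sub>R fact n"
          unfolding scaleR_conv_of_real using y[of k] by (intro mult_nonneg_nonneg zero_le_power) auto
      qed simp
      moreover have "(\<Sum>n\<in>{s}. (y k / 2) ^ n /\<^sub>R fact n) = (y k / 2) ^ s / fact s"
        by (simp only: sum.insert[OF finite.emptyI] empty_iff not_False_eq_True sum.empty add_0_right real_scaleR_def divide_inverse mult.commute)
      moreover have "exp (y k / 2) = (\<Sum>n. (y k / 2) ^ n /\<^sub>R fact n)" by (simp only: exp_def)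
      ultimately show ?thesis by (simp only:)
    qed
    then have "exp (- y k) * (2 ^ s * ((y k / 2) ^ s / fact s)) \<le> exp (- y k) * (2 ^ s * exp (y k / 2))"
      by (intro mult_left_mono) auto
    also have "exp (- y k) * (2 ^ s * exp (y k / 2)) = 2 ^ s * exp (- y k / 2)"
      by (simp flip: exp_add)
    also have "exp (- y k) * (2 ^ s * ((y k / 2) ^ s / fact s)) = \<omega> s k" by (simp add: \<omega>_def power_divide)
    finally show ?thesis .
  qed
  have Gle: "cmod (G s) \<le> L * N * (1/2) ^ s" for s
  proof -
    have "cmod (G s) \<le> (2 ^ s * L) * (3 * (1/12)) ^ s * sqrt (ell2 S c) * sqrt (ell2 S d)"
      unfolding G_def z_def \<kappa>_def
    proof (rule separation_power[OF \<omega>0])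
      fix c
      have "(\<Sum>k\<in>F. \<omega> s k * sqmod (\<Sum>r\<in>S. c r * \<phi> r k)) \<le> (\<Sum>k\<in>F. 2 ^ s * (exp (- y k / 2) * sqmod (\<Sum>r\<in>S. c r * \<phi> r k)))"
        using \<omega>le by (intro sum_mono) (simp add: mult.assoc[symmetric] mult_right_mono)
      also have "\<dots> = 2 ^ s * (\<Sum>k\<in>F. exp (- y k / 2) * sqmod (\<Sum>r\<in>S. c r * \<phi> r k))" by (simp only: sum_distrib_left)
      also have "\<dots> \<le> 2 ^ s * (L * ell2 S c)" by (intro mult_left_mono bound) auto
      finally show "(\<Sum>k\<in>F. \<omega> s k * sqmod (\<Sum>r\<in>S. c r * \<phi> r k)) \<le> 2 ^ s * L * ell2 S c" by (simp add: mult.assoc)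
    qed (use L \<delta> in auto)
    also have "(2 ^ s * L) * (3 * (1/12)) ^ s = L * (1/2) ^ s"
    proof -
      have "(2::real) ^ s * (3 * (1/12)) ^ s = (1/2) ^ s" by (simp flip: power_mult_distrib)
      then show ?thesis by (simp add: mult_ac)
    qed
    finally show ?thesis by (simp add: N_def mult_ac)
  qed
  have sums: "(\<lambda>s. (- 1) ^ s * G s) sums (\<Sum>k\<in>F. \<Sum>r\<in>S. \<Sum>t\<in>S. z k r t * of_real (exp (- y k * ((1 + \<delta> r) * (1 + \<delta> t)))))"
  proof -
    have "(\<lambda>s. z k r t * of_real (exp (- y k) * ((- y k * \<kappa> r t) ^ s / fact s))) sums (z k r t * of_real (exp (- y k * ((1 + \<delta> r) * (1 + \<delta> t)))))" for k r t
    proof -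
      have "(\<lambda>s. (- y k * \<kappa> r t) ^ s /\<^sub>R fact s) sums exp (- y k * \<kappa> r t)" by (rule exp_converges)
      then have "(\<lambda>s. exp (- y k) * ((- y k * \<kappa> r t) ^ s / fact s)) sums (exp (- y k) * exp (- y k * \<kappa> r t))"
        by (intro sums_mult) (simp add: divide_inverse mult.commute)
      also have "exp (- y k) * exp (- y k * \<kappa> r t) = exp (- y k * ((1 + \<delta> r) * (1 + \<delta> t)))"
        by (simp add: \<kappa>_def algebra_simps flip: exp_add)
      finally show ?thesis by (intro sums_mult sums_of_real)
    qed
    then have "(\<lambda>s. \<Sum>k\<in>F. \<Sum>r\<in>S. \<Sum>t\<in>S. z k r t * of_real (exp (- y k) * ((- y k * \<kappa> r t) ^ s / fact s))) sums
      (\<Sum>k\<in>F. \<Sum>r\<in>S. \<Sum>t\<in>S. z k r t * of_real (exp (- y k * ((1 + \<delta> r) * (1 + \<delta> t)))))"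
      by (intro sums_sum)
    moreover have "(\<Sum>k\<in>F. \<Sum>r\<in>S. \<Sum>t\<in>S. z k r t * of_real (exp (- y k) * ((- y k * \<kappa> r t) ^ s / fact s))) = (- 1) ^ s * G s" for s
    proof -
      have "(- y k * \<kappa> r t) ^ s = (- 1) ^ s * (y k ^ s * \<kappa> r t ^ s)" for k r t
        unfolding power_mult_distrib[symmetric] by simp
      then show ?thesis unfolding G_def sum_distrib_left \<omega>_def
        by (intro sum.cong refl) (simp add: mult_ac)
    qed
    ultimately show ?thesis by simp
  qed
  have gs: "(\<lambda>s. L * N * (1/2) ^ s) sums (L * N * 2)"
    using sums_mult[OF geometric_sums[of "1/2 :: real"], of "L * N"] by simp
  have sn: "summable (\<lambda>s. norm ((- 1) ^ s * G s))"
    by (rule summable_comparison_test'[OF sums_summable[OF gs]]) (simp add: norm_mult norm_power Gle)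
  have "cmod (\<Sum>k\<in>F. \<Sum>r\<in>S. \<Sum>t\<in>S. z k r t * of_real (exp (- y k * ((1 + \<delta> r) * (1 + \<delta> t))))) = norm (\<Sum>s. (- 1) ^ s * G s)"
    using sums by (simp add: sums_iff)
  also have "\<dots> \<le> (\<Sum>s. norm ((- 1) ^ s * G s))" by (rule summable_norm[OF sn])
  also have "\<dots> \<le> (\<Sum>s. L * N * (1/2) ^ s)"
    by (rule suminf_le[OF _ sn sums_summable[OF gs]]) (simp add: norm_mult norm_power Gle)
  also have "\<dots> = L * N * 2" using gs by (simp add: sums_iff)
  also have "\<dots> = 2 * L * sqrt (ell2 S c) * sqrt (ell2 S d)" unfolding N_def mult.assoc[symmetric] mult.commute[of _ 2] by (rule refl)
  finally show ?thesis unfolding z_def .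
qed

section \<open>Poisson summation for the off-diagonal terms\<close>

lemma sum_Pow_sign:
  assumes "finite A"
  shows "(\<Sum>F\<in>Pow A. (- 1 :: complex) ^ card F) = (if A = {} then 1 else 0)"
  using assms
proof (induction A rule: finite_induct)
  case empty
  then show ?case by simp
next
  case (insert x A)
  have inj: "inj_on (insert x) (Pow A)"
  proof (rule inj_onI)
    fix F G assume "F \<in> Pow A" "G \<in> Pow A" "insert x F = insert x G"
    then show "F = G" using insert.hyps(2) by (metis Diff_insert_absorb PowD subsetD)
  qed
  have disj: "Pow A \<inter> insert x ` Pow A = {}" using insert.hyps(2) by auto
  have "(\<Sum>F\<in>Pow (insert x A). (- 1 :: complex) ^ card F) = (\<Sum>F\<in>Pow A. (- 1) ^ card F) + (\<Sum>F\<in>insert x ` Pow A. (- 1) ^ card F)"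
    unfolding Pow_insert using insert.hyps(1) disj by (intro sum.union_disjoint) auto
  also have "(\<Sum>F\<in>insert x ` Pow A. (- 1 :: complex) ^ card F) = (\<Sum>F\<in>Pow A. (- 1) ^ card (insert x F))"
    by (simp only: sum.reindex[OF inj] comp_def)
  also have "\<dots> = (\<Sum>F\<in>Pow A. - ((- 1) ^ card F))"
  proof (rule sum.cong[OF refl])
    fix F assume F: "F \<in> Pow A"
    then have "finite F" using insert.hyps(1) finite_subset by blast
    moreover have "x \<notin> F" using F insert.hyps(2) by blast
    ultimately show "(- 1 :: complex) ^ card (insert x F) = - ((- 1) ^ card F)" by simp
  qed
  finally show ?case by (simp add: sum_negf)
qed

text \<open>The common primes of two moduli contribute only the condition that \<open>q\<close> is coprime to them, which
  inclusion--exclusion resolves into divisibility conditions.\<close>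

lemma coprime_indicator:
  assumes D: "finite D" "D \<subseteq> PP"
  shows "chi D q * cnj (chi D q) = (\<Sum>E\<in>Pow D. (- 1) ^ card E * (if \<Prod>E dvd q then 1 else 0))"
proof -
  define B where "B = {p\<in>D. p dvd q}"
  have fB: "finite B" "B \<subseteq> D" using D(1) by (auto simp: B_def)
  have sub: "\<Prod>E dvd q \<longleftrightarrow> E \<in> Pow B" if "E \<in> Pow D" for E
  proof -
    have "finite E" "E \<subseteq> PP" using that D finite_subset by auto
    from PP_prod_dvd_iff[OF this, of q] show ?thesis using that by (auto simp: B_def)
  qed
  have "(\<Sum>E\<in>Pow D. (- 1) ^ card E * (if \<Prod>E dvd q then 1 else 0)) = (\<Sum>E\<in>Pow B. (- 1 :: complex) ^ card E)"
  proof (rule sum.mono_neutral_cong_right)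
    show "\<forall>E\<in>Pow D - Pow B. (- 1 :: complex) ^ card E * (if \<Prod>E dvd q then 1 else 0) = 0"
      using sub by auto
    fix E assume E: "E \<in> Pow B"
    then have "\<Prod>E dvd q" using sub[of E] fB(2) by blast
    then show "(- 1 :: complex) ^ card E * (if \<Prod>E dvd q then 1 else 0) = (- 1) ^ card E" by simp
  qed (use D(1) fB in auto)
  also have "\<dots> = (if B = {} then 1 else 0)" by (rule sum_Pow_sign[OF fB(1)])
  also have "\<dots> = chi D q * cnj (chi D q)"
  proof (cases "B = {}")
    case True
    then have "cmod (chi D q) = 1" by (intro chiE_norm D) (auto simp: B_def)
    then show ?thesis by (simp add: True flip: complex_norm_square)
  next
    case False
    then obtain p where "p \<in> D" "p dvd q" by (auto simp: B_def)
    from chiE_zero[OF D(1) this(1) _ this(2)] show ?thesis using False by simp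
  qed
  finally show ?thesis by simp
qed

lemma gsum_cong: "(\<And>p. p \<in> P \<Longrightarrow> e p = e' p) \<Longrightarrow> gsum P e k = gsum P e' k"
  unfolding gsum_def by (intro sum.cong refl arg_cong2[of _ _ _ _ "(*)"] chiE_cong) auto

lemma has_sum_multiples:
  fixes g :: "gauss_int \<Rightarrow> complex"
  assumes n: "n \<noteq> 0" and g: "((\<lambda>m. g (n * m)) has_sum x) UNIV"
  shows "((\<lambda>q. if n dvd q then g q else 0) has_sum x) UNIV"
proof -
  have inj: "inj ((*) n)" using n by (simp add: inj_on_def)
  have "(g has_sum x) (range ((*) n))"
    using g by (simp add: has_sum_reindex[OF inj] comp_def)
  moreover have "(g has_sum x) (range ((*) n)) \<longleftrightarrow> ((\<lambda>q. if n dvd q then g q else 0) has_sum x) UNIV"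
    by (rule has_sum_cong_neutral) (auto simp: dvd_def)
  ultimately show ?thesis by simp
qed

lemma char_gaussian_summable:
  assumes a: "a > 0" and h: "\<And>m. cmod (h m) \<le> 1"
  shows "(\<lambda>m. of_real (exp (- a * rnorm m)) * h m) summable_on UNIV"
proof -
  have "(\<lambda>m. norm (of_real (exp (- a * rnorm m)) * h m)) summable_on UNIV"
  proof (rule summable_on_comparison_test[OF summable_gauss_norm[OF a]])
    fix m
    have "exp (- a * rnorm m) * cmod (h m) \<le> exp (- a * rnorm m) * 1"
      by (intro mult_left_mono h) auto
    then show "norm (of_real (exp (- a * rnorm m)) * h m) \<le> exp (- a * rnorm m)"
      by (simp add: norm_mult)
  qed auto
  then show ?thesis by (rule abs_summable_summable)
qed

lemma norm_prod_union:
  assumes "finite A" "finite B" "A \<inter> B = {}"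
  shows "gauss_norm (\<Prod>(A \<union> B)) = gauss_norm (\<Prod>A) * gauss_norm (\<Prod>B)"
  using prod.union_disjoint[OF assms, of "\<lambda>p. p"] by (simp add: gauss_norm_mult)

text \<open>The summand at frequency \<open>k\<close> of the sum dual to a sum over the multiples of \<open>\<Prod>E\<close>, up to sign and
  coefficients: apart from the exponential it is a product of a function of \<open>R\<close> and a function of \<open>S\<close>.\<close>

definition dual_term :: "real \<Rightarrow> gauss_int set \<Rightarrow> gauss_int set \<Rightarrow> gauss_int set \<Rightarrow> gauss_int \<Rightarrow> complex" where
  "dual_term Q E R S k = of_real (Q / rnorm (\<Prod>E))
      * (chi R (\<Prod>E) / gsum R (\<lambda>_. 3) 1) * (cnj (chi S (\<Prod>E)) / gsum S (\<lambda>_. 1) 1)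
      * (cnj (chi R k) * chi S k)
      * of_real (exp (- pi * Q * rnorm k / (rnorm (\<Prod>E) * rnorm (\<Prod>R) * rnorm (\<Prod>S))))"

text \<open>The common part \<open>D\<close> is removed by inclusion--exclusion over its subsets \<open>E\<close>; on the multiples of \<open>\<Prod>E\<close> there
  remains a primitive character modulo \<open>\<Prod>R * \<Prod>S\<close>, and Poisson summation applies.  Its Gauss sum is the
  product of those for \<open>R\<close> and \<open>S\<close> and of two mixed symbols, which by reciprocity multiply to the sign
  \<open>sg\<close>.  Apart from this sign and the exponential, \<open>R\<close> and \<open>S\<close> are thus separated.\<close>

lemma offdiag_poisson:
  assumes P: "finite P1" "P1 \<subseteq> PP" "finite P2" "P2 \<subseteq> PP" and Q: "Q > 0"
    and D: "D = P1 \<inter> P2" and R: "R = P1 - D" and S: "S = P2 - D"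
    and sg: "sg = (- 1 :: complex) ^ (parE R (\<lambda>_. 1) * parE S (\<lambda>_. 1))"
  shows "((\<lambda>k. \<Sum>E\<in>Pow D. (- 1) ^ card E * sg * dual_term Q E R S k)
    has_sum (\<Sum>\<^sub>\<infinity>q. of_real (exp (- (pi / Q) * rnorm q)) * (chi P1 q * cnj (chi P2 q)))) UNIV"
proof -
  have fin: "finite R" "finite S" "finite D" "R \<subseteq> PP" "S \<subseteq> PP" "D \<subseteq> PP" using P by (auto simp: D R S)
  have disj: "R \<inter> S = {}" by (auto simp: D R S)
  have P12: "P1 = D \<union> R" "D \<inter> R = {}" "P2 = D \<union> S" "D \<inter> S = {}" by (auto simp: D R S)
  \<comment> \<open>The exponent \<open>3\<close> stands for the conjugate character.\<close>
  define f where "f = (\<lambda>p. if p \<in> R then 1 else 3 :: nat)"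
  have valid: "valid_exps (R \<union> S) f" using fin by (auto simp: valid_exps_def f_def)
  define psi where "psi = chiE (R \<union> S) f"
  have v1: "valid_exps S (\<lambda>_. 1)" "valid_exps R (\<lambda>_. 1)" using fin by (auto simp: valid_exps_def)
  have c3: "chiE S (\<lambda>_. 3) q = cnj (chi S q)" "chiE R (\<lambda>_. 3) q = cnj (chi R q)" for q
    using chiE_cnj[OF v1(1), of q] chiE_cnj[OF v1(2), of q] by simp_all
  have fR: "chiE R f q = chi R q" for q by (rule chiE_cong) (simp add: f_def)
  have fS: "chiE S f q = chiE S (\<lambda>_. 3) q" for q by (rule chiE_cong) (use disj in \<open>auto simp: f_def\<close>)
  have psi: "psi q = chi R q * cnj (chi S q)" for q
    unfolding psi_def chiE_union[OF fin(1,2) disj] fR fS c3 ..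
  have psi_le: "cmod (psi q) \<le> 1" for q unfolding psi_def using fin by (intro chiE_norm_le) auto
  have psi_mult: "psi (x * y) = psi x * psi y" for x y unfolding psi_def using fin by (intro chiE_mult) auto
  have prod12: "chi P1 q * cnj (chi P2 q) = (chi D q * cnj (chi D q)) * psi q" for q
    unfolding P12(1,3) chiE_union[OF fin(3,1) P12(2)] chiE_union[OF fin(3,2) P12(4)] psi by (simp add: mult_ac)
  define g where "g = gsum (R \<union> S) (\<lambda>p. 4 - f p) 1"
  have sg_sq: "sg * sg = 1" unfolding sg by (simp add: minus_one_power_iff)
  have gs: "g = sg * gsum R (\<lambda>_. 3) 1 * gsum S (\<lambda>_. 1) 1"
  proof -
    have a: "gsum R (\<lambda>p. 4 - f p) 1 = gsum R (\<lambda>_. 3) 1" "chiE R (\<lambda>p. 4 - f p) (\<Prod>S) = chiE R (\<lambda>_. 3) (\<Prod>S)"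
      by (rule gsum_cong, simp add: f_def) (rule chiE_cong, simp add: f_def)
    have b: "gsum S (\<lambda>p. 4 - f p) 1 = gsum S (\<lambda>_. 1) 1" "chiE S (\<lambda>p. 4 - f p) (\<Prod>R) = chi S (\<Prod>R)"
      by (rule gsum_cong, use disj in \<open>auto simp: f_def\<close>) (rule chiE_cong, use disj in \<open>auto simp: f_def\<close>)
    have "cmod (chi R (\<Prod>S)) = 1"
    proof (rule chiE_norm[OF fin(4)])
      fix p assume "p \<in> R"
      then have "p \<in> PP" "p \<notin> S" using fin disj by auto
      then show "\<not> p dvd \<Prod>S" using PP_dvd_prod_iff[OF _ fin(2,5)] by blast
    qed
    then have n: "chi R (\<Prod>S) * cnj (chi R (\<Prod>S)) = 1" by (simp flip: complex_norm_square)
    have "chi S (\<Prod>R) = sg * chi R (\<Prod>S)"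
      using reciprocity_sets[OF fin(5,4), of "\<lambda>_. 1"] by (simp add: sg mult.commute)
    then have "g = cnj (chi R (\<Prod>S)) * (sg * chi R (\<Prod>S)) * gsum R (\<lambda>_. 3) 1 * gsum S (\<lambda>_. 1) 1"
      unfolding g_def gsum_union[OF valid_exps_cnj[OF valid] disj] a b c3 by simp
    also have "\<dots> = (chi R (\<Prod>S) * cnj (chi R (\<Prod>S))) * (sg * gsum R (\<lambda>_. 3) 1 * gsum S (\<lambda>_. 1) 1)" by (simp only: mult_ac)
    finally show ?thesis unfolding n by simp
  qed
  define G where "G = (\<lambda>q. complex_of_real (exp (- (pi / Q) * rnorm q)) * psi q)"
  define nE where "nE = (\<lambda>E :: gauss_int set. rnorm (\<Prod>E))"
  have nRS: "rnorm (\<Prod>(R \<union> S)) = nE R * nE S" using norm_prod_union[OF fin(1,2) disj] by (simp add: nE_def)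
  define v where "v = (\<lambda>E. psi (\<Prod>E) * (\<Sum>\<^sub>\<infinity>m. of_real (exp (- pi * (nE E / Q) * rnorm m)) * psi m))"
  define T where "T = (\<lambda>E k. dual_term Q E R S k)"
  have T_eq: "T E k = of_real (Q / nE E) * (chi R (\<Prod>E) / gsum R (\<lambda>_. 3) 1) * (cnj (chi S (\<Prod>E)) / gsum S (\<lambda>_. 1) 1)
      * (cnj (chi R k) * chi S k) * complex_of_real (exp (- pi * Q * rnorm k / (nE E * nE R * nE S)))" for E k
    by (simp only: T_def dual_term_def nE_def)
  have nEpos: "nE E \<ge> 1" if "E \<subseteq> PP" for E using norm_prod_PP_pos[OF that] by (simp add: nE_def)
  have h1: "((\<lambda>q. if \<Prod>E dvd q then G q else 0) has_sum v E) UNIV" if E: "E \<in> Pow D" for E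
  proof (rule has_sum_multiples)
    have EP: "E \<subseteq> PP" using E fin by auto
    show "\<Prod>E \<noteq> 0" using prod_PP_nonzero[OF EP] .
    have "pi * (nE E / Q) > 0" using nEpos[OF EP] Q by simp
    from char_gaussian_summable[OF this psi_le]
    have "((\<lambda>m. psi (\<Prod>E) * (of_real (exp (- (pi * (nE E / Q)) * rnorm m)) * psi m)) has_sum v E) UNIV"
      unfolding v_def by (intro has_sum_cmult_right) (simp add: has_sum_infsum)
    moreover have "psi (\<Prod>E) * (of_real (exp (- (pi * (nE E / Q)) * rnorm m)) * psi m) = G (\<Prod>E * m)" for m
      by (simp add: G_def psi_mult gauss_norm_mult nE_def mult_ac)
    ultimately show "((\<lambda>m. G (\<Prod>E * m)) has_sum v E) UNIV" by simp
  qed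
  have h2: "((\<lambda>k. sg * T E k) has_sum v E) UNIV" if E: "E \<in> Pow D" for E
  proof -
    have EP: "E \<subseteq> PP" using E fin by auto
    have nE1: "nE E > 0" "nE R > 0" "nE S > 0" using nEpos[OF EP] nEpos[OF fin(4)] nEpos[OF fin(5)] by auto
    define a where "a = pi * Q / (nE E * nE R * nE S)"
    have a: "a > 0" using nE1 Q by (simp add: a_def)
    have t: "nE E / Q > 0" using nE1 Q by simp
    have eq: "- pi * x / (nE E / Q * (nE R * nE S)) = - a * x" for x using nE1 Q by (simp add: a_def field_simps)
    have v_eq: "v E = psi (\<Prod>E) * ((\<Sum>\<^sub>\<infinity>k. of_real (exp (- a * rnorm k)) * cnj (psi k)) / (of_real (nE E / Q) * g))"
      unfolding v_def poisson_char[OF valid t, folded psi_def g_def] nRS eq ..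
    have "(\<lambda>k. of_real (exp (- a * rnorm k)) * cnj (psi k)) summable_on UNIV"
      by (rule char_gaussian_summable[OF a]) (simp add: psi_le)
    then have "((\<lambda>k. psi (\<Prod>E) * (of_real (exp (- a * rnorm k)) * cnj (psi k) * inverse (of_real (nE E / Q) * g))) has_sum v E) UNIV"
      unfolding v_eq divide_inverse by (intro has_sum_cmult_right has_sum_cmult_left has_sum_infsum)
    moreover have "psi (\<Prod>E) * (of_real (exp (- a * rnorm k)) * cnj (psi k) * inverse (of_real (nE E / Q) * g)) = sg * T E k" for k
    proof -
      have i: "inverse (of_real (nE E / Q) * g) = sg * (of_real (Q / nE E) * inverse (gsum R (\<lambda>_. 3) 1) * inverse (gsum S (\<lambda>_. 1) 1))"
      proof -
        have "inverse sg = sg" using sg_sq by (rule inverse_unique)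
        moreover have "inverse (complex_of_real (nE E / Q)) = of_real (Q / nE E)" by (simp flip: of_real_inverse)
        ultimately show ?thesis unfolding gs inverse_mult_distrib by (simp only: mult_ac)
      qed
      have e: "- a * rnorm k = - pi * Q * rnorm k / (nE E * nE R * nE S)" by (simp add: a_def)
      show ?thesis unfolding i psi T_eq e divide_inverse[of "chi R _"] divide_inverse[of "cnj _"]
        by (simp only: complex_cnj_mult complex_cnj_cnj mult_ac)
    qed
    ultimately show ?thesis by simp
  qed
  have "((\<lambda>q. \<Sum>E\<in>Pow D. (- 1) ^ card E * (if \<Prod>E dvd q then G q else 0)) has_sum (\<Sum>E\<in>Pow D. (- 1) ^ card E * v E)) UNIV"
    by (intro has_sum_finite_sum has_sum_cmult_right h1)
  moreover have "(\<Sum>E\<in>Pow D. (- 1) ^ card E * (if \<Prod>E dvd q then G q else 0)) =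
      of_real (exp (- (pi / Q) * rnorm q)) * (chi P1 q * cnj (chi P2 q))" for q
  proof -
    have "(\<Sum>E\<in>Pow D. (- 1) ^ card E * (if \<Prod>E dvd q then G q else 0)) = (\<Sum>E\<in>Pow D. (- 1) ^ card E * (if \<Prod>E dvd q then 1 else 0)) * G q"
      unfolding sum_distrib_right by (intro sum.cong) auto
    then show ?thesis unfolding prod12 coprime_indicator[OF fin(3,6)] by (simp add: G_def mult_ac)
  qed
  ultimately have "(\<Sum>\<^sub>\<infinity>q. of_real (exp (- (pi / Q) * rnorm q)) * (chi P1 q * cnj (chi P2 q))) = (\<Sum>E\<in>Pow D. (- 1) ^ card E * v E)"
    by (intro infsumI) simp
  moreover have "((\<lambda>k. \<Sum>E\<in>Pow D. (- 1) ^ card E * (sg * T E k)) has_sum (\<Sum>E\<in>Pow D. (- 1) ^ card E * v E)) UNIV"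
    by (intro has_sum_finite_sum has_sum_cmult_right h2)
  ultimately show ?thesis by (simp only: T_def mult.assoc)
qed

section \<open>The large sieve over a short range of moduli\<close>

text \<open>The frequencies for given \<open>D\<close> and \<open>E\<close> have norm up to about \<open>nE * A\<^sup>2 / Q\<close>, where \<open>A = N / nD\<close> bounds the moduli
  that remain after removal of \<open>D\<close>; the case \<open>E = D = {}\<close> is the worst one.\<close>

lemma cell_numeric:
  fixes Q N nD nE A K' K C :: real
  assumes h: "Q \<ge> 1" "nE \<ge> 1" "nE \<le> nD" "A \<ge> 1" "N = A * nD" "C \<ge> 0"
    and K': "K' = max 1 (nE * A\<^sup>2 / Q)" and K: "K = max 1 (N\<^sup>2 / Q)"
  shows "Q / nE * (2 * (C * (A * K' powr (1/4) + K'\<^sup>2))) * (13 / 12 / A) \<le> 8 * C * (Q * K powr (1/4) + N ^ 3 / Q)"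
proof -
  have nD: "nD \<ge> 1" using h by simp
  have "nE * A\<^sup>2 \<le> nD\<^sup>2 * A\<^sup>2"
  proof (rule mult_right_mono)
    have "nD * 1 \<le> nD * nD" using nD by (intro mult_left_mono) auto
    then show "nE \<le> nD\<^sup>2" using h(3) by (simp add: power2_eq_square)
  qed simp
  then have NE: "nE * A\<^sup>2 \<le> N\<^sup>2" by (simp add: h(5) power_mult_distrib mult.commute)
  then have "nE * A\<^sup>2 / Q \<le> N\<^sup>2 / Q" using h(1) by (intro divide_right_mono) auto
  then have KK: "K' \<le> K" "K' \<ge> 1" "K \<ge> 1" unfolding K K' by auto
  have p: "K' powr (1/4) \<le> K powr (1/4)" "1 \<le> K powr (1/4)"
    using KK by (auto intro!: powr_mono2 ge_one_powr_ge_zero)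
  have h1: "Q / nE * K' powr (1/4) \<le> Q * K powr (1/4)"
  proof (rule mult_mono[OF _ p(1)])
    show "Q / nE \<le> Q" using h by (simp add: divide_le_eq mult_left_mono[of 1 nE Q, simplified])
  qed (use h in auto)
  have h2: "K'\<^sup>2 \<le> 1 + (nE * A\<^sup>2 / Q)\<^sup>2" unfolding K' max_def by simp
  have nEA: "nE * A \<ge> 1" using mult_mono[of 1 nE 1 A] h by simp
  have "Q / (nE * A) * K'\<^sup>2 \<le> Q / (nE * A) * (1 + (nE * A\<^sup>2 / Q)\<^sup>2)" using h nEA by (intro mult_left_mono h2) auto
  also have "\<dots> = Q / (nE * A) + nE * A ^ 3 / Q" using h by (simp add: field_simps power2_eq_square power3_eq_cube)
  also have "\<dots> \<le> Q + N ^ 3 / Q"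
  proof (rule add_mono)
    show "Q / (nE * A) \<le> Q" using h(1) nEA by (simp add: divide_le_eq mult_left_mono[of 1 "nE * A" Q, simplified])
    have "nD ^ 1 \<le> nD ^ 3" using nD by (intro power_increasing) auto
    then have "nE * A ^ 3 \<le> nD ^ 3 * A ^ 3" using h by (intro mult_right_mono) auto
    also have "\<dots> = N ^ 3" by (simp add: h(5) power_mult_distrib mult.commute)
    finally show "nE * A ^ 3 / Q \<le> N ^ 3 / Q" using h(1) by (intro divide_right_mono) auto
  qed
  also have "Q + N ^ 3 / Q \<le> Q * K powr (1/4) + N ^ 3 / Q" using p(2) h(1) mult_left_mono[of 1 "K powr (1/4)" Q] by simp
  finally have h3: "Q / (nE * A) * K'\<^sup>2 \<le> Q * K powr (1/4) + N ^ 3 / Q" .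
  have "Q / nE * (2 * (C * (A * K' powr (1/4) + K'\<^sup>2))) * (13 / 12 / A) = 13 / 6 * C * (Q / nE * K' powr (1/4) + Q / (nE * A) * K'\<^sup>2)"
    using h by (simp add: field_simps)
  also have "\<dots> \<le> 13 / 6 * C * (Q * K powr (1/4) + (Q * K powr (1/4) + N ^ 3 / Q))"
    using h(6) by (intro mult_left_mono add_mono h1 h3) auto
  also have "\<dots> \<le> 8 * C * (Q * K powr (1/4) + N ^ 3 / Q)"
  proof -
    have "0 \<le> N" using h by simp
    then have "0 \<le> C * (Q * K powr (1/4))" "0 \<le> C * (N ^ 3 / Q)" using h by auto
    then show ?thesis by (simp add: algebra_simps)
  qed
  finally show ?thesis .
qed

text \<open>Relative to the upper bound \<open>A\<close>, the reciprocal norms of the moduli \<open>P - D\<close> are \<open>(1 + \<delta> P) / A\<close> with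
  \<open>0 \<le> \<delta> P \<le> 1 / 12\<close>, because the norms in \<open>\<C>\<close> vary by a factor at most \<open>13 / 12\<close>.  So \<open>separation_exp\<close> removes
  the exponential, and \<open>weighted_large_sieve\<close> bounds the rest.\<close>

lemma cell_bilinear_bound:
  assumes C: "finite \<C>" and CP: "\<And>P. P \<in> \<C> \<Longrightarrow> finite P \<and> P \<subseteq> PP \<and> D \<subset> P"
    and CN: "\<And>P. P \<in> \<C> \<Longrightarrow> 12 / 13 * N \<le> rnorm (\<Prod>P) \<and> rnorm (\<Prod>P) \<le> N"
    and E: "E \<subseteq> D" and Q: "Q \<ge> 1" and F: "finite F" "0 \<notin> F"
  shows "cmod (\<Sum>k\<in>F. \<Sum>P1\<in>\<C>. \<Sum>P2\<in>\<C>. b P1 * cnj (b P2) * dual_term Q E (P1 - D) (P2 - D) k)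
    \<le> 8 * C\<^sub>4 * (Q * (max 1 (N\<^sup>2 / Q)) powr (1/4) + N ^ 3 / Q) * ell2 \<C> b"
proof (cases "\<C> = {}")
  case True
  then show ?thesis by simp
next
  case False
  then obtain P0 where P0: "P0 \<in> \<C>" by blast
  have fD: "finite D" "D \<subseteq> PP" using CP[OF P0] finite_subset by auto
  have fE: "finite E" "E \<subseteq> PP" using E fD finite_subset by auto
  define nn where "nn = (\<lambda>P :: gauss_int set. rnorm (\<Prod>P))"
  have nn1: "nn P \<ge> 1" if "P \<subseteq> PP" for P using norm_prod_PP_pos[OF that] by (simp add: nn_def)
  have nP: "nn P = nn D * nn (P - D)" if "P \<in> \<C>" for P
  proof -
    have "P = D \<union> (P - D)" using CP[OF that] by blast
    then show ?thesis using norm_prod_union[of D "P - D"] fD CP[OF that] by (simp add: nn_def)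
  qed
  have nD: "nn D \<ge> 1" "nn E \<ge> 1" using nn1 fD fE by auto
  have nED: "nn E \<le> nn D"
  proof -
    have "D = E \<union> (D - E)" using E by blast
    then have "nn D = nn E * nn (D - E)" using norm_prod_union[of E "D - E"] fD fE by (simp add: nn_def)
    moreover have "nn (D - E) \<ge> 1" using fD by (intro nn1) auto
    ultimately show ?thesis using nD(2) mult_left_mono[of 1 "nn (D - E)" "nn E"] by simp
  qed
  define A where "A = N / nn D"
  have N: "N = A * nn D" using nD by (simp add: A_def)
  have RP: "P - D \<subseteq> PP" "finite (P - D)" if "P \<in> \<C>" for P using CP[OF that] by auto
  have nR: "nn (P - D) \<ge> 1" "nn (P - D) \<le> A" "12 / 13 * A \<le> nn (P - D)" if "P \<in> \<C>" for P
  proof -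
    show "nn (P - D) \<ge> 1" using nn1 RP[OF that] by blast
    have "nn P \<le> N" "12 / 13 * N \<le> nn P" using CN[OF that] by (auto simp: nn_def)
    then have "nn D * nn (P - D) \<le> nn D * A" "nn D * (12 / 13 * A) \<le> nn D * nn (P - D)" unfolding nP[OF that] N by (simp_all add: mult_ac)
    then show "nn (P - D) \<le> A" "12 / 13 * A \<le> nn (P - D)" using nD by auto
  qed
  have A1: "A \<ge> 1" using nR[OF P0] by linarith
  define \<delta> where "\<delta> = (\<lambda>P. A / nn (P - D) - 1)"
  define y where "y = (\<lambda>k. pi * Q * rnorm k / (nn E * A\<^sup>2))"
  define \<phi> where "\<phi> = (\<lambda>P k. cnj (chi (P - D) k))"
  define u where "u = (\<lambda>P. b P * (chi (P - D) (\<Prod>E) / gsum (P - D) (\<lambda>_. 3) 1))"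
  define v where "v = (\<lambda>P. b P * (chi (P - D) (\<Prod>E) / cnj (gsum (P - D) (\<lambda>_. 1) 1)))"
  define \<beta> where "\<beta> = ell2 \<C> b"
  have \<beta>0: "\<beta> \<ge> 0" by (auto simp: \<beta>_def intro: sum_nonneg)
  define K' where "K' = max 1 (nn E * A\<^sup>2 / Q)"
  have K'1: "K' \<ge> 1" by (simp add: K'_def)
  define L where "L = C\<^sub>4 * (A * K' powr (1/4) + K'\<^sup>2)"
  have L0: "L \<ge> 0" using C4_pos A1 by (simp add: L_def)
  have quot: "sqmod (b P * (chi (P - D) (\<Prod>E) / z)) \<le> 13 / 12 / A * sqmod (b P)"
    if P: "P \<in> \<C>" and z: "sqmod z = nn (P - D)" for P z
  proof -
    have "sqmod (b P * (chi (P - D) (\<Prod>E) / z)) = sqmod (b P) * (sqmod (chi (P - D) (\<Prod>E)) / nn (P - D))"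
      by (simp add: norm_mult norm_divide power_mult_distrib power_divide z)
    also have "\<dots> \<le> sqmod (b P) * (1 / (12 / 13 * A))"
    proof (intro mult_left_mono frac_le)
      show "sqmod (chi (P - D) (\<Prod>E)) \<le> 1" using chiE_norm_le[OF RP(1)[OF P]] by (simp add: power_le_one)
    qed (use nR[OF P] A1 in auto)
    finally show ?thesis using A1 by (simp add: field_simps)
  qed
  have nu: "ell2 \<C> u \<le> 13 / 12 / A * \<beta>" "ell2 \<C> v \<le> 13 / 12 / A * \<beta>"
  proof -
    have "valid_exps (P - D) (\<lambda>_. 3)" "valid_exps (P - D) (\<lambda>_. 1)" if "P \<in> \<C>" for P
      using RP[OF that] by (auto simp: valid_exps_def)
    then have z: "sqmod (gsum (P - D) (\<lambda>_. 3) 1) = nn (P - D)" "sqmod (cnj (gsum (P - D) (\<lambda>_. 1) 1)) = nn (P - D)" if "P \<in> \<C>" for P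
      using gsum_norm_sq that by (auto simp: nn_def)
    show "ell2 \<C> u \<le> 13 / 12 / A * \<beta>" "ell2 \<C> v \<le> 13 / 12 / A * \<beta>"
      unfolding \<beta>_def sum_distrib_left u_def v_def using quot z by (auto intro!: sum_mono)
  qed
  have inj: "inj_on (\<lambda>P. P - D) \<C>"
  proof (rule inj_onI)
    fix P P' assume "P \<in> \<C>" "P' \<in> \<C>" "P - D = P' - D"
    then show "P = P'" using CP[of P] CP[of P'] by blast
  qed
  have sep: "cmod (\<Sum>k\<in>F. \<Sum>P1\<in>\<C>. \<Sum>P2\<in>\<C>. u P1 * \<phi> P1 k * cnj (v P2 * \<phi> P2 k) * of_real (exp (- y k * ((1 + \<delta> P1) * (1 + \<delta> P2)))))
      \<le> 2 * L * sqrt (ell2 \<C> u) * sqrt (ell2 \<C> v)"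
  proof (rule separation_exp[OF _ L0])
    show "y k \<ge> 0" for k using Q nD A1 by (simp add: y_def)
    fix P assume P: "P \<in> \<C>"
    have "A / nn (P - D) \<le> 13 / 12" using nR[OF P] by (simp add: divide_le_eq)
    moreover have "1 \<le> A / nn (P - D)" using nR[OF P] by (simp add: le_divide_eq)
    ultimately show "0 \<le> \<delta> P \<and> \<delta> P \<le> 1 / 12" by (simp add: \<delta>_def)
  next
    fix c :: "gauss_int set \<Rightarrow> complex"
    have le: "exp (- y k / 2) \<le> exp (- rnorm k / K')" for k
    proof -
      have "rnorm k / K' \<le> rnorm k / (nn E * A\<^sup>2 / Q)"
        using nD A1 Q by (intro divide_left_mono) (auto simp: K'_def)
      also have "\<dots> = 1 * (Q * rnorm k / (nn E * A\<^sup>2))" by simp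
      also have "\<dots> \<le> (pi / 2) * (Q * rnorm k / (nn E * A\<^sup>2))"
        using Q nD A1 pi_ge_two by (intro mult_right_mono) auto
      also have "\<dots> = y k / 2" by (simp add: y_def)
      finally show ?thesis by simp
    qed
    define d where "d = (\<lambda>R. cnj (c (R \<union> D)))"
    have cd: "cmod (\<Sum>P\<in>\<C>. c P * \<phi> P k) = cmod (\<Sum>R\<in>(\<lambda>P. P - D) ` \<C>. d R * chi R k)" for k
    proof -
      have "(\<Sum>R\<in>(\<lambda>P. P - D) ` \<C>. d R * chi R k) = (\<Sum>P\<in>\<C>. d (P - D) * chi (P - D) k)" by (simp only: sum.reindex[OF inj] comp_def)
      also have "\<dots> = (\<Sum>P\<in>\<C>. cnj (c P * \<phi> P k))"
      proof (rule sum.cong[OF refl])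
        fix P assume "P \<in> \<C>"
        then have "P - D \<union> D = P" using CP by blast
        then show "d (P - D) * chi (P - D) k = cnj (c P * \<phi> P k)" by (simp add: d_def \<phi>_def)
      qed
      also have "\<dots> = cnj (\<Sum>P\<in>\<C>. c P * \<phi> P k)" by (rule cnj_sum[symmetric])
      finally show ?thesis by (simp only: complex_mod_cnj)
    qed
    have "(\<Sum>k\<in>F. exp (- y k / 2) * sqmod (\<Sum>P\<in>\<C>. c P * \<phi> P k)) \<le> (\<Sum>k\<in>F. exp (- rnorm k / K') * sqmod (\<Sum>R\<in>(\<lambda>P. P - D) ` \<C>. d R * chi R k))"
      unfolding cd by (intro sum_mono mult_right_mono le) auto
    also have "\<dots> \<le> L * (\<Sum>R\<in>(\<lambda>P. P - D) ` \<C>. sqmod (d R))"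
      unfolding L_def
    proof (rule weighted_large_sieve[OF K'1 _ _ _ F])
      show "0 < A" using A1 by simp
      show "finite ((\<lambda>P. P - D) ` \<C>)" using C by simp
      fix R assume "R \<in> (\<lambda>P. P - D) ` \<C>"
      then obtain P where P: "P \<in> \<C>" "R = P - D" by blast
      then show "finite R \<and> R \<subseteq> PP \<and> rnorm (\<Prod>R) \<le> A" using nR(2)[OF P(1)] RP[OF P(1)] by (simp add: nn_def)
    qed
    also have "(\<Sum>R\<in>(\<lambda>P. P - D) ` \<C>. sqmod (d R)) = ell2 \<C> c"
    proof -
      have "(\<Sum>R\<in>(\<lambda>P. P - D) ` \<C>. sqmod (d R)) = (\<Sum>P\<in>\<C>. sqmod (d (P - D)))" by (simp only: sum.reindex[OF inj] comp_def)
      also have "\<dots> = ell2 \<C> c"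
      proof (rule sum.cong[OF refl])
        fix P assume "P \<in> \<C>"
        then have "P - D \<union> D = P" using CP by blast
        then show "sqmod (d (P - D)) = sqmod (c P)" by (simp add: d_def)
      qed
      finally show ?thesis .
    qed
    finally show "(\<Sum>k\<in>F. exp (- y k / 2) * sqmod (\<Sum>P\<in>\<C>. c P * \<phi> P k)) \<le> L * ell2 \<C> c" .
  qed
  have "(\<Sum>k\<in>F. \<Sum>P1\<in>\<C>. \<Sum>P2\<in>\<C>. b P1 * cnj (b P2) * dual_term Q E (P1 - D) (P2 - D) k) =
    of_real (Q / nn E) * (\<Sum>k\<in>F. \<Sum>P1\<in>\<C>. \<Sum>P2\<in>\<C>. u P1 * \<phi> P1 k * cnj (v P2 * \<phi> P2 k) * of_real (exp (- y k * ((1 + \<delta> P1) * (1 + \<delta> P2)))))"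
    unfolding sum_distrib_left
  proof (intro sum.cong refl)
    fix k P1 P2 assume P: "P1 \<in> \<C>" "P2 \<in> \<C>"
    have "- y k * ((1 + \<delta> P1) * (1 + \<delta> P2)) = - pi * Q * rnorm k / (nn E * nn (P1 - D) * nn (P2 - D))"
      using nR(1)[OF P(1)] nR(1)[OF P(2)] A1 nD by (simp add: y_def \<delta>_def power2_eq_square)
    then show "b P1 * cnj (b P2) * dual_term Q E (P1 - D) (P2 - D) k =
      of_real (Q / nn E) * (u P1 * \<phi> P1 k * cnj (v P2 * \<phi> P2 k) * of_real (exp (- y k * ((1 + \<delta> P1) * (1 + \<delta> P2)))))"
      by (simp only: dual_term_def nn_def u_def v_def \<phi>_def complex_cnj_mult complex_cnj_divide complex_cnj_cnj mult_ac)
  qed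
  also have "cmod \<dots> = Q / nn E * cmod (\<Sum>k\<in>F. \<Sum>P1\<in>\<C>. \<Sum>P2\<in>\<C>. u P1 * \<phi> P1 k * cnj (v P2 * \<phi> P2 k) * of_real (exp (- y k * ((1 + \<delta> P1) * (1 + \<delta> P2)))))"
    unfolding norm_mult norm_of_real using Q nD by simp
  also have "\<dots> \<le> Q / nn E * (2 * L * sqrt (ell2 \<C> u) * sqrt (ell2 \<C> v))"
    using Q nD by (intro mult_left_mono sep) auto
  also have "\<dots> \<le> Q / nn E * (2 * L * sqrt (13 / 12 / A * \<beta>) * sqrt (13 / 12 / A * \<beta>))"
    using Q nD L0 A1 \<beta>0 by (intro mult_left_mono mult_mono real_sqrt_le_mono nu) (auto intro!: sum_nonneg)
  also have "\<dots> = (Q / nn E * (2 * L) * (13 / 12 / A)) * \<beta>"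
  proof -
    have "13 / 12 / A * \<beta> \<ge> 0" using A1 \<beta>0 by simp
    then have "sqrt (13 / 12 / A * \<beta>) * sqrt (13 / 12 / A * \<beta>) = 13 / 12 / A * \<beta>" by (simp only: real_sqrt_mult_self abs_of_nonneg)
    then show ?thesis by (simp only: mult.assoc)
  qed
  also have "\<dots> \<le> (8 * C\<^sub>4 * (Q * (max 1 (N\<^sup>2 / Q)) powr (1/4) + N ^ 3 / Q)) * \<beta>"
    unfolding L_def using C4_pos by (intro mult_right_mono \<beta>0 cell_numeric[OF Q nD(2) nED A1 N _ K'_def refl]) auto
  finally show ?thesis unfolding \<beta>_def .
qed

lemma has_sum_norm_bound:
  fixes H :: "'a \<Rightarrow> complex"
  assumes "(H has_sum x) UNIV" "\<And>F. finite F \<Longrightarrow> cmod (sum H F) \<le> B"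
  shows "cmod x \<le> B"
proof (rule Lim_norm_ubound)
  show "(sum H \<longlongrightarrow> x) (finite_subsets_at_top UNIV)" using assms(1) by (simp add: has_sum_def)
  show "\<forall>\<^sub>F F in finite_subsets_at_top UNIV. cmod (sum H F) \<le> B"
    by (rule eventually_finite_subsets_at_top_weakI) (use assms(2) in auto)
qed simp

lemma sum4_swap: "(\<Sum>a\<in>A. \<Sum>b\<in>B. \<Sum>c\<in>C. \<Sum>d\<in>D. f a b c d) = (\<Sum>c\<in>C. \<Sum>d\<in>D. \<Sum>a\<in>A. \<Sum>b\<in>B. f a b c d)"
proof -
  have "(\<Sum>a\<in>A. \<Sum>b\<in>B. \<Sum>c\<in>C. \<Sum>d\<in>D. f a b c d) = (\<Sum>a\<in>A. \<Sum>c\<in>C. \<Sum>b\<in>B. \<Sum>d\<in>D. f a b c d)"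
    by (rule sum.cong[OF refl], rule sum.swap)
  also have "\<dots> = (\<Sum>c\<in>C. \<Sum>a\<in>A. \<Sum>b\<in>B. \<Sum>d\<in>D. f a b c d)" by (rule sum.swap)
  also have "\<dots> = (\<Sum>c\<in>C. \<Sum>a\<in>A. \<Sum>d\<in>D. \<Sum>b\<in>B. f a b c d)"
    by (rule sum.cong[OF refl], rule sum.cong[OF refl], rule sum.swap)
  also have "\<dots> = (\<Sum>c\<in>C. \<Sum>d\<in>D. \<Sum>a\<in>A. \<Sum>b\<in>B. f a b c d)"
    by (rule sum.cong[OF refl], rule sum.swap)
  finally show ?thesis .
qed

lemma sum_restrict_pairs:
  fixes w :: "'a \<Rightarrow> 'a \<Rightarrow> 'b :: comm_ring_1"
  assumes "finite A" "X \<subseteq> A"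
  shows "(\<Sum>a\<in>A. \<Sum>b\<in>A. c * (if a \<in> X \<and> b \<in> X then w a b else 0)) = c * (\<Sum>a\<in>X. \<Sum>b\<in>X. w a b)"
proof -
  have r: "sum g X = (\<Sum>a\<in>A. if a \<in> X then g a else 0)" for g :: "'a \<Rightarrow> 'b"
    using sum.inter_restrict[OF assms(1), of g X] assms(2) by (simp add: Int_absorb1)
  show ?thesis unfolding r sum_distrib_left
    by (intro sum.cong refl) (auto simp: sum_distrib_left intro: sum.cong)
qed

lemma norm_prod_ge_5:
  assumes "finite R" "R \<subseteq> PP" "R \<noteq> {}"
  shows "gauss_norm (\<Prod>R) \<ge> 5"
proof -
  obtain p where p: "p \<in> R" using assms(3) by blast
  have "gauss_norm (\<Prod>R) = gauss_norm p * gauss_norm (\<Prod>(R - {p}))"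
    using prod.remove[OF assms(1) p, of "\<lambda>q. q"] by (simp add: gauss_norm_mult)
  moreover have "gauss_norm p \<ge> 5" using p assms PP_norm_ge_5 by blast
  moreover have "gauss_norm (\<Prod>(R - {p})) \<ge> 1" using assms by (intro norm_prod_PP_pos) auto
  ultimately show ?thesis using mult_le_mono[of 5 "gauss_norm p" 1 "gauss_norm (\<Prod>(R - {p}))"] by simp
qed

text \<open>Poisson summation produces terms that depend on the intersection \<open>D\<close> of the two moduli.  Given a set \<open>D\<close>
  below both, the condition that the rests are disjoint is resolved by inclusion--exclusion over the
  common subsets \<open>G\<close>, which makes the ranges of \<open>P1\<close> and \<open>P2\<close> independent.  Requiring \<open>D\<close> to be a proper subset
  of both makes the sum vanish on the diagonal.\<close>

lemma moebius_pairs: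
  fixes z :: "gauss_int set \<Rightarrow> complex"
  assumes U: "finite U" "P1 \<subseteq> U" "P2 \<subseteq> U"
    and ne: "P1 \<noteq> P2 \<Longrightarrow> P1 \<inter> P2 \<subset> P1 \<and> P1 \<inter> P2 \<subset> P2"
  shows "(if P1 = P2 then 0 else z (P1 \<inter> P2)) =
    (\<Sum>D\<in>Pow U. \<Sum>G\<in>Pow U. (- 1) ^ card G * (if (D \<subset> P1 \<and> G \<subseteq> P1 - D) \<and> (D \<subset> P2 \<and> G \<subseteq> P2 - D) then z D else 0))"
proof -
  have inner: "(\<Sum>G\<in>Pow U. (- 1) ^ card G * (if (D \<subset> P1 \<and> G \<subseteq> P1 - D) \<and> (D \<subset> P2 \<and> G \<subseteq> P2 - D) then z D else 0))
    = (if D = P1 \<inter> P2 then (if P1 = P2 then 0 else z (P1 \<inter> P2)) else 0)" for D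
  proof (cases "D \<subset> P1 \<and> D \<subset> P2")
    case True
    define A where "A = (P1 - D) \<inter> (P2 - D)"
    have A: "A \<subseteq> U" using U by (auto simp: A_def)
    then have fA: "finite A" using U(1) finite_subset by blast
    have "(\<Sum>G\<in>Pow U. (- 1) ^ card G * (if (D \<subset> P1 \<and> G \<subseteq> P1 - D) \<and> (D \<subset> P2 \<and> G \<subseteq> P2 - D) then z D else 0))
      = (\<Sum>G\<in>Pow A. (- 1) ^ card G * z D)"
      by (rule sum.mono_neutral_cong_right) (use U(1) A True in \<open>auto simp: A_def\<close>)
    also have "\<dots> = (\<Sum>G\<in>Pow A. (- 1) ^ card G) * z D" by (simp only: sum_distrib_right)
    also have "\<dots> = (if A = {} then 1 else 0) * z D" unfolding sum_Pow_sign[OF fA] ..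
    also have "A = {} \<longleftrightarrow> D = P1 \<inter> P2" using True by (auto simp: A_def)
    finally show ?thesis using True by auto
  next
    case False
    then have h: "D = P1 \<inter> P2 \<Longrightarrow> P1 = P2" using ne by auto
    have c: "((D \<subset> P1 \<and> G \<subseteq> P1 - D) \<and> (D \<subset> P2 \<and> G \<subseteq> P2 - D)) = False" for G using False by blast
    show ?thesis unfolding c using h by simp
  qed
  have "P1 \<inter> P2 \<in> Pow U" using U by auto
  then show ?thesis unfolding inner using U(1) by simp
qed

text \<open>Two different moduli in \<open>\<C>\<close> never divide one another, since primes have norm at least \<open>5\<close> and the norms
  in \<open>\<C>\<close> vary by less than that.  So both rests are nontrivial, the frequency \<open>k = 0\<close> drops out, and
  \<open>cell_bilinear_bound\<close> applies to every \<open>D\<close>, \<open>G\<close> and \<open>E\<close>.  A given \<open>P\<close> occurs for at most \<open>8 ^ card P\<close> such triples.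
  The common parity makes the sign from \<open>offdiag_poisson\<close> a function of \<open>D\<close>.\<close>

lemma offdiag_total_bound:
  fixes b :: "gauss_int set \<Rightarrow> complex"
  assumes C: "finite \<C>" and CP: "\<And>P. P \<in> \<C> \<Longrightarrow> finite P \<and> P \<subseteq> PP"
    and CN: "\<And>P. P \<in> \<C> \<Longrightarrow> 12 / 13 * N \<le> rnorm (\<Prod>P) \<and> rnorm (\<Prod>P) \<le> N"
    and par: "\<And>P. P \<in> \<C> \<Longrightarrow> even (parE P (\<lambda>_. 1)) = s"
    and Q: "Q \<ge> 1" and N: "N \<ge> 0"
  shows "cmod (\<Sum>P1\<in>\<C>. \<Sum>P2\<in>\<C>. if P1 = P2 then 0 else b P1 * cnj (b P2)
      * (\<Sum>\<^sub>\<infinity>q. of_real (exp (- (pi / Q) * rnorm q)) * (chi P1 q * cnj (chi P2 q))))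
    \<le> 8 * C\<^sub>4 * (Q * (max 1 (N\<^sup>2 / Q)) powr (1/4) + N ^ 3 / Q) * (\<Sum>P\<in>\<C>. 8 ^ card P * sqmod (b P))"
proof -
  define V where "V = 8 * C\<^sub>4 * (Q * (max 1 (N\<^sup>2 / Q)) powr (1/4) + N ^ 3 / Q)"
  define \<beta> where "\<beta> = (\<lambda>P. sqmod (b P))"
  define T where "T = (\<lambda>P1 P2. \<Sum>\<^sub>\<infinity>q. of_real (exp (- (pi / Q) * rnorm q)) * (chi P1 q * cnj (chi P2 q)))"
  define Z where "Z = (\<lambda>R S E k. dual_term Q E R S k)"
  define Y where "Y = (\<lambda>D E P1 P2 k. b P1 * cnj (b P2) * Z (P1 - D) (P2 - D) E k)"
  define sgD where "sgD = (\<lambda>D. if even (parE D (\<lambda>_. 1)) = s then 1 else - 1 :: complex)"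
  define W where "W = (\<lambda>D P1 P2 k. \<Sum>E\<in>Pow D. (- 1) ^ card E * sgD D * Y D E P1 P2 k)"
  define H where "H = (\<lambda>k. \<Sum>P1\<in>\<C>. \<Sum>P2\<in>\<C>. if P1 = P2 then 0 else W (P1 \<inter> P2) P1 P2 k)"
  define U where "U = \<Union>\<C>"
  have U: "finite U" "\<And>P. P \<in> \<C> \<Longrightarrow> P \<subseteq> U" using C CP by (auto simp: U_def)
  define CD where "CD = (\<lambda>D G. {P\<in>\<C>. D \<subset> P \<and> G \<subseteq> P - D})"
  have CDsub: "CD D G \<subseteq> \<C>" "finite (CD D G)" for D G using C by (auto simp: CD_def)
  have noss: False if P: "P \<in> \<C>" "P' \<in> \<C>" "P \<subset> P'" for P P'
  proof -
    have e: "P' = P \<union> (P' - P)" using P by blast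
    have "gauss_norm (\<Prod>P') = gauss_norm (\<Prod>P) * gauss_norm (\<Prod>(P' - P))"
      using norm_prod_union[of P "P' - P"] CP[OF P(1)] CP[OF P(2)] e by auto
    moreover have "gauss_norm (\<Prod>(P' - P)) \<ge> 5" using P CP[OF P(2)] by (intro norm_prod_ge_5) auto
    moreover have one: "gauss_norm (\<Prod>P) \<ge> 1" using norm_prod_PP_pos CP[OF P(1)] by blast
    ultimately have "gauss_norm (\<Prod>P') \<ge> gauss_norm (\<Prod>P) * 5" by simp
    then have "rnorm (\<Prod>P') \<ge> rnorm (\<Prod>P) * 5" by linarith
    then show False using CN[OF P(1)] CN[OF P(2)] one by linarith
  qed
  have strict: "P1 \<inter> P2 \<subset> P1 \<and> P1 \<inter> P2 \<subset> P2" if "P1 \<in> \<C>" "P2 \<in> \<C>" "P1 \<noteq> P2" for P1 P2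
    using noss[OF that(1,2)] noss[OF that(2,1)] that(3) by blast
  have sgeq: "sgD D = (- 1) ^ (parE (P1 - D) (\<lambda>_. 1) * parE (P2 - D) (\<lambda>_. 1))" if P: "P1 \<in> \<C>" "P2 \<in> \<C>" "D = P1 \<inter> P2" for P1 P2 D
  proof -
    have "parE P (\<lambda>_. 1) = parE (P - D) (\<lambda>_. 1) + parE D (\<lambda>_. 1)" if "P \<in> \<C>" "D \<subseteq> P" for P
      unfolding parE_def using CP[OF that(1)] that(2) by (intro sum.subset_diff) auto
    then have "even (parE (P - D) (\<lambda>_. 1)) \<longleftrightarrow> (even (parE D (\<lambda>_. 1)) = s)" if "P \<in> \<C>" "D \<subseteq> P" for P
      using par[OF that(1)] that by auto
    from this[OF P(1)] this[OF P(2)] show ?thesis using P(3) unfolding sgD_def minus_one_power_iff even_mult_iff by auto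
  qed
  have hs: "(H has_sum (\<Sum>P1\<in>\<C>. \<Sum>P2\<in>\<C>. if P1 = P2 then 0 else b P1 * cnj (b P2) * T P1 P2)) UNIV"
    unfolding H_def
  proof (intro has_sum_finite_sum)
    fix P1 P2 assume P: "P1 \<in> \<C>" "P2 \<in> \<C>"
    show "((\<lambda>k. if P1 = P2 then 0 else W (P1 \<inter> P2) P1 P2 k) has_sum (if P1 = P2 then 0 else b P1 * cnj (b P2) * T P1 P2)) UNIV"
    proof (cases "P1 = P2")
      case True
      then show ?thesis by simp
    next
      case False
      define D where "D = P1 \<inter> P2"
      have "((\<lambda>k. \<Sum>E\<in>Pow D. (- 1) ^ card E * sgD D * Z (P1 - D) (P2 - D) E k) has_sum T P1 P2) UNIV"
        unfolding Z_def T_def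
        by (rule offdiag_poisson[OF _ _ _ _ _ D_def refl refl sgeq[OF P D_def]]) (use CP[OF P(1)] CP[OF P(2)] Q in auto)
      then have "((\<lambda>k. b P1 * cnj (b P2) * (\<Sum>E\<in>Pow D. (- 1) ^ card E * sgD D * Z (P1 - D) (P2 - D) E k)) has_sum (b P1 * cnj (b P2) * T P1 P2)) UNIV"
        by (rule has_sum_cmult_right)
      moreover have "b P1 * cnj (b P2) * (\<Sum>E\<in>Pow D. (- 1) ^ card E * sgD D * Z (P1 - D) (P2 - D) E k) = W D P1 P2 k" for k
        unfolding W_def Y_def sum_distrib_left by (intro sum.cong refl) (simp only: mult_ac)
      ultimately show ?thesis using False by (simp add: D_def)
    qed
  qed
  have H0: "H 0 = 0"
    unfolding H_def
  proof (intro sum.neutral ballI)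
    fix P1 P2 assume P: "P1 \<in> \<C>" "P2 \<in> \<C>"
    have "W (P1 \<inter> P2) P1 P2 0 = 0" if ne: "P1 \<noteq> P2"
    proof -
      define R where "R = P1 - P1 \<inter> P2"
      obtain p where "p \<in> R" using strict[OF P ne] by (auto simp: R_def)
      then have "chi R 0 = 0" using CP[OF P(1)] by (intro chiE_zero[of R p]) (auto simp: R_def)
      then show ?thesis unfolding W_def Y_def Z_def dual_term_def R_def[symmetric] by simp
    qed
    then show "(if P1 = P2 then 0 else W (P1 \<inter> P2) P1 P2 0) = 0" by simp
  qed
  have sumH: "sum H F = (\<Sum>D\<in>Pow U. \<Sum>G\<in>Pow U. (- 1) ^ card G * (\<Sum>E\<in>Pow D. (- 1) ^ card E * sgD D
      * (\<Sum>k\<in>F. \<Sum>P1\<in>CD D G. \<Sum>P2\<in>CD D G. Y D E P1 P2 k)))" for F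
  proof -
    have "H k = (\<Sum>D\<in>Pow U. \<Sum>G\<in>Pow U. (- 1) ^ card G * (\<Sum>P1\<in>CD D G. \<Sum>P2\<in>CD D G. W D P1 P2 k))" for k
    proof -
      have "H k = (\<Sum>P1\<in>\<C>. \<Sum>P2\<in>\<C>. \<Sum>D\<in>Pow U. \<Sum>G\<in>Pow U. (- 1) ^ card G * (if P1 \<in> CD D G \<and> P2 \<in> CD D G then W D P1 P2 k else 0))"
        unfolding H_def
      proof (intro sum.cong refl)
        fix P1 P2 assume P: "P1 \<in> \<C>" "P2 \<in> \<C>"
        have "(if P1 = P2 then 0 else W (P1 \<inter> P2) P1 P2 k) =
          (\<Sum>D\<in>Pow U. \<Sum>G\<in>Pow U. (- 1) ^ card G * (if (D \<subset> P1 \<and> G \<subseteq> P1 - D) \<and> (D \<subset> P2 \<and> G \<subseteq> P2 - D) then W D P1 P2 k else 0))"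
          using strict[OF P] by (intro moebius_pairs[OF U(1) U(2)[OF P(1)] U(2)[OF P(2)]])
        then show "(if P1 = P2 then 0 else W (P1 \<inter> P2) P1 P2 k) =
          (\<Sum>D\<in>Pow U. \<Sum>G\<in>Pow U. (- 1) ^ card G * (if P1 \<in> CD D G \<and> P2 \<in> CD D G then W D P1 P2 k else 0))"
          using P by (simp only: CD_def mem_Collect_eq simp_thms)
      qed
      also have "\<dots> = (\<Sum>D\<in>Pow U. \<Sum>G\<in>Pow U. \<Sum>P1\<in>\<C>. \<Sum>P2\<in>\<C>. (- 1) ^ card G * (if P1 \<in> CD D G \<and> P2 \<in> CD D G then W D P1 P2 k else 0))"
        by (rule sum4_swap)
      also have "\<dots> = (\<Sum>D\<in>Pow U. \<Sum>G\<in>Pow U. (- 1) ^ card G * (\<Sum>P1\<in>CD D G. \<Sum>P2\<in>CD D G. W D P1 P2 k))"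
        by (intro sum.cong refl sum_restrict_pairs C CDsub)
      finally show ?thesis .
    qed
    then have "sum H F = (\<Sum>k\<in>F. \<Sum>D\<in>Pow U. \<Sum>G\<in>Pow U. (- 1) ^ card G * (\<Sum>P1\<in>CD D G. \<Sum>P2\<in>CD D G. W D P1 P2 k))"
      by simp
    also have "\<dots> = (\<Sum>D\<in>Pow U. \<Sum>k\<in>F. \<Sum>G\<in>Pow U. (- 1) ^ card G * (\<Sum>P1\<in>CD D G. \<Sum>P2\<in>CD D G. W D P1 P2 k))"
      by (rule sum.swap)
    also have "\<dots> = (\<Sum>D\<in>Pow U. \<Sum>G\<in>Pow U. \<Sum>k\<in>F. (- 1) ^ card G * (\<Sum>P1\<in>CD D G. \<Sum>P2\<in>CD D G. W D P1 P2 k))"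
      by (rule sum.cong[OF refl], rule sum.swap)
    also have "\<dots> = (\<Sum>D\<in>Pow U. \<Sum>G\<in>Pow U. (- 1) ^ card G * (\<Sum>E\<in>Pow D. (- 1) ^ card E * sgD D
      * (\<Sum>k\<in>F. \<Sum>P1\<in>CD D G. \<Sum>P2\<in>CD D G. Y D E P1 P2 k)))"
    proof (intro sum.cong refl)
      fix D G
      have "(\<Sum>k\<in>F. \<Sum>P1\<in>CD D G. \<Sum>P2\<in>CD D G. W D P1 P2 k) = (\<Sum>k\<in>F. \<Sum>P1\<in>CD D G. \<Sum>E\<in>Pow D. \<Sum>P2\<in>CD D G. (- 1) ^ card E * sgD D * Y D E P1 P2 k)"
        unfolding W_def by (rule sum.cong[OF refl], rule sum.cong[OF refl], rule sum.swap)
      also have "\<dots> = (\<Sum>k\<in>F. \<Sum>E\<in>Pow D. \<Sum>P1\<in>CD D G. \<Sum>P2\<in>CD D G. (- 1) ^ card E * sgD D * Y D E P1 P2 k)"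
        by (rule sum.cong[OF refl], rule sum.swap)
      also have "\<dots> = (\<Sum>E\<in>Pow D. \<Sum>k\<in>F. \<Sum>P1\<in>CD D G. \<Sum>P2\<in>CD D G. (- 1) ^ card E * sgD D * Y D E P1 P2 k)"
        by (rule sum.swap)
      also have "\<dots> = (\<Sum>E\<in>Pow D. (- 1) ^ card E * sgD D * (\<Sum>k\<in>F. \<Sum>P1\<in>CD D G. \<Sum>P2\<in>CD D G. Y D E P1 P2 k))"
        by (simp only: sum_distrib_left)
      finally have "(\<Sum>k\<in>F. \<Sum>P1\<in>CD D G. \<Sum>P2\<in>CD D G. W D P1 P2 k) = \<dots>" .
      then show "(\<Sum>k\<in>F. (- 1) ^ card G * (\<Sum>P1\<in>CD D G. \<Sum>P2\<in>CD D G. W D P1 P2 k)) =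
        (- 1) ^ card G * (\<Sum>E\<in>Pow D. (- 1) ^ card E * sgD D * (\<Sum>k\<in>F. \<Sum>P1\<in>CD D G. \<Sum>P2\<in>CD D G. Y D E P1 P2 k))"
        by (simp only: sum_distrib_left[symmetric])
    qed
    finally show ?thesis .
  qed
  have count: "(\<Sum>D\<in>Pow U. \<Sum>G\<in>Pow U. \<Sum>E\<in>Pow D. \<Sum>P\<in>CD D G. \<beta> P) \<le> (\<Sum>P\<in>\<C>. 8 ^ card P * \<beta> P)"
  proof -
    have "(\<Sum>D\<in>Pow U. \<Sum>G\<in>Pow U. \<Sum>E\<in>Pow D. \<Sum>P\<in>CD D G. \<beta> P) \<le>
      (\<Sum>D\<in>Pow U. \<Sum>G\<in>Pow U. \<Sum>P\<in>\<C>. 1 * (if D \<in> Pow P \<and> G \<in> Pow P then 2 ^ card P * \<beta> P else 0))"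
    proof (intro sum_mono)
      fix D G assume "D \<in> Pow U" "G \<in> Pow U"
      then have fD: "finite D" using U finite_subset by blast
      have "(\<Sum>E\<in>Pow D. \<Sum>P\<in>CD D G. \<beta> P) = 2 ^ card D * (\<Sum>P\<in>CD D G. \<beta> P)" using fD by (simp add: card_Pow)
      also have "\<dots> = (\<Sum>P\<in>CD D G. 2 ^ card D * \<beta> P)" by (simp only: sum_distrib_left)
      also have "\<dots> \<le> (\<Sum>P\<in>CD D G. 1 * (if D \<in> Pow P \<and> G \<in> Pow P then 2 ^ card P * \<beta> P else 0))"
      proof (rule sum_mono)
        fix P assume P: "P \<in> CD D G"
        then have "card D \<le> card P" using CP by (intro card_mono) (auto simp: CD_def)
        then have "2 ^ card D * \<beta> P \<le> 2 ^ card P * \<beta> P" by (intro mult_right_mono power_increasing) (auto simp: \<beta>_def)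
        then show "2 ^ card D * \<beta> P \<le> 1 * (if D \<in> Pow P \<and> G \<in> Pow P then 2 ^ card P * \<beta> P else 0)"
          using P by (auto simp: CD_def)
      qed
      also have "\<dots> \<le> (\<Sum>P\<in>\<C>. 1 * (if D \<in> Pow P \<and> G \<in> Pow P then 2 ^ card P * \<beta> P else 0))"
        by (rule sum_mono2[OF C CDsub(1)]) (simp add: \<beta>_def)
      finally show "(\<Sum>E\<in>Pow D. \<Sum>P\<in>CD D G. \<beta> P) \<le> (\<Sum>P\<in>\<C>. 1 * (if D \<in> Pow P \<and> G \<in> Pow P then 2 ^ card P * \<beta> P else 0))" .
    qed
    also have "\<dots> = (\<Sum>D\<in>Pow U. \<Sum>P\<in>\<C>. \<Sum>G\<in>Pow U. 1 * (if D \<in> Pow P \<and> G \<in> Pow P then 2 ^ card P * \<beta> P else 0))"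
      by (rule sum.cong[OF refl], rule sum.swap)
    also have "\<dots> = (\<Sum>P\<in>\<C>. \<Sum>D\<in>Pow U. \<Sum>G\<in>Pow U. 1 * (if D \<in> Pow P \<and> G \<in> Pow P then 2 ^ card P * \<beta> P else 0))"
      by (rule sum.swap)
    also have "\<dots> = (\<Sum>P\<in>\<C>. 8 ^ card P * \<beta> P)"
    proof (rule sum.cong[OF refl])
      fix P assume P: "P \<in> \<C>"
      have "(\<Sum>D\<in>Pow U. \<Sum>G\<in>Pow U. 1 * (if D \<in> Pow P \<and> G \<in> Pow P then 2 ^ card P * \<beta> P else 0)) = 1 * (\<Sum>D\<in>Pow P. \<Sum>G\<in>Pow P. 2 ^ card P * \<beta> P)"
        using U(1) U(2)[OF P] by (intro sum_restrict_pairs) auto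
      also have "\<dots> = 2 ^ card P * (2 ^ card P * 2 ^ card P) * \<beta> P" using CP[OF P] by (simp add: card_Pow)
      also have "(2::real) ^ card P * (2 ^ card P * 2 ^ card P) = 8 ^ card P" unfolding power_mult_distrib[symmetric] by simp
      finally show "(\<Sum>D\<in>Pow U. \<Sum>G\<in>Pow U. 1 * (if D \<in> Pow P \<and> G \<in> Pow P then 2 ^ card P * \<beta> P else 0)) = 8 ^ card P * \<beta> P" .
    qed
    finally show ?thesis .
  qed
  have V0: "V \<ge> 0" using C4_pos Q N by (simp add: V_def)
  have fb: "cmod (sum H F) \<le> V * (\<Sum>P\<in>\<C>. 8 ^ card P * \<beta> P)" if F: "finite F" "0 \<notin> F" for F
  proof -
    have sg1: "cmod (sgD D) = 1" for D by (simp add: sgD_def)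
    have "cmod (sum H F) \<le> (\<Sum>D\<in>Pow U. \<Sum>G\<in>Pow U. \<Sum>E\<in>Pow D. V * (\<Sum>P\<in>CD D G. \<beta> P))"
      unfolding sumH
    proof (intro sum_norm_le)
      fix D G
      have "cmod (\<Sum>E\<in>Pow D. (- 1) ^ card E * sgD D * (\<Sum>k\<in>F. \<Sum>P1\<in>CD D G. \<Sum>P2\<in>CD D G. Y D E P1 P2 k)) \<le> (\<Sum>E\<in>Pow D. V * (\<Sum>P\<in>CD D G. \<beta> P))"
      proof (rule sum_norm_le)
        fix E assume E: "E \<in> Pow D"
        have "cmod (\<Sum>k\<in>F. \<Sum>P1\<in>CD D G. \<Sum>P2\<in>CD D G. Y D E P1 P2 k) \<le> V * (\<Sum>P\<in>CD D G. \<beta> P)"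
          unfolding Y_def Z_def V_def \<beta>_def
          by (rule cell_bilinear_bound[OF CDsub(2) _ _ _ Q F]) (use CP CN E in \<open>auto simp: CD_def\<close>)
        then show "cmod ((- 1) ^ card E * sgD D * (\<Sum>k\<in>F. \<Sum>P1\<in>CD D G. \<Sum>P2\<in>CD D G. Y D E P1 P2 k)) \<le> V * (\<Sum>P\<in>CD D G. \<beta> P)"
          by (simp add: norm_mult norm_power sg1)
      qed
      then show "cmod ((- 1) ^ card G * (\<Sum>E\<in>Pow D. (- 1) ^ card E * sgD D * (\<Sum>k\<in>F. \<Sum>P1\<in>CD D G. \<Sum>P2\<in>CD D G. Y D E P1 P2 k))) \<le> (\<Sum>E\<in>Pow D. V * (\<Sum>P\<in>CD D G. \<beta> P))"
        by (simp only: norm_mult norm_power norm_minus_cancel norm_one power_one mult_1_left)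
    qed
    also have "\<dots> = V * (\<Sum>D\<in>Pow U. \<Sum>G\<in>Pow U. \<Sum>E\<in>Pow D. \<Sum>P\<in>CD D G. \<beta> P)" by (simp only: sum_distrib_left)
    also have "\<dots> \<le> V * (\<Sum>P\<in>\<C>. 8 ^ card P * \<beta> P)" by (intro mult_left_mono count V0)
    finally show ?thesis .
  qed
  have "cmod (\<Sum>P1\<in>\<C>. \<Sum>P2\<in>\<C>. if P1 = P2 then 0 else b P1 * cnj (b P2) * T P1 P2) \<le> V * (\<Sum>P\<in>\<C>. 8 ^ card P * \<beta> P)"
  proof (rule has_sum_norm_bound[OF hs])
    fix F :: "gauss_int set" assume F: "finite F"
    have "sum H F = sum H (F - {0})" using F H0 by (intro sum.mono_neutral_right) auto
    then show "cmod (sum H F) \<le> V * (\<Sum>P\<in>\<C>. 8 ^ card P * \<beta> P)" using fb[of "F - {0}"] F by simp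
  qed
  then show ?thesis by (simp only: T_def V_def \<beta>_def)
qed

definition C\<^sub>5 :: real where "C\<^sub>5 = exp pi * (64 + 8 * C\<^sub>4)"

lemma C5_pos: "C\<^sub>5 > 0" using C4_pos by (simp add: C\<^sub>5_def add_pos_pos)

lemma gaussian_norm_sum_le:
  assumes "finite F" and Q: "Q \<ge> 1"
  shows "(\<Sum>q\<in>F. exp (- (pi / Q) * rnorm q)) \<le> 64 * Q"
proof -
  have "(\<Sum>q\<in>F. exp (- (pi / Q) * rnorm q)) \<le> (4 * (1 + 1 / sqrt (pi / Q)))\<^sup>2"
    using gaussian_sum_le[of "pi / Q" F 0] assms by (simp add: cmod_complex_of_gauss_sq)
  also have "\<dots> \<le> (4 * (2 * sqrt Q))\<^sup>2"
  proof (intro power_mono mult_left_mono)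
    have "sqrt (1 / Q) \<le> sqrt (pi / Q)" using Q pi_ge_two by (intro real_sqrt_le_mono divide_right_mono) auto
    then have "1 / sqrt (pi / Q) \<le> 1 / sqrt (1 / Q)" using Q by (intro divide_left_mono) auto
    also have "1 / sqrt (1 / Q) = sqrt Q" using Q by (simp add: real_sqrt_divide)
    finally have "1 / sqrt (pi / Q) \<le> sqrt Q" .
    moreover have "1 \<le> sqrt Q" using Q by simp
    ultimately show "1 + 1 / sqrt (pi / Q) \<le> 2 * sqrt Q" by linarith
  qed (use Q in auto)
  also have "\<dots> = 64 * Q" using Q by (simp add: power_mult_distrib)
  finally show ?thesis .
qed

text \<open>A Gaussian majorises the range of \<open>q\<close>; on the diagonal its sum is \<open>O(Q)\<close>.\<close>

lemma cell_large_sieve: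
  fixes b :: "gauss_int set \<Rightarrow> complex"
  assumes C: "finite \<C>" and CP: "\<And>P. P \<in> \<C> \<Longrightarrow> finite P \<and> P \<subseteq> PP"
    and CN: "\<And>P. P \<in> \<C> \<Longrightarrow> 12 / 13 * N \<le> rnorm (\<Prod>P) \<and> rnorm (\<Prod>P) \<le> N"
    and par: "\<And>P. P \<in> \<C> \<Longrightarrow> even (parE P (\<lambda>_. 1)) = s"
    and Q: "Q \<ge> 1" and N: "N \<ge> 0"
  shows "(\<Sum>q\<in>gauss_upto Q. sqmod (\<Sum>P\<in>\<C>. b P * chi P q))
    \<le> C\<^sub>5 * (real Q * (max 1 (N\<^sup>2 / real Q)) powr (1/4) + N ^ 3 / real Q) * (\<Sum>P\<in>\<C>. 8 ^ card P * sqmod (b P))"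
proof -
  define V where "V = real Q * (max 1 (N\<^sup>2 / real Q)) powr (1/4) + N ^ 3 / real Q"
  define \<beta> where "\<beta> = (\<Sum>P\<in>\<C>. 8 ^ card P * sqmod (b P))"
  have \<beta>0: "\<beta> \<ge> 0" unfolding \<beta>_def by (intro sum_nonneg) auto
  have Q1: "real Q \<ge> 1" using Q by simp
  have QV: "real Q \<le> V"
  proof -
    have "1 \<le> (max 1 (N\<^sup>2 / real Q)) powr (1/4)" by (intro ge_one_powr_ge_zero) auto
    then have "real Q * 1 \<le> real Q * (max 1 (N\<^sup>2 / real Q)) powr (1/4)" by (intro mult_left_mono) auto
    moreover have "0 \<le> N ^ 3 / real Q" using N by simp
    ultimately show ?thesis by (simp add: V_def)
  qed
  define w where "w = (\<lambda>q. exp (- (pi / real Q) * rnorm q))"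
  define T where "T = (\<lambda>P1 P2. \<Sum>\<^sub>\<infinity>q. of_real (w q) * (chi P1 q * cnj (chi P2 q)))"
  define f where "f = (\<lambda>P q. if P \<in> \<C> then chi P q else 0)"
  have w: "\<And>q. w q \<ge> 0" "w summable_on UNIV"
    unfolding w_def using summable_gauss_norm[of "pi / real Q"] Q by auto
  have f1: "cmod (f P q) \<le> 1" for P q using chiE_norm_le CP by (simp add: f_def)
  have ff: "(\<Sum>P\<in>\<C>. b P * f P q) = (\<Sum>P\<in>\<C>. b P * chi P q)" for q by (simp add: f_def cong: sum.cong)
  define x where "x = (\<Sum>\<^sub>\<infinity>q. w q * sqmod (\<Sum>P\<in>\<C>. b P * chi P q))"
  have sm: "(\<lambda>q. w q * sqmod (\<Sum>P\<in>\<C>. b P * chi P q)) summable_on UNIV"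
    using infsum_norm_square_expand(1)[where f = f and b = b, OF C w f1] by (simp only: ff)
  have "(\<Sum>q\<in>gauss_upto Q. sqmod (\<Sum>P\<in>\<C>. b P * chi P q)) \<le> (\<Sum>q\<in>gauss_upto Q. exp pi * (w q * sqmod (\<Sum>P\<in>\<C>. b P * chi P q)))"
  proof (rule sum_mono)
    fix q assume "q \<in> gauss_upto Q"
    then have "pi * (rnorm q / real Q) \<le> pi * 1" using Q by (intro mult_left_mono) (auto simp: gauss_upto_def)
    then have "1 \<le> exp pi * w q" unfolding w_def by (simp flip: exp_add)
    then have "1 * sqmod (\<Sum>P\<in>\<C>. b P * chi P q) \<le> exp pi * w q * sqmod (\<Sum>P\<in>\<C>. b P * chi P q)" by (intro mult_right_mono) auto
    then show "sqmod (\<Sum>P\<in>\<C>. b P * chi P q) \<le> exp pi * (w q * sqmod (\<Sum>P\<in>\<C>. b P * chi P q))" by (simp only: mult_1_left mult.assoc)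
  qed
  also have "\<dots> = exp pi * (\<Sum>q\<in>gauss_upto Q. w q * sqmod (\<Sum>P\<in>\<C>. b P * chi P q))" by (simp only: sum_distrib_left)
  also have "\<dots> \<le> exp pi * x"
    unfolding x_def using w(1) by (intro mult_left_mono finite_sum_le_infsum[OF sm] finite_gauss_upto) auto
  also have "x \<le> (64 + 8 * C\<^sub>4) * (V * \<beta>)"
  proof -
    have "complex_of_real x = (\<Sum>P1\<in>\<C>. \<Sum>P2\<in>\<C>. b P1 * cnj (b P2) * (\<Sum>\<^sub>\<infinity>q. of_real (w q) * (f P1 q * cnj (f P2 q))))"
      unfolding x_def using infsum_norm_square_expand(2)[where f = f and b = b, OF C w f1] by (simp only: ff)
    also have "\<dots> = (\<Sum>P1\<in>\<C>. \<Sum>P2\<in>\<C>. b P1 * cnj (b P2) * T P1 P2)"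
      by (intro sum.cong refl) (simp add: f_def T_def)
    also have "\<dots> = (\<Sum>P\<in>\<C>. b P * cnj (b P) * T P P) + (\<Sum>P1\<in>\<C>. \<Sum>P2\<in>\<C>. if P1 = P2 then 0 else b P1 * cnj (b P2) * T P1 P2)"
      unfolding sum.distrib[symmetric]
    proof (rule sum.cong[OF refl])
      fix P1 assume P1: "P1 \<in> \<C>"
      have "(\<Sum>P2\<in>\<C>. b P1 * cnj (b P2) * T P1 P2) = (\<Sum>P2\<in>\<C>. (if P1 = P2 then b P1 * cnj (b P2) * T P1 P2 else 0) + (if P1 = P2 then 0 else b P1 * cnj (b P2) * T P1 P2))"
        by (intro sum.cong) auto
      also have "\<dots> = b P1 * cnj (b P1) * T P1 P1 + (\<Sum>P2\<in>\<C>. if P1 = P2 then 0 else b P1 * cnj (b P2) * T P1 P2)"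
        using P1 C by (simp add: sum.distrib)
      finally show "(\<Sum>P2\<in>\<C>. b P1 * cnj (b P2) * T P1 P2) = b P1 * cnj (b P1) * T P1 P1 + (\<Sum>P2\<in>\<C>. if P1 = P2 then 0 else b P1 * cnj (b P2) * T P1 P2)" .
    qed
    finally have xeq: "complex_of_real x = \<dots>" .
    have x0: "x \<ge> 0" unfolding x_def using w(1) by (intro infsum_nonneg) auto
    have diag: "cmod (\<Sum>P\<in>\<C>. b P * cnj (b P) * T P P) \<le> (\<Sum>P\<in>\<C>. (64 * real Q) * (8 ^ card P * sqmod (b P)))"
    proof (rule sum_norm_le)
      fix P assume P: "P \<in> \<C>"
      have h1: "cmod (chi P q * cnj (chi P q)) \<le> 1" for q
        using chiE_norm_le[of P "\<lambda>_. 1" q] CP[OF P] by (simp add: norm_mult mult_le_one)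
      have TP: "cmod (T P P) \<le> 64 * real Q"
        unfolding T_def
      proof (rule has_sum_norm_bound[OF has_sum_infsum])
        show "(\<lambda>q. complex_of_real (w q) * (chi P q * cnj (chi P q))) summable_on UNIV"
          unfolding w_def by (rule char_gaussian_summable[OF _ h1]) (use Q in simp)
        fix F :: "gauss_int set" assume F: "finite F"
        have "cmod (\<Sum>q\<in>F. of_real (w q) * (chi P q * cnj (chi P q))) \<le> (\<Sum>q\<in>F. w q)"
        proof (rule sum_norm_le)
          fix q
          have "cmod (of_real (w q) * (chi P q * cnj (chi P q))) = w q * cmod (chi P q * cnj (chi P q))"
            using w(1)[of q] by (simp only: norm_mult norm_of_real abs_of_nonneg)
          also have "\<dots> \<le> w q * 1" by (intro mult_left_mono h1 w(1))
          finally show "cmod (of_real (w q) * (chi P q * cnj (chi P q))) \<le> w q" by simp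
        qed
        also have "\<dots> \<le> 64 * real Q" unfolding w_def by (rule gaussian_norm_sum_le[OF F Q1])
        finally show "cmod (\<Sum>q\<in>F. of_real (w q) * (chi P q * cnj (chi P q))) \<le> 64 * real Q" .
      qed
      have "cmod (b P * cnj (b P) * T P P) = (1 * sqmod (b P)) * cmod (T P P)" by (simp add: norm_mult power2_eq_square)
      also have "\<dots> \<le> (8 ^ card P * sqmod (b P)) * (64 * real Q)"
        by (intro mult_mono TP mult_right_mono one_le_power) auto
      finally show "cmod (b P * cnj (b P) * T P P) \<le> (64 * real Q) * (8 ^ card P * sqmod (b P))" by (simp only: mult.commute)
    qed
    have off: "cmod (\<Sum>P1\<in>\<C>. \<Sum>P2\<in>\<C>. if P1 = P2 then 0 else b P1 * cnj (b P2) * T P1 P2) \<le> 8 * C\<^sub>4 * V * \<beta>"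
      unfolding T_def w_def V_def \<beta>_def by (rule offdiag_total_bound[OF C CP CN par Q1 N])
    have "x = cmod (complex_of_real x)" using x0 by simp
    also have "\<dots> \<le> (\<Sum>P\<in>\<C>. (64 * real Q) * (8 ^ card P * sqmod (b P))) + 8 * C\<^sub>4 * V * \<beta>"
      unfolding xeq by (rule order.trans[OF norm_triangle_ineq add_mono[OF diag off]])
    also have "(\<Sum>P\<in>\<C>. (64 * real Q) * (8 ^ card P * sqmod (b P))) = 64 * real Q * \<beta>" by (simp only: \<beta>_def sum_distrib_left)
    also have "64 * real Q * \<beta> \<le> 64 * V * \<beta>" using QV \<beta>0 by (intro mult_right_mono) auto
    finally show ?thesis by (simp add: algebra_simps)
  qed
  finally show ?thesis by (simp add: C\<^sub>5_def V_def \<beta>_def mult.assoc)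
qed

section \<open>Smooth moduli and the recursive estimate\<close>

text \<open>Each of the finitely many primes with \<open>gauss_norm p powr \<epsilon> < 8\<close> costs a factor at most \<open>8\<close>, and every
  other prime pays for its own factor.\<close>

lemma eight_power_card_le:
  assumes e: "\<epsilon> > 0"
  shows "\<exists>K>0. \<forall>P. finite P \<longrightarrow> P \<subseteq> PP \<longrightarrow> 8 ^ card P \<le> K * rnorm (\<Prod>P) powr \<epsilon>"
proof -
  define T where "T = (8::real) powr (1 / \<epsilon>)"
  have Te: "T powr \<epsilon> = 8" using e by (simp add: T_def powr_powr)
  define S where "S = {p\<in>PP. rnorm p < T}"
  have S: "finite S"
  proof (rule finite_subset[OF _ finite_gauss_upto])
    show "S \<subseteq> gauss_upto (nat \<lfloor>T\<rfloor>)" by (auto simp: S_def gauss_upto_def le_nat_floor)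
  qed
  have "8 ^ card P \<le> 8 ^ card S * rnorm (\<Prod>P) powr \<epsilon>" if P: "finite P" "P \<subseteq> PP" for P
  proof -
    have "(8::real) ^ card P = (\<Prod>p\<in>P. 8)" by simp
    also have "\<dots> \<le> (\<Prod>p\<in>P. (if p \<in> S then 8 else 1) * rnorm p powr \<epsilon>)"
    proof (rule prod_mono)
      fix p assume p: "p \<in> P"
      then have n: "rnorm p \<ge> 5" using P PP_norm_ge_5[of p] by force
      show "0 \<le> (8::real) \<and> 8 \<le> (if p \<in> S then 8 else 1) * rnorm p powr \<epsilon>"
      proof (cases "p \<in> S")
        case True
        have "1 \<le> rnorm p powr \<epsilon>" using n e by (intro ge_one_powr_ge_zero) auto
        then show ?thesis using True by simp
      next
        case False
        then have "T \<le> rnorm p" using p P by (auto simp: S_def)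
        then have "T powr \<epsilon> \<le> rnorm p powr \<epsilon>" using e by (intro powr_mono2) (auto simp: T_def)
        then show ?thesis using False Te by simp
      qed
    qed
    also have "\<dots> = (\<Prod>p\<in>P. if p \<in> S then 8 else 1) * (\<Prod>p\<in>P. rnorm p) powr \<epsilon>"
      by (simp only: prod.distrib prod_powr_distrib)
    also have "(\<Prod>p\<in>P. if p \<in> S then 8 else 1 :: real) = 8 ^ card (P \<inter> S)"
      using prod.inter_restrict[OF P(1), of "\<lambda>_. 8 :: real" S] by simp
    also have "(\<Prod>p\<in>P. rnorm p) = rnorm (\<Prod>P)" by (simp add: gauss_norm_prod)
    also have "(8::real) ^ card (P \<inter> S) * rnorm (\<Prod>P) powr \<epsilon> \<le> 8 ^ card S * rnorm (\<Prod>P) powr \<epsilon>"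
      using S by (intro mult_right_mono power_increasing card_mono) auto
    finally show ?thesis .
  qed
  then show ?thesis by (intro exI[of _ "8 ^ card S"]) auto
qed

lemma cell_factor_le:
  fixes Q M N :: real
  assumes "Q \<ge> 1" "M \<ge> 1" "0 \<le> N" "N \<le> M"
  shows "Q * (max 1 (N\<^sup>2 / Q)) powr (1/4) + N ^ 3 / Q \<le> Q + Q powr (3/4) * M powr (1/2) + M ^ 3 / Q"
proof (rule add_mono)
  show "N ^ 3 / Q \<le> M ^ 3 / Q" using assms by (intro divide_right_mono power_mono) auto
  show "Q * (max 1 (N\<^sup>2 / Q)) powr (1/4) \<le> Q + Q powr (3/4) * M powr (1/2)"
  proof (cases "N\<^sup>2 / Q \<le> 1")
    case True
    then show ?thesis using assms by simp
  next
    case False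
    have "(N\<^sup>2 / Q) powr (1/4) \<le> (M\<^sup>2 / Q) powr (1/4)"
      using assms by (intro powr_mono2 divide_right_mono power_mono) auto
    also have "\<dots> = M powr (1/2) / Q powr (1/4)"
    proof -
      have "(M\<^sup>2) powr (1/4) = M powr (1/2)" using assms by (simp add: powr_powr flip: powr_numeral)
      then show ?thesis by (simp add: powr_divide)
    qed
    finally have "Q * (N\<^sup>2 / Q) powr (1/4) \<le> Q * (M powr (1/2) / Q powr (1/4))" using assms by (intro mult_left_mono) auto
    also have "\<dots> = (Q powr 1 / Q powr (1/4)) * M powr (1/2)" using assms by simp
    also have "Q powr 1 / Q powr (1/4) = Q powr (3/4)" by (simp only: powr_diff[symmetric]) simp
    finally show ?thesis using False assms by simp
  qed
qed

text \<open>The moduli are divided according to parity and into ranges \<open>12 / 13 * N \<le> gauss_norm (\<Prod>P) \<le> N\<close>.  There are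
  \<open>O(ln M)\<close> classes, so Cauchy--Schwarz over the classes is affordable.\<close>

lemma recursive_large_sieve:
  assumes e: "\<epsilon> > 0"
  shows "\<exists>C>0. \<forall>Q M b. Q \<ge> 1 \<longrightarrow> M \<ge> 1 \<longrightarrow> (\<Sum>q\<in>gauss_upto Q. sqmod (\<Sum>P\<in>psets M. b P * chi P q))
    \<le> C * real M powr \<epsilon> * (real Q + real Q powr (3/4) * real M powr (1/2) + real M ^ 3 / real Q) * ell2 (psets M) b"
proof -
  obtain K where K: "K > 0" "\<And>P. finite P \<Longrightarrow> P \<subseteq> PP \<Longrightarrow> 8 ^ card P \<le> K * rnorm (\<Prod>P) powr (\<epsilon> / 2)"
    using eight_power_card_le[of "\<epsilon> / 2"] e by auto
  define r where "r = (13 / 12 :: real)"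
  have r: "r > 1" "ln r > 0" by (auto simp: r_def)
  define C where "C = 2 * (1 + 2 / (\<epsilon> * ln r)) * C\<^sub>5 * K"
  have Cpos: "C > 0" unfolding C_def using e r K C5_pos by (intro mult_pos_pos add_pos_pos divide_pos_pos) auto
  have main: "(\<Sum>q\<in>gauss_upto Q. sqmod (\<Sum>P\<in>psets M. b P * chi P q))
    \<le> C * real M powr \<epsilon> * (real Q + real Q powr (3/4) * real M powr (1/2) + real M ^ 3 / real Q) * ell2 (psets M) b"
    if Q: "Q \<ge> 1" and M: "M \<ge> 1" for Q M b
  proof -
    define V where "V = real Q + real Q powr (3/4) * real M powr (1/2) + real M ^ 3 / real Q"
    have V0: "V \<ge> 0" by (simp add: V_def)
    define nn where "nn = (\<lambda>P :: gauss_int set. rnorm (\<Prod>P))"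
    define idx where "idx = (\<lambda>P. nat \<lfloor>log r (real M / nn P)\<rfloor>)"
    define J where "J = nat \<lfloor>log r (real M)\<rfloor>"
    define I where "I = {..J} \<times> (UNIV :: bool set)"
    define g where "g = (\<lambda>P. (idx P, even (parE P (\<lambda>_. 1))))"
    define cell where "cell = (\<lambda>i. {P. P \<in> psets M \<and> g P = i})"
    have P: "finite P" "P \<subseteq> PP" "1 \<le> nn P" "nn P \<le> real M" if "P \<in> psets M" for P
      using that norm_prod_PP_pos[of P] by (auto simp: psets_def nn_def)
    have finI: "finite I" by (simp add: I_def)
    have gI: "g ` psets M \<subseteq> I"
    proof (rule image_subsetI)
      fix P assume h: "P \<in> psets M"
      have "real M / nn P \<le> real M" using P[OF h] by (simp add: divide_le_eq mult_left_mono[of 1 "nn P" "real M", simplified])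
      moreover have "real M / nn P > 0" using P[OF h] M by simp
      ultimately have "log r (real M / nn P) \<le> log r (real M)" using r by (simp add: log_le_cancel_iff)
      then show "g P \<in> I" by (auto simp: g_def I_def idx_def J_def intro!: nat_mono floor_mono)
    qed
    have idx: "r ^ idx P \<le> real M / nn P" "real M / nn P < r * r ^ idx P" if h: "P \<in> psets M" for P
    proof -
      define x where "x = real M / nn P"
      have x: "x \<ge> 1" using P[OF h] by (simp add: x_def)
      then have l0: "log r x \<ge> 0" using r by (simp add: zero_le_log_cancel_iff)
      then have i: "real (idx P) \<le> log r x" "log r x < real (idx P) + 1" unfolding idx_def x_def[symmetric] by linarith+
      have rx: "r powr log r x = x" using r x by (intro powr_log_cancel) auto
      have "r powr real (idx P) \<le> r powr log r x" "r powr log r x < r powr (1 + real (idx P))"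
        using i r by (auto intro!: powr_mono powr_less_mono)
      then show "r ^ idx P \<le> real M / nn P" "real M / nn P < r * r ^ idx P"
        unfolding rx powr_add x_def[symmetric] using r by (simp_all add: powr_realpow)
    qed
    have cell_le: "(\<Sum>q\<in>gauss_upto Q. sqmod (\<Sum>P\<in>cell i. b P * chi P q)) \<le> C\<^sub>5 * V * (K * real M powr (\<epsilon> / 2)) * ell2 (cell i) b" for i
    proof -
      obtain j s where i: "i = (j, s)" by (cases i)
      define N where "N = real M / r ^ j"
      have rj: "r ^ j \<ge> 1" using r by simp
      have N: "0 \<le> N" "N \<le> real M"
        using rj M by (auto simp: N_def divide_le_eq mult_left_mono[of 1 "r ^ j" "real M", simplified])
      have inc: "P \<in> psets M" "idx P = j" "even (parE P (\<lambda>_. 1)) = s" if "P \<in> cell i" for P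
        using that i by (auto simp: cell_def g_def)
      have "(\<Sum>q\<in>gauss_upto Q. sqmod (\<Sum>P\<in>cell i. b P * chi P q))
        \<le> C\<^sub>5 * (real Q * (max 1 (N\<^sup>2 / real Q)) powr (1/4) + N ^ 3 / real Q) * (\<Sum>P\<in>cell i. 8 ^ card P * sqmod (b P))"
      proof (rule cell_large_sieve[OF _ _ _ inc(3) Q N(1)])
        show "finite (cell i)" by (rule finite_subset[OF _ finite_psets[of M]]) (auto simp: cell_def)
        fix Pa assume h: "Pa \<in> cell i"
        show "finite Pa \<and> Pa \<subseteq> PP" using P[OF inc(1)[OF h]] by blast
        have a: "r ^ j \<le> real M / nn Pa" "real M / nn Pa < r * r ^ j" using idx[OF inc(1)[OF h]] inc(2)[OF h] by auto
        have n: "nn Pa > 0" using P[OF inc(1)[OF h]] by simp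
        have "nn Pa * r ^ j \<le> real M" using a(1) n by (simp add: le_divide_eq mult.commute)
        then have b1: "nn Pa \<le> N" using rj by (simp add: N_def le_divide_eq)
        have "real M < r * r ^ j * nn Pa" using a(2) n by (simp add: divide_less_eq)
        then have "N < r * nn Pa" using rj by (simp add: N_def divide_less_eq mult_ac)
        then have "12 / 13 * N \<le> nn Pa" by (simp add: r_def)
        then show "12 / 13 * N \<le> rnorm (\<Prod>Pa) \<and> rnorm (\<Prod>Pa) \<le> N" using b1 by (simp add: nn_def)
      qed
      also have "\<dots> \<le> C\<^sub>5 * V * (\<Sum>P\<in>cell i. (K * real M powr (\<epsilon> / 2)) * sqmod (b P))"
      proof (intro mult_mono sum_mono)
        show "real Q * (max 1 (N\<^sup>2 / real Q)) powr (1/4) + N ^ 3 / real Q \<le> V"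
          unfolding V_def by (rule cell_factor_le) (use Q M N in auto)
        fix Pa assume h: "Pa \<in> cell i"
        have "8 ^ card Pa \<le> K * nn Pa powr (\<epsilon> / 2)" using K(2) P[OF inc(1)[OF h]] by (simp add: nn_def)
        also have "\<dots> \<le> K * real M powr (\<epsilon> / 2)" using P[OF inc(1)[OF h]] K(1) e by (intro mult_left_mono powr_mono2) auto
        finally show "8 ^ card Pa \<le> K * real M powr (\<epsilon> / 2)" .
      qed (use C5_pos V0 K(1) N Q in \<open>auto intro!: sum_nonneg\<close>)
      also have "\<dots> = C\<^sub>5 * V * (K * real M powr (\<epsilon> / 2)) * ell2 (cell i) b"
        by (simp only: sum_distrib_left mult.assoc)
      finally show ?thesis .
    qed
    have split: "(\<Sum>P\<in>psets M. b P * chi P q) = (\<Sum>i\<in>I. \<Sum>P\<in>cell i. b P * chi P q)" for q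
      unfolding cell_def by (rule sum.group[OF finite_psets finI gI, symmetric])
    have split': "(\<Sum>i\<in>I. \<Sum>P\<in>cell i. sqmod (b P)) = ell2 (psets M) b"
      unfolding cell_def by (rule sum.group[OF finite_psets finI gI])
    have cs: "sqmod (\<Sum>i\<in>I. f i) \<le> real (card I) * ell2 I f" for f
      using cauchy_schwarz_complex[of "\<lambda>_. 1" f I] by simp
    have "(\<Sum>q\<in>gauss_upto Q. sqmod (\<Sum>P\<in>psets M. b P * chi P q)) \<le> (\<Sum>q\<in>gauss_upto Q. real (card I) * (\<Sum>i\<in>I. sqmod (\<Sum>P\<in>cell i. b P * chi P q)))"
      unfolding split by (intro sum_mono cs)
    also have "\<dots> = real (card I) * (\<Sum>i\<in>I. \<Sum>q\<in>gauss_upto Q. sqmod (\<Sum>P\<in>cell i. b P * chi P q))"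
      unfolding sum_distrib_left[symmetric] by (subst sum.swap) (rule refl)
    also have "\<dots> \<le> real (card I) * (\<Sum>i\<in>I. C\<^sub>5 * V * (K * real M powr (\<epsilon> / 2)) * ell2 (cell i) b)"
      by (intro mult_left_mono sum_mono cell_le) auto
    also have "\<dots> = real (card I) * (C\<^sub>5 * V * (K * real M powr (\<epsilon> / 2)) * ell2 (psets M) b)"
      unfolding sum_distrib_left[symmetric] split' ..
    also have "\<dots> \<le> (2 * (1 + 2 / (\<epsilon> * ln r)) * real M powr (\<epsilon> / 2)) * (C\<^sub>5 * V * (K * real M powr (\<epsilon> / 2)) * ell2 (psets M) b)"
    proof (rule mult_right_mono)
      have lM: "0 \<le> ln (real M)" using M by simp
      have "real J \<le> log r (real M)" unfolding J_def using M r by (simp add: zero_le_log_cancel_iff)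
      also have "\<dots> = ln (real M) / ln r" by (simp add: log_def)
      also have "\<dots> \<le> (real M powr (\<epsilon> / 2) / (\<epsilon> / 2)) / ln r" using M e r by (intro divide_right_mono ln_powr_bound) auto
      also have "\<dots> = 2 / (\<epsilon> * ln r) * real M powr (\<epsilon> / 2)" by simp
      finally have "real J \<le> 2 / (\<epsilon> * ln r) * real M powr (\<epsilon> / 2)" .
      moreover have "1 \<le> real M powr (\<epsilon> / 2)" using M e by (intro ge_one_powr_ge_zero) auto
      moreover have "real (card I) = 2 * (1 + real J)" by (simp add: I_def card_cartesian_product)
      ultimately show "real (card I) \<le> 2 * (1 + 2 / (\<epsilon> * ln r)) * real M powr (\<epsilon> / 2)" by (simp add: distrib_right)
    qed (use C5_pos V0 K(1) in \<open>auto intro!: mult_nonneg_nonneg sum_nonneg\<close>)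
    also have "\<dots> = C * (real M powr (\<epsilon> / 2) * real M powr (\<epsilon> / 2)) * V * ell2 (psets M) b"
      by (simp only: C_def mult_ac)
    also have "real M powr (\<epsilon> / 2) * real M powr (\<epsilon> / 2) = real M powr \<epsilon>" by (simp flip: powr_add)
    finally show ?thesis by (simp only: V_def)
  qed
  show ?thesis by (intro exI[of _ C] conjI Cpos allI impI main)
qed

section \<open>Conclusion\<close>

lemma quartic_symbol_prod:
  assumes "finite P" "P \<subseteq> PP"
  shows "quartic_symbol a (\<Prod>P) = chi P a"
  using assms
proof (induction P rule: finite_induct)
  case empty
  then show ?case by (simp add: quartic_symbol_unit)
next
  case (insert p P)
  have "quartic_symbol a (p * \<Prod>P) = quartic_symbol a p * quartic_symbol a (\<Prod>P)"
    using insert.prems PP_nonzero prod_PP_nonzero by (intro quartic_symbol_mult) auto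
  then show ?case using insert quartic_symbol_prime_elem[OF PP_prime[of p], of a] by (simp add: chiE_def)
qed

text \<open>A sign of this form is constant in \<open>i\<close> on one parity class of \<open>j\<close>, and on the other it is a factor that
  depends on \<open>i\<close> only.\<close>

lemma sign_flip:
  fixes x y :: "'i \<Rightarrow> 'j \<Rightarrow> complex"
  assumes \<Delta>: "\<Delta> \<ge> 0"
    and bound: "\<And>b. (\<Sum>i\<in>I. sqmod (\<Sum>j\<in>J. b j * x i j)) \<le> \<Delta> * ell2 J b"
    and y: "\<And>i j. i \<in> I \<Longrightarrow> j \<in> J \<Longrightarrow> y i j = (- 1) ^ (e i * f j) * x i j"
  shows "(\<Sum>i\<in>I. sqmod (\<Sum>j\<in>J. b j * y i j)) \<le> 2 * \<Delta> * ell2 J b"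
proof -
  define b1 where "b1 = (\<lambda>j. if even (f j :: nat) then b j else 0)"
  define b2 where "b2 = (\<lambda>j. if even (f j) then 0 else b j)"
  have sq: "sqmod (\<Sum>j\<in>J. b j * y i j) \<le> 2 * sqmod (\<Sum>j\<in>J. b1 j * x i j) + 2 * sqmod (\<Sum>j\<in>J. b2 j * x i j)" if i: "i \<in> I" for i
  proof -
    have "(\<Sum>j\<in>J. b j * y i j) = (\<Sum>j\<in>J. b1 j * x i j + (- 1) ^ e i * (b2 j * x i j))"
    proof (rule sum.cong[OF refl])
      fix j assume "j \<in> J"
      from y[OF i this] show "b j * y i j = b1 j * x i j + (- 1) ^ e i * (b2 j * x i j)"
        by (auto simp: b1_def b2_def minus_one_power_iff)
    qed
    also have "\<dots> = (\<Sum>j\<in>J. b1 j * x i j) + (- 1) ^ e i * (\<Sum>j\<in>J. b2 j * x i j)" by (simp only: sum.distrib sum_distrib_left)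
    finally show ?thesis
      using norm_add_sq_le[of "\<Sum>j\<in>J. b1 j * x i j" "(- 1) ^ e i * (\<Sum>j\<in>J. b2 j * x i j)"] by (simp add: norm_mult norm_power)
  qed
  have "(\<Sum>i\<in>I. sqmod (\<Sum>j\<in>J. b j * y i j)) \<le> (\<Sum>i\<in>I. 2 * sqmod (\<Sum>j\<in>J. b1 j * x i j) + 2 * sqmod (\<Sum>j\<in>J. b2 j * x i j))"
    by (intro sum_mono sq)
  also have "\<dots> = 2 * (\<Sum>i\<in>I. sqmod (\<Sum>j\<in>J. b1 j * x i j)) + 2 * (\<Sum>i\<in>I. sqmod (\<Sum>j\<in>J. b2 j * x i j))"
    by (simp only: sum.distrib sum_distrib_left)
  also have "\<dots> \<le> 2 * (\<Delta> * ell2 J b1) + 2 * (\<Delta> * ell2 J b2)"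
    by (intro add_mono mult_left_mono bound) auto
  also have "\<dots> = 2 * \<Delta> * (\<Sum>j\<in>J. sqmod (b1 j) + sqmod (b2 j))" by (simp only: sum.distrib distrib_left mult.assoc)
  also have "(\<Sum>j\<in>J. sqmod (b1 j) + sqmod (b2 j)) = ell2 J b"
    by (intro sum.cong) (auto simp: b1_def b2_def)
  finally show ?thesis .
qed

lemma chi_reciprocity:
  assumes "P \<subseteq> PP" "R \<subseteq> PP"
  shows "chi P (\<Prod>R) = (- 1) ^ (parE P (\<lambda>_. 1) * parE R (\<lambda>_. 1)) * chi R (\<Prod>P)"
  using reciprocity_sets[OF assms, of "\<lambda>_. 1"] by simp

lemma psets_PP: "P \<in> psets X \<Longrightarrow> P \<subseteq> PP" by (auto simp: psets_def)

lemma sum_psets_le: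
  fixes f :: "gauss_int \<Rightarrow> real"
  assumes "\<And>q. f q \<ge> 0"
  shows "(\<Sum>P\<in>psets X. f (\<Prod>P)) \<le> (\<Sum>q\<in>gauss_upto X. f q)"
proof -
  have "(\<Sum>P\<in>psets X. f (\<Prod>P)) = (\<Sum>q\<in>gauss_star_upto X. f q)" by (rule sum.reindex_bij_betw[OF bij_betw_psets])
  also have "\<dots> \<le> (\<Sum>q\<in>gauss_upto X. f q)"
    by (intro sum_mono2 finite_gauss_upto assms) (auto simp: gauss_upto_def gauss_star_upto_def)
  finally show ?thesis .
qed

lemma short_numeric:
  fixes L s :: real
  assumes s: "s \<ge> 1" and L: "L \<ge> 1" and sL: "s \<le> L powr (7/9)"
  shows "L + L powr (3/4) * s powr (1/2) + s ^ 3 / L \<le> 2 * (L + s + (L * s) powr (3/4))"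
proof -
  define l t where "l = ln L" and "t = ln s"
  have e: "L = exp l" "s = exp t" using s L by (auto simp: l_def t_def)
  have t0: "t \<ge> 0" using s by (simp add: t_def)
  have tl: "t \<le> 7 / 9 * l"
  proof -
    have "ln s \<le> ln (L powr (7/9))" using s L sL by (subst ln_le_cancel_iff) auto
    then show ?thesis using L by (simp add: t_def l_def ln_powr)
  qed
  have p: "exp l powr a = exp (a * l)" "exp t powr a = exp (a * t)" for a by (simp_all add: powr_def)
  have "(L * s) powr (3/4) = exp (3/4 * (l + t))" unfolding e by (simp add: powr_def flip: exp_add)
  moreover have "L powr (3/4) * s powr (1/2) \<le> exp (3/4 * (l + t))"
    unfolding e p exp_add[symmetric] using t0 by simp
  moreover have "s ^ 3 / L \<le> exp (3/4 * (l + t))"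
  proof -
    have "s ^ 3 / L = exp (3 * t - l)" unfolding e by (simp add: exp_diff flip: exp_of_nat_mult)
    then show ?thesis using tl by simp
  qed
  ultimately have "L + L powr (3/4) * s powr (1/2) + s ^ 3 / L \<le> L + (L * s) powr (3/4) + (L * s) powr (3/4)"
    by (simp only: add_mono order.refl)
  also have "\<dots> \<le> 2 * (L + s + (L * s) powr (3/4))" using s L by simp
  finally show ?thesis .
qed

abbreviation (input) sieve_sum :: "nat \<Rightarrow> nat \<Rightarrow> (gauss_int set \<Rightarrow> complex) \<Rightarrow> real" where
  "sieve_sum L s b \<equiv> (\<Sum>P\<in>psets L. sqmod (\<Sum>R\<in>psets s. b R * chi P (\<Prod>R)))"

text \<open>The long range is extended to all Gaussian integers.\<close>

lemma short_case:
  assumes e: "\<epsilon> > 0"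
  shows "\<exists>C>0. \<forall>L s b. s \<ge> 1 \<longrightarrow> L \<ge> 1 \<longrightarrow> real s \<le> real L powr (7/9) \<longrightarrow>
    sieve_sum L s b
    \<le> C * (real L + real s + (real L * real s) powr (3/4)) * (real L * real s) powr \<epsilon> * ell2 (psets s) b"
proof -
  obtain C where C: "C > 0" and R: "\<And>Q M b. Q \<ge> 1 \<Longrightarrow> M \<ge> 1 \<Longrightarrow> (\<Sum>q\<in>gauss_upto Q. sqmod (\<Sum>P\<in>psets M. b P * chi P q))
    \<le> C * real M powr \<epsilon> * (real Q + real Q powr (3/4) * real M powr (1/2) + real M ^ 3 / real Q) * ell2 (psets M) b"
    using recursive_large_sieve[OF e] by blast
  have main: "sieve_sum L s b
    \<le> 4 * C * (real L + real s + (real L * real s) powr (3/4)) * (real L * real s) powr \<epsilon> * ell2 (psets s) b"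
    if s: "s \<ge> 1" and L: "L \<ge> 1" and sL: "real s \<le> real L powr (7/9)" for L s b
  proof -
    define \<Delta> where "\<Delta> = 2 * C * (real L + real s + (real L * real s) powr (3/4)) * (real L * real s) powr \<epsilon>"
    have \<Delta>0: "\<Delta> \<ge> 0" using C by (simp add: \<Delta>_def)
    have "(\<Sum>P\<in>psets L. sqmod (\<Sum>R\<in>psets s. b R * chi R (\<Prod>P))) \<le> \<Delta> * ell2 (psets s) b" for b
    proof -
      have "(\<Sum>P\<in>psets L. sqmod (\<Sum>R\<in>psets s. b R * chi R (\<Prod>P))) \<le> (\<Sum>q\<in>gauss_upto L. sqmod (\<Sum>R\<in>psets s. b R * chi R q))"
        by (rule sum_psets_le) simp
      also have "\<dots> \<le> C * real s powr \<epsilon> * (real L + real L powr (3/4) * real s powr (1/2) + real s ^ 3 / real L) * ell2 (psets s) b"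
        by (rule R[OF L s])
      also have "\<dots> \<le> C * (real L * real s) powr \<epsilon> * (2 * (real L + real s + (real L * real s) powr (3/4))) * ell2 (psets s) b"
      proof (intro mult_right_mono mult_mono)
        have "1 * real s \<le> real L * real s" using L by (intro mult_right_mono) auto
        then show "real s powr \<epsilon> \<le> (real L * real s) powr \<epsilon>" using e by (intro powr_mono2) auto
        show "real L + real L powr (3/4) * real s powr (1/2) + real s ^ 3 / real L \<le> 2 * (real L + real s + (real L * real s) powr (3/4))"
          by (rule short_numeric) (use s L sL in auto)
      qed (use C in \<open>auto intro!: sum_nonneg mult_nonneg_nonneg\<close>)
      finally show ?thesis by (simp add: \<Delta>_def mult_ac)
    qed
    then have "sieve_sum L s b \<le> 2 * \<Delta> * ell2 (psets s) b"
      by (rule sign_flip[where e = "\<lambda>P. parE P (\<lambda>_. 1)" and f = "\<lambda>R. parE R (\<lambda>_. 1)", OF \<Delta>0])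
         (rule chi_reciprocity[OF psets_PP psets_PP])
    also have "2 * \<Delta> = 4 * C * (real L + real s + (real L * real s) powr (3/4)) * (real L * real s) powr \<epsilon>" by (simp add: \<Delta>_def)
    finally show ?thesis .
  qed
  show ?thesis by (intro exI[of _ "4 * C"] conjI allI impI main) (use C in auto)
qed

lemma card_psets_le:
  assumes "X \<ge> 1"
  shows "real (card (psets X)) \<le> 64 * exp 1 * real X"
proof -
  have fin: "finite {b. b \<noteq> 0 \<and> rnorm b \<le> real X}"
    by (rule finite_subset[OF _ finite_gauss_upto[of X]]) (auto simp: gauss_upto_def)
  have "card (psets X) = card (gauss_star_upto X)" by (rule bij_betw_same_card[OF bij_betw_psets])
  also have "\<dots> \<le> card {b. b \<noteq> 0 \<and> rnorm b \<le> real X}"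
    by (rule card_mono[OF fin]) (auto simp: gauss_star_upto_def)
  finally have "real (card (psets X)) \<le> real (card {b. b \<noteq> 0 \<and> rnorm b \<le> real X})" by simp
  also have "\<dots> \<le> 64 * exp 1 * real X" by (rule card_gauss_upto_le) (use assms in simp)
  finally show ?thesis .
qed

text \<open>In logarithms, \<open>l = ln L\<close> and \<open>t = ln s\<close>, the three terms require \<open>t \<le> l\<close>, nothing, and \<open>5 * l \<le> 7 * t\<close>.\<close>

lemma long_numeric:
  fixes L s :: real
  assumes s: "s \<ge> 1" and L: "L \<ge> 1" and sL: "s \<le> L" and Ls: "L powr (7/9) \<le> s" and e: "\<epsilon> > 0"
  shows "L * (L powr \<epsilon> * (s\<^sup>2 + (s\<^sup>2) powr (3/4) * L powr (1/2) + L ^ 3 / s\<^sup>2) * (s\<^sup>2) powr \<epsilon>) \<le> 3 * ((L * s) powr (3/4) * (L * s) powr \<epsilon>)\<^sup>2"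
proof -
  define l t where "l = ln L" and "t = ln s"
  have ex: "L = exp l" "s = exp t" using s L by (auto simp: l_def t_def)
  have t0: "t \<ge> 0" "l \<ge> 0" using s L by (auto simp: t_def l_def)
  have tl: "t \<le> l" using s L sL by (simp add: t_def l_def)
  have lt: "7 / 9 * l \<le> t"
  proof -
    have "ln (L powr (7/9)) \<le> ln s" using s L Ls by (subst ln_le_cancel_iff) auto
    then show ?thesis using L by (simp add: t_def l_def ln_powr)
  qed
  have s2: "s\<^sup>2 = exp (2 * t)" unfolding ex by (simp flip: exp_of_nat_mult)
  have L3: "L ^ 3 = exp (3 * l)" unfolding ex by (simp flip: exp_of_nat_mult)
  define E where "E = exp (3/2 * (l + t))"
  have 1: "L * s\<^sup>2 \<le> E" unfolding s2 E_def ex(1) exp_add[symmetric] using tl by simp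
  have 2: "L * ((s\<^sup>2) powr (3/4) * L powr (1/2)) \<le> E" unfolding s2 E_def ex(1) powr_def by (simp add: algebra_simps flip: exp_add)
  have 3: "L * (L ^ 3 / s\<^sup>2) \<le> E" unfolding s2 L3 E_def unfolding ex(1) exp_diff[symmetric] exp_add[symmetric] using lt t0 by simp
  have 4: "L powr \<epsilon> * (s\<^sup>2) powr \<epsilon> \<le> exp (2 * \<epsilon> * (l + t))"
  proof -
    have "L powr \<epsilon> * (s\<^sup>2) powr \<epsilon> = exp (\<epsilon> * l + \<epsilon> * (2 * t))" unfolding s2 unfolding ex(1) powr_def by (simp flip: exp_add)
    moreover have "\<epsilon> * l \<ge> 0" using e t0 by simp
    ultimately show ?thesis by (simp add: algebra_simps)
  qed
  have "L * (L powr \<epsilon> * (s\<^sup>2 + (s\<^sup>2) powr (3/4) * L powr (1/2) + L ^ 3 / s\<^sup>2) * (s\<^sup>2) powr \<epsilon>) =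
    (L powr \<epsilon> * (s\<^sup>2) powr \<epsilon>) * (L * s\<^sup>2 + L * ((s\<^sup>2) powr (3/4) * L powr (1/2)) + L * (L ^ 3 / s\<^sup>2))" by (simp only: distrib_left distrib_right mult_ac)
  also have "\<dots> \<le> exp (2 * \<epsilon> * (l + t)) * (E + E + E)"
    using L by (intro mult_mono 4 add_mono 1 2 3) auto
  also have "\<dots> = 3 * (exp (3/4 * (l + t)) * exp (\<epsilon> * (l + t)))\<^sup>2"
    unfolding E_def power_mult_distrib exp_double[symmetric] by (simp add: mult.assoc)
  also have "exp (3/4 * (l + t)) = (L * s) powr (3/4)" unfolding ex by (simp add: powr_def flip: exp_add)
  also have "exp (\<epsilon> * (l + t)) = (L * s) powr \<epsilon>" unfolding ex by (simp add: powr_def flip: exp_add)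
  finally show ?thesis .
qed

text \<open>Cauchy--Schwarz over the moduli brings in the fourth power of the inner sums.  The coefficients \<open>b'\<close> of
  the squared inner sum are a multiplicative convolution, whose energy exceeds the square of that of
  \<open>b\<close> by a factor at most the number of ways to write \<open>q\<close> as a product, and that is \<open>O(s\<^bsup>2\<epsilon>\<^esup>)\<close>.\<close>

lemma long_case:
  assumes e: "\<epsilon> > 0"
  shows "\<exists>C>0. \<forall>L s b. s \<ge> 1 \<longrightarrow> L \<ge> 1 \<longrightarrow> real L powr (7/9) \<le> real s \<longrightarrow> s \<le> L \<longrightarrow>
    sieve_sum L s b
    \<le> C * (real L * real s) powr (3/4) * (real L * real s) powr \<epsilon> * ell2 (psets s) b"
proof -
  obtain C where C: "C > 0" and R: "\<And>Q M b. Q \<ge> 1 \<Longrightarrow> M \<ge> 1 \<Longrightarrow> (\<Sum>q\<in>gauss_upto Q. sqmod (\<Sum>P\<in>psets M. b P * chi P q))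
    \<le> C * real M powr \<epsilon> * (real Q + real Q powr (3/4) * real M powr (1/2) + real M ^ 3 / real Q) * ell2 (psets M) b"
    using recursive_large_sieve[OF e] by blast
  obtain K where K: "K > 0" "\<And>P. finite P \<Longrightarrow> P \<subseteq> PP \<Longrightarrow> 8 ^ card P \<le> K * rnorm (\<Prod>P) powr \<epsilon>"
    using eight_power_card_le[OF e] by auto
  define A where "A = 64 * exp 1 * C * K * 3"
  have A: "A > 0" using C K by (simp add: A_def)
  have main: "sieve_sum L s b
    \<le> sqrt A * (real L * real s) powr (3/4) * (real L * real s) powr \<epsilon> * ell2 (psets s) b"
    if s: "s \<ge> 1" and L: "L \<ge> 1" and Ls: "real L powr (7/9) \<le> real s" and sL: "s \<le> L" for L s b
  proof -
    define \<beta> where "\<beta> = ell2 (psets s) b"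
    have \<beta>0: "\<beta> \<ge> 0" by (auto simp: \<beta>_def intro: sum_nonneg)
    define X where "X = (\<lambda>P. \<Sum>R\<in>psets s. b R * chi P (\<Prod>R))"
    define pairs where "pairs = psets s \<times> psets s"
    have fp: "finite pairs" using finite_psets by (simp add: pairs_def)
    define pr where "pr = (\<lambda>(R1 :: gauss_int set, R2 :: gauss_int set). \<Prod>R1 * \<Prod>R2)"
    define bb where "bb = (\<lambda>(R1, R2). b R1 * b R2)"
    define fib where "fib = (\<lambda>q. {x. x \<in> pairs \<and> pr x = q})"
    \<comment> \<open>\<open>q\<close> need not be square-free here, hence the estimate is needed for all \<open>q\<close>.\<close>
    define b' where "b' = (\<lambda>q. \<Sum>x\<in>fib q. bb x)"
    have ps: "finite R'" "R' \<subseteq> PP" "gauss_norm (\<Prod>R') \<le> s" if "R' \<in> psets s" for R' using that by (auto simp: psets_def)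
    have img: "pr ` pairs \<subseteq> gauss_upto (s\<^sup>2)"
      using mult_mono[OF ps(3) ps(3)] by (auto simp: pairs_def pr_def gauss_upto_def gauss_norm_mult power2_eq_square)
    have X2: "X P * X P = (\<Sum>q\<in>gauss_upto (s\<^sup>2). b' q * chi P q)" if P: "P \<in> psets L" for P
    proof -
      have "X P * X P = (\<Sum>R1\<in>psets s. \<Sum>R2\<in>psets s. (b R1 * chi P (\<Prod>R1)) * (b R2 * chi P (\<Prod>R2)))"
        unfolding X_def by (rule sum_product)
      also have "\<dots> = (\<Sum>x\<in>pairs. bb x * chi P (pr x))"
        unfolding pairs_def sum.cartesian_product bb_def pr_def
        by (intro sum.cong refl) (auto simp: chiE_mult[OF psets_PP[OF P]])
      also have "\<dots> = (\<Sum>q\<in>gauss_upto (s\<^sup>2). \<Sum>x\<in>fib q. bb x * chi P (pr x))"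
        unfolding fib_def by (rule sum.group[OF fp finite_gauss_upto img, symmetric])
      also have "\<dots> = (\<Sum>q\<in>gauss_upto (s\<^sup>2). b' q * chi P q)"
        unfolding b'_def sum_distrib_right by (intro sum.cong refl) (auto simp: fib_def)
      finally show ?thesis .
    qed
    have fibcard: "real (card (fib q)) \<le> K * real (s\<^sup>2) powr \<epsilon>" for q
    proof (cases "fib q = {}")
      case True
      then show ?thesis using K by simp
    next
      case False
      then obtain R1 R2 where R12: "R1 \<in> psets s" "R2 \<in> psets s" "q = \<Prod>R1 * \<Prod>R2" by (auto simp: fib_def pairs_def pr_def)
      define U where "U = R1 \<union> R2"
      have U: "finite U" "U \<subseteq> PP" using ps[OF R12(1)] ps[OF R12(2)] by (auto simp: U_def)
      have pdvd: "p dvd \<Prod>R1' * \<Prod>R2' \<longleftrightarrow> p \<in> R1' \<union> R2'" if "p \<in> PP" "R1' \<in> psets s" "R2' \<in> psets s" for p R1' R2'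
        unfolding PP_dvd_mult_iff[OF that(1)] PP_dvd_prod_iff[OF that(1) ps(1,2)[OF that(2)]] PP_dvd_prod_iff[OF that(1) ps(1,2)[OF that(3)]]
        by simp
      have "fib q \<subseteq> Pow U \<times> Pow U"
      proof
        fix x assume "x \<in> fib q"
        then obtain S1 S2 where S: "x = (S1, S2)" "S1 \<in> psets s" "S2 \<in> psets s" "\<Prod>S1 * \<Prod>S2 = q" by (auto simp: fib_def pairs_def pr_def)
        have "p \<in> U" if p: "p \<in> S1 \<union> S2" for p
        proof -
          have pp: "p \<in> PP" using p ps(2)[OF S(2)] ps(2)[OF S(3)] by blast
          have "p dvd q" using pdvd[OF pp S(2,3)] p S(4) by simp
          then show ?thesis using pdvd[OF pp R12(1,2)] R12(3) by (simp add: U_def)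
        qed
        then show "x \<in> Pow U \<times> Pow U" using S(1) by auto
      qed
      then have "card (fib q) \<le> card (Pow U \<times> Pow U)" using U(1) by (intro card_mono) auto
      also have "\<dots> = 4 ^ card U" using U(1) by (simp add: card_cartesian_product card_Pow flip: power_mult_distrib)
      finally have "real (card (fib q)) \<le> 4 ^ card U" by (metis of_nat_le_iff of_nat_numeral of_nat_power)
      also have "(4::real) ^ card U \<le> 8 ^ card U" by (intro power_mono) auto
      also have "\<dots> \<le> K * rnorm (\<Prod>U) powr \<epsilon>" by (rule K(2)[OF U])
      also have "\<dots> \<le> K * real (s\<^sup>2) powr \<epsilon>"
      proof (intro mult_left_mono powr_mono2)
        have d: "gauss_norm (\<Prod>R2) = gauss_norm (\<Prod>(R2 - R1)) * gauss_norm (\<Prod>(R2 \<inter> R1))"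
        proof -
          have "(R2 - R1) \<inter> (R2 \<inter> R1) = {}" "(R2 - R1) \<union> (R2 \<inter> R1) = R2" by auto
          with norm_prod_union[OF _ _ this(1)] ps(1)[OF R12(2)] show ?thesis by simp
        qed
        have "gauss_norm (\<Prod>(R2 \<inter> R1)) \<ge> 1" using ps(2)[OF R12(2)] by (intro norm_prod_PP_pos) auto
        then have d2: "gauss_norm (\<Prod>(R2 - R1)) \<le> gauss_norm (\<Prod>R2)" unfolding d by simp
        have "gauss_norm (\<Prod>U) = gauss_norm (\<Prod>R1) * gauss_norm (\<Prod>(R2 - R1))"
          using norm_prod_union[of R1 "R2 - R1"] ps(1)[OF R12(1)] ps(1)[OF R12(2)] by (simp add: U_def)
        also have "\<dots> \<le> s * s" using d2 ps(3)[OF R12(1)] ps(3)[OF R12(2)] by (intro mult_mono) auto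
        finally show "rnorm (\<Prod>U) \<le> real (s\<^sup>2)" by (simp only: of_nat_le_iff power2_eq_square)
      qed (use K e in auto)
      finally show ?thesis .
    qed
    have nb': "(\<Sum>q\<in>gauss_upto (s\<^sup>2). sqmod (b' q)) \<le> K * real (s\<^sup>2) powr \<epsilon> * \<beta>\<^sup>2"
    proof -
      have "(\<Sum>q\<in>gauss_upto (s\<^sup>2). sqmod (b' q)) \<le> (\<Sum>q\<in>gauss_upto (s\<^sup>2). K * real (s\<^sup>2) powr \<epsilon> * ell2 (fib q) bb)"
      proof (rule sum_mono)
        fix q
        have "sqmod (b' q) \<le> real (card (fib q)) * ell2 (fib q) bb"
          unfolding b'_def using cauchy_schwarz_complex[of "\<lambda>_. 1" bb "fib q"] by simp
        also have "\<dots> \<le> K * real (s\<^sup>2) powr \<epsilon> * ell2 (fib q) bb"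
          by (intro mult_right_mono fibcard sum_nonneg) auto
        finally show "sqmod (b' q) \<le> K * real (s\<^sup>2) powr \<epsilon> * ell2 (fib q) bb" .
      qed
      also have "\<dots> = K * real (s\<^sup>2) powr \<epsilon> * (\<Sum>q\<in>gauss_upto (s\<^sup>2). \<Sum>x\<in>fib q. sqmod (bb x))" by (simp only: sum_distrib_left)
      also have "(\<Sum>q\<in>gauss_upto (s\<^sup>2). \<Sum>x\<in>fib q. sqmod (bb x)) = ell2 pairs bb"
        unfolding fib_def by (rule sum.group[OF fp finite_gauss_upto img])
      also have "\<dots> = \<beta>\<^sup>2"
      proof -
        have "\<beta>\<^sup>2 = \<beta> * \<beta>" by (rule power2_eq_square)
        also have "\<dots> = (\<Sum>R1\<in>psets s. \<Sum>R2\<in>psets s. sqmod (b R1) * sqmod (b R2))" unfolding \<beta>_def by (rule sum_product)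
        also have "\<dots> = ell2 pairs bb"
          unfolding sum.cartesian_product pairs_def bb_def
          by (intro sum.cong refl) (auto simp: norm_mult power_mult_distrib)
        finally show ?thesis by simp
      qed
      finally show ?thesis .
    qed
    define V where "V = real (s\<^sup>2) + real (s\<^sup>2) powr (3/4) * real L powr (1/2) + real L ^ 3 / real (s\<^sup>2)"
    have V0: "V \<ge> 0" by (simp add: V_def)
    have "(ell2 (psets L) X)\<^sup>2 \<le> real (card (psets L)) * (\<Sum>P\<in>psets L. sqmod (X P * X P))"
    proof -
      define z where "z = (\<lambda>P. complex_of_real (sqmod (X P)))"
      have "sqmod (\<Sum>P\<in>psets L. 1 * z P) \<le> (\<Sum>P\<in>psets L. sqmod 1) * ell2 (psets L) z" by (rule cauchy_schwarz_complex)
      moreover have "cmod (\<Sum>P\<in>psets L. 1 * z P) = ell2 (psets L) X"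
      proof -
        have "(\<Sum>P\<in>psets L. 1 * z P) = complex_of_real (ell2 (psets L) X)" by (simp add: z_def)
        then show ?thesis by (simp only: norm_of_real) (simp add: sum_nonneg)
      qed
      moreover have "cmod (z P) = cmod (X P * X P)" for P by (simp add: z_def norm_mult power2_eq_square)
      ultimately show ?thesis by simp
    qed
    also have "(\<Sum>P\<in>psets L. sqmod (X P * X P)) = (\<Sum>P\<in>psets L. sqmod (\<Sum>q\<in>gauss_upto (s\<^sup>2). b' q * chi P q))"
      using X2 by simp
    also have "\<dots> \<le> C * real L powr \<epsilon> * V * (\<Sum>q\<in>gauss_upto (s\<^sup>2). sqmod (b' q))"
    proof (rule duality)
      show "0 \<le> C * real L powr \<epsilon> * V" using C V0 by simp
      show "(\<Sum>q\<in>gauss_upto (s\<^sup>2). sqmod (\<Sum>P\<in>psets L. b P * chi P q)) \<le> C * real L powr \<epsilon> * V * ell2 (psets L) b" for b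
        unfolding V_def by (rule R) (use s L in auto)
    qed
    also have "\<dots> \<le> C * real L powr \<epsilon> * V * (K * real (s\<^sup>2) powr \<epsilon> * \<beta>\<^sup>2)"
      using C V0 by (intro mult_left_mono nb') auto
    finally have "(ell2 (psets L) X)\<^sup>2 \<le> real (card (psets L)) * (C * real L powr \<epsilon> * V * (K * real (s\<^sup>2) powr \<epsilon> * \<beta>\<^sup>2))"
      by (simp add: mult_left_mono)
    also have "\<dots> \<le> (64 * exp 1 * real L) * (C * real L powr \<epsilon> * V * (K * real (s\<^sup>2) powr \<epsilon> * \<beta>\<^sup>2))"
      using C V0 K by (intro mult_right_mono card_psets_le L) auto
    also have "\<dots> = 64 * exp 1 * C * K * \<beta>\<^sup>2 * (real L * (real L powr \<epsilon> * V * (real (s\<^sup>2)) powr \<epsilon>))" by (simp only: mult_ac)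
    also have "\<dots> \<le> 64 * exp 1 * C * K * \<beta>\<^sup>2 * (3 * ((real L * real s) powr (3/4) * (real L * real s) powr \<epsilon>)\<^sup>2)"
      unfolding V_def of_nat_power using C K s L sL Ls e by (intro mult_left_mono long_numeric) auto
    also have "\<dots> = (sqrt A * (real L * real s) powr (3/4) * (real L * real s) powr \<epsilon> * \<beta>)\<^sup>2"
      using A by (simp add: power_mult_distrib) (simp add: A_def mult_ac)
    finally have "ell2 (psets L) X \<le> sqrt A * (real L * real s) powr (3/4) * (real L * real s) powr \<epsilon> * \<beta>"
      by (rule power2_le_imp_le) (use A \<beta>0 in auto)
    then show ?thesis by (simp only: X_def \<beta>_def)
  qed
  show ?thesis by (intro exI[of _ "sqrt A"] conjI allI impI main) (use A in auto)
qed

lemma long_modulus: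
  assumes e: "\<epsilon> > 0"
  shows "\<exists>C>0. \<forall>L s b. s \<ge> 1 \<longrightarrow> s \<le> L \<longrightarrow>
    sieve_sum L s b
    \<le> C * ((real L + real s + (real L * real s) powr (3/4)) * (real L * real s) powr \<epsilon>) * ell2 (psets s) b"
proof -
  obtain C where C: "C > 0" "\<And>L s b. s \<ge> 1 \<Longrightarrow> L \<ge> 1 \<Longrightarrow> real s \<le> real L powr (7/9) \<Longrightarrow>
    sieve_sum L s b
    \<le> C * (real L + real s + (real L * real s) powr (3/4)) * (real L * real s) powr \<epsilon> * ell2 (psets s) b"
    using short_case[OF e] by blast
  obtain C' where C': "C' > 0" "\<And>L s b. s \<ge> 1 \<Longrightarrow> L \<ge> 1 \<Longrightarrow> real L powr (7/9) \<le> real s \<Longrightarrow> s \<le> L \<Longrightarrow>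
    sieve_sum L s b
    \<le> C' * (real L * real s) powr (3/4) * (real L * real s) powr \<epsilon> * ell2 (psets s) b"
    using long_case[OF e] by blast
  have main: "sieve_sum L s b
    \<le> (C + C') * ((real L + real s + (real L * real s) powr (3/4)) * (real L * real s) powr \<epsilon>) * ell2 (psets s) b"
    if s: "s \<ge> 1" and sL: "s \<le> L" for L s b
  proof -
    define \<beta> where "\<beta> = ell2 (psets s) b"
    have \<beta>0: "\<beta> \<ge> 0" by (auto simp: \<beta>_def intro: sum_nonneg)
    define W where "W = (real L * real s) powr \<epsilon>"
    have L: "L \<ge> 1" using s sL by simp
    show ?thesis
    proof (cases "real s \<le> real L powr (7/9)")
      case True
      have "sieve_sum L s b \<le> C * ((real L + real s + (real L * real s) powr (3/4)) * W) * \<beta>"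
        using C(2)[OF s L True, of b] by (simp only: W_def \<beta>_def mult.assoc)
      also have "\<dots> \<le> (C + C') * ((real L + real s + (real L * real s) powr (3/4)) * W) * \<beta>"
        using C' \<beta>0 by (intro mult_right_mono) (auto simp: W_def)
      finally show ?thesis by (simp only: W_def \<beta>_def)
    next
      case False
      have "sieve_sum L s b \<le> C' * ((real L * real s) powr (3/4) * W) * \<beta>"
        using C'(2)[OF s L _ sL, of b] False by (simp add: W_def \<beta>_def mult.assoc)
      also have "\<dots> \<le> (C + C') * ((real L + real s + (real L * real s) powr (3/4)) * W) * \<beta>"
        using C C' \<beta>0 by (intro mult_right_mono mult_mono) (auto simp: W_def)
      finally show ?thesis by (simp only: W_def \<beta>_def)
    qed
  qed
  show ?thesis by (intro exI[of _ "C + C'"] conjI allI impI main) (use C C' in auto)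
qed

theorem theorem1p1:
  shows "\<forall>\<epsilon>::real. \<epsilon> > 0 \<longrightarrow> (\<exists>C::real. C > 0 \<and>
    (\<forall>(M::nat) (N::nat) (a :: gauss_int \<Rightarrow> complex). M > 0 \<longrightarrow> N > 0 \<longrightarrow>
      (\<Sum>m\<in>gauss_star_upto M. (cmod (\<Sum>n\<in>gauss_star_upto N. a n * quartic_symbol n m))\<^sup>2)
      \<le> C * (real M + real N + (real M * real N) powr (3/4)) * (real M * real N) powr \<epsilon>
          * (\<Sum>n\<in>gauss_upto N. (cmod (a n))\<^sup>2)))"
proof (intro allI impI)
  fix \<epsilon> :: real assume e: "\<epsilon> > 0"
  obtain C where C: "C > 0" and B: "\<And>L s b. s \<ge> 1 \<Longrightarrow> s \<le> L \<Longrightarrow>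
    sieve_sum L s b
    \<le> C * ((real L + real s + (real L * real s) powr (3/4)) * (real L * real s) powr \<epsilon>) * ell2 (psets s) b"
    using long_modulus[OF e] by blast
  have main: "(\<Sum>m\<in>gauss_star_upto M. sqmod (\<Sum>n\<in>gauss_star_upto N. a n * quartic_symbol n m))
      \<le> 2 * C * (real M + real N + (real M * real N) powr (3/4)) * (real M * real N) powr \<epsilon>
          * ell2 (gauss_upto N) a" if M: "M > 0" and N: "N > 0" for M N and a :: "gauss_int \<Rightarrow> complex"
  proof -
    define \<Delta> where "\<Delta> = C * ((real M + real N + (real M * real N) powr (3/4)) * (real M * real N) powr \<epsilon>)"
    have \<Delta>0: "\<Delta> \<ge> 0" using C by (simp add: \<Delta>_def)
    define b where "b = (\<lambda>R. a (\<Prod>R))"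
    have "(\<Sum>m\<in>gauss_star_upto M. sqmod (\<Sum>n\<in>gauss_star_upto N. a n * quartic_symbol n m))
      = (\<Sum>P\<in>psets M. sqmod (\<Sum>n\<in>gauss_star_upto N. a n * quartic_symbol n (\<Prod>P)))"
      by (rule sum.reindex_bij_betw[OF bij_betw_psets, symmetric])
    also have "\<dots> = sieve_sum M N b"
    proof (rule sum.cong[OF refl])
      fix P assume P: "P \<in> psets M"
      have "(\<Sum>n\<in>gauss_star_upto N. a n * quartic_symbol n (\<Prod>P)) = (\<Sum>n\<in>gauss_star_upto N. a n * chi P n)"
        using P by (simp add: quartic_symbol_prod psets_def)
      also have "\<dots> = (\<Sum>R\<in>psets N. b R * chi P (\<Prod>R))"
        unfolding b_def by (rule sum.reindex_bij_betw[OF bij_betw_psets, symmetric])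
      finally show "sqmod (\<Sum>n\<in>gauss_star_upto N. a n * quartic_symbol n (\<Prod>P)) = sqmod (\<Sum>R\<in>psets N. b R * chi P (\<Prod>R))"
        by simp
    qed
    also have "\<dots> \<le> 2 * \<Delta> * ell2 (psets N) b"
    proof (cases "N \<le> M")
      case True
      have "sieve_sum M N b \<le> \<Delta> * ell2 (psets N) b"
        unfolding \<Delta>_def by (rule B) (use True N in auto)
      also have "\<dots> \<le> 2 * \<Delta> * ell2 (psets N) b" using \<Delta>0 by (intro mult_right_mono sum_nonneg) auto
      finally show ?thesis .
    next
      case False
      have B': "(\<Sum>R\<in>psets N. sqmod (\<Sum>P\<in>psets M. c P * chi R (\<Prod>P))) \<le> \<Delta> * ell2 (psets M) c" for c
        using B[of M N c] False M by (simp add: \<Delta>_def add_ac mult_ac)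
      have "(\<Sum>R\<in>psets N. sqmod (\<Sum>P\<in>psets M. c P * chi P (\<Prod>R))) \<le> 2 * \<Delta> * ell2 (psets M) c" for c
      proof (rule sign_flip[where e = "\<lambda>R. parE R (\<lambda>_. 1)" and f = "\<lambda>P. parE P (\<lambda>_. 1)", OF \<Delta>0 B'])
        fix R P assume "R \<in> psets N" "P \<in> psets M"
        from chi_reciprocity[OF psets_PP[OF this(2)] psets_PP[OF this(1)]]
        show "chi P (\<Prod>R) = (- 1) ^ (parE R (\<lambda>_. 1) * parE P (\<lambda>_. 1)) * chi R (\<Prod>P)" by (simp only: mult.commute)
      qed
      from duality[OF _ this] show ?thesis using \<Delta>0 by simp
    qed
    also have "2 * \<Delta> * ell2 (psets N) b \<le> 2 * \<Delta> * ell2 (gauss_upto N) a"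
      unfolding b_def using \<Delta>0 by (intro mult_left_mono sum_psets_le) auto
    also have "2 * \<Delta> = 2 * C * (real M + real N + (real M * real N) powr (3/4)) * (real M * real N) powr \<epsilon>"
      by (simp only: \<Delta>_def mult.assoc)
    finally show ?thesis .
  qed
  show "\<exists>C::real. C > 0 \<and>
    (\<forall>(M::nat) (N::nat) (a :: gauss_int \<Rightarrow> complex). M > 0 \<longrightarrow> N > 0 \<longrightarrow>
      (\<Sum>m\<in>gauss_star_upto M. sqmod (\<Sum>n\<in>gauss_star_upto N. a n * quartic_symbol n m))
      \<le> C * (real M + real N + (real M * real N) powr (3/4)) * (real M * real N) powr \<epsilon>
          * ell2 (gauss_upto N) a)"
    by (intro exI[of _ "2 * C"] conjI allI impI main) (use C in auto)
qed

end
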